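(* Let $X$ be a fractional Brownian motion with index $H\in(0,1)$, and let $\beta\in(-\frac12,0)$ and $-\frac12<\beta_1<\beta_2<0$. Let $\widehat H_n$ (built from $\beta$), $\hat\alpha_n$ (built from $\beta_1,\beta_2$), $\Xi_1$ and $\Sigma_1$ be as defined in the context. Then, as $n\to+\infty$: (a) $\widehat H_n-H=O_{\mathbb{P}}(n^{-1/2})$ and $\hat\alpha_n-2=O_{\mathbb{P}}(n^{-1/2})$; (b) $\sqrt n(\widehat H_n-H)\xrightarrow{(d)}\mathcal{N}_1(0,\Xi_1)$ and $\sqrt n(\hat\alpha_n-2)\xrightarrow{(d)}\mathcal{N}_1(0,\Sigma_1)$.
   Context: Fractional Brownian motion of index $H$: centered Gaussian process with $\mathbb{E}X(t)X(s)=\frac{\mathbb{E}X(1)^2}{2}\{|s|^{2H}+|t|^{2H}-|s-t|^{2H}\}$ (with $\mathbb{E}X(1)^2>0$). It is $H$-self-similar with stationary increments and is symmetric $2$-stable. Increments: fix integers $L\ge1,K\ge1$ and reals $a_0,\dots,a_K$ with $\sum_{k=0}^K k^q a_k=0$ for all $q\in\{0,\dots,L\}$ and $\sum_{k=0}^K k^{L+1}a_k\ne0$ (convention $0^0=1$). Set $\triangle_{p,n}X=\sum_{k=0}^K a_k X\left(\frac{k+p}{n}\right)$. For $\gamma\in(-\frac12,0)$: $V_n(\gamma)=\frac{1}{n-K+1}\sum_{p=0}^{n-K}|\triangle_{p,n}X|^{\gamma}$ and $W_n(\gamma)=n^{\gamma H}V_n(\gamma)$. When $n/2$ appears, $n$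 is even (and large enough). Estimator of $H$: $\widehat H_n=\frac1\beta\log_2\frac{V_{n/2}(\beta)}{V_n(\beta)}$. Estimator of $\alpha$: for $u>v>0$ let $\psi_{u,v}(x,y)=-v\ln x+u\ln y+C(u,v)$ ($x,y>0$) with $C(u,v)=\frac{u-v}{2}\ln\pi+u\ln\Gamma(1+\frac v2)+v\ln\Gamma(\frac{1-u}{2})-v\ln\Gamma(1+\frac u2)-u\ln\Gamma(\frac{1-v}{2})$; $h_{u,v}:(0,+\infty)\to(-\infty,0)$, $h_{u,v}(x)=u\ln\Gamma(1+\frac vx)-v\ln\Gamma(1+\frac ux)$, which is a bijection; $\varphi_{u,v}(x)=0$ if $x\ge0$ and $\varphi_{u,v}(x)=h_{u,v}^{-1}(x)$ if $x<0$. Then $\hat\alpha_n=\varphi_{-\beta_1,-\beta_2}\left(\psi_{-\beta_1,-\beta_2}(W_n(\beta_1),W_n(\beta_2))\right)$. Variances: for $\gamma\in(-\frac12,0)$ let $Z_0=\triangle_{0,1}X/\sqrt{\mathrm{var}\,\triangle_{0,1}X}$ and $f_\gamma(x)=\left(\sqrt{\mathrm{var}\,\triangle_{0,1}X}\right)^{\gamma}(|x|^\gamma-\mathbb{E}|Z_0|^\gamma)$, with expansion $f_\gamma=\sum_{q}f_{\gamma,q}H_q$ in the (probabilists') Hermite polynomials $H_q$; the Hermite rank of $f_\gamma$ is the smallest $q$ with $f_{\gamma,q}\neq0$. Let $d$ be the Hermite rank of $f_\beta$ and $d_1$ the minimum of the Hermite ranks of $f_{\beta_1},f_{\beta_2}$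 (one has $d,d_1\ge2$). For $r\in\mathbb{Z}$ let $$\rho(r)=\frac{\sum_{p,p'=0}^K a_pa_{p'}|r+p-p'|^{2H}}{\sum_{p,p'=0}^K a_pa_{p'}|p-p'|^{2H}},\qquad \rho_1(r)=\frac{\sum_{p,p'=0}^K a_pa_{p'}|r+p-2p'|^{2H}}{2^H\sum_{p,p'=0}^K a_pa_{p'}|p-p'|^{2H}}.$$ Let $\varGamma_1$ be the symmetric $2\times2$ matrix with entries $(\varGamma_1)_{11}=\sum_{q\ge d}q!f_{\beta,q}^2\sum_{r\in\mathbb{Z}}\rho^q(r)$, $(\varGamma_1)_{12}=(\varGamma_1)_{21}=\sum_{q\ge d}q!f_{\beta,q}^2\sum_{r\in\mathbb{Z}}\rho_1^q(r)$, $(\varGamma_1)_{22}=2\sum_{q\ge d}q!f_{\beta,q}^2\sum_{r\in\mathbb{Z}}\rho^q(r)$. With $\phi(x,y)=\frac1\beta\log_2\frac xy$ and $(x_0,y_0)=(\mathbb{E}|\triangle_{0,1}X|^\beta,\mathbb{E}|\triangle_{0,1}X|^\beta)$, set $\Xi_1=\phi'(x_0,y_0)\,\varGamma_1\,\phi'(x_0,y_0)^t$, where $\phi'$ is the gradient as a row vector. Let $\varGamma_2$ be the symmetric $2\times2$ matrix with diagonal entries $\sum_{q\ge d_1}q!f_{\beta_i,q}^2\sum_{k\in\mathbb{Z}}\rho(k)^q$ ($i=1,2$) and off-diagonal entry $\sum_{q\ge d_1}q!f_{\beta_1,q}f_{\beta_2,q}\sum_{k\in\mathbb{Z}}\rho(k)^q$.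 With $(x_1,y_1)=(\mathbb{E}|\triangle_{0,1}X|^{\beta_1},\mathbb{E}|\triangle_{0,1}X|^{\beta_2})$ and $\nabla$ the gradient (row vector), set $\Sigma_1=\nabla_{\varphi_{-\beta_1,-\beta_2}\circ\psi_{-\beta_1,-\beta_2}}(x_1,y_1)\,\varGamma_2\,\nabla_{\varphi_{-\beta_1,-\beta_2}\circ\psi_{-\beta_1,-\beta_2}}(x_1,y_1)^t$. $X_n=O_{\mathbb{P}}(1)$ means: for all $\epsilon>0$ there is $M>0$ with $\sup_n\mathbb{P}(|X_n|>M)<\epsilon$; $Y_n=O_{\mathbb{P}}(a_n)$ means $Y_n=a_nX_n$ with $X_n=O_{\mathbb{P}}(1)$. $\xrightarrow{(d)}$ is convergence in distribution and $\mathcal{N}_1(0,s)$ is the centered normal law with variance $s$. *)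

theory Defs
  imports "HOL-Probability.Probability"
begin

section \<open>Gaussian laws and fractional Brownian motion\<close>

text \<open>The normal law with mean \<open>m\<close> and variance \<open>s\<close> (not standard deviation, unlike
  \<^const>\<open>normal_density\<close>); for \<open>s = 0\<close> it is the point mass at \<open>m\<close>.
  It is only meant for \<open>s \<ge> 0\<close>.\<close>

definition normal_law :: "real \<Rightarrow> real \<Rightarrow> real measure" where
  "normal_law m s =
     (if s = 0 then return borel m else density lborel (normal_density m (sqrt s)))"

definition gaussian_process :: "'w measure \<Rightarrow> (real \<Rightarrow> 'w \<Rightarrow> real) \<Rightarrow> bool" where
  "gaussian_process M X \<longleftrightarrow>
     prob_space M \<and>
     (\<forall>t. X t \<in> borel_measurable M) \<and>
     (\<forall>T c. finite T \<longrightarrow>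
        (\<exists>m s. s \<ge> 0 \<and> distr M borel (\<lambda>w. \<Sum>t\<in>T. c t * X t w) = normal_law m s))"

definition fractional_brownian_motion ::
    "'w measure \<Rightarrow> real \<Rightarrow> (real \<Rightarrow> 'w \<Rightarrow> real) \<Rightarrow> bool" where
  "fractional_brownian_motion M H X \<longleftrightarrow>
     gaussian_process M X \<and>
     (\<forall>t. prob_space.expectation M (X t) = 0) \<and>
     prob_space.expectation M (\<lambda>w. (X 1 w)\<^sup>2) > 0 \<and>
     (\<forall>s t. prob_space.expectation M (\<lambda>w. X t w * X s w) =
        prob_space.expectation M (\<lambda>w. (X 1 w)\<^sup>2) / 2 *
          (\<bar>s\<bar> powr (2 * H) + \<bar>t\<bar> powr (2 * H) - \<bar>s - t\<bar> powr (2 * H)))"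


section \<open>Increments and estimators\<close>

definition incr ::
    "(nat \<Rightarrow> real) \<Rightarrow> nat \<Rightarrow> (real \<Rightarrow> 'w \<Rightarrow> real) \<Rightarrow> nat \<Rightarrow> nat \<Rightarrow> 'w \<Rightarrow> real" where
  "incr a K X p n w = (\<Sum>k=0..K. a k * X ((real k + real p) / real n) w)"

text \<open>Only meant for \<open>n \<ge> K\<close>. Since \<open>0 powr \<gamma> = 0\<close>, a vanishing increment (a null event)
  contributes \<open>0\<close>.\<close>

definition V_stat ::
    "(nat \<Rightarrow> real) \<Rightarrow> nat \<Rightarrow> (real \<Rightarrow> 'w \<Rightarrow> real) \<Rightarrow> real \<Rightarrow> nat \<Rightarrow> 'w \<Rightarrow> real" where
  "V_stat a K X \<gamma> n w =
     1 / real (n - K + 1) * (\<Sum>p=0..n-K. \<bar>incr a K X p n w\<bar> powr \<gamma>)"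

definition W_stat ::
    "(nat \<Rightarrow> real) \<Rightarrow> nat \<Rightarrow> real \<Rightarrow> (real \<Rightarrow> 'w \<Rightarrow> real) \<Rightarrow> real \<Rightarrow> nat \<Rightarrow> 'w \<Rightarrow> real" where
  "W_stat a K H X \<gamma> n w = real n powr (\<gamma> * H) * V_stat a K X \<gamma> n w"

text \<open>Only meant for even \<open>n\<close> with \<open>n \<ge> 2 * K\<close>.\<close>

definition H_hat ::
    "(nat \<Rightarrow> real) \<Rightarrow> nat \<Rightarrow> (real \<Rightarrow> 'w \<Rightarrow> real) \<Rightarrow> real \<Rightarrow> nat \<Rightarrow> 'w \<Rightarrow> real" where
  "H_hat a K X \<beta> n w = 1 / \<beta> * log 2 (V_stat a K X \<beta> (n div 2) w / V_stat a K X \<beta> n w)"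

definition C_const :: "real \<Rightarrow> real \<Rightarrow> real" where
  "C_const u v =
     (u - v) / 2 * ln pi + u * ln (Gamma (1 + v / 2)) + v * ln (Gamma ((1 - u) / 2))
       - v * ln (Gamma (1 + u / 2)) - u * ln (Gamma ((1 - v) / 2))"

definition psi_fun :: "real \<Rightarrow> real \<Rightarrow> real \<Rightarrow> real \<Rightarrow> real" where
  "psi_fun u v x y = - v * ln x + u * ln y + C_const u v"

definition h_fun :: "real \<Rightarrow> real \<Rightarrow> real \<Rightarrow> real" where
  "h_fun u v x = u * ln (Gamma (1 + v / x)) - v * ln (Gamma (1 + u / x))"

definition phi_fun :: "real \<Rightarrow> real \<Rightarrow> real \<Rightarrow> real" where
  "phi_fun u v x = (if x \<ge> 0 then 0 else the_inv_into {0<..} (h_fun u v) x)"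

definition alpha_hat ::
    "(nat \<Rightarrow> real) \<Rightarrow> nat \<Rightarrow> real \<Rightarrow> (real \<Rightarrow> 'w \<Rightarrow> real) \<Rightarrow> real \<Rightarrow> real \<Rightarrow> nat \<Rightarrow> 'w \<Rightarrow> real" where
  "alpha_hat a K H X \<beta>1 \<beta>2 n w =
     phi_fun (- \<beta>1) (- \<beta>2)
       (psi_fun (- \<beta>1) (- \<beta>2) (W_stat a K H X \<beta>1 n w) (W_stat a K H X \<beta>2 n w))"


section \<open>Hermite expansions\<close>

fun hermite :: "nat \<Rightarrow> real \<Rightarrow> real" where
  "hermite 0 x = 1"
| "hermite (Suc 0) x = x"
| "hermite (Suc (Suc n)) x = x * hermite (Suc n) x - real (Suc n) * hermite n x"

text \<open>The expansion is understood in \<open>L\<^sup>2\<close> of the standard normal law; there the coefficients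
  are unique and \<open>c q = E (f(Z) H\<^sub>q(Z)) / q!\<close>.\<close>

definition hermite_expansion :: "(real \<Rightarrow> real) \<Rightarrow> (nat \<Rightarrow> real) \<Rightarrow> bool" where
  "hermite_expansion f c \<longleftrightarrow>
     (\<lambda>N. \<integral>\<^sup>+x. ennreal ((f x - (\<Sum>q<N. c q * hermite q x))\<^sup>2)
            \<partial>density lborel std_normal_density) \<longlonglongrightarrow> 0"

definition hermite_coeff :: "(real \<Rightarrow> real) \<Rightarrow> nat \<Rightarrow> real" where
  "hermite_coeff f = (THE c. hermite_expansion f c)"

definition hermite_rank :: "(real \<Rightarrow> real) \<Rightarrow> nat" where
  "hermite_rank f = (LEAST q. hermite_coeff f q \<noteq> 0)"


section \<open>Asymptotic variances\<close>

definition incr_sd ::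
    "'w measure \<Rightarrow> (nat \<Rightarrow> real) \<Rightarrow> nat \<Rightarrow> (real \<Rightarrow> 'w \<Rightarrow> real) \<Rightarrow> real" where
  "incr_sd M a K X = sqrt (prob_space.variance M (incr a K X 0 1))"

definition f_fun ::
    "'w measure \<Rightarrow> (nat \<Rightarrow> real) \<Rightarrow> nat \<Rightarrow> (real \<Rightarrow> 'w \<Rightarrow> real) \<Rightarrow> real \<Rightarrow> real \<Rightarrow> real" where
  "f_fun M a K X \<gamma> x =
     incr_sd M a K X powr \<gamma> *
       (\<bar>x\<bar> powr \<gamma>
        - prob_space.expectation M (\<lambda>w. \<bar>incr a K X 0 1 w / incr_sd M a K X\<bar> powr \<gamma>))"

definition f_coeff ::
    "'w measure \<Rightarrow> (nat \<Rightarrow> real) \<Rightarrow> nat \<Rightarrow> (real \<Rightarrow> 'w \<Rightarrow> real) \<Rightarrow> real \<Rightarrow> nat \<Rightarrow> real" where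
  "f_coeff M a K X \<gamma> = hermite_coeff (f_fun M a K X \<gamma>)"

definition f_rank ::
    "'w measure \<Rightarrow> (nat \<Rightarrow> real) \<Rightarrow> nat \<Rightarrow> (real \<Rightarrow> 'w \<Rightarrow> real) \<Rightarrow> real \<Rightarrow> nat" where
  "f_rank M a K X \<gamma> = hermite_rank (f_fun M a K X \<gamma>)"

definition rho :: "(nat \<Rightarrow> real) \<Rightarrow> nat \<Rightarrow> real \<Rightarrow> int \<Rightarrow> real" where
  "rho a K H r =
     (\<Sum>p=0..K. \<Sum>p'=0..K. a p * a p' * \<bar>real_of_int r + real p - real p'\<bar> powr (2 * H)) /
     (\<Sum>p=0..K. \<Sum>p'=0..K. a p * a p' * \<bar>real p - real p'\<bar> powr (2 * H))"

definition rho1 :: "(nat \<Rightarrow> real) \<Rightarrow> nat \<Rightarrow> real \<Rightarrow> int \<Rightarrow> real" where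
  "rho1 a K H r =
     (\<Sum>p=0..K. \<Sum>p'=0..K. a p * a p' * \<bar>real_of_int r + real p - 2 * real p'\<bar> powr (2 * H)) /
     (2 powr H * (\<Sum>p=0..K. \<Sum>p'=0..K. a p * a p' * \<bar>real p - real p'\<bar> powr (2 * H)))"

text \<open>The series \<open>\<Sum>q\<ge>m. q! g\<^sub>q h\<^sub>q \<Sum>r\<in>\<int>. R(r)\<^sup>q\<close>.\<close>

definition herm_series ::
    "nat \<Rightarrow> (nat \<Rightarrow> real) \<Rightarrow> (nat \<Rightarrow> real) \<Rightarrow> (int \<Rightarrow> real) \<Rightarrow> real" where
  "herm_series m g h R =
     (\<Sum>\<^sub>\<infinity>q\<in>{m..}. fact q * g q * h q * (\<Sum>\<^sub>\<infinity>r\<in>UNIV. R r ^ q))"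

definition Gamma1 ::
    "'w measure \<Rightarrow> (nat \<Rightarrow> real) \<Rightarrow> nat \<Rightarrow> real \<Rightarrow> (real \<Rightarrow> 'w \<Rightarrow> real) \<Rightarrow> real \<Rightarrow> real^2^2" where
  "Gamma1 M a K H X \<beta> =
     (let d = f_rank M a K X \<beta>;
          c = f_coeff M a K X \<beta>;
          s = herm_series d c c (rho a K H);
          t = herm_series d c c (rho1 a K H)
      in vector [vector [s, t], vector [t, 2 * s]])"

definition Gamma2 ::
    "'w measure \<Rightarrow> (nat \<Rightarrow> real) \<Rightarrow> nat \<Rightarrow> real \<Rightarrow> (real \<Rightarrow> 'w \<Rightarrow> real) \<Rightarrow> real \<Rightarrow> real
      \<Rightarrow> real^2^2" where
  "Gamma2 M a K H X \<beta>1 \<beta>2 =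
     (let d1 = min (f_rank M a K X \<beta>1) (f_rank M a K X \<beta>2);
          c1 = f_coeff M a K X \<beta>1;
          c2 = f_coeff M a K X \<beta>2;
          s = (\<lambda>g h. herm_series d1 g h (rho a K H))
      in vector [vector [s c1 c1, s c1 c2], vector [s c1 c2, s c2 c2]])"

definition gradient2 :: "(real \<Rightarrow> real \<Rightarrow> real) \<Rightarrow> real \<Rightarrow> real \<Rightarrow> real^2" where
  "gradient2 g x y = vector [deriv (\<lambda>s. g s y) x, deriv (\<lambda>t. g x t) y]"

definition abs_moment ::
    "'w measure \<Rightarrow> (nat \<Rightarrow> real) \<Rightarrow> nat \<Rightarrow> (real \<Rightarrow> 'w \<Rightarrow> real) \<Rightarrow> real \<Rightarrow> real" where
  "abs_moment M a K X \<gamma> = prob_space.expectation M (\<lambda>w. \<bar>incr a K X 0 1 w\<bar> powr \<gamma>)"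

definition Xi1 ::
    "'w measure \<Rightarrow> (nat \<Rightarrow> real) \<Rightarrow> nat \<Rightarrow> real \<Rightarrow> (real \<Rightarrow> 'w \<Rightarrow> real) \<Rightarrow> real \<Rightarrow> real" where
  "Xi1 M a K H X \<beta> =
     (let g = gradient2 (\<lambda>x y. 1 / \<beta> * log 2 (x / y))
                (abs_moment M a K X \<beta>) (abs_moment M a K X \<beta>)
      in (g v* Gamma1 M a K H X \<beta>) \<bullet> g)"

definition Sigma1 ::
    "'w measure \<Rightarrow> (nat \<Rightarrow> real) \<Rightarrow> nat \<Rightarrow> real \<Rightarrow> (real \<Rightarrow> 'w \<Rightarrow> real) \<Rightarrow> real \<Rightarrow> real
      \<Rightarrow> real" where
  "Sigma1 M a K H X \<beta>1 \<beta>2 =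
     (let g = gradient2 (\<lambda>x y. phi_fun (- \<beta>1) (- \<beta>2) (psi_fun (- \<beta>1) (- \<beta>2) x y))
                (abs_moment M a K X \<beta>1) (abs_moment M a K X \<beta>2)
      in (g v* Gamma2 M a K H X \<beta>1 \<beta>2) \<bullet> g)"


section \<open>Boundedness in probability\<close>

text \<open>The set \<open>A\<close> is the range of the index \<open>n\<close>, i.e. those \<open>n\<close> for which the statistic is
  defined. Measurability is required because \<^const>\<open>measure\<close> is \<open>0\<close> on non-measurable sets.\<close>

definition bounded_in_prob :: "'w measure \<Rightarrow> nat set \<Rightarrow> (nat \<Rightarrow> 'w \<Rightarrow> real) \<Rightarrow> bool" where
  "bounded_in_prob M A Y \<longleftrightarrow>
     (\<forall>n\<in>A. Y n \<in> borel_measurable M) \<and>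
     (\<forall>\<epsilon>>0. \<exists>B>0. (SUP n\<in>A. measure M {w \<in> space M. \<bar>Y n w\<bar> > B}) < \<epsilon>)"

definition O_prob :: "'w measure \<Rightarrow> nat set \<Rightarrow> (nat \<Rightarrow> real) \<Rightarrow> (nat \<Rightarrow> 'w \<Rightarrow> real) \<Rightarrow> bool" where
  "O_prob M A b Y \<longleftrightarrow>
     (\<exists>Z. bounded_in_prob M A Z \<and> (\<forall>n\<in>A. \<forall>w\<in>space M. Y n w = b n * Z n w))"

end

theory Submission imports Defs "HOL-Probability.Probability"
begin

text \<open>
  Write \<open>W\<^sub>n(\<gamma>)\<close> for the normalised power variation \<^const>\<open>W_stat\<close>. By self-similarity it is an average of
  \<open>\<bar>\<cdot>\<bar> powr \<gamma>\<close>, up to a constant, over stationary, correlated standard normal variables: the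
  normalised increments of the process. Everything follows from a joint central limit theorem
  for such averages at one scale, for the index \<open>\<alpha>\<close>, and at the two scales \<open>n\<close> and \<open>n / 2\<close>, for \<open>H\<close>,
  because both estimators are smooth functions of two power variations.

  The increments have positive variance since \<open>\<bar>x\<bar> powr (2 * H)\<close> is strictly negative definite on coefficients
  with vanishing sum (\<open>abs_powr_strictly_negative_definite\<close>). They annihilate affine functions, so their
  correlations decay like the third discrete derivative of \<open>\<bar>r\<bar> powr (2 * H)\<close> and are absolutely
  summable (\<open>double_increment_summable\<close>). Averages of powers of the correlations over
  pairs of increments therefore converge to the sums over the integers that appear in the asymptotic
  variances (\<open>average_shifted_sums\<close>).

  The central limit theorem is that of Breuer and Major (\<open>breuer_major\<close>), proved here by the
  Malliavin-Stein method in elementary terms. A function with finite Hermite expansion satisfies an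
  integration by parts formula (\<open>stein_identity\<close>), which is a differential equation for the characteristic
  function of the weighted sum. It differs from the equation of a normal law by the fluctuation
  of the Stein kernel, whose variance is small because fourth moments of
  Hermite polynomials factor up to cross covariances (\<open>E4_decoupling\<close>, \<open>stein_kernel_variance\<close>). Gaussian
  integration by parts itself comes from exchanging one variable of a Gaussian family for an independent
  copy (\<open>resample_law\<close>, \<open>gaussian_ibp\<close>). General functions are reached by truncating
  their Hermite expansion, and \<open>\<bar>x\<bar> powr \<gamma>\<close> has such an expansion as soon as it is square integrable, that is for
  \<open>\<gamma> > - 1 / 2\<close> (\<open>approximable_abs_powr\<close>).

  The delta method (\<open>delta_clt\<close>) transfers the limit to the estimators. For \<open>H\<close> the function is the logarithm of a
  ratio, in which the power of the scale leaves \<open>\<beta> * H\<close>; for \<open>\<alpha>\<close> the constants in \<^const>\<open>psi_fun\<close> are made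
  so that the Gaussian moments are mapped to \<open>h_fun u v 2\<close> (\<open>psi_fun_at_gaussian_moments\<close>).
  Boundedness in probability at the rate \<open>n powr (- 1 / 2)\<close> is tightness of the weakly
  convergent normalised errors (\<open>O_prob_of_weak_conv\<close>).
\<close>

section \<open>Laws determined by characteristic functions\<close>

lemma iexp_cos_sin: "iexp x = Complex (cos x) (sin x)"
  by (simp add: exp_Euler complex_eq_iff Re_cos Im_cos Re_sin Im_sin cos_of_real sin_of_real)

lemma (in prob_space) integrable_cos [simp]:
  assumes [measurable]: "Y \<in> borel_measurable M"
  shows "integrable M (\<lambda>w. cos (Y w :: real))"
  by (rule integrable_const_bound[where B = 1]) auto

lemma (in prob_space) integrable_sin [simp]:
  assumes [measurable]: "Y \<in> borel_measurable M"
  shows "integrable M (\<lambda>w. sin (Y w :: real))"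
  by (rule integrable_const_bound[where B = 1]) auto

lemma (in prob_space) integrable_bounded_mult:
  fixes V Y :: "_ \<Rightarrow> real"
  assumes [measurable]: "V \<in> borel_measurable M" "Y \<in> borel_measurable M"
    and "\<And>w. \<bar>V w\<bar> \<le> B" "\<And>w. \<bar>Y w\<bar> \<le> C"
  shows "integrable M (\<lambda>w. V w * Y w)"
proof (rule integrable_const_bound[where B = "B * C"])
  have "\<bar>V w * Y w\<bar> \<le> B * C" for w
    unfolding abs_mult using assms(3,4) by (intro mult_mono) (auto intro: order_trans[OF abs_ge_zero])
  then show "AE w in M. norm (V w * Y w) \<le> B * C" by simp
qed simp

lemma char_weighted_law:
  fixes V X :: "_ \<Rightarrow> real"
  assumes "prob_space M" and V [measurable]: "V \<in> borel_measurable M" and X [measurable]: "X \<in> borel_measurable M"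
    and V0: "\<And>w. 0 \<le> V w" "\<And>w. V w \<le> B" and m: "m = (\<integral>w. V w \<partial>M)" "m > 0"
  defines "\<nu> \<equiv> distr (density M (\<lambda>w. ennreal (V w / m))) borel X"
  shows "real_distribution \<nu>"
    and "char \<nu> s = Complex (\<integral>w. V w * cos (s * X w) \<partial>M) (\<integral>w. V w * sin (s * X w) \<partial>M) / m"
    and "A \<in> sets borel \<Longrightarrow> measure \<nu> A = (\<integral>w. V w * indicator A (X w) \<partial>M) / m"
proof -
  interpret prob_space M by fact
  have int_V: "integrable M (\<lambda>w. V w * Y w)"
    if [measurable]: "Y \<in> borel_measurable M" and "\<And>w. \<bar>Y w\<bar> \<le> 1" for Y
    using that V0 by (intro integrable_bounded_mult[where B = B and C = 1]) auto
  have "prob_space (density M (\<lambda>w. ennreal (V w / m)))"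
  proof (rule prob_spaceI)
    have "emeasure (density M (\<lambda>w. ennreal (V w / m))) (space (density M (\<lambda>w. ennreal (V w / m))))
        = (\<integral>\<^sup>+w. ennreal (V w / m) \<partial>M)"
      by (subst emeasure_density) (auto intro!: nn_integral_cong)
    also have "\<dots> = ennreal (\<integral>w. V w / m \<partial>M)"
      using int_V[of "\<lambda>_. 1"] V0 m by (intro nn_integral_eq_integral) auto
    also have "\<dots> = 1" using m by simp
    finally show "emeasure (density M (\<lambda>w. ennreal (V w / m))) (space (density M (\<lambda>w. ennreal (V w / m)))) = 1" .
  qed
  then show rd: "real_distribution \<nu>"
    unfolding \<nu>_def by (intro prob_space.real_distribution_distr) auto
  have *: "(\<integral>x. f x \<partial>\<nu>) = (\<integral>w. (V w / m) *\<^sub>R f (X w) \<partial>M)"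
    if [measurable]: "f \<in> borel_measurable borel" for f :: "real \<Rightarrow> 'b::{banach, second_countable_topology}"
    unfolding \<nu>_def using V0 m
    by (subst integral_distr) (auto simp: integral_density intro!: integral_density)
  have "char \<nu> s = (CLINT w|M. (V w / m) *\<^sub>R iexp (s * X w))"
    unfolding char_def by (subst *) auto
  also have "\<dots> = (CLINT w|M. complex_of_real (V w * cos (s * X w)) / m + \<i> * (complex_of_real (V w * sin (s * X w)) / m))"
    by (intro Bochner_Integration.integral_cong) (auto simp: iexp_cos_sin complex_eq_iff simp del: of_real_mult)
  also have "\<dots> = (CLINT w|M. complex_of_real (V w * cos (s * X w)) / m) + \<i> * (CLINT w|M. complex_of_real (V w * sin (s * X w)) / m)"
    by (subst Bochner_Integration.integral_add) (auto intro!: integrable_of_real int_V integrable_mult_right integrable_divide simp del: of_real_mult)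
  also have "\<dots> = Complex (\<integral>w. V w * cos (s * X w) \<partial>M) (\<integral>w. V w * sin (s * X w) \<partial>M) / m"
    by (simp add: complex_eq_iff del: of_real_mult)
  finally show "char \<nu> s = \<dots>" .
  show "measure \<nu> A = (\<integral>w. V w * indicator A (X w) \<partial>M) / m" if [measurable]: "A \<in> sets borel"
  proof -
    interpret \<nu>: real_distribution \<nu> by fact
    have "measure \<nu> A = (\<integral>x. indicator A x \<partial>\<nu>)" by simp
    also have "\<dots> = (\<integral>w. (V w / m) *\<^sub>R indicator A (X w) \<partial>M)" by (rule *) auto
    finally show ?thesis by simp
  qed
qed

text \<open>Normalising the weights turns both sides into probability laws on the line whose characteristic
functions agree, so the one-dimensional uniqueness theorem of Levy applies. Only nonnegative weights
can be handled this way.\<close>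
lemma weighted_law_eq:
  fixes V X :: "_ \<Rightarrow> real" and W Y :: "_ \<Rightarrow> real"
  assumes M: "prob_space M" and V[measurable]: "V \<in> borel_measurable M" and X[measurable]: "X \<in> borel_measurable M"
    and V0: "\<And>w. 0 \<le> V w" "\<And>w. V w \<le> B"
    and N: "prob_space N" and W[measurable]: "W \<in> borel_measurable N" and Y[measurable]: "Y \<in> borel_measurable N"
    and W0: "\<And>w. 0 \<le> W w" "\<And>w. W w \<le> B"
    and c: "\<And>s. (\<integral>w. V w * cos (s * X w) \<partial>M) = (\<integral>w. W w * cos (s * Y w) \<partial>N)"
    and s: "\<And>s. (\<integral>w. V w * sin (s * X w) \<partial>M) = (\<integral>w. W w * sin (s * Y w) \<partial>N)"
    and A[measurable]: "A \<in> sets borel"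
  shows "(\<integral>w. V w * indicator A (X w) \<partial>M) = (\<integral>w. W w * indicator A (Y w) \<partial>N)"
proof -
  define m where "m = (\<integral>w. V w \<partial>M)"
  have mW: "m = (\<integral>w. W w \<partial>N)" using c[of 0] by (simp add: m_def)
  have "m \<ge> 0" unfolding m_def by (intro integral_nonneg_AE) (auto simp: V0)
  have iV: "integrable M V" and iV': "integrable M (\<lambda>w. V w * indicator A (X w))"
    using V0 prob_space.integrable_bounded_mult[OF M V, of "\<lambda>_. 1" B 1]
      prob_space.integrable_bounded_mult[OF M V, of "\<lambda>w. indicator A (X w)" B 1] by (auto simp: indicator_def)
  have iW: "integrable N W" and iW': "integrable N (\<lambda>w. W w * indicator A (Y w))"
    using W0 prob_space.integrable_bounded_mult[OF N W, of "\<lambda>_. 1" B 1]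
      prob_space.integrable_bounded_mult[OF N W, of "\<lambda>w. indicator A (Y w)" B 1] by (auto simp: indicator_def)
  show ?thesis
  proof (cases "m = 0")
    case True
    have "(\<integral>w. V w * indicator A (X w) \<partial>M) \<le> (\<integral>w. V w \<partial>M)"
      using iV iV' by (intro integral_mono) (auto simp: V0 indicator_def)
    moreover have "(\<integral>w. V w * indicator A (X w) \<partial>M) \<ge> 0" by (intro integral_nonneg_AE) (auto simp: V0)
    moreover have "(\<integral>w. W w * indicator A (Y w) \<partial>N) \<le> (\<integral>w. W w \<partial>N)"
      using iW iW' by (intro integral_mono) (auto simp: W0 indicator_def)
    moreover have "(\<integral>w. W w * indicator A (Y w) \<partial>N) \<ge> 0" by (intro integral_nonneg_AE) (auto simp: W0)
    ultimately show ?thesis using True m_def mW by simp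
  next
    case False
    with \<open>m \<ge> 0\<close> have "m > 0" by simp
    note 1 = char_weighted_law[OF M V X V0 m_def \<open>m > 0\<close>]
    note 2 = char_weighted_law[OF N W Y W0 mW \<open>m > 0\<close>]
    have "distr (density M (\<lambda>w. ennreal (V w / m))) borel X = distr (density N (\<lambda>w. ennreal (W w / m))) borel Y"
      by (intro Levy_uniqueness ext 1(1) 2(1)) (simp only: 1(2) 2(2) c s)
    then have "(\<integral>w. V w * indicator A (X w) \<partial>M) / m = (\<integral>w. W w * indicator A (Y w) \<partial>N) / m"
      unfolding 1(3)[OF A, symmetric] 2(3)[OF A, symmetric] by simp
    then show ?thesis using \<open>m > 0\<close> by simp
  qed
qed

lemma sum_shift_coeff:
  fixes u :: "'i \<Rightarrow> real"
  assumes "finite T"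
  shows "(\<Sum>t\<in>insert j T. ((if t \<in> T then u t else 0) + (if t = j then s else 0)) * x t) = (\<Sum>t\<in>T. u t * x t) + s * x j"
proof -
  have "(\<Sum>t\<in>insert j T. ((if t \<in> T then u t else 0) + (if t = j then s else 0)) * x t)
     = (\<Sum>t\<in>insert j T. (if t \<in> T then u t * x t else 0)) + (\<Sum>t\<in>insert j T. (if t = j then s * x t else 0))"
    by (simp add: distrib_right sum.distrib if_distrib[where f = "\<lambda>y. y * _"] cong: if_cong)
  also have "(\<Sum>t\<in>insert j T. (if t \<in> T then u t * x t else 0)) = (\<Sum>t\<in>T. u t * x t)"
    using assms by (intro sum.mono_neutral_cong_right) auto
  finally show ?thesis using assms by simp
qed

text \<open>These two product formulas express a weighted trigonometric moment through unweighted ones: the phase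
\<open>c\<close> is arbitrary, so a sine is a cosine with a shifted phase and the induction below only has
to carry cosines.\<close>
lemma one_plus_cos_mult_cos:
  fixes p a b c :: real
  shows "(p * (1 + cos (a + c))) * cos b = p * cos (b + 0) + (p * cos (a + b + c) + p * cos (a + (- b) + c)) / 2"
proof -
  have "cos (a + b + c) = cos (a + c) * cos b - sin (a + c) * sin b"
    "cos (a + (- b) + c) = cos (a + c) * cos b + sin (a + c) * sin b"
    using cos_add[of "a + c" b] cos_diff[of "a + c" b] by (simp_all add: algebra_simps)
  then show ?thesis by (simp only:) (simp add: field_simps)
qed

lemma one_plus_cos_mult_sin:
  fixes p a b c :: real
  shows "(p * (1 + cos (a + c))) * sin b
    = p * cos (b + - (pi / 2)) + (p * cos (a + b + (c - pi / 2)) + p * cos (a + (- b) + (c + pi / 2))) / 2"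
proof -
  have "sin b = cos (b + - (pi / 2))" by (simp add: cos_diff)
  moreover have "cos (a + b + (c - pi / 2)) = cos ((a + c) + (b + - (pi / 2)))"
    "cos (a + (- b) + (c + pi / 2)) = cos ((a + c) - (b + - (pi / 2)))"
    by (simp_all add: algebra_simps)
  ultimately show ?thesis
    using one_plus_cos_mult_cos[of p a c "b + - (pi / 2)"] by (simp add: algebra_simps)
qed

text \<open>The indicators are introduced one coordinate at a time. In the induction step the indicators that are
already present form a weight for the law of the new coordinate, and the remaining trigonometric
factor keeps the statement strong enough to be used again.\<close>
lemma char_eq_imp_cylinder_eq:
  fixes X :: "'i \<Rightarrow> _ \<Rightarrow> real" and Y :: "'i \<Rightarrow> _ \<Rightarrow> real"
  assumes M: "prob_space M" and X[measurable]: "\<And>i. X i \<in> borel_measurable M"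
    and N: "prob_space N" and Y[measurable]: "\<And>i. Y i \<in> borel_measurable N"
    and ceq: "\<And>T u. finite T \<Longrightarrow> (\<integral>w. cos (\<Sum>t\<in>T. u t * X t w) \<partial>M) = (\<integral>w. cos (\<Sum>t\<in>T. u t * Y t w) \<partial>N)"
    and seq: "\<And>T u. finite T \<Longrightarrow> (\<integral>w. sin (\<Sum>t\<in>T. u t * X t w) \<partial>M) = (\<integral>w. sin (\<Sum>t\<in>T. u t * Y t w) \<partial>N)"
    and J: "finite J" and A: "\<And>j. j \<in> J \<Longrightarrow> A j \<in> sets borel" and T: "finite T"
  shows "(\<integral>w. (\<Prod>j\<in>J. indicator (A j) (X j w)) * cos ((\<Sum>t\<in>T. u t * X t w) + c) \<partial>M)
       = (\<integral>w. (\<Prod>j\<in>J. indicator (A j) (Y j w)) * cos ((\<Sum>t\<in>T. u t * Y t w) + c) \<partial>N)"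
  using J A T
proof (induction J arbitrary: T u c rule: finite_induct)
  case empty
  interpret M: prob_space M by fact
  interpret N: prob_space N by fact
  show ?case using empty ceq[of T u] seq[of T u]
    by (simp add: cos_add)
next
  case (insert j J)
  interpret M: prob_space M by fact
  interpret N: prob_space N by fact
  have [measurable]: "A i \<in> sets borel" if "i \<in> J" for i using insert.prems that by simp
  have Aj[measurable]: "A j \<in> sets borel" using insert.prems by simp
  define P where "P w = (\<Prod>i\<in>J. indicator (A i) (X i w) :: real)" for w
  define Q where "Q w = (\<Prod>i\<in>J. indicator (A i) (Y i w) :: real)" for w
  have P01: "0 \<le> P w" "P w \<le> 1" for w unfolding P_def by (auto intro!: prod_nonneg prod_le_1 simp: indicator_def)
  have Q01: "0 \<le> Q w" "Q w \<le> 1" for w unfolding Q_def by (auto intro!: prod_nonneg prod_le_1 simp: indicator_def)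
  have [measurable]: "P \<in> borel_measurable M" unfolding P_def by measurable
  have [measurable]: "Q \<in> borel_measurable N" unfolding Q_def by measurable
  have IH: "(\<integral>w. P w * cos ((\<Sum>t\<in>T. u t * X t w) + c) \<partial>M) = (\<integral>w. Q w * cos ((\<Sum>t\<in>T. u t * Y t w) + c) \<partial>N)"
    if "finite T" for T u c using insert.IH[of T] insert.prems that unfolding P_def Q_def by simp
  have IH': "(\<integral>w. P w * cos ((\<Sum>t\<in>T. u t * X t w) + s * X j w + c) \<partial>M)
     = (\<integral>w. Q w * cos ((\<Sum>t\<in>T. u t * Y t w) + s * Y j w + c) \<partial>N)" if "finite T" for T u c s
    using IH[of "insert j T" "\<lambda>t. (if t \<in> T then u t else 0) + (if t = j then s else 0)"] that
    by (simp only: sum_shift_coeff[OF that]) simp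
  have iM: "integrable M (\<lambda>w. P w * cos (Z w))" if [measurable]: "Z \<in> borel_measurable M" for Z
    by (rule M.integrable_bounded_mult[where B = 1 and C = 1]) (auto simp: P01)
  have iN: "integrable N (\<lambda>w. Q w * cos (Z w))" if [measurable]: "Z \<in> borel_measurable N" for Z
    by (rule N.integrable_bounded_mult[where B = 1 and C = 1]) (auto simp: Q01)
  have splitM: "(\<integral>w. P w * cos (Z1 w) + (P w * cos (Z2 w) + P w * cos (Z3 w)) / 2 \<partial>M)
    = (\<integral>w. P w * cos (Z1 w) \<partial>M) + ((\<integral>w. P w * cos (Z2 w) \<partial>M) + (\<integral>w. P w * cos (Z3 w) \<partial>M)) / 2"
    if "Z1 \<in> borel_measurable M" "Z2 \<in> borel_measurable M" "Z3 \<in> borel_measurable M" for Z1 Z2 Z3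
    using iM[OF that(1)] iM[OF that(2)] iM[OF that(3)] by simp
  have splitN: "(\<integral>w. Q w * cos (Z1 w) + (Q w * cos (Z2 w) + Q w * cos (Z3 w)) / 2 \<partial>N)
    = (\<integral>w. Q w * cos (Z1 w) \<partial>N) + ((\<integral>w. Q w * cos (Z2 w) \<partial>N) + (\<integral>w. Q w * cos (Z3 w) \<partial>N)) / 2"
    if "Z1 \<in> borel_measurable N" "Z2 \<in> borel_measurable N" "Z3 \<in> borel_measurable N" for Z1 Z2 Z3
    using iN[OF that(1)] iN[OF that(2)] iN[OF that(3)] by simp
  \<comment> \<open>Multiplying by \<open>1 + cos\<close> keeps the weight nonnegative, so that the one-dimensional uniqueness
    theorem applies to the law of the new coordinate.\<close>
  have key: "(\<integral>w. (P w * (1 + cos ((\<Sum>t\<in>T. u t * X t w) + c))) * indicator (A j) (X j w) \<partial>M)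
     = (\<integral>w. (Q w * (1 + cos ((\<Sum>t\<in>T. u t * Y t w) + c))) * indicator (A j) (Y j w) \<partial>N)" if T: "finite T" for T u c
  proof (rule weighted_law_eq[OF M _ _ _ _ N, where B = 2])
    fix s
    let ?SX = "\<lambda>w. (\<Sum>t\<in>T. u t * X t w)" and ?SY = "\<lambda>w. (\<Sum>t\<in>T. u t * Y t w)"
    have "(\<integral>w. (P w * (1 + cos (?SX w + c))) * cos (s * X j w) \<partial>M)
       = (\<integral>w. P w * cos ((\<Sum>t\<in>{}. u t * X t w) + s * X j w + 0) + (P w * cos (?SX w + s * X j w + c) + P w * cos (?SX w + (-s) * X j w + c)) / 2 \<partial>M)"
      by (intro Bochner_Integration.integral_cong refl) (simp add: one_plus_cos_mult_cos)
    also have "\<dots> = (\<integral>w. Q w * cos ((\<Sum>t\<in>{}. u t * Y t w) + s * Y j w + 0) + (Q w * cos (?SY w + s * Y j w + c) + Q w * cos (?SY w + (-s) * Y j w + c)) / 2 \<partial>N)"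
      by (subst splitM splitN; (measurable)?)+ (simp only: IH'[OF T] IH'[OF finite.emptyI])
    also have "\<dots> = (\<integral>w. (Q w * (1 + cos (?SY w + c))) * cos (s * Y j w) \<partial>N)"
      by (intro Bochner_Integration.integral_cong refl) (simp add: one_plus_cos_mult_cos)
    finally show "(\<integral>w. (P w * (1 + cos (?SX w + c))) * cos (s * X j w) \<partial>M) = (\<integral>w. (Q w * (1 + cos (?SY w + c))) * cos (s * Y j w) \<partial>N)" .
    have "(\<integral>w. (P w * (1 + cos (?SX w + c))) * sin (s * X j w) \<partial>M)
       = (\<integral>w. P w * cos ((\<Sum>t\<in>{}. u t * X t w) + s * X j w + - (pi/2)) + (P w * cos (?SX w + s * X j w + (c - pi/2)) + P w * cos (?SX w + (-s) * X j w + (c + pi/2))) / 2 \<partial>M)"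
      by (intro Bochner_Integration.integral_cong refl) (simp add: one_plus_cos_mult_sin)
    also have "\<dots> = (\<integral>w. Q w * cos ((\<Sum>t\<in>{}. u t * Y t w) + s * Y j w + - (pi/2)) + (Q w * cos (?SY w + s * Y j w + (c - pi/2)) + Q w * cos (?SY w + (-s) * Y j w + (c + pi/2))) / 2 \<partial>N)"
      by (subst splitM splitN; (measurable)?)+ (simp only: IH'[OF T] IH'[OF finite.emptyI])
    also have "\<dots> = (\<integral>w. (Q w * (1 + cos (?SY w + c))) * sin (s * Y j w) \<partial>N)"
      by (intro Bochner_Integration.integral_cong refl) (simp add: one_plus_cos_mult_sin)
    finally show "(\<integral>w. (P w * (1 + cos (?SX w + c))) * sin (s * X j w) \<partial>M) = (\<integral>w. (Q w * (1 + cos (?SY w + c))) * sin (s * Y j w) \<partial>N)" .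
  next
    fix w
    have 1: "0 \<le> 1 + cos z" "1 + cos z \<le> 2" for z :: real using cos_ge_minus_one[of z] cos_le_one[of z] by linarith+
    show "0 \<le> P w * (1 + cos ((\<Sum>t\<in>T. u t * X t w) + c))" using P01 1 by simp
    show "P w * (1 + cos ((\<Sum>t\<in>T. u t * X t w) + c)) \<le> 2" using P01 1 mult_mono[of "P w" 1 _ 2] by fastforce
  next
    fix w
    have 1: "0 \<le> 1 + cos z" "1 + cos z \<le> 2" for z :: real using cos_ge_minus_one[of z] cos_le_one[of z] by linarith+
    show "0 \<le> Q w * (1 + cos ((\<Sum>t\<in>T. u t * Y t w) + c))" using Q01 1 by simp
    show "Q w * (1 + cos ((\<Sum>t\<in>T. u t * Y t w) + c)) \<le> 2" using Q01 1 mult_mono[of "Q w" 1 _ 2] by fastforce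
  qed auto
  have iM': "integrable M (\<lambda>w. P w * indicator (A j) (X j w) * cos (Z w))" if [measurable]: "Z \<in> borel_measurable M" for Z
    using P01 by (intro M.integrable_bounded_mult[where B = 1 and C = 1]) (auto simp: indicator_def)
  have iN': "integrable N (\<lambda>w. Q w * indicator (A j) (Y j w) * cos (Z w))" if [measurable]: "Z \<in> borel_measurable N" for Z
    using Q01 by (intro N.integrable_bounded_mult[where B = 1 and C = 1]) (auto simp: indicator_def)
  \<comment> \<open>At \<open>T = {}\<close> and phase \<open>pi / 2\<close> the cosine vanishes; subtracting this case removes the summand \<open>1\<close>.\<close>
  have base: "(\<integral>w. P w * indicator (A j) (X j w) \<partial>M) = (\<integral>w. Q w * indicator (A j) (Y j w) \<partial>N)"
    using key[of "{}" u "pi / 2"] by simp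
  have "(\<integral>w. P w * indicator (A j) (X j w) + P w * indicator (A j) (X j w) * cos ((\<Sum>t\<in>T. u t * X t w) + c) \<partial>M)
    = (\<integral>w. Q w * indicator (A j) (Y j w) + Q w * indicator (A j) (Y j w) * cos ((\<Sum>t\<in>T. u t * Y t w) + c) \<partial>N)"
    using key[OF insert.prems(2), of u c] by (simp add: algebra_simps)
  then have "(\<integral>w. P w * indicator (A j) (X j w) * cos ((\<Sum>t\<in>T. u t * X t w) + c) \<partial>M)
    = (\<integral>w. Q w * indicator (A j) (Y j w) * cos ((\<Sum>t\<in>T. u t * Y t w) + c) \<partial>N)"
    using base iM'[of "\<lambda>_. 0"] iN'[of "\<lambda>_. 0"]
    by (subst (asm) (1 2) Bochner_Integration.integral_add) (auto intro!: iM' iN')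
  then show ?case using insert.hyps by (simp add: P_def Q_def mult_ac)
qed

text \<open>The Cramer-Wold device for families with an arbitrary index set: a law on the product space is
determined by cylinder sets, hence by the characteristic functions of all finite linear combinations.\<close>
theorem char_eq_imp_law_eq:
  fixes X :: "'i \<Rightarrow> _ \<Rightarrow> real" and Y :: "'i \<Rightarrow> _ \<Rightarrow> real"
  assumes M: "prob_space M" and X[measurable]: "\<And>i. X i \<in> borel_measurable M"
    and N: "prob_space N" and Y[measurable]: "\<And>i. Y i \<in> borel_measurable N"
    and ceq: "\<And>T u. finite T \<Longrightarrow> (\<integral>w. cos (\<Sum>t\<in>T. u t * X t w) \<partial>M) = (\<integral>w. cos (\<Sum>t\<in>T. u t * Y t w) \<partial>N)"
    and seq: "\<And>T u. finite T \<Longrightarrow> (\<integral>w. sin (\<Sum>t\<in>T. u t * X t w) \<partial>M) = (\<integral>w. sin (\<Sum>t\<in>T. u t * Y t w) \<partial>N)"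
  shows "distr M (Pi\<^sub>M UNIV (\<lambda>_. borel)) (\<lambda>w i. X i w) = distr N (Pi\<^sub>M UNIV (\<lambda>_. borel)) (\<lambda>w i. Y i w)"
proof (rule measure_eqI_PiM_infinite)
  interpret M: prob_space M by fact
  interpret N: prob_space N by fact
  have mX[measurable]: "(\<lambda>w i. X i w) \<in> measurable M (Pi\<^sub>M UNIV (\<lambda>_. borel))" by (rule measurable_PiM_single') auto
  have mY[measurable]: "(\<lambda>w i. Y i w) \<in> measurable N (Pi\<^sub>M UNIV (\<lambda>_. borel))" by (rule measurable_PiM_single') auto
  show "finite_measure (distr M (Pi\<^sub>M UNIV (\<lambda>_. borel)) (\<lambda>w i. X i w))"
    by (intro M.finite_measure_distr) simp
  fix A :: "'i \<Rightarrow> real set" and J :: "'i set"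
  assume J: "finite J" and A: "\<And>i. i \<in> J \<Longrightarrow> A i \<in> sets borel"
  have [measurable]: "A i \<in> sets borel" if "i \<in> J" for i using A that .
  let ?E = "prod_emb UNIV (\<lambda>_. borel) J (Pi\<^sub>E J A)"
  have E: "?E \<in> sets (Pi\<^sub>M UNIV (\<lambda>_. borel))" using J A by (intro sets_PiM_I) auto
  have "emeasure (distr M (Pi\<^sub>M UNIV (\<lambda>_. borel)) (\<lambda>w i. X i w)) ?E = emeasure M {w\<in>space M. \<forall>j\<in>J. X j w \<in> A j}"
    by (subst emeasure_distr[OF mX E]) (auto intro!: arg_cong[where f = "emeasure M"] simp: prod_emb_iff PiE_iff)
  also have "\<dots> = ennreal (\<integral>w. indicator {w\<in>space M. \<forall>j\<in>J. X j w \<in> A j} w \<partial>M)"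
    using J by (simp add: M.emeasure_eq_measure Int_absorb2)
  also have "(\<integral>w. indicator {w\<in>space M. \<forall>j\<in>J. X j w \<in> A j} w \<partial>M) = (\<integral>w. (\<Prod>j\<in>J. indicator (A j) (X j w)) * cos ((\<Sum>t\<in>{}. 0 * X t w) + 0) \<partial>M)"
    using J by (intro Bochner_Integration.integral_cong) (auto simp: indicator_def prod_zero_iff)
  also have "\<dots> = (\<integral>w. (\<Prod>j\<in>J. indicator (A j) (Y j w)) * cos ((\<Sum>t\<in>{}. 0 * Y t w) + 0) \<partial>N)"
    by (rule char_eq_imp_cylinder_eq[OF M X N Y ceq seq J A]) auto
  also have "\<dots> = (\<integral>w. indicator {w\<in>space N. \<forall>j\<in>J. Y j w \<in> A j} w \<partial>N)"
    using J by (intro Bochner_Integration.integral_cong) (auto simp: indicator_def prod_zero_iff)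
  also have "ennreal \<dots> = emeasure N {w\<in>space N. \<forall>j\<in>J. Y j w \<in> A j}"
    using J by (simp add: N.emeasure_eq_measure Int_absorb2)
  also have "\<dots> = emeasure (distr N (Pi\<^sub>M UNIV (\<lambda>_. borel)) (\<lambda>w i. Y i w)) ?E"
    by (subst emeasure_distr[OF mY E]) (auto intro!: arg_cong[where f = "emeasure N"] simp: prod_emb_iff PiE_iff)
  finally show "emeasure (distr M (Pi\<^sub>M UNIV (\<lambda>_. borel)) (\<lambda>w i. X i w)) ?E = emeasure (distr N (Pi\<^sub>M UNIV (\<lambda>_. borel)) (\<lambda>w i. Y i w)) ?E" .
qed simp_all

section \<open>The standard normal law\<close>

abbreviation std_gauss :: "real measure" where
  "std_gauss \<equiv> density lborel std_normal_density"

interpretation std_gauss: real_distribution std_gauss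
  by (rule real_dist_normal_dist)

lemma integral_std_gauss:
  "f \<in> borel_measurable borel \<Longrightarrow> (\<integral>x. f x \<partial>std_gauss) = (\<integral>x. std_normal_density x * (f x :: real) \<partial>lborel)"
  by (subst integral_density) auto

lemma integrable_std_gauss:
  "f \<in> borel_measurable borel \<Longrightarrow> integrable std_gauss f \<longleftrightarrow> integrable lborel (\<lambda>x. std_normal_density x * (f x :: real))"
  by (subst integrable_density) auto

lemma cos_sin_std_gauss:
  "(\<integral>x. cos (t * x) \<partial>std_gauss) = exp (- t\<^sup>2 / 2)" "(\<integral>x. sin (t * x) \<partial>std_gauss) = 0"
proof -
  have i: "integrable std_gauss (\<lambda>x. iexp (t * x))"
    by (rule std_gauss.integrable_iexp) auto
  have "(CLINT x|std_gauss. iexp (t * x)) = exp (- t\<^sup>2 / 2)"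
    using fun_cong[OF char_std_normal_distribution, of t] by (simp add: char_def exp_of_real)
  then have "Re (CLINT x|std_gauss. iexp (t * x)) = exp (- t\<^sup>2 / 2)" "Im (CLINT x|std_gauss. iexp (t * x)) = 0"
    by (simp_all del: of_real_mult)
  moreover have "Re (CLINT x|std_gauss. iexp (t * x)) = (\<integral>x. cos (t * x) \<partial>std_gauss)"
    using i by (subst integral_Re[symmetric]) (auto simp: iexp_cos_sin simp del: of_real_mult)
  moreover have "Im (CLINT x|std_gauss. iexp (t * x)) = (\<integral>x. sin (t * x) \<partial>std_gauss)"
    using i by (subst integral_Im[symmetric]) (auto simp: iexp_cos_sin simp del: of_real_mult)
  ultimately show "(\<integral>x. cos (t * x) \<partial>std_gauss) = exp (- t\<^sup>2 / 2)" "(\<integral>x. sin (t * x) \<partial>std_gauss) = 0"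
    by simp_all
qed

lemma integrable_std_gauss_abs_power: "integrable std_gauss (\<lambda>x. \<bar>x\<bar> ^ k)"
  using integrable_std_normal_moment_abs[of k] by (subst integrable_std_gauss) auto

lemma one_plus_power_le:
  fixes x :: real assumes "x \<ge> 0" shows "(1 + x) ^ m \<le> 2 ^ m * (1 + x ^ m)"
proof -
  have "1 + x \<le> 2 * max 1 x" by simp
  then have "(1 + x) ^ m \<le> (2 * max 1 x) ^ m" using assms by (intro power_mono) auto
  also have "\<dots> = 2 ^ m * max 1 x ^ m" by (simp add: power_mult_distrib)
  also have "max 1 x ^ m \<le> 1 + x ^ m" using assms by (auto simp: max_def)
  finally show ?thesis by simp
qed

lemma integrable_std_gauss_growth:
  assumes [measurable]: "g \<in> borel_measurable borel" and "\<And>x. \<bar>g x\<bar> \<le> C * (1 + \<bar>x\<bar>) ^ m"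
  shows "integrable std_gauss (g :: real \<Rightarrow> real)"
proof (rule Bochner_Integration.integrable_bound)
  show "integrable std_gauss (\<lambda>x. \<bar>C\<bar> * (2 ^ m * (1 + \<bar>x\<bar> ^ m)))"
    using integrable_std_gauss_abs_power[of m] by (intro integrable_mult_right Bochner_Integration.integrable_add) auto
  show "AE x in std_gauss. norm (g x) \<le> norm (\<bar>C\<bar> * (2 ^ m * (1 + \<bar>x\<bar> ^ m)))"
  proof (rule AE_I2)
    fix x :: real
    have "\<bar>g x\<bar> \<le> \<bar>C\<bar> * (1 + \<bar>x\<bar>) ^ m"
      using assms(2)[of x] mult_right_mono[OF abs_ge_self[of C], of "(1 + \<bar>x\<bar>) ^ m", OF zero_le_power] by (auto intro: order_trans)
    also have "\<dots> \<le> \<bar>C\<bar> * (2 ^ m * (1 + \<bar>x\<bar> ^ m))" by (intro mult_left_mono one_plus_power_le) auto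
    finally show "norm (g x) \<le> norm (\<bar>C\<bar> * (2 ^ m * (1 + \<bar>x\<bar> ^ m)))" by (simp add: abs_mult)
  qed
qed simp

lemma tendsto_growth_mult_gauss:
  assumes "\<And>x. \<bar>g x\<bar> \<le> C * (1 + \<bar>x\<bar>) ^ m"
  shows "((\<lambda>x. g x * std_normal_density x) \<longlongrightarrow> 0) at_top"
    "((\<lambda>x. g x * std_normal_density x) \<longlongrightarrow> 0) at_bot"
proof -
  have "filterlim (\<lambda>x::real. \<bar>x\<bar>) at_top F \<Longrightarrow> ((\<lambda>x. g x * std_normal_density x) \<longlongrightarrow> 0) F" for F
  proof -
    assume F: "filterlim (\<lambda>x::real. \<bar>x\<bar>) at_top F"
    have 1: "((\<lambda>x::real. \<bar>C\<bar> * (1 + x) ^ m * (1 / sqrt (2 * pi) * exp (- x\<^sup>2 / 2))) \<longlongrightarrow> 0) at_top"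
    proof (rule Lim_null_comparison)
      have "((\<lambda>x::real. (1 + x) ^ m / exp (1 + x)) \<longlongrightarrow> 0) at_top"
        by (rule filterlim_compose[OF tendsto_power_div_exp_0]) (rule filterlim_tendsto_add_at_top[OF tendsto_const filterlim_ident])
      then show "((\<lambda>x::real. \<bar>C\<bar> * exp 1 * ((1 + x) ^ m / exp (1 + x))) \<longlongrightarrow> 0) at_top"
        by (rule tendsto_mult_right_zero)
      show "\<forall>\<^sub>F x::real in at_top. norm (\<bar>C\<bar> * (1 + x) ^ m * (1 / sqrt (2 * pi) * exp (- x\<^sup>2 / 2)))
         \<le> \<bar>C\<bar> * exp 1 * ((1 + x) ^ m / exp (1 + x))"
        using eventually_ge_at_top[of 2]
      proof eventually_elim
        case (elim x)
        have "exp (- x\<^sup>2 / 2) \<le> exp (- x)" using elim by (simp add: power2_eq_square)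
        moreover have "1 / sqrt (2 * pi) \<le> 1" using pi_gt3 by (auto simp: field_simps real_le_lsqrt real_le_rsqrt)
        ultimately have "1 / sqrt (2 * pi) * exp (- x\<^sup>2 / 2) \<le> 1 * exp (- x)" by (intro mult_mono) auto
        then have "\<bar>C\<bar> * (1 + x) ^ m * (1 / sqrt (2 * pi) * exp (- x\<^sup>2 / 2)) \<le> \<bar>C\<bar> * (1 + x) ^ m * exp (- x)"
          using elim by (intro mult_left_mono) auto
        also have "\<dots> = \<bar>C\<bar> * exp 1 * ((1 + x) ^ m / exp (1 + x))" by (simp add: exp_add exp_minus field_simps)
        finally show ?case using elim by (simp add: abs_mult)
      qed
    qed
    have "((\<lambda>x::real. \<bar>C\<bar> * (1 + \<bar>x\<bar>) ^ m * (1 / sqrt (2 * pi) * exp (- \<bar>x\<bar>\<^sup>2 / 2))) \<longlongrightarrow> 0) F"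
      by (rule filterlim_compose[OF 1 F])
    then show ?thesis
    proof (rule Lim_null_comparison[rotated])
      show "\<forall>\<^sub>F x in F. norm (g x * std_normal_density x) \<le> \<bar>C\<bar> * (1 + \<bar>x\<bar>) ^ m * (1 / sqrt (2 * pi) * exp (- \<bar>x\<bar>\<^sup>2 / 2))"
      proof (rule always_eventually, rule allI)
        fix x :: real
        have "\<bar>g x\<bar> \<le> \<bar>C\<bar> * (1 + \<bar>x\<bar>) ^ m"
          using assms(1)[of x] mult_right_mono[OF abs_ge_self[of C], of "(1 + \<bar>x\<bar>) ^ m", OF zero_le_power] by (auto intro: order_trans)
        then have "\<bar>g x\<bar> * std_normal_density x \<le> \<bar>C\<bar> * (1 + \<bar>x\<bar>) ^ m * std_normal_density x"
          by (intro mult_right_mono) auto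
        then show "norm (g x * std_normal_density x) \<le> \<bar>C\<bar> * (1 + \<bar>x\<bar>) ^ m * (1 / sqrt (2 * pi) * exp (- \<bar>x\<bar>\<^sup>2 / 2))"
          by (simp add: abs_mult std_normal_density_def)
      qed
    qed
  qed
  from this[OF filterlim_abs_real] this[OF filterlim_at_infinity_imp_norm_at_top[OF filterlim_mono[OF filterlim_ident order_refl at_bot_le_at_infinity], unfolded real_norm_def]]
  show "((\<lambda>x. g x * std_normal_density x) \<longlongrightarrow> 0) at_top" "((\<lambda>x. g x * std_normal_density x) \<longlongrightarrow> 0) at_bot" by auto
qed

text \<open>Since \<open>- x\<close> is the logarithmic derivative of the density, both integrands combine to minus the
derivative of \<open>g\<close> times the density, and this product vanishes at infinity.\<close>
lemma std_gauss_ibp: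
  fixes g g' :: "real \<Rightarrow> real"
  assumes d: "\<And>x. (g has_real_derivative g' x) (at x)" and c: "continuous_on UNIV g'"
    and b: "\<And>x. \<bar>g x\<bar> \<le> C * (1 + \<bar>x\<bar>) ^ m" and b': "\<And>x. \<bar>g' x\<bar> \<le> C' * (1 + \<bar>x\<bar>) ^ m'"
  shows "(\<integral>x. x * g x \<partial>std_gauss) = (\<integral>x. g' x \<partial>std_gauss)"
proof -
  have cg: "continuous_on UNIV g" using d by (meson DERIV_isCont continuous_at_imp_continuous_on)
  have [measurable]: "g \<in> borel_measurable borel" "g' \<in> borel_measurable borel"
    using c cg by (auto intro: borel_measurable_continuous_onI)
  have i': "integrable std_gauss g'" by (rule integrable_std_gauss_growth[OF _ b']) simp
  have i: "integrable std_gauss (\<lambda>x. x * g x)"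
  proof (rule integrable_std_gauss_growth)
    fix x :: real
    have "\<bar>x * g x\<bar> \<le> (1 + \<bar>x\<bar>) * (C * (1 + \<bar>x\<bar>) ^ m)" unfolding abs_mult using b by (intro mult_mono) auto
    then show "\<bar>x * g x\<bar> \<le> C * (1 + \<bar>x\<bar>) ^ Suc m" by (simp add: mult_ac)
  qed simp
  define F where "F x = g x * std_normal_density x" for x
  define f where "f x = std_normal_density x * g' x - std_normal_density x * (x * g x)" for x
  have intf: "integrable lborel f" using i i' unfolding f_def by (simp add: integrable_std_gauss)
  have dd: "(std_normal_density has_real_derivative (- x * std_normal_density x)) (at x)" for x
    unfolding std_normal_density_def[abs_def] by (auto intro!: derivative_eq_intros simp: field_simps)
  have "(LBINT x=-\<infinity>..\<infinity>. f x) = 0 - 0"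
  proof (rule interval_integral_FTC_integrable[where F = F])
    show "(F has_vector_derivative f x) (at x)" for x
      unfolding F_def f_def has_real_derivative_iff_has_vector_derivative[symmetric]
      by (auto intro!: derivative_eq_intros d dd simp: algebra_simps)
    show "isCont f x" for x unfolding f_def
      using c cg DERIV_isCont[OF dd] by (auto intro!: continuous_intros simp: continuous_on_eq_continuous_at)
    show "set_integrable lborel (einterval (- \<infinity>) \<infinity>) f" using intf by (simp add: set_integrable_def einterval_eq)
    show "((F \<circ> real_of_ereal) \<longlongrightarrow> 0) (at_right (- \<infinity>))" "((F \<circ> real_of_ereal) \<longlongrightarrow> 0) (at_left \<infinity>)"
      using tendsto_growth_mult_gauss[OF b] by (simp_all add: ereal_tendsto_simps1 F_def[abs_def])
  qed simp
  then have "(\<integral>x. f x \<partial>lborel) = 0" by (simp add: interval_lebesgue_integral_def set_lebesgue_integral_def einterval_eq)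
  then have "(\<integral>x. g' x \<partial>std_gauss) - (\<integral>x. x * g x \<partial>std_gauss) = 0"
    unfolding f_def using i i' by (simp add: integral_std_gauss integrable_std_gauss)
  then show ?thesis by simp
qed

section \<open>Jointly Gaussian families\<close>

text \<open>A centred Gaussian family with unit variances, described only by the characteristic functions of its
finite linear combinations; \<open>r\<close> is the covariance. The index set is arbitrary, which allows the
increments at all scales of one process to be treated as a single family.\<close>
locale std_gaussian_family = prob_space M for M :: "'w measure" +
  fixes \<xi> :: "'i \<Rightarrow> 'w \<Rightarrow> real" and r :: "'i \<Rightarrow> 'i \<Rightarrow> real"
  assumes measurable_\<xi> [measurable]: "\<And>i. \<xi> i \<in> borel_measurable M"
    and expectation_cos: "\<And>T c. finite T \<Longrightarrow>
      expectation (\<lambda>w. cos (\<Sum>t\<in>T. c t * \<xi> t w)) = exp (- (\<Sum>s\<in>T. \<Sum>t\<in>T. c s * c t * r s t) / 2)"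
    and expectation_sin: "\<And>T c. finite T \<Longrightarrow> expectation (\<lambda>w. sin (\<Sum>t\<in>T. c t * \<xi> t w)) = 0"
    and r_refl [simp]: "\<And>i. r i i = 1" and r_sym: "\<And>i j. r i j = r j i"
begin

lemma quadratic_form_shift:
  fixes c :: "'i \<Rightarrow> real"
  assumes T: "finite T" and \<rho>: "\<rho> = (\<Sum>t\<in>T. c t * r i t)"
  defines "d \<equiv> \<lambda>t. (if t \<in> T then c t else 0) + (if t = i then - \<rho> else 0)"
  shows "(\<Sum>s\<in>insert i T. \<Sum>t\<in>insert i T. d s * d t * r s t) = (\<Sum>s\<in>T. \<Sum>t\<in>T. c s * c t * r s t) - \<rho>\<^sup>2"
proof -
  have 1: "(\<Sum>t\<in>insert i T. d t * x t) = (\<Sum>t\<in>T. c t * x t) - \<rho> * x i" for x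
    unfolding d_def using sum_shift_coeff[OF T, where j = i and u = c and s = "-\<rho>" and x = x] by simp
  have "(\<Sum>s\<in>insert i T. \<Sum>t\<in>insert i T. d s * d t * r s t) = (\<Sum>s\<in>insert i T. d s * (\<Sum>t\<in>insert i T. d t * r s t))"
    by (simp add: sum_distrib_left mult_ac)
  also have "\<dots> = (\<Sum>s\<in>T. c s * (\<Sum>t\<in>insert i T. d t * r s t)) - \<rho> * (\<Sum>t\<in>insert i T. d t * r i t)"
    by (rule 1)
  also have "\<dots> = (\<Sum>s\<in>T. c s * ((\<Sum>t\<in>T. c t * r s t) - \<rho> * r s i)) - \<rho> * ((\<Sum>t\<in>T. c t * r i t) - \<rho> * r i i)"
    unfolding 1 by simp
  also have "(\<Sum>s\<in>T. c s * ((\<Sum>t\<in>T. c t * r s t) - \<rho> * r s i)) = (\<Sum>s\<in>T. \<Sum>t\<in>T. c s * c t * r s t) - \<rho> * (\<Sum>s\<in>T. c s * r i s)"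
    by (simp add: right_diff_distrib sum_subtractf sum_distrib_left mult_ac r_sym[of i])
  finally show ?thesis by (simp add: \<rho>[symmetric] power2_eq_square)
qed

text \<open>The \<open>i\<close>-th variable is replaced by an independent standard normal \<open>x\<close>, and every other variable
is moved along its regression on the \<open>i\<close>-th one.\<close>
definition resample :: "'i \<Rightarrow> real \<times> 'w \<Rightarrow> 'i \<Rightarrow> real" where
  "resample i = (\<lambda>(x, w) j. \<xi> j w + r i j * (x - \<xi> i w))"

lemma measurable_resample [measurable]: "(\<lambda>z. resample i z j) \<in> borel_measurable (std_gauss \<Otimes>\<^sub>M M)"
  unfolding resample_def by (simp add: case_prod_beta)

lemma measurable_resample_PiM [measurable]: "resample i \<in> measurable (std_gauss \<Otimes>\<^sub>M M) (Pi\<^sub>M UNIV (\<lambda>_. borel))"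
  by (rule measurable_PiM_single') auto

lemma measurable_\<xi>_PiM [measurable]: "(\<lambda>w i. \<xi> i w) \<in> measurable M (Pi\<^sub>M UNIV (\<lambda>_. borel))"
  by (rule measurable_PiM_single') auto

sublocale pr: pair_prob_space std_gauss M ..

text \<open>The residuals \<open>\<xi> j - r i j * \<xi> i\<close> are uncorrelated with \<open>\<xi> i\<close>, hence independent of it, so exchanging
\<open>\<xi> i\<close> for an independent copy does not change the joint law. On the level of characteristic functions
independence is the additive splitting of the quadratic form in \<open>quadratic_form_shift\<close>.
This reduces Gaussian integration by parts to the one-dimensional formula.\<close>
lemma resample_law:
  "distr M (Pi\<^sub>M UNIV (\<lambda>_. borel)) (\<lambda>w j. \<xi> j w) = distr (std_gauss \<Otimes>\<^sub>M M) (Pi\<^sub>M UNIV (\<lambda>_. borel)) (resample i)"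
proof -
  have "distr M (Pi\<^sub>M UNIV (\<lambda>_. borel)) (\<lambda>w j. \<xi> j w)
     = distr (std_gauss \<Otimes>\<^sub>M M) (Pi\<^sub>M UNIV (\<lambda>_. borel)) (\<lambda>z j. resample i z j)"
  proof (rule char_eq_imp_law_eq)
    show "prob_space M" "prob_space (std_gauss \<Otimes>\<^sub>M M)" by unfold_locales
    fix T :: "'i set" and u :: "'i \<Rightarrow> real" assume T: "finite T"
    define \<rho> where "\<rho> = (\<Sum>t\<in>T. u t * r i t)"
    define d where "d = (\<lambda>t. (if t \<in> T then u t else 0) + (if t = i then - \<rho> else 0))"
    define A where "A w = (\<Sum>t\<in>insert i T. d t * \<xi> t w)" for w
    have Aeq: "A w = (\<Sum>t\<in>T. u t * \<xi> t w) - \<rho> * \<xi> i w" for w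
      unfolding A_def d_def using sum_shift_coeff[OF T, where j = i and u = u and s = "-\<rho>"] by simp
    have [measurable]: "A \<in> borel_measurable M" unfolding A_def by simp
    have lin: "(\<Sum>t\<in>T. u t * resample i (x, w) t) = \<rho> * x + A w" for x w
      unfolding Aeq resample_def \<rho>_def by (simp add: algebra_simps sum.distrib sum_subtractf sum_distrib_left)
    have EA: "expectation (\<lambda>w. cos (A w)) = exp (- ((\<Sum>s\<in>T. \<Sum>t\<in>T. u s * u t * r s t) - \<rho>\<^sup>2) / 2)"
      "expectation (\<lambda>w. sin (A w)) = 0"
      unfolding A_def using T quadratic_form_shift[OF T \<rho>_def, folded d_def]
      unfolding d_def by (simp_all only: expectation_cos expectation_sin finite_insert)
    have "(\<integral>z. cos (\<Sum>t\<in>T. u t * resample i z t) \<partial>(std_gauss \<Otimes>\<^sub>M M)) = (\<integral>x. (\<integral>w. cos (\<rho> * x + A w) \<partial>M) \<partial>std_gauss)"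
      by (subst pr.integral_fst'[symmetric]) (auto simp: lin[symmetric] intro!: pr.integrable_cos)
    also have "\<dots> = (\<integral>x. cos (\<rho> * x) * expectation (\<lambda>w. cos (A w)) \<partial>std_gauss)"
      by (simp add: cos_add EA(2))
    also have "\<dots> = exp (- \<rho>\<^sup>2 / 2) * exp (- ((\<Sum>s\<in>T. \<Sum>t\<in>T. u s * u t * r s t) - \<rho>\<^sup>2) / 2)"
      by (simp add: EA(1) cos_sin_std_gauss)
    also have "\<dots> = expectation (\<lambda>w. cos (\<Sum>t\<in>T. u t * \<xi> t w))"
      using T by (simp add: expectation_cos flip: exp_add) (simp add: field_simps)
    finally show "expectation (\<lambda>w. cos (\<Sum>t\<in>T. u t * \<xi> t w)) = (\<integral>z. cos (\<Sum>t\<in>T. u t * resample i z t) \<partial>(std_gauss \<Otimes>\<^sub>M M))" ..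
    have "(\<integral>z. sin (\<Sum>t\<in>T. u t * resample i z t) \<partial>(std_gauss \<Otimes>\<^sub>M M)) = (\<integral>x. (\<integral>w. sin (\<rho> * x + A w) \<partial>M) \<partial>std_gauss)"
      by (subst pr.integral_fst'[symmetric]) (auto simp: lin[symmetric] intro!: pr.integrable_sin)
    also have "\<dots> = (\<integral>x. sin (\<rho> * x) * expectation (\<lambda>w. cos (A w)) \<partial>std_gauss)"
      by (simp add: sin_add EA(2))
    also have "\<dots> = 0" by (simp add: cos_sin_std_gauss)
    finally show "expectation (\<lambda>w. sin (\<Sum>t\<in>T. u t * \<xi> t w)) = (\<integral>z. sin (\<Sum>t\<in>T. u t * resample i z t) \<partial>(std_gauss \<Otimes>\<^sub>M M))"
      using T by (simp add: expectation_sin)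
  qed auto
  then show ?thesis by simp
qed

lemma integral_resample:
  fixes \<Phi> :: "('i \<Rightarrow> real) \<Rightarrow> real"
  assumes [measurable]: "\<Phi> \<in> borel_measurable (Pi\<^sub>M UNIV (\<lambda>_. borel))" and "integrable M (\<lambda>w. \<Phi> (\<lambda>j. \<xi> j w))"
  shows "integrable (std_gauss \<Otimes>\<^sub>M M) (\<lambda>z. \<Phi> (resample i z))"
    and "expectation (\<lambda>w. \<Phi> (\<lambda>j. \<xi> j w)) = (\<integral>w. (\<integral>x. \<Phi> (resample i (x, w)) \<partial>std_gauss) \<partial>M)"
proof -
  have "integrable (distr M (Pi\<^sub>M UNIV (\<lambda>_. borel)) (\<lambda>w j. \<xi> j w)) \<Phi>"
    using assms by (subst integrable_distr_eq) auto
  then show 1: "integrable (std_gauss \<Otimes>\<^sub>M M) (\<lambda>z. \<Phi> (resample i z))"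
    unfolding resample_law[of i] by (subst (asm) integrable_distr_eq) auto
  have "expectation (\<lambda>w. \<Phi> (\<lambda>j. \<xi> j w)) = (\<integral>y. \<Phi> y \<partial>distr M (Pi\<^sub>M UNIV (\<lambda>_. borel)) (\<lambda>w j. \<xi> j w))"
    by (subst integral_distr) auto
  also have "\<dots> = (\<integral>z. \<Phi> (resample i z) \<partial>(std_gauss \<Otimes>\<^sub>M M))"
    unfolding resample_law[of i] by (subst integral_distr) auto
  also have "\<dots> = (\<integral>w. (\<integral>x. \<Phi> (resample i (x, w)) \<partial>std_gauss) \<partial>M)"
    using pr.integral_snd[of "\<lambda>x w. \<Phi> (resample i (x, w))"] 1 by (simp add: case_prod_unfold)
  finally show "expectation (\<lambda>w. \<Phi> (\<lambda>j. \<xi> j w)) = (\<integral>w. (\<integral>x. \<Phi> (resample i (x, w)) \<partial>std_gauss) \<partial>M)" .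
qed

end

lemma char_distr_cos_sin:
  assumes "prob_space M" and [measurable]: "Y \<in> borel_measurable M"
  shows "char (distr M borel Y) t = Complex (\<integral>w. cos (t * Y w) \<partial>M) (\<integral>w. sin (t * Y w) \<partial>M)"
proof -
  interpret prob_space M by fact
  have i: "integrable M (\<lambda>w. iexp (t * Y w))" by (rule integrable_iexp) auto
  have "char (distr M borel Y) t = (CLINT w|M. iexp (t * Y w))"
    unfolding char_def by (subst integral_distr) auto
  moreover have "Re (CLINT w|M. iexp (t * Y w)) = (\<integral>w. cos (t * Y w) \<partial>M)"
    using i by (subst integral_Re[symmetric]) (auto simp: iexp_cos_sin simp del: of_real_mult)
  moreover have "Im (CLINT w|M. iexp (t * Y w)) = (\<integral>w. sin (t * Y w) \<partial>M)"
    using i by (subst integral_Im[symmetric]) (auto simp: iexp_cos_sin simp del: of_real_mult)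
  ultimately show ?thesis by (simp add: complex_eq_iff)
qed

text \<open>The observables for which every integral below exists: functions of finitely many coordinates
with at most polynomial growth. The class is closed under the algebraic operations and contains
the Hermite polynomials of the coordinates, which is all that integration by parts is applied to.\<close>
section \<open>Gaussian integration by parts\<close>

definition moderate :: "(('i \<Rightarrow> real) \<Rightarrow> real) \<Rightarrow> bool" where
  "moderate \<Phi> \<longleftrightarrow> \<Phi> \<in> borel_measurable (Pi\<^sub>M UNIV (\<lambda>_. borel)) \<and>
     (\<exists>J C m. finite J \<and> C \<ge> 0 \<and> (\<forall>y. \<bar>\<Phi> y\<bar> \<le> C * (1 + (\<Sum>j\<in>J. \<bar>y j\<bar>)) ^ m))"

lemma moderateD [measurable_dest]: "moderate \<Phi> \<Longrightarrow> \<Phi> \<in> borel_measurable (Pi\<^sub>M UNIV (\<lambda>_. borel))"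
  by (simp add: moderate_def)

lemma moderateI:
  assumes "\<Phi> \<in> borel_measurable (Pi\<^sub>M UNIV (\<lambda>_. borel))"
    "finite J" "C \<ge> 0" "\<And>y. \<bar>\<Phi> y\<bar> \<le> C * (1 + (\<Sum>j\<in>J. \<bar>y j\<bar>)) ^ m"
  shows "moderate \<Phi>"
  unfolding moderate_def using assms by blast

lemma moderate_bounded:
  assumes "\<Phi> \<in> borel_measurable (Pi\<^sub>M UNIV (\<lambda>_. borel))" "\<And>y. \<bar>\<Phi> y\<bar> \<le> C"
  shows "moderate \<Phi>"
  using assms by (intro moderateI[where J = "{}" and C = C and m = 0]) (auto intro: order_trans[OF abs_ge_zero])

lemma moderate_const [intro]: "moderate (\<lambda>_. c)"
  by (rule moderate_bounded[where C = "\<bar>c\<bar>"]) auto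

lemma moderate_coord [intro]: "moderate (\<lambda>y. y j)"
  by (rule moderateI[where J = "{j}" and C = 1 and m = 1]) auto

lemma moderate_mult [intro]:
  assumes \<Phi>: "moderate \<Phi>" and \<Psi>: "moderate \<Psi>"
  shows "moderate (\<lambda>y. \<Phi> y * \<Psi> y)"
proof -
  obtain J C m where 1: "finite J" "C \<ge> 0" "\<And>y. \<bar>\<Phi> y\<bar> \<le> C * (1 + (\<Sum>j\<in>J. \<bar>y j\<bar>)) ^ m" using \<Phi> unfolding moderate_def by blast
  obtain K D n where 2: "finite K" "D \<ge> 0" "\<And>y. \<bar>\<Psi> y\<bar> \<le> D * (1 + (\<Sum>j\<in>K. \<bar>y j\<bar>)) ^ n" using \<Psi> unfolding moderate_def by blast
  show ?thesis
  proof (rule moderateI[where J = "J \<union> K" and C = "C * D" and m = "m + n"])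
    show "(\<lambda>y. \<Phi> y * \<Psi> y) \<in> borel_measurable (Pi\<^sub>M UNIV (\<lambda>_. borel))" using \<Phi> \<Psi> by measurable
    fix y :: "_ \<Rightarrow> real"
    let ?s = "1 + (\<Sum>j\<in>J \<union> K. \<bar>y j\<bar>)"
    have "1 + (\<Sum>j\<in>J. \<bar>y j\<bar>) \<le> ?s" "1 + (\<Sum>j\<in>K. \<bar>y j\<bar>) \<le> ?s"
      using 1(1) 2(1) by (auto intro!: sum_mono2)
    then have "(1 + (\<Sum>j\<in>J. \<bar>y j\<bar>)) ^ m \<le> ?s ^ m" "(1 + (\<Sum>j\<in>K. \<bar>y j\<bar>)) ^ n \<le> ?s ^ n"
      by (auto intro!: power_mono add_nonneg_nonneg sum_nonneg)
    then have "\<bar>\<Phi> y\<bar> \<le> C * ?s ^ m" "\<bar>\<Psi> y\<bar> \<le> D * ?s ^ n"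
      using 1(2,3) 2(2,3) by (meson mult_left_mono order_trans)+
    then have "\<bar>\<Phi> y * \<Psi> y\<bar> \<le> (C * ?s ^ m) * (D * ?s ^ n)"
      unfolding abs_mult using 1(2) by (intro mult_mono) (auto intro!: add_nonneg_nonneg sum_nonneg)
    then show "\<bar>\<Phi> y * \<Psi> y\<bar> \<le> C * D * ?s ^ (m + n)" by (simp add: power_add mult_ac)
  qed (use 1 2 in auto)
qed

lemma moderate_add [intro]:
  assumes \<Phi>: "moderate \<Phi>" and \<Psi>: "moderate \<Psi>"
  shows "moderate (\<lambda>y. \<Phi> y + \<Psi> y)"
proof -
  obtain J C m where 1: "finite J" "C \<ge> 0" "\<And>y. \<bar>\<Phi> y\<bar> \<le> C * (1 + (\<Sum>j\<in>J. \<bar>y j\<bar>)) ^ m" using \<Phi> unfolding moderate_def by blast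
  obtain K D n where 2: "finite K" "D \<ge> 0" "\<And>y. \<bar>\<Psi> y\<bar> \<le> D * (1 + (\<Sum>j\<in>K. \<bar>y j\<bar>)) ^ n" using \<Psi> unfolding moderate_def by blast
  show ?thesis
  proof (rule moderateI[where J = "J \<union> K" and C = "C + D" and m = "m + n"])
    show "(\<lambda>y. \<Phi> y + \<Psi> y) \<in> borel_measurable (Pi\<^sub>M UNIV (\<lambda>_. borel))" using \<Phi> \<Psi> by measurable
    fix y :: "_ \<Rightarrow> real"
    let ?s = "1 + (\<Sum>j\<in>J \<union> K. \<bar>y j\<bar>)"
    have s1: "?s \<ge> 1" by (simp add: sum_nonneg)
    have "1 + (\<Sum>j\<in>J. \<bar>y j\<bar>) \<le> ?s" "1 + (\<Sum>j\<in>K. \<bar>y j\<bar>) \<le> ?s"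
      using 1(1) 2(1) by (auto intro!: sum_mono2)
    then have "(1 + (\<Sum>j\<in>J. \<bar>y j\<bar>)) ^ m \<le> ?s ^ m" "(1 + (\<Sum>j\<in>K. \<bar>y j\<bar>)) ^ n \<le> ?s ^ n"
      by (auto intro!: power_mono add_nonneg_nonneg sum_nonneg)
    moreover have "?s ^ m \<le> ?s ^ (m + n)" "?s ^ n \<le> ?s ^ (m + n)" using s1 by (auto intro!: power_increasing)
    ultimately have "\<bar>\<Phi> y\<bar> \<le> C * ?s ^ (m + n)" "\<bar>\<Psi> y\<bar> \<le> D * ?s ^ (m + n)"
      using 1(2,3) 2(2,3) by (meson mult_left_mono order_trans)+
    then show "\<bar>\<Phi> y + \<Psi> y\<bar> \<le> (C + D) * ?s ^ (m + n)" by (simp add: distrib_right)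
  qed (use 1 2 in auto)
qed

lemma moderate_diff [intro]: "moderate \<Phi> \<Longrightarrow> moderate \<Psi> \<Longrightarrow> moderate (\<lambda>y. \<Phi> y - \<Psi> y)"
  using moderate_add[of \<Phi> "\<lambda>y. (-1) * \<Psi> y"] moderate_mult[OF moderate_const[of "-1"], of \<Psi>] by simp

lemma moderate_uminus [intro]: "moderate \<Phi> \<Longrightarrow> moderate (\<lambda>y. - \<Phi> y)"
  using moderate_mult[OF moderate_const[of "-1"], of \<Phi>] by simp

lemma moderate_sum [intro]: "(\<And>k. k \<in> T \<Longrightarrow> moderate (\<Phi> k)) \<Longrightarrow> moderate (\<lambda>y. \<Sum>k\<in>T. \<Phi> k y)"
  by (induction T rule: infinite_finite_induct) auto

lemma moderate_power [intro]: "moderate \<Phi> \<Longrightarrow> moderate (\<lambda>y. \<Phi> y ^ k)"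
  by (induction k) auto

lemma moderate_cos [intro]: "moderate \<Phi> \<Longrightarrow> moderate (\<lambda>y. cos (\<Phi> y))"
  by (rule moderate_bounded[where C = 1]) auto

lemma moderate_sin [intro]: "moderate \<Phi> \<Longrightarrow> moderate (\<lambda>y. sin (\<Phi> y))"
  by (rule moderate_bounded[where C = 1]) auto

lemma moderate_hermite [intro]: "moderate \<Phi> \<Longrightarrow> moderate (\<lambda>y. hermite q (\<Phi> y))"
  by (induction q "0::real" rule: hermite.induct) (auto simp del: of_nat_Suc intro!: moderate_diff moderate_mult moderate_const)

lemmas moderate_intros = moderate_const moderate_coord moderate_add moderate_diff moderate_mult moderate_uminus
  moderate_sum moderate_power moderate_cos moderate_sin moderate_hermite

lemma has_real_derivative_hermite:
  "(hermite q has_real_derivative real q * hermite (q - 1) x) (at x)"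
proof (induction q x rule: hermite.induct)
  case (3 n x)
  have "((\<lambda>x. x * hermite (Suc n) x - real (Suc n) * hermite n x) has_real_derivative
     (1 * hermite (Suc n) x + real (Suc n) * hermite (Suc n - 1) x * x) - real (Suc n) * (real n * hermite (n - 1) x)) (at x)"
    using 3 by (intro DERIV_diff DERIV_mult DERIV_cmult DERIV_ident)
  moreover have "(1 * hermite (Suc n) x + real (Suc n) * hermite (Suc n - 1) x * x) - real (Suc n) * (real n * hermite (n - 1) x)
     = real (Suc (Suc n)) * hermite (Suc n) x"
    by (cases n) (auto simp: algebra_simps)
  moreover have "hermite (Suc (Suc n)) = (\<lambda>x. x * hermite (Suc n) x - real (Suc n) * hermite n x)" by auto
  ultimately show ?case by simp
next
  case (1 x) have "hermite 0 = (\<lambda>_. 1)" by auto then show ?case by simp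
next
  case (2 x) have "hermite (Suc 0) = (\<lambda>x. x)" by auto then show ?case by simp
qed

lemma continuous_hermite: "continuous_on UNIV (hermite q)"
  by (meson has_real_derivative_hermite DERIV_isCont continuous_at_imp_continuous_on)

lemma hermite_Suc: "hermite (Suc q) x = x * hermite q x - real q * hermite (q - 1) x"
  by (cases q) auto

lemma measurable_hermite [measurable]: "hermite q \<in> borel_measurable borel"
  by (rule borel_measurable_continuous_onI[OF continuous_hermite])

lemma one_plus_sum_power_le:
  fixes a :: "'i \<Rightarrow> real"
  assumes "finite J" "\<And>j. j \<in> J \<Longrightarrow> a j \<ge> 0"
  shows "(1 + (\<Sum>j\<in>J. a j)) ^ m \<le> real (card J + 1) ^ m * (1 + (\<Sum>j\<in>J. a j ^ m))"
proof -
  define b where "b = Max (insert 1 (a ` J))"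
  have b: "1 \<le> b" "\<And>j. j \<in> J \<Longrightarrow> a j \<le> b" using assms(1) by (auto simp: b_def)
  have "(\<Sum>j\<in>J. a j) \<le> card J * b" using sum_mono[of J a "\<lambda>_. b"] b by simp
  then have "(1 + (\<Sum>j\<in>J. a j)) ^ m \<le> ((card J + 1) * b) ^ m"
    using b assms by (intro power_mono) (auto simp: algebra_simps intro!: add_nonneg_nonneg sum_nonneg)
  also have "\<dots> = (card J + 1) ^ m * b ^ m" by (simp add: power_mult_distrib)
  also have "b ^ m \<le> 1 + (\<Sum>j\<in>J. a j ^ m)"
  proof -
    have "b \<in> insert 1 (a ` J)" unfolding b_def using assms(1) by (intro Max_in) auto
    then consider "b = 1" | j where "j \<in> J" "b = a j" by auto
    then show ?thesis
    proof cases
      case 1 then show ?thesis using assms by (auto intro!: sum_nonneg)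
    next
      case (2 j)
      have "a j ^ m \<le> (\<Sum>j\<in>J. a j ^ m)" using 2 assms by (intro member_le_sum) auto
      then show ?thesis using 2 by simp
    qed
  qed
  finally show ?thesis by simp
qed

context std_gaussian_family
begin

lemma \<xi>_law: "distr M borel (\<xi> i) = std_gauss"
proof (rule Levy_uniqueness)
  show "real_distribution (distr M borel (\<xi> i))" by (rule real_distribution_distr) simp
  show "real_distribution std_gauss" by (rule real_dist_normal_dist)
  show "char (distr M borel (\<xi> i)) = char std_gauss"
  proof
    fix t
    show "char (distr M borel (\<xi> i)) t = char std_gauss t"
      using expectation_cos[of "{i}" "\<lambda>_. t"] expectation_sin[of "{i}" "\<lambda>_. t"]
      unfolding char_distr_cos_sin[OF prob_space_axioms measurable_\<xi>] char_std_normal_distribution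
      by (simp add: complex_eq_iff power2_eq_square exp_of_real[symmetric] del: of_real_mult of_real_exp)
  qed
qed

lemma integral_\<xi>: "f \<in> borel_measurable borel \<Longrightarrow> expectation (\<lambda>w. f (\<xi> i w) :: real) = (\<integral>x. f x \<partial>std_gauss)"
  unfolding \<xi>_law[of i, symmetric] by (subst integral_distr) auto

lemma integrable_\<xi>: "f \<in> borel_measurable borel \<Longrightarrow> integrable M (\<lambda>w. f (\<xi> i w) :: real) \<longleftrightarrow> integrable std_gauss f"
  unfolding \<xi>_law[of i, symmetric] by (subst integrable_distr_eq) auto

lemma integrable_moderate:
  assumes "moderate \<Phi>" shows "integrable M (\<lambda>w. \<Phi> (\<lambda>j. \<xi> j w))"
proof -
  obtain J C m where 1: "finite J" "C \<ge> 0" "\<And>y. \<bar>\<Phi> y\<bar> \<le> C * (1 + (\<Sum>j\<in>J. \<bar>y j\<bar>)) ^ m" using assms unfolding moderate_def by blast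
  show ?thesis
  proof (rule Bochner_Integration.integrable_bound)
    show "integrable M (\<lambda>w. C * (real (card J + 1) ^ m * (1 + (\<Sum>j\<in>J. \<bar>\<xi> j w\<bar> ^ m))))"
      using integrable_std_gauss_abs_power[of m]
      by (intro integrable_mult_right Bochner_Integration.integrable_add Bochner_Integration.integrable_sum)
         (auto simp: integrable_\<xi>[where f = "\<lambda>x. \<bar>x\<bar> ^ m"])
    show "(\<lambda>w. \<Phi> (\<lambda>j. \<xi> j w)) \<in> borel_measurable M"
      using moderateD[OF assms] by measurable
    show "AE w in M. norm (\<Phi> (\<lambda>j. \<xi> j w)) \<le> norm (C * (real (card J + 1) ^ m * (1 + (\<Sum>j\<in>J. \<bar>\<xi> j w\<bar> ^ m))))"
    proof (rule AE_I2)
      fix w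
      have "\<bar>\<Phi> (\<lambda>j. \<xi> j w)\<bar> \<le> C * (1 + (\<Sum>j\<in>J. \<bar>\<xi> j w\<bar>)) ^ m" by (rule 1)
      also have "\<dots> \<le> C * (real (card J + 1) ^ m * (1 + (\<Sum>j\<in>J. \<bar>\<xi> j w\<bar> ^ m)))"
        using 1 by (intro mult_left_mono one_plus_sum_power_le) auto
      finally show "norm (\<Phi> (\<lambda>j. \<xi> j w)) \<le> norm (C * (real (card J + 1) ^ m * (1 + (\<Sum>j\<in>J. \<bar>\<xi> j w\<bar> ^ m))))"
        unfolding real_norm_def by (rule order_trans[OF _ abs_ge_self])
    qed
  qed
qed

text \<open>Differentiation in the direction \<open>r i\<close>: this is the derivative of a function of the family with
respect to the resampled variable \<open>x\<close>, that is the inner product of its Malliavin derivative with the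
\<open>i\<close>-th variable. It is a relation, so that derivatives of concrete expressions can be assembled by
the rules below.\<close>
definition gdiff :: "'i \<Rightarrow> (('i \<Rightarrow> real) \<Rightarrow> real) \<Rightarrow> (('i \<Rightarrow> real) \<Rightarrow> real) \<Rightarrow> bool" where
  "gdiff i \<Phi> \<Phi>' \<longleftrightarrow> moderate \<Phi> \<and> moderate \<Phi>' \<and>
     (\<forall>y x. ((\<lambda>x. \<Phi> (\<lambda>j. y j + r i j * x)) has_real_derivative \<Phi>' (\<lambda>j. y j + r i j * x)) (at x)) \<and>
     (\<forall>y. continuous_on UNIV (\<lambda>x. \<Phi>' (\<lambda>j. y j + r i j * x)))"

lemma gdiffD:
  assumes "gdiff i \<Phi> \<Phi>'"
  shows "moderate \<Phi>" "moderate \<Phi>'"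
    "((\<lambda>x. \<Phi> (\<lambda>j. y j + r i j * x)) has_real_derivative \<Phi>' (\<lambda>j. y j + r i j * x)) (at x)"
    "continuous_on UNIV (\<lambda>x. \<Phi>' (\<lambda>j. y j + r i j * x))"
    "continuous_on UNIV (\<lambda>x. \<Phi> (\<lambda>j. y j + r i j * x))"
  using assms unfolding gdiff_def by (auto intro!: continuous_at_imp_continuous_on intro: DERIV_isCont)

lemma gdiff_const: "gdiff i (\<lambda>_. c) (\<lambda>_. 0)"
  unfolding gdiff_def by auto

lemma gdiff_coord: "gdiff i (\<lambda>y. y j) (\<lambda>_. r i j)"
  unfolding gdiff_def by (auto intro!: derivative_eq_intros)

lemma gdiff_add: "gdiff i \<Phi> \<Phi>' \<Longrightarrow> gdiff i \<Psi> \<Psi>' \<Longrightarrow> gdiff i (\<lambda>y. \<Phi> y + \<Psi> y) (\<lambda>y. \<Phi>' y + \<Psi>' y)"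
  by (subst gdiff_def) (auto intro!: derivative_eq_intros continuous_intros dest: gdiffD)

lemma gdiff_mult:
  "gdiff i \<Phi> \<Phi>' \<Longrightarrow> gdiff i \<Psi> \<Psi>' \<Longrightarrow> gdiff i (\<lambda>y. \<Phi> y * \<Psi> y) (\<lambda>y. \<Phi>' y * \<Psi> y + \<Phi> y * \<Psi>' y)"
  using DERIV_mult[OF gdiffD(3) gdiffD(3), of i \<Phi> \<Phi>' i \<Psi> \<Psi>']
  by (subst gdiff_def, intro conjI allI moderate_mult moderate_add continuous_intros)
     (auto dest: gdiffD simp: mult.commute)

lemma gdiff_cmult: "gdiff i \<Phi> \<Phi>' \<Longrightarrow> gdiff i (\<lambda>y. c * \<Phi> y) (\<lambda>y. c * \<Phi>' y)"
  using gdiff_mult[OF gdiff_const[of i c], of \<Phi> \<Phi>'] by simp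

lemma gdiff_sum:
  "(\<And>k. k \<in> T \<Longrightarrow> gdiff i (\<Phi> k) (\<Phi>' k)) \<Longrightarrow> gdiff i (\<lambda>y. \<Sum>k\<in>T. \<Phi> k y) (\<lambda>y. \<Sum>k\<in>T. \<Phi>' k y)"
  by (induction T rule: infinite_finite_induct) (auto intro: gdiff_const gdiff_add)

lemma gdiff_chain:
  assumes "gdiff i \<Phi> \<Phi>'" and "\<And>x. (f has_real_derivative f' x) (at x)" and "continuous_on UNIV f'"
    and "moderate (\<lambda>y. f (\<Phi> y))" "moderate (\<lambda>y. f' (\<Phi> y))"
  shows "gdiff i (\<lambda>y. f (\<Phi> y)) (\<lambda>y. f' (\<Phi> y) * \<Phi>' y)"
proof (subst gdiff_def, intro conjI allI)
  show "((\<lambda>x. f (\<Phi> (\<lambda>j. y j + r i j * x))) has_real_derivative f' (\<Phi> (\<lambda>j. y j + r i j * x)) * \<Phi>' (\<lambda>j. y j + r i j * x)) (at x)"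
    for x y by (rule DERIV_chain2[OF assms(2) gdiffD(3)[OF assms(1)]])
  show "continuous_on UNIV (\<lambda>x. f' (\<Phi> (\<lambda>j. y j + r i j * x)) * \<Phi>' (\<lambda>j. y j + r i j * x))" for y
    using gdiffD[OF assms(1)] by (intro continuous_on_mult continuous_on_compose2[OF assms(3)]) auto
qed (use assms gdiffD[OF assms(1)] in auto)

lemma gdiff_hermite: "gdiff i (\<lambda>y. hermite q (y j)) (\<lambda>y. real q * hermite (q - 1) (y j) * r i j)"
proof (rule gdiff_chain[OF gdiff_coord, where f' = "\<lambda>x. real q * hermite (q - 1) x"])
  show "continuous_on UNIV (\<lambda>x. real q * hermite (q - 1) x)"
    by (intro continuous_intros continuous_hermite)
qed (auto simp del: One_nat_def intro!: has_real_derivative_hermite moderate_mult moderate_const)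

lemma gdiff_cos: "gdiff i \<Phi> \<Phi>' \<Longrightarrow> gdiff i (\<lambda>y. cos (\<Phi> y)) (\<lambda>y. - sin (\<Phi> y) * \<Phi>' y)"
  by (rule gdiff_chain) (auto intro!: derivative_eq_intros continuous_intros moderate_uminus moderate_sin moderate_cos dest: gdiffD)

lemma gdiff_sin: "gdiff i \<Phi> \<Phi>' \<Longrightarrow> gdiff i (\<lambda>y. sin (\<Phi> y)) (\<lambda>y. cos (\<Phi> y) * \<Phi>' y)"
  by (rule gdiff_chain) (auto intro!: derivative_eq_intros continuous_intros moderate_uminus moderate_sin moderate_cos dest: gdiffD)

text \<open>By \<open>resample_law\<close> the \<open>i\<close>-th variable may be taken independent of the residuals; with these held
fixed the formula is \<open>std_gauss_ibp\<close> in the single variable \<open>x\<close>.\<close>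
theorem gaussian_ibp:
  assumes d: "gdiff i \<Phi> \<Phi>'"
  shows "expectation (\<lambda>w. \<xi> i w * \<Phi> (\<lambda>j. \<xi> j w)) = expectation (\<lambda>w. \<Phi>' (\<lambda>j. \<xi> j w))"
proof -
  have m1: "moderate (\<lambda>y. y i * \<Phi> y)" using gdiffD(1)[OF d] by auto
  have eq: "resample i (x, w) = (\<lambda>j. (\<xi> j w - r i j * \<xi> i w) + r i j * x)" for x w
    unfolding resample_def by (auto simp: algebra_simps)
  have growth: "\<exists>C m. \<forall>x. \<bar>\<Psi> (\<lambda>j. y j + r i j * x)\<bar> \<le> C * (1 + \<bar>x\<bar>) ^ m" if \<Psi>: "moderate \<Psi>" for \<Psi> y
  proof -
    obtain J C m where 1: "finite J" "C \<ge> 0" "\<And>y. \<bar>\<Psi> y\<bar> \<le> C * (1 + (\<Sum>j\<in>J. \<bar>y j\<bar>)) ^ m" using \<Psi> unfolding moderate_def by blast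
    define A where "A = 1 + (\<Sum>j\<in>J. \<bar>y j\<bar>) + (\<Sum>j\<in>J. \<bar>r i j\<bar>)"
    have "\<bar>\<Psi> (\<lambda>j. y j + r i j * x)\<bar> \<le> (C * A ^ m) * (1 + \<bar>x\<bar>) ^ m" for x
    proof -
      have "1 + (\<Sum>j\<in>J. \<bar>y j + r i j * x\<bar>) \<le> 1 + (\<Sum>j\<in>J. \<bar>y j\<bar> + \<bar>r i j\<bar> * \<bar>x\<bar>)"
        by (intro add_left_mono sum_mono) (simp add: abs_mult[symmetric])
      also have "\<dots> = 1 + (\<Sum>j\<in>J. \<bar>y j\<bar>) + (\<Sum>j\<in>J. \<bar>r i j\<bar>) * \<bar>x\<bar>" by (simp add: sum.distrib sum_distrib_right)
      also have "\<dots> \<le> A * (1 + \<bar>x\<bar>)"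
        unfolding A_def by (simp add: algebra_simps sum_nonneg)
      finally have "(1 + (\<Sum>j\<in>J. \<bar>y j + r i j * x\<bar>)) ^ m \<le> (A * (1 + \<bar>x\<bar>)) ^ m"
        by (intro power_mono) (auto intro!: add_nonneg_nonneg sum_nonneg)
      then have "C * (1 + (\<Sum>j\<in>J. \<bar>y j + r i j * x\<bar>)) ^ m \<le> C * (A * (1 + \<bar>x\<bar>)) ^ m"
        using 1 by (intro mult_left_mono)
      then show ?thesis using 1(3)[of "\<lambda>j. y j + r i j * x"] by (simp add: power_mult_distrib mult_ac)
    qed
    then show ?thesis by blast
  qed
  have "expectation (\<lambda>w. \<xi> i w * \<Phi> (\<lambda>j. \<xi> j w)) = (\<integral>w. (\<integral>x. resample i (x, w) i * \<Phi> (resample i (x, w)) \<partial>std_gauss) \<partial>M)"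
    using integral_resample(2)[OF moderateD[OF m1] integrable_moderate[OF m1], of i] .
  also have "\<dots> = (\<integral>w. (\<integral>x. x * \<Phi> (\<lambda>j. (\<xi> j w - r i j * \<xi> i w) + r i j * x) \<partial>std_gauss) \<partial>M)"
    unfolding eq by simp
  also have "\<dots> = (\<integral>w. (\<integral>x. \<Phi>' (\<lambda>j. (\<xi> j w - r i j * \<xi> i w) + r i j * x) \<partial>std_gauss) \<partial>M)"
  proof (rule Bochner_Integration.integral_cong[OF refl])
    fix w
    let ?y = "\<lambda>j. \<xi> j w - r i j * \<xi> i w"
    obtain C m where 1: "\<And>x. \<bar>\<Phi> (\<lambda>j. ?y j + r i j * x)\<bar> \<le> C * (1 + \<bar>x\<bar>) ^ m" using growth[OF gdiffD(1)[OF d], of ?y] by blast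
    obtain C' m' where 2: "\<And>x. \<bar>\<Phi>' (\<lambda>j. ?y j + r i j * x)\<bar> \<le> C' * (1 + \<bar>x\<bar>) ^ m'" using growth[OF gdiffD(2)[OF d], of ?y] by blast
    show "(\<integral>x. x * \<Phi> (\<lambda>j. ?y j + r i j * x) \<partial>std_gauss) = (\<integral>x. \<Phi>' (\<lambda>j. ?y j + r i j * x) \<partial>std_gauss)"
      by (rule std_gauss_ibp[OF gdiffD(3)[OF d] gdiffD(4)[OF d] 1 2])
  qed
  also have "\<dots> = expectation (\<lambda>w. \<Phi>' (\<lambda>j. \<xi> j w))"
    using integral_resample(2)[OF moderateD integrable_moderate, OF gdiffD(2)[OF d] gdiffD(2)[OF d], of i] unfolding eq by simp
  finally show ?thesis .
qed

text \<open>Integrating by parts against \<open>\<xi> i\<close> times a Hermite polynomial, the derivative that falls on the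
polynomial is cancelled by the second term of the three-term recurrence, because \<open>r i i = 1\<close>.\<close>
corollary hermite_ibp:
  assumes d: "gdiff i G G'"
  shows "expectation (\<lambda>w. hermite (Suc q) (\<xi> i w) * G (\<lambda>j. \<xi> j w)) = expectation (\<lambda>w. hermite q (\<xi> i w) * G' (\<lambda>j. \<xi> j w))"
proof -
  have mG: "moderate G" "moderate G'" using gdiffD[OF d] by auto
  have d': "gdiff i (\<lambda>y. hermite q (y i) * G y) (\<lambda>y. real q * hermite (q - 1) (y i) * r i i * G y + hermite q (y i) * G' y)"
    by (rule gdiff_mult[OF gdiff_hermite d])
  have "moderate (\<lambda>y. y i * (hermite q (y i) * G y))" "moderate (\<lambda>y. real q * (hermite (q - 1) (y i) * G y))"
    "moderate (\<lambda>y. hermite q (y i) * G' y)"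
    by (intro moderate_intros mG)+
  then have i1: "integrable M (\<lambda>w. \<xi> i w * (hermite q (\<xi> i w) * G (\<lambda>j. \<xi> j w)))"
    "integrable M (\<lambda>w. real q * (hermite (q - 1) (\<xi> i w) * G (\<lambda>j. \<xi> j w)))"
    "integrable M (\<lambda>w. hermite q (\<xi> i w) * G' (\<lambda>j. \<xi> j w))"
    using integrable_moderate by fast+
  have "expectation (\<lambda>w. hermite (Suc q) (\<xi> i w) * G (\<lambda>j. \<xi> j w))
     = expectation (\<lambda>w. \<xi> i w * (hermite q (\<xi> i w) * G (\<lambda>j. \<xi> j w)) - real q * (hermite (q - 1) (\<xi> i w) * G (\<lambda>j. \<xi> j w)))"
    by (intro Bochner_Integration.integral_cong refl) (simp add: hermite_Suc algebra_simps)
  also have "\<dots> = expectation (\<lambda>w. \<xi> i w * (hermite q (\<xi> i w) * G (\<lambda>j. \<xi> j w))) - expectation (\<lambda>w. real q * (hermite (q - 1) (\<xi> i w) * G (\<lambda>j. \<xi> j w)))"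
    by (rule Bochner_Integration.integral_diff[OF i1(1,2)])
  also have "expectation (\<lambda>w. \<xi> i w * (hermite q (\<xi> i w) * G (\<lambda>j. \<xi> j w)))
     = expectation (\<lambda>w. real q * (hermite (q - 1) (\<xi> i w) * G (\<lambda>j. \<xi> j w)) + hermite q (\<xi> i w) * G' (\<lambda>j. \<xi> j w))"
    using gaussian_ibp[OF d'] by (simp add: mult_ac)
  also have "\<dots> = expectation (\<lambda>w. real q * (hermite (q - 1) (\<xi> i w) * G (\<lambda>j. \<xi> j w))) + expectation (\<lambda>w. hermite q (\<xi> i w) * G' (\<lambda>j. \<xi> j w))"
    by (rule Bochner_Integration.integral_add[OF i1(2,3)])
  finally show ?thesis by simp
qed

text \<open>Each integration by parts lowers both degrees by one and produces one factor \<open>r i j\<close>.\<close>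
lemma expectation_hermite_mult:
  "expectation (\<lambda>w. hermite p (\<xi> i w) * hermite q (\<xi> j w)) = (if p = q then fact p * r i j ^ p else 0)"
proof (induction p arbitrary: q)
  case 0
  show ?case
  proof (cases q)
    case (Suc k)
    have "expectation (\<lambda>w. hermite (Suc k) (\<xi> j w) * 1) = expectation (\<lambda>w. hermite k (\<xi> j w) * 0)"
      by (rule hermite_ibp[OF gdiff_const])
    then show ?thesis using Suc by simp
  qed (simp add: prob_space)
next
  case (Suc p)
  have "expectation (\<lambda>w. hermite (Suc p) (\<xi> i w) * hermite q (\<xi> j w))
    = expectation (\<lambda>w. hermite p (\<xi> i w) * (real q * hermite (q - 1) (\<xi> j w) * r i j))"
    by (rule hermite_ibp[OF gdiff_hermite])
  also have "\<dots> = expectation (\<lambda>w. (real q * r i j) * (hermite p (\<xi> i w) * hermite (q - 1) (\<xi> j w)))"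
    by (simp add: mult_ac)
  also have "\<dots> = real q * r i j * (if p = q - 1 then fact p * r i j ^ p else 0)"
    unfolding integral_mult_right_zero Suc ..
  finally show ?case by (cases q) auto
qed

lemma abs_r_le_1: "\<bar>r i j\<bar> \<le> 1"
proof -
  have i: "integrable M (\<lambda>w. (\<xi> k w)\<^sup>2)" for k
    by (rule integrable_moderate[of "\<lambda>y. (y k)\<^sup>2"]) (intro moderate_intros)
  have ij: "integrable M (\<lambda>w. \<xi> i w * \<xi> j w)"
    by (rule integrable_moderate[of "\<lambda>y. y i * y j"]) (intro moderate_intros)
  have e: "expectation (\<lambda>w. (\<xi> k w)\<^sup>2) = 1" for k
    using expectation_hermite_mult[of 1 k 1 k] by (simp add: power2_eq_square)
  have 0: "0 \<le> expectation (\<lambda>w. (\<xi> i w + s * \<xi> j w)\<^sup>2)" for s by simp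
  have "expectation (\<lambda>w. (\<xi> i w + s * \<xi> j w)\<^sup>2) = 1 + s\<^sup>2 + 2 * s * r i j" for s
  proof -
    have "expectation (\<lambda>w. (\<xi> i w + s * \<xi> j w)\<^sup>2) = expectation (\<lambda>w. (\<xi> i w)\<^sup>2 + s\<^sup>2 * (\<xi> j w)\<^sup>2 + 2 * s * (\<xi> i w * \<xi> j w))"
      by (simp add: power2_eq_square algebra_simps)
    also have "\<dots> = 1 + s\<^sup>2 + 2 * s * r i j"
      using i ij expectation_hermite_mult[of 1 i 1 j] by (simp add: e)
    finally show ?thesis .
  qed
  then have "0 \<le> 1 + s\<^sup>2 + 2 * s * r i j" for s using 0[of s] by metis
  from this[of 1] this[of "-1"] show ?thesis by simp
qed

end

section \<open>Decoupling of Hermite products\<close>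

definition hermite_sum :: "(nat \<Rightarrow> real) \<Rightarrow> nat \<Rightarrow> real \<Rightarrow> real" where
  "hermite_sum c N x = (\<Sum>q<N. c q * hermite q x)"

lemma moderate_hermite_sum: "moderate \<Phi> \<Longrightarrow> moderate (\<lambda>y. hermite_sum c N (\<Phi> y))"
  unfolding hermite_sum_def by (intro moderate_intros)

lemma measurable_hermite_sum [measurable]: "hermite_sum c N \<in> borel_measurable borel"
  unfolding hermite_sum_def[abs_def] by measurable

lemma sum_sum_mult_sum_sum:
  fixes X Y :: "'a \<Rightarrow> 'a \<Rightarrow> real"
  shows "(\<Sum>a\<in>I. \<Sum>b\<in>I. X a b) * (\<Sum>c\<in>I. \<Sum>d\<in>I. Y c d) = (\<Sum>a\<in>I. \<Sum>b\<in>I. \<Sum>c\<in>I. \<Sum>d\<in>I. X a b * Y c d)"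
proof -
  have d1: "(\<Sum>a\<in>I. \<Sum>b\<in>I. X a b) * T = (\<Sum>a\<in>I. \<Sum>b\<in>I. X a b * T)" for T by (simp add: sum_distrib_right)
  have d2: "x * (\<Sum>c\<in>I. \<Sum>d\<in>I. Y c d) = (\<Sum>c\<in>I. \<Sum>d\<in>I. x * Y c d)" for x by (simp add: sum_distrib_left)
  show ?thesis by (subst d1) (simp only: d2)
qed

text \<open>The indices form a chain \<open>j - i - k - l\<close>; summing it up from both ends costs one row sum per edge and
leaves one free index. The naive bound would be of order \<open>(card I)\<^sup>2\<close>.\<close>
lemma chain_sum_bound:
  fixes a :: "'i \<Rightarrow> 'i \<Rightarrow> real"
  assumes I: "finite I" and pos: "\<And>i j. 0 \<le> a i j" and R: "\<And>i. i \<in> I \<Longrightarrow> (\<Sum>j\<in>I. a i j) \<le> R"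
  shows "(\<Sum>i\<in>I. \<Sum>j\<in>I. \<Sum>k\<in>I. \<Sum>l\<in>I. a i j * a k l * a i k) \<le> R ^ 3 * card I"
proof -
  have "(\<Sum>i\<in>I. \<Sum>j\<in>I. \<Sum>k\<in>I. \<Sum>l\<in>I. a i j * a k l * a i k)
     = (\<Sum>i\<in>I. (\<Sum>j\<in>I. a i j) * (\<Sum>k\<in>I. a i k * (\<Sum>l\<in>I. a k l)))"
    unfolding sum_product by (simp add: sum_distrib_left mult_ac)
  also have "\<dots> \<le> (\<Sum>i\<in>I. R * (R * R))"
  proof (rule sum_mono)
    fix i assume i: "i \<in> I"
    have R0: "0 \<le> R" using R[OF i] pos by (meson order_trans sum_nonneg)
    have "(\<Sum>k\<in>I. a i k * (\<Sum>l\<in>I. a k l)) \<le> (\<Sum>k\<in>I. a i k * R)"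
      using R pos by (intro sum_mono mult_left_mono) auto
    also have "\<dots> = (\<Sum>k\<in>I. a i k) * R" by (simp add: sum_distrib_right)
    also have "\<dots> \<le> R * R" using R[OF i] R0 by (intro mult_right_mono) auto
    finally show "(\<Sum>j\<in>I. a i j) * (\<Sum>k\<in>I. a i k * (\<Sum>l\<in>I. a k l)) \<le> R * (R * R)"
      using R[OF i] R0 pos by (intro mult_mono) (auto intro!: sum_nonneg mult_nonneg_nonneg)
  qed
  finally show ?thesis by (simp add: power3_eq_cube mult_ac)
qed

text \<open>The function \<open>exp (- s * t\<^sup>2 / 2)\<close> solves \<open>f' = - t * s * f\<close>; the quotient of an approximate solution by
it has a small derivative.\<close>
lemma gaussian_ode_bound:
  fixes f f' :: "real \<Rightarrow> real"
  assumes d: "\<And>t. (f has_real_derivative f' t) (at t)"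
    and b: "\<And>t. \<bar>f' t + t * s * f t\<bar> \<le> \<bar>t\<bar> * e" and s: "s \<ge> 0" and e: "e \<ge> 0"
  shows "\<bar>f t - f 0 * exp (- s * t\<^sup>2 / 2)\<bar> \<le> t\<^sup>2 * e"
proof -
  define g where "g x = f x * exp (s * x\<^sup>2 / 2)" for x
  have dg: "(g has_real_derivative (f' x + x * s * f x) * exp (s * x\<^sup>2 / 2)) (at x)" for x
    unfolding g_def by (auto intro!: derivative_eq_intros d simp: algebra_simps)
  have "norm (g t - g 0) \<le> (\<bar>t\<bar> * e * exp (s * t\<^sup>2 / 2)) * norm (t - 0)"
  proof (rule field_differentiable_bound)
    show "convex {-\<bar>t\<bar>..\<bar>t\<bar>}" by simp
    show "(g has_real_derivative (f' x + x * s * f x) * exp (s * x\<^sup>2 / 2)) (at x within {-\<bar>t\<bar>..\<bar>t\<bar>})" for x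
      using dg by (rule DERIV_subset) auto
    fix x assume x: "x \<in> {-\<bar>t\<bar>..\<bar>t\<bar>}"
    then have "\<bar>x\<bar> \<le> \<bar>t\<bar>" by auto
    then have "x\<^sup>2 \<le> t\<^sup>2" by (simp add: abs_le_square_iff)
    then have "exp (s * x\<^sup>2 / 2) \<le> exp (s * t\<^sup>2 / 2)" using s by (simp add: mult_left_mono)
    moreover have "\<bar>f' x + x * s * f x\<bar> \<le> \<bar>t\<bar> * e"
      using b[of x] mult_right_mono[OF \<open>\<bar>x\<bar> \<le> \<bar>t\<bar>\<close> e] by linarith
    ultimately show "norm ((f' x + x * s * f x) * exp (s * x\<^sup>2 / 2)) \<le> \<bar>t\<bar> * e * exp (s * t\<^sup>2 / 2)"
      using e by (simp add: abs_mult mult_mono)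
  qed auto
  then have "\<bar>f t * exp (s * t\<^sup>2 / 2) - f 0\<bar> \<le> t\<^sup>2 * e * exp (s * t\<^sup>2 / 2)"
    by (simp add: g_def mult_ac power2_eq_square flip: abs_mult)
  then have m1: "\<bar>f t * exp (s * t\<^sup>2 / 2) - f 0\<bar> * exp (- s * t\<^sup>2 / 2) \<le> t\<^sup>2 * e * exp (s * t\<^sup>2 / 2) * exp (- s * t\<^sup>2 / 2)"
    by (intro mult_right_mono) auto
  have m2: "\<bar>f t * exp (s * t\<^sup>2 / 2) - f 0\<bar> * exp (- s * t\<^sup>2 / 2) = \<bar>f t - f 0 * exp (- s * t\<^sup>2 / 2)\<bar>"
  proof -
    have "\<bar>f t * exp (s * t\<^sup>2 / 2) - f 0\<bar> * exp (- s * t\<^sup>2 / 2) = \<bar>(f t * exp (s * t\<^sup>2 / 2) - f 0) * exp (- s * t\<^sup>2 / 2)\<bar>"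
      by (simp add: abs_mult)
    then show ?thesis by (simp add: left_diff_distrib mult.assoc flip: exp_add)
  qed
  have m3: "t\<^sup>2 * e * exp (s * t\<^sup>2 / 2) * exp (- s * t\<^sup>2 / 2) = t\<^sup>2 * e" by (simp add: mult.assoc flip: exp_add)
  show ?thesis using m1 unfolding m2 m3 .
qed

lemma trig_taylor_bound:
  fixes a b :: real
  shows "\<bar>cos (a + b) - cos a + b * sin a\<bar> \<le> b\<^sup>2" "\<bar>sin (a + b) - sin a - b * cos a\<bar> \<le> b\<^sup>2"
proof -
  have 0: "cmod (iexp b - (1 + \<i> * b)) \<le> b\<^sup>2 / 2"
    using iexp_approx1[of b 1] by (simp add: eval_nat_numeral)
  have 1: "\<bar>cos b - 1\<bar> \<le> b\<^sup>2 / 2" "\<bar>sin b - b\<bar> \<le> b\<^sup>2 / 2"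
    using order_trans[OF abs_Re_le_cmod 0] order_trans[OF abs_Im_le_cmod 0]
    by (simp_all add: iexp_cos_sin)
  have 2: "\<bar>x * (cos b - 1) + y * (sin b - b)\<bar> \<le> b\<^sup>2" if "\<bar>x\<bar> \<le> 1" "\<bar>y\<bar> \<le> 1" for x y
  proof -
    have "\<bar>x * (cos b - 1)\<bar> \<le> 1 * (b\<^sup>2 / 2)" "\<bar>y * (sin b - b)\<bar> \<le> 1 * (b\<^sup>2 / 2)"
      unfolding abs_mult using 1 that by (intro mult_mono; simp)+
    then show ?thesis by linarith
  qed
  show "\<bar>cos (a + b) - cos a + b * sin a\<bar> \<le> b\<^sup>2"
    using 2[of "cos a" "- sin a"] by (simp add: cos_add algebra_simps)
  show "\<bar>sin (a + b) - sin a - b * cos a\<bar> \<le> b\<^sup>2"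
    using 2[of "sin a" "cos a"] by (simp add: sin_add algebra_simps)
qed

lemma DERIV_quadratic_error:
  fixes f :: "real \<Rightarrow> real"
  assumes "\<And>h. \<bar>f (t + h) - f t - h * D\<bar> \<le> B * h\<^sup>2"
  shows "(f has_real_derivative D) (at t)"
  unfolding DERIV_def
proof (rule LIM_zero_cancel, rule Lim_null_comparison)
  show "((\<lambda>h. B * \<bar>h\<bar>) \<longlongrightarrow> 0) (at 0)" by (auto intro!: tendsto_eq_intros)
  show "\<forall>\<^sub>F h in at 0. norm ((f (t + h) - f t) / h - D) \<le> B * \<bar>h\<bar>"
    unfolding eventually_at_filter
  proof (rule always_eventually, intro allI impI)
    fix h :: real assume h: "h \<noteq> 0"
    have "norm ((f (t + h) - f t) / h - D) = \<bar>f (t + h) - f t - h * D\<bar> / \<bar>h\<bar>"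
      using h by (simp add: field_simps flip: abs_divide)
    also have "\<dots> \<le> B * h\<^sup>2 / \<bar>h\<bar>" using assms by (intro divide_right_mono) auto
    also have "\<dots> = B * \<bar>h\<bar>" using h by (simp add: power2_eq_square field_simps abs_if)
    finally show "norm ((f (t + h) - f t) / h - D) \<le> B * \<bar>h\<bar>" .
  qed
qed

lemma (in prob_space) DERIV_expectation_trig:
  assumes [measurable]: "F \<in> borel_measurable M" and i2: "integrable M (\<lambda>w. (F w)\<^sup>2)"
  shows "((\<lambda>t. expectation (\<lambda>w. cos (t * F w))) has_real_derivative - expectation (\<lambda>w. F w * sin (t * F w))) (at t)"
    and "((\<lambda>t. expectation (\<lambda>w. sin (t * F w))) has_real_derivative expectation (\<lambda>w. F w * cos (t * F w))) (at t)"
proof -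
  have i1: "integrable M F"
    using square_integrable_imp_integrable[OF _ i2] by simp
  have iS: "integrable M (\<lambda>w. F w * sin (t * F w))" "integrable M (\<lambda>w. F w * cos (t * F w))"
    by (rule Bochner_Integration.integrable_bound[OF i1]; auto simp: abs_mult intro!: mult_left_le)+
  have ab: "\<bar>expectation g\<bar> \<le> expectation (\<lambda>w. h\<^sup>2 * (F w)\<^sup>2)" if "\<And>w. \<bar>g w\<bar> \<le> (h * F w)\<^sup>2" "integrable M g" for g h
  proof -
    have "\<bar>expectation g\<bar> \<le> expectation (\<lambda>w. \<bar>g w\<bar>)" by simp
    also have "\<dots> \<le> expectation (\<lambda>w. h\<^sup>2 * (F w)\<^sup>2)"
      using that i2 by (intro integral_mono) (auto simp: power_mult_distrib)
    finally show ?thesis .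
  qed
  show "((\<lambda>t. expectation (\<lambda>w. cos (t * F w))) has_real_derivative - expectation (\<lambda>w. F w * sin (t * F w))) (at t)"
  proof (rule DERIV_quadratic_error)
    fix h
    have "expectation (\<lambda>w. cos ((t + h) * F w)) - expectation (\<lambda>w. cos (t * F w)) - h * - expectation (\<lambda>w. F w * sin (t * F w))
       = expectation (\<lambda>w. cos (t * F w + h * F w) - cos (t * F w) + (h * F w) * sin (t * F w))"
      using iS by (simp add: distrib_right mult.assoc)
    also have "\<bar>\<dots>\<bar> \<le> expectation (\<lambda>w. h\<^sup>2 * (F w)\<^sup>2)"
      using iS by (intro ab trig_taylor_bound) (simp add: mult.assoc)
    finally show "\<bar>expectation (\<lambda>w. cos ((t + h) * F w)) - expectation (\<lambda>w. cos (t * F w)) - h * - expectation (\<lambda>w. F w * sin (t * F w))\<bar>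
      \<le> expectation (\<lambda>w. (F w)\<^sup>2) * h\<^sup>2" by (simp add: mult.commute)
  qed
  show "((\<lambda>t. expectation (\<lambda>w. sin (t * F w))) has_real_derivative expectation (\<lambda>w. F w * cos (t * F w))) (at t)"
  proof (rule DERIV_quadratic_error)
    fix h
    have "expectation (\<lambda>w. sin ((t + h) * F w)) - expectation (\<lambda>w. sin (t * F w)) - h * expectation (\<lambda>w. F w * cos (t * F w))
       = expectation (\<lambda>w. sin (t * F w + h * F w) - sin (t * F w) - (h * F w) * cos (t * F w))"
      using iS by (simp add: distrib_right mult.assoc)
    also have "\<bar>\<dots>\<bar> \<le> expectation (\<lambda>w. h\<^sup>2 * (F w)\<^sup>2)"
      using iS by (intro ab trig_taylor_bound) (simp add: mult.assoc)
    finally show "\<bar>expectation (\<lambda>w. sin ((t + h) * F w)) - expectation (\<lambda>w. sin (t * F w)) - h * expectation (\<lambda>w. F w * cos (t * F w))\<bar>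
      \<le> expectation (\<lambda>w. (F w)\<^sup>2) * h\<^sup>2" by (simp add: mult.commute)
  qed
qed

lemma (in prob_space) expectation_abs_le_sqrt:
  assumes [measurable]: "Y \<in> borel_measurable M" and i: "integrable M (\<lambda>w. (Y w)\<^sup>2)"
  shows "expectation (\<lambda>w. \<bar>Y w :: real\<bar>) \<le> sqrt (expectation (\<lambda>w. (Y w)\<^sup>2))"
proof (rule real_le_rsqrt)
  have i1: "integrable M (\<lambda>w. \<bar>Y w\<bar>)"
    using square_integrable_imp_integrable[OF _ i] by simp
  have "0 \<le> variance (\<lambda>w. \<bar>Y w\<bar>)" by simp
  also have "\<dots> = expectation (\<lambda>w. (Y w)\<^sup>2) - (expectation (\<lambda>w. \<bar>Y w\<bar>))\<^sup>2"
    using i i1 by (subst variance_eq) auto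
  finally show "(expectation (\<lambda>w. \<bar>Y w\<bar>))\<^sup>2 \<le> expectation (\<lambda>w. (Y w)\<^sup>2)" by simp
qed

context std_gaussian_family
begin

definition E2 :: "nat \<Rightarrow> nat \<Rightarrow> 'i \<Rightarrow> 'i \<Rightarrow> real" where
  "E2 a b i j = expectation (\<lambda>w. hermite a (\<xi> i w) * hermite b (\<xi> j w))"

definition E4 :: "nat \<Rightarrow> nat \<Rightarrow> nat \<Rightarrow> nat \<Rightarrow> 'i \<Rightarrow> 'i \<Rightarrow> 'i \<Rightarrow> 'i \<Rightarrow> real" where
  "E4 a b c d i j k l = expectation (\<lambda>w. hermite a (\<xi> i w) * (hermite b (\<xi> j w) * (hermite c (\<xi> k w) * hermite d (\<xi> l w))))"

lemma gdiff_hermite3: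
  "gdiff i (\<lambda>y. hermite b (y j) * (hermite c (y k) * hermite d (y l)))
     (\<lambda>y. (real b * hermite (b - 1) (y j) * r i j) * (hermite c (y k) * hermite d (y l)) +
          hermite b (y j) * ((real c * hermite (c - 1) (y k) * r i k) * hermite d (y l)
            + hermite c (y k) * (real d * hermite (d - 1) (y l) * r i l)))"
  by (intro gdiff_mult gdiff_hermite)

lemma integrable_hermite4:
  "integrable M (\<lambda>w. hermite a (\<xi> i w) * (hermite b (\<xi> j w) * (hermite c (\<xi> k w) * hermite d (\<xi> l w))))"
  by (rule integrable_moderate[of "\<lambda>y. hermite a (y i) * (hermite b (y j) * (hermite c (y k) * hermite d (y l)))"])
     (intro moderate_intros)

lemma E4_Suc:
  "E4 (Suc a) b c d i j k l = r i j * real b * E4 a (b - 1) c d i j k l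
     + r i k * real c * E4 a b (c - 1) d i j k l + r i l * real d * E4 a b c (d - 1) i j k l"
proof -
  have "E4 (Suc a) b c d i j k l = expectation (\<lambda>w. hermite a (\<xi> i w) *
     ((real b * hermite (b - 1) (\<xi> j w) * r i j) * (hermite c (\<xi> k w) * hermite d (\<xi> l w)) +
          hermite b (\<xi> j w) * ((real c * hermite (c - 1) (\<xi> k w) * r i k) * hermite d (\<xi> l w)
            + hermite c (\<xi> k w) * (real d * hermite (d - 1) (\<xi> l w) * r i l))))"
    unfolding E4_def by (rule hermite_ibp[OF gdiff_hermite3])
  also have "\<dots> = expectation (\<lambda>w. r i j * real b * (hermite a (\<xi> i w) * (hermite (b - 1) (\<xi> j w) * (hermite c (\<xi> k w) * hermite d (\<xi> l w))))
     + r i k * real c * (hermite a (\<xi> i w) * (hermite b (\<xi> j w) * (hermite (c - 1) (\<xi> k w) * hermite d (\<xi> l w))))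
     + r i l * real d * (hermite a (\<xi> i w) * (hermite b (\<xi> j w) * (hermite c (\<xi> k w) * hermite (d - 1) (\<xi> l w)))))"
    by (intro Bochner_Integration.integral_cong refl) (simp add: algebra_simps)
  also have "\<dots> = r i j * real b * E4 a (b - 1) c d i j k l
     + r i k * real c * E4 a b (c - 1) d i j k l + r i l * real d * E4 a b c (d - 1) i j k l"
    unfolding E4_def by (simp add: integrable_hermite4 del: One_nat_def)
  finally show ?thesis .
qed

lemma E4_swap: "E4 a b c d i j k l = E4 b a c d j i k l"
  unfolding E4_def by (simp add: mult_ac)

lemma E4_bounded:
  "\<exists>B\<ge>0. \<forall>i j k l. \<bar>E4 a b c d i j k l\<bar> \<le> B"
proof -
  define m where "m q = (\<integral>x. (hermite q x) ^ 4 \<partial>std_gauss)" for q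
  have i4: "integrable M (\<lambda>w. hermite q (\<xi> i w) ^ 4)" for q i
    by (rule integrable_moderate[of "\<lambda>y. hermite q (y i) ^ 4"]) (intro moderate_intros)
  have e4: "expectation (\<lambda>w. hermite q (\<xi> i w) ^ 4) = m q" for q i
    unfolding m_def by (rule integral_\<xi>) simp
  have m0: "m q \<ge> 0" for q unfolding m_def by simp
  \<comment> \<open>The inequality of arithmetic and geometric means reduces the mixed moment to pure fourth moments.\<close>
  have amgm: "\<bar>x * (y * (z * u))\<bar> \<le> x ^ 4 + y ^ 4 + z ^ 4 + u ^ 4" for x y z u :: real
  proof -
    have 1: "\<bar>p * q\<bar> \<le> (p\<^sup>2 + q\<^sup>2) / 2" for p q :: real
      using sum_squares_bound[of "\<bar>p\<bar>" "\<bar>q\<bar>"] by (simp add: abs_mult)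
    have gen: "p \<le> (A + B + C + D) / 4" if "p \<le> (s + t) / 2" "s \<le> (A + B) / 2" "t \<le> (C + D) / 2"
      for p s t A B C D :: real using that by auto
    have gen': "p \<le> A + B + C + D" if "p \<le> (A + B + C + D) / 4" "0 \<le> A" "0 \<le> B" "0 \<le> C" "0 \<le> D"
      for p A B C D :: real using that by auto
    have "\<bar>(x * y) * (z * u)\<bar> \<le> ((x * y)\<^sup>2 + (z * u)\<^sup>2) / 2" by (rule 1)
    moreover have "(x * y)\<^sup>2 \<le> (x ^ 4 + y ^ 4) / 2" using 1[of "x\<^sup>2" "y\<^sup>2"] by (simp add: power_mult_distrib abs_mult flip: power_mult)
    moreover have "(z * u)\<^sup>2 \<le> (z ^ 4 + u ^ 4) / 2" using 1[of "z\<^sup>2" "u\<^sup>2"] by (simp add: power_mult_distrib abs_mult flip: power_mult)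
    ultimately have "\<bar>(x * y) * (z * u)\<bar> \<le> (x ^ 4 + y ^ 4 + z ^ 4 + u ^ 4) / 4"
      by (rule gen)
    moreover have "0 \<le> x ^ 4" "0 \<le> y ^ 4" "0 \<le> z ^ 4" "0 \<le> u ^ 4" by simp_all
    ultimately have "\<bar>(x * y) * (z * u)\<bar> \<le> x ^ 4 + y ^ 4 + z ^ 4 + u ^ 4" by (rule gen')
    then show ?thesis by (simp only: mult.assoc)
  qed
  have "\<bar>E4 a b c d i j k l\<bar> \<le> m a + m b + m c + m d" for i j k l
  proof -
    have "\<bar>E4 a b c d i j k l\<bar> \<le> expectation (\<lambda>w. \<bar>hermite a (\<xi> i w) * (hermite b (\<xi> j w) * (hermite c (\<xi> k w) * hermite d (\<xi> l w)))\<bar>)"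
      unfolding E4_def by simp
    also have "\<dots> \<le> expectation (\<lambda>w. hermite a (\<xi> i w) ^ 4 + hermite b (\<xi> j w) ^ 4 + hermite c (\<xi> k w) ^ 4 + hermite d (\<xi> l w) ^ 4)"
      by (intro integral_mono amgm Bochner_Integration.integrable_add i4 integrable_abs integrable_hermite4)
    also have "\<dots> = m a + m b + m c + m d" by (simp add: i4 e4)
    finally show ?thesis .
  qed
  then show ?thesis using m0 by (intro exI[of _ "m a + m b + m c + m d"]) simp
qed

lemma E2_Suc: "E2 (Suc a) b i j = r i j * real b * E2 a (b - 1) i j"
  unfolding E2_def expectation_hermite_mult by (cases b) auto

text \<open>If the pairs \<open>{i, j}\<close> and \<open>{k, l}\<close> were uncorrelated, the fourth moment would factor. The recurrence
\<open>E4_Suc\<close> lowers the degree of the first polynomial: the contraction of \<open>i\<close> with \<open>j\<close> reproduces the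
recurrence for the second moments, while a contraction with \<open>k\<close> or \<open>l\<close> carries a factor \<open>r i k\<close> or
\<open>r i l\<close> and is an error term. When the first degree is exhausted, the same is done with \<open>j\<close>.
The constant is uniform in the indices since the fourth moments are bounded by \<open>E4_bounded\<close>.\<close>
lemma E4_decoupling:
  "\<exists>C\<ge>0. \<forall>i j k l. \<bar>E4 a b c d i j k l - E2 a b i j * E2 c d k l\<bar>
      \<le> C * (\<bar>r i k\<bar> + \<bar>r i l\<bar> + \<bar>r j k\<bar> + \<bar>r j l\<bar>)"
proof -
  have l1: "s * x + s * y = (x + y) * s" and l2: "p * (q * s) + s * x + s * y = (p * q + x + y) * s" for s x y p q :: real
    by (simp_all add: algebra_simps)
  have l3: "\<bar>x + y\<bar> \<le> a + b" if "\<bar>x\<bar> \<le> a" "\<bar>y\<bar> \<le> b" for x y a b :: real using that by linarith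
  have l4: "\<bar>x + y + z\<bar> \<le> a + b + c" if "\<bar>x\<bar> \<le> a" "\<bar>y\<bar> \<le> b" "\<bar>z\<bar> \<le> c" for x y z a b c :: real using that by linarith
  show ?thesis
proof (induction a arbitrary: b)
  case 0
  show ?case
  proof (cases b)
    case 0
    have "E4 0 0 c d i j k l = E2 0 0 i j * E2 c d k l" for i j k l
      unfolding E4_def E2_def by (simp add: prob_space)
    then show ?thesis using 0 by (intro exI[of _ 0]) auto
  next
    case (Suc b')
    obtain B1 where B1: "B1 \<ge> 0" "\<And>i j k l. \<bar>E4 b' 0 (c - 1) d i j k l\<bar> \<le> B1" using E4_bounded by blast
    obtain B2 where B2: "B2 \<ge> 0" "\<And>i j k l. \<bar>E4 b' 0 c (d - 1) i j k l\<bar> \<le> B2" using E4_bounded by blast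
    have "\<bar>E4 0 b c d i j k l - E2 0 b i j * E2 c d k l\<bar> \<le> (real c * B1 + real d * B2) * (\<bar>r i k\<bar> + \<bar>r i l\<bar> + \<bar>r j k\<bar> + \<bar>r j l\<bar>)" for i j k l
    proof -
      have "E2 0 b i j = 0" unfolding E2_def expectation_hermite_mult using Suc by simp
      then have "\<bar>E4 0 b c d i j k l - E2 0 b i j * E2 c d k l\<bar> = \<bar>r j k * real c * E4 b' 0 (c - 1) d j i k l + r j l * real d * E4 b' 0 c (d - 1) j i k l\<bar>"
        using E4_swap[of 0 "Suc b'" c d i j k l] by (simp only: Suc E4_Suc) simp
      also have "\<dots> \<le> \<bar>r j k\<bar> * (real c * B1) + \<bar>r j l\<bar> * (real d * B2)"
      proof -
        have "\<bar>r j k * real c * E4 b' 0 (c - 1) d j i k l\<bar> \<le> \<bar>r j k\<bar> * (real c * B1)"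
          unfolding abs_mult mult.assoc abs_of_nat by (intro mult_left_mono B1 abs_ge_zero of_nat_0_le_iff)
        moreover have "\<bar>r j l * real d * E4 b' 0 c (d - 1) j i k l\<bar> \<le> \<bar>r j l\<bar> * (real d * B2)"
          unfolding abs_mult mult.assoc abs_of_nat by (intro mult_left_mono B2 abs_ge_zero of_nat_0_le_iff)
        ultimately show ?thesis by (rule l3)
      qed
      also have "\<dots> \<le> (\<bar>r i k\<bar> + \<bar>r i l\<bar> + \<bar>r j k\<bar> + \<bar>r j l\<bar>) * (real c * B1) + (\<bar>r i k\<bar> + \<bar>r i l\<bar> + \<bar>r j k\<bar> + \<bar>r j l\<bar>) * (real d * B2)"
        using B1(1) B2(1) by (intro add_mono mult_right_mono) simp_all
      also have "\<dots> = (real c * B1 + real d * B2) * (\<bar>r i k\<bar> + \<bar>r i l\<bar> + \<bar>r j k\<bar> + \<bar>r j l\<bar>)"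
        by (rule l1)
      finally show ?thesis .
    qed
    then show ?thesis using B1 B2 by (intro exI[of _ "real c * B1 + real d * B2"]) auto
  qed
next
  case (Suc a)
  obtain B1 where B1: "B1 \<ge> 0" "\<And>i j k l. \<bar>E4 a b (c - 1) d i j k l\<bar> \<le> B1" using E4_bounded by blast
  obtain B2 where B2: "B2 \<ge> 0" "\<And>i j k l. \<bar>E4 a b c (d - 1) i j k l\<bar> \<le> B2" using E4_bounded by blast
  obtain C where C: "C \<ge> 0" "\<And>i j k l. \<bar>E4 a (b - 1) c d i j k l - E2 a (b - 1) i j * E2 c d k l\<bar> \<le> C * (\<bar>r i k\<bar> + \<bar>r i l\<bar> + \<bar>r j k\<bar> + \<bar>r j l\<bar>)"
    using Suc.IH[of "b - 1"] by blast
  have "\<bar>E4 (Suc a) b c d i j k l - E2 (Suc a) b i j * E2 c d k l\<bar> \<le> (real b * C + real c * B1 + real d * B2) * (\<bar>r i k\<bar> + \<bar>r i l\<bar> + \<bar>r j k\<bar> + \<bar>r j l\<bar>)" for i j k l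
  proof -
    let ?s = "\<bar>r i k\<bar> + \<bar>r i l\<bar> + \<bar>r j k\<bar> + \<bar>r j l\<bar>"
    have "E4 (Suc a) b c d i j k l - E2 (Suc a) b i j * E2 c d k l
      = r i j * (real b * (E4 a (b - 1) c d i j k l - E2 a (b - 1) i j * E2 c d k l))
        + r i k * real c * E4 a b (c - 1) d i j k l + r i l * real d * E4 a b c (d - 1) i j k l"
      unfolding E4_Suc E2_Suc by (simp add: algebra_simps)
    moreover have "\<bar>r i j * (real b * (E4 a (b - 1) c d i j k l - E2 a (b - 1) i j * E2 c d k l))\<bar> \<le> real b * (C * ?s)"
    proof -
      have "\<bar>r i j * (real b * (E4 a (b - 1) c d i j k l - E2 a (b - 1) i j * E2 c d k l))\<bar> \<le> 1 * (real b * (C * ?s))"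
        unfolding abs_mult abs_of_nat
        by (intro mult_mono abs_r_le_1 C order_refl mult_nonneg_nonneg of_nat_0_le_iff abs_ge_zero zero_le_one)
      then show ?thesis by (simp only: mult_1)
    qed
    moreover have "\<bar>r i k * real c * E4 a b (c - 1) d i j k l\<bar> \<le> \<bar>r i k\<bar> * (real c * B1)"
      unfolding abs_mult mult.assoc abs_of_nat by (intro mult_left_mono B1 abs_ge_zero of_nat_0_le_iff)
    moreover have "\<bar>r i l * real d * E4 a b c (d - 1) i j k l\<bar> \<le> \<bar>r i l\<bar> * (real d * B2)"
      unfolding abs_mult mult.assoc abs_of_nat by (intro mult_left_mono B2 abs_ge_zero of_nat_0_le_iff)
    ultimately have "\<bar>E4 (Suc a) b c d i j k l - E2 (Suc a) b i j * E2 c d k l\<bar>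
      \<le> real b * (C * ?s) + \<bar>r i k\<bar> * (real c * B1) + \<bar>r i l\<bar> * (real d * B2)"
      by (simp only: l4)
    also have "\<dots> \<le> real b * (C * ?s) + ?s * (real c * B1) + ?s * (real d * B2)"
      using B1(1) B2(1) by (intro add_mono mult_right_mono order_refl mult_nonneg_nonneg of_nat_0_le_iff) simp_all
    also have "\<dots> = (real b * C + real c * B1 + real d * B2) * ?s"
      by (rule l2)
    finally show ?thesis .
  qed
  then show ?case using B1 B2 C by (intro exI[of _ "real b * C + real c * B1 + real d * B2"]) auto
qed
qed

lemma hermite_sum_decoupling:
  fixes \<alpha> \<beta> :: "nat \<Rightarrow> real" and N :: nat
  defines "A \<equiv> hermite_sum \<alpha> N" and "B \<equiv> hermite_sum \<beta> N"
  shows "\<exists>C\<ge>0. \<forall>i j k l. \<bar>expectation (\<lambda>w. (A (\<xi> i w) * B (\<xi> j w)) * (A (\<xi> k w) * B (\<xi> l w)))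
       - expectation (\<lambda>w. A (\<xi> i w) * B (\<xi> j w)) * expectation (\<lambda>w. A (\<xi> k w) * B (\<xi> l w))\<bar>
      \<le> C * (\<bar>r i k\<bar> + \<bar>r i l\<bar> + \<bar>r j k\<bar> + \<bar>r j l\<bar>)"
proof -
  define C where "C a b c d = (SOME C. C \<ge> 0 \<and> (\<forall>i j k l. \<bar>E4 a b c d i j k l - E2 a b i j * E2 c d k l\<bar>
      \<le> C * (\<bar>r i k\<bar> + \<bar>r i l\<bar> + \<bar>r j k\<bar> + \<bar>r j l\<bar>)))" for a b c d
  have C: "C a b c d \<ge> 0" "\<bar>E4 a b c d i j k l - E2 a b i j * E2 c d k l\<bar>
      \<le> C a b c d * (\<bar>r i k\<bar> + \<bar>r i l\<bar> + \<bar>r j k\<bar> + \<bar>r j l\<bar>)" for a b c d i j k l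
    using someI_ex[OF E4_decoupling[of a b c d]] unfolding C_def by blast+
  \<comment> \<open>The constants are chosen once and for all, so that their weighted sum is uniform in the indices.\<close>
  define D where "D = (\<Sum>a<N. \<Sum>b<N. \<Sum>c<N. \<Sum>d<N. \<bar>\<alpha> a * \<beta> b * \<alpha> c * \<beta> d\<bar> * C a b c d)"
  have i2: "integrable M (\<lambda>w. hermite a (\<xi> i w) * hermite b (\<xi> j w))" for a b i j
    by (rule integrable_moderate[of "\<lambda>y. hermite a (y i) * hermite b (y j)"]) (intro moderate_intros)
  have e2: "expectation (\<lambda>w. A (\<xi> i w) * B (\<xi> j w)) = (\<Sum>a<N. \<Sum>b<N. \<alpha> a * \<beta> b * E2 a b i j)" for i j
  proof -
    have "expectation (\<lambda>w. A (\<xi> i w) * B (\<xi> j w)) = expectation (\<lambda>w. \<Sum>a<N. \<Sum>b<N. \<alpha> a * \<beta> b * (hermite a (\<xi> i w) * hermite b (\<xi> j w)))"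
      unfolding A_def B_def hermite_sum_def sum_product by (simp add: mult_ac)
    then show ?thesis by (simp add: i2 E2_def)
  qed
  have e4: "expectation (\<lambda>w. (A (\<xi> i w) * B (\<xi> j w)) * (A (\<xi> k w) * B (\<xi> l w)))
    = (\<Sum>a<N. \<Sum>b<N. \<Sum>c<N. \<Sum>d<N. \<alpha> a * \<beta> b * \<alpha> c * \<beta> d * E4 a b c d i j k l)" for i j k l
  proof -
    have "(A x * B y) * (A z * B u) = (\<Sum>a<N. \<Sum>b<N. \<Sum>c<N. \<Sum>d<N. \<alpha> a * \<beta> b * \<alpha> c * \<beta> d * (hermite a x * (hermite b y * (hermite c z * hermite d u))))" for x y z u
    proof -
      have AB: "A x * B y = (\<Sum>a<N. \<Sum>b<N. \<alpha> a * \<beta> b * (hermite a x * hermite b y))" for x y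
        unfolding A_def B_def hermite_sum_def sum_product by (simp add: mult_ac)
      show ?thesis unfolding AB sum_sum_mult_sum_sum by (simp add: mult_ac)
    qed
    then show ?thesis by (simp add: integrable_hermite4 E4_def)
  qed
  have "\<bar>expectation (\<lambda>w. (A (\<xi> i w) * B (\<xi> j w)) * (A (\<xi> k w) * B (\<xi> l w)))
       - expectation (\<lambda>w. A (\<xi> i w) * B (\<xi> j w)) * expectation (\<lambda>w. A (\<xi> k w) * B (\<xi> l w))\<bar>
      \<le> D * (\<bar>r i k\<bar> + \<bar>r i l\<bar> + \<bar>r j k\<bar> + \<bar>r j l\<bar>)" for i j k l
  proof -
    let ?s = "\<bar>r i k\<bar> + \<bar>r i l\<bar> + \<bar>r j k\<bar> + \<bar>r j l\<bar>"
    have "expectation (\<lambda>w. A (\<xi> i w) * B (\<xi> j w)) * expectation (\<lambda>w. A (\<xi> k w) * B (\<xi> l w))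
      = (\<Sum>a<N. \<Sum>b<N. \<Sum>c<N. \<Sum>d<N. \<alpha> a * \<beta> b * \<alpha> c * \<beta> d * (E2 a b i j * E2 c d k l))"
      unfolding e2 sum_sum_mult_sum_sum by (simp add: mult_ac)
    then have eq: "expectation (\<lambda>w. (A (\<xi> i w) * B (\<xi> j w)) * (A (\<xi> k w) * B (\<xi> l w)))
       - expectation (\<lambda>w. A (\<xi> i w) * B (\<xi> j w)) * expectation (\<lambda>w. A (\<xi> k w) * B (\<xi> l w))
      = (\<Sum>a<N. \<Sum>b<N. \<Sum>c<N. \<Sum>d<N. \<alpha> a * \<beta> b * \<alpha> c * \<beta> d * (E4 a b c d i j k l - E2 a b i j * E2 c d k l))"
      unfolding e4 by (simp add: right_diff_distrib sum_subtractf)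
    have "\<bar>\<Sum>a<N. \<Sum>b<N. \<Sum>c<N. \<Sum>d<N. \<alpha> a * \<beta> b * \<alpha> c * \<beta> d * (E4 a b c d i j k l - E2 a b i j * E2 c d k l)\<bar>
       \<le> (\<Sum>a<N. \<Sum>b<N. \<Sum>c<N. \<Sum>d<N. \<bar>\<alpha> a * \<beta> b * \<alpha> c * \<beta> d\<bar> * (C a b c d * ?s))"
      by (intro order_trans[OF sum_abs] sum_mono) (subst abs_mult, intro mult_left_mono C, simp)
    also have "\<dots> = D * ?s" unfolding D_def sum_distrib_right by (simp add: mult_ac)
    finally show ?thesis unfolding eq .
  qed
  moreover have "D \<ge> 0" unfolding D_def by (intro sum_nonneg mult_nonneg_nonneg C) auto
  ultimately show ?thesis by blast
qed

text \<open>By the symmetry of \<open>r\<close> each of the four cross terms is a chain as in \<open>chain_sum_bound\<close>.\<close>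
lemma chain_sum_bound4:
  assumes I: "finite I" and R: "\<And>i. i \<in> I \<Longrightarrow> (\<Sum>j\<in>I. \<bar>r i j\<bar>) \<le> R"
  shows "(\<Sum>i\<in>I. \<Sum>j\<in>I. \<Sum>k\<in>I. \<Sum>l\<in>I. \<bar>r i j\<bar> * \<bar>r k l\<bar> * (\<bar>r i k\<bar> + \<bar>r i l\<bar> + \<bar>r j k\<bar> + \<bar>r j l\<bar>)) \<le> 4 * (R ^ 3 * card I)"
proof -
  let ?a = "\<lambda>i j. \<bar>r i j\<bar>"
  have b: "(\<Sum>i\<in>I. \<Sum>j\<in>I. \<Sum>k\<in>I. \<Sum>l\<in>I. ?a i j * ?a k l * ?a i k) \<le> R ^ 3 * card I"
    by (rule chain_sum_bound[OF I _ R]) auto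
  have s1: "(\<Sum>k\<in>I. \<Sum>l\<in>I. ?a i j * ?a k l * ?a i' l) = (\<Sum>k\<in>I. \<Sum>l\<in>I. ?a i j * ?a k l * ?a i' k)" for i j i'
    by (subst sum.swap) (simp only: r_sym)
  have s2: "(\<Sum>i\<in>I. \<Sum>j\<in>I. \<Sum>k\<in>I. \<Sum>l\<in>I. ?a i j * ?a k l * ?a j k) = (\<Sum>i\<in>I. \<Sum>j\<in>I. \<Sum>k\<in>I. \<Sum>l\<in>I. ?a i j * ?a k l * ?a i k)"
  proof -
    have "(\<Sum>i\<in>I. \<Sum>j\<in>I. \<Sum>k\<in>I. \<Sum>l\<in>I. ?a i j * ?a k l * ?a j k) = (\<Sum>j\<in>I. \<Sum>i\<in>I. \<Sum>k\<in>I. \<Sum>l\<in>I. ?a i j * ?a k l * ?a j k)"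
      by (rule sum.swap)
    also have "\<dots> = (\<Sum>j\<in>I. \<Sum>i\<in>I. \<Sum>k\<in>I. \<Sum>l\<in>I. ?a j i * ?a k l * ?a j k)"
      by (intro sum.cong refl) (simp only: r_sym)
    finally show ?thesis .
  qed
  show ?thesis using b by (simp only: distrib_left sum.distrib s1 s2)
qed

end

section \<open>Square-integrable functions\<close>

lemma quadratic_nonneg_imp:
  fixes X Y p :: real
  assumes "\<And>s. 0 \<le> X * s\<^sup>2 - 2 * p * s + Y" "X \<ge> 0" "p \<ge> 0"
  shows "p\<^sup>2 \<le> X * Y"
proof (cases "X = 0")
  case True
  have "p = 0"
  proof (rule ccontr)
    assume "p \<noteq> 0"
    then have "0 \<le> - (Y + 1) + Y" using assms(1)[of "(Y + 1) / (2 * p)"] True by (simp add: field_simps)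
    then show False by simp
  qed
  then show ?thesis using True by simp
next
  case False
  then have "0 \<le> X * (X * (p / X)\<^sup>2 - 2 * p * (p / X) + Y)" using assms by (intro mult_nonneg_nonneg)
  also have "\<dots> = X * Y - p\<^sup>2" using False by (simp add: power2_eq_square algebra_simps)
  finally show ?thesis by simp
qed

lemma integrable_mult_square_integrable:
  fixes f g :: "'a \<Rightarrow> real"
  assumes [measurable]: "f \<in> borel_measurable M" "g \<in> borel_measurable M"
    and i: "integrable M (\<lambda>x. (f x)\<^sup>2)" "integrable M (\<lambda>x. (g x)\<^sup>2)"
  shows "integrable M (\<lambda>x. f x * g x)"
proof (rule Bochner_Integration.integrable_bound)
  show "integrable M (\<lambda>x. (f x)\<^sup>2 + (g x)\<^sup>2)" using i by simp
  show "AE x in M. norm (f x * g x) \<le> norm ((f x)\<^sup>2 + (g x)\<^sup>2)"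
  proof (rule AE_I2)
    fix x
    have "2 * \<bar>f x * g x\<bar> \<le> (f x)\<^sup>2 + (g x)\<^sup>2" using sum_squares_bound[of "\<bar>f x\<bar>" "\<bar>g x\<bar>"] by (simp add: abs_mult)
    then show "norm (f x * g x) \<le> norm ((f x)\<^sup>2 + (g x)\<^sup>2)" by simp
  qed
qed simp

lemma integrable_square_add:
  fixes f g :: "'a \<Rightarrow> real"
  assumes [measurable]: "f \<in> borel_measurable M" "g \<in> borel_measurable M"
    and i: "integrable M (\<lambda>x. (f x)\<^sup>2)" "integrable M (\<lambda>x. (g x)\<^sup>2)"
  shows "integrable M (\<lambda>x. (f x + g x)\<^sup>2)" "integrable M (\<lambda>x. (f x - g x)\<^sup>2)"
proof -
  have 1: "integrable M (\<lambda>x. f x * g x)" by (rule integrable_mult_square_integrable) (use i in auto)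
  have "integrable M (\<lambda>x. (f x)\<^sup>2 + (g x)\<^sup>2 + 2 * (f x * g x))" "integrable M (\<lambda>x. (f x)\<^sup>2 + (g x)\<^sup>2 - 2 * (f x * g x))"
    using i 1 by simp_all
  then show "integrable M (\<lambda>x. (f x + g x)\<^sup>2)" "integrable M (\<lambda>x. (f x - g x)\<^sup>2)"
    by (simp_all add: power2_eq_square algebra_simps)
qed

text \<open>Obtained, as in every inner product space, from the discriminant of a nonnegative quadratic polynomial.\<close>
lemma integral_Cauchy_Schwarz:
  fixes f g :: "'a \<Rightarrow> real"
  assumes [measurable]: "f \<in> borel_measurable M" "g \<in> borel_measurable M"
    and i: "integrable M (\<lambda>x. (f x)\<^sup>2)" "integrable M (\<lambda>x. (g x)\<^sup>2)"
  shows "(\<integral>x. \<bar>f x * g x\<bar> \<partial>M) \<le> sqrt (\<integral>x. (f x)\<^sup>2 \<partial>M) * sqrt (\<integral>x. (g x)\<^sup>2 \<partial>M)"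
proof -
  have 1: "integrable M (\<lambda>x. f x * g x)" by (rule integrable_mult_square_integrable) (use i in auto)
  have "(\<integral>x. \<bar>f x * g x\<bar> \<partial>M)\<^sup>2 \<le> (\<integral>x. (f x)\<^sup>2 \<partial>M) * (\<integral>x. (g x)\<^sup>2 \<partial>M)"
  proof (rule quadratic_nonneg_imp)
    fix s :: real
    have "0 \<le> (\<integral>x. (s * \<bar>f x\<bar> - \<bar>g x\<bar>)\<^sup>2 \<partial>M)" by simp
    also have "\<dots> = (\<integral>x. s\<^sup>2 * (f x)\<^sup>2 - 2 * s * \<bar>f x * g x\<bar> + (g x)\<^sup>2 \<partial>M)"
      by (simp add: power2_eq_square algebra_simps abs_mult)
    also have "\<dots> = (\<integral>x. (f x)\<^sup>2 \<partial>M) * s\<^sup>2 - 2 * (\<integral>x. \<bar>f x * g x\<bar> \<partial>M) * s + (\<integral>x. (g x)\<^sup>2 \<partial>M)"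
      using i 1 by (simp add: mult_ac)
    finally show "0 \<le> (\<integral>x. (f x)\<^sup>2 \<partial>M) * s\<^sup>2 - 2 * (\<integral>x. \<bar>f x * g x\<bar> \<partial>M) * s + (\<integral>x. (g x)\<^sup>2 \<partial>M)" .
  qed auto
  then have "(\<integral>x. \<bar>f x * g x\<bar> \<partial>M) \<le> sqrt ((\<integral>x. (f x)\<^sup>2 \<partial>M) * (\<integral>x. (g x)\<^sup>2 \<partial>M))"
    by (rule real_le_rsqrt)
  then show ?thesis by (simp add: real_sqrt_mult)
qed

lemma L2_tendsto_inner:
  fixes a b :: "'a \<Rightarrow> real" and A B :: "nat \<Rightarrow> 'a \<Rightarrow> real"
  assumes m[measurable]: "a \<in> borel_measurable M" "b \<in> borel_measurable M" "\<And>n. A n \<in> borel_measurable M" "\<And>n. B n \<in> borel_measurable M"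
    and i: "integrable M (\<lambda>x. (a x)\<^sup>2)" "integrable M (\<lambda>x. (b x)\<^sup>2)" "\<And>n. integrable M (\<lambda>x. (A n x)\<^sup>2)" "\<And>n. integrable M (\<lambda>x. (B n x)\<^sup>2)"
    and l: "(\<lambda>n. \<integral>x. (a x - A n x)\<^sup>2 \<partial>M) \<longlonglongrightarrow> 0" "(\<lambda>n. \<integral>x. (b x - B n x)\<^sup>2 \<partial>M) \<longlonglongrightarrow> 0"
  shows "(\<lambda>n. \<integral>x. A n x * B n x \<partial>M) \<longlonglongrightarrow> (\<integral>x. a x * b x \<partial>M)"
proof -
  let ?n = "\<lambda>f. sqrt (\<integral>x. (f x)\<^sup>2 \<partial>M)"
  have ia: "integrable M (\<lambda>x. (a x - A n x)\<^sup>2)" "integrable M (\<lambda>x. (b x - B n x)\<^sup>2)" for n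
    by (rule integrable_square_add(2); use i in auto)+
  have cs: "\<bar>\<integral>x. f x * g x \<partial>M\<bar> \<le> ?n f * ?n g" if "f \<in> borel_measurable M" "g \<in> borel_measurable M"
    "integrable M (\<lambda>x. (f x)\<^sup>2)" "integrable M (\<lambda>x. (g x)\<^sup>2)" for f g
    using integral_Cauchy_Schwarz[OF that] integral_abs_bound[of M "\<lambda>x. f x * g x"] by linarith
  have bnd: "\<bar>(\<integral>x. A n x * B n x \<partial>M) - (\<integral>x. a x * b x \<partial>M)\<bar>
    \<le> ?n (\<lambda>x. a x - A n x) * ?n (\<lambda>x. b x - B n x) + ?n a * ?n (\<lambda>x. b x - B n x) + ?n (\<lambda>x. a x - A n x) * ?n b" for n
  proof -
    have "(\<integral>x. A n x * B n x \<partial>M) = (\<integral>x. (a x - A n x) * (b x - B n x) - a x * (b x - B n x) - (a x - A n x) * b x + a x * b x \<partial>M)"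
      by (simp add: algebra_simps)
    also have "\<dots> = (\<integral>x. (a x - A n x) * (b x - B n x) \<partial>M) - (\<integral>x. a x * (b x - B n x) \<partial>M) - (\<integral>x. (a x - A n x) * b x \<partial>M) + (\<integral>x. a x * b x \<partial>M)"
      using integrable_mult_square_integrable[OF _ _ ia, of n n] integrable_mult_square_integrable[OF _ _ i(1) ia(2), of n]
        integrable_mult_square_integrable[OF _ _ ia(1) i(2), of n] integrable_mult_square_integrable[OF m(1,2) i(1,2)] by simp
    finally show ?thesis
      using cs[of "\<lambda>x. a x - A n x" "\<lambda>x. b x - B n x"] cs[of a "\<lambda>x. b x - B n x"] cs[of "\<lambda>x. a x - A n x" b] i ia by simp
  qed
  have s: "(\<lambda>n. ?n (\<lambda>x. a x - A n x)) \<longlonglongrightarrow> 0" "(\<lambda>n. ?n (\<lambda>x. b x - B n x)) \<longlonglongrightarrow> 0"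
    using tendsto_real_sqrt[OF l(1)] tendsto_real_sqrt[OF l(2)] by simp_all
  have "(\<lambda>n. (\<integral>x. A n x * B n x \<partial>M) - (\<integral>x. a x * b x \<partial>M)) \<longlonglongrightarrow> 0"
  proof (rule Lim_null_comparison)
    show "\<forall>\<^sub>F n in sequentially. norm ((\<integral>x. A n x * B n x \<partial>M) - (\<integral>x. a x * b x \<partial>M))
      \<le> ?n (\<lambda>x. a x - A n x) * ?n (\<lambda>x. b x - B n x) + ?n a * ?n (\<lambda>x. b x - B n x) + ?n (\<lambda>x. a x - A n x) * ?n b"
      using bnd by simp
    show "(\<lambda>n. ?n (\<lambda>x. a x - A n x) * ?n (\<lambda>x. b x - B n x) + ?n a * ?n (\<lambda>x. b x - B n x) + ?n (\<lambda>x. a x - A n x) * ?n b) \<longlonglongrightarrow> 0"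
      using tendsto_add[OF tendsto_add[OF tendsto_mult[OF s] tendsto_mult_left[OF s(2), of "?n a"]] tendsto_mult_right[OF s(1), of "?n b"]]
      by simp
  qed
  then show ?thesis by (rule LIM_zero_cancel)
qed

lemma tendsto_by_approximation:
  fixes a :: "nat \<Rightarrow> real"
  assumes "\<And>N n. \<bar>a n - b N n\<bar> \<le> \<eta> N" "\<eta> \<longlonglongrightarrow> 0" "\<And>N. b N \<longlonglongrightarrow> l N" "l \<longlonglongrightarrow> L"
  shows "a \<longlonglongrightarrow> L"
proof (rule LIMSEQ_I)
  fix e :: real assume e: "0 < e"
  define d where "d = e / 3"
  have d: "d > 0" "e = 3 * d" using e by (auto simp: d_def)
  have "\<forall>\<^sub>F N in sequentially. \<eta> N < d \<and> dist (l N) L < d"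
    by (rule eventually_conj[OF order_tendstoD(2)[OF assms(2) d(1)] tendstoD[OF assms(4) d(1)]])
  then obtain N where N: "\<eta> N < d" "\<bar>l N - L\<bar> < d"
    unfolding dist_real_def using eventually_happens'[OF sequentially_bot] by fast
  obtain n0 where n0: "\<And>n. n \<ge> n0 \<Longrightarrow> \<bar>b N n - l N\<bar> < d" using LIMSEQ_D[OF assms(3)[of N], of d] d by auto
  show "\<exists>no. \<forall>n\<ge>no. norm (a n - L) < e"
  proof (intro exI allI impI)
    fix n assume "n \<ge> n0"
    then have "\<bar>b N n - l N\<bar> < d" by (rule n0)
    then have "\<bar>a n - L\<bar> < 3 * d" using N assms(1)[of n N] by linarith
    then show "norm (a n - L) < e" using d by simp
  qed
qed

text \<open>The partial sums are compared with \<open>f\<close> through a Bochner integral, which, unlike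
\<^const>\<open>hermite_expansion\<close>, is only meaningful together with measurability and square
integrability of \<open>f\<close>; \<open>hermite_expansion_iff\<close> relates the two.\<close>
section \<open>Hermite expansions along a Gaussian family\<close>

definition has_hermite_exp :: "(real \<Rightarrow> real) \<Rightarrow> (nat \<Rightarrow> real) \<Rightarrow> bool" where
  "has_hermite_exp f c \<longleftrightarrow> f \<in> borel_measurable borel \<and> integrable std_gauss (\<lambda>x. (f x)\<^sup>2) \<and>
     (\<lambda>N. \<integral>x. (f x - hermite_sum c N x)\<^sup>2 \<partial>std_gauss) \<longlonglongrightarrow> 0"

lemma hermite_sum_growth: "\<exists>C m. \<forall>x. \<bar>hermite_sum c N x\<bar> \<le> C * (1 + \<bar>x\<bar>) ^ m"
proof -
  have "moderate (\<lambda>y::unit \<Rightarrow> real. hermite_sum c N (y ()))" by (rule moderate_hermite_sum[OF moderate_coord])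
  then obtain J C m where J: "\<And>y::unit \<Rightarrow> real. \<bar>hermite_sum c N (y ())\<bar> \<le> C * (1 + (\<Sum>j\<in>J. \<bar>y j\<bar>)) ^ m" and "C \<ge> 0"
    unfolding moderate_def by blast
  have "\<bar>hermite_sum c N x\<bar> \<le> C * (1 + \<bar>x\<bar>) ^ m" for x
  proof -
    have "J = {} \<or> J = {()}" by auto
    then have "(\<Sum>j\<in>J. \<bar>x\<bar>) \<le> \<bar>x\<bar>" by (elim disjE) simp_all
    then have "(1 + (\<Sum>j\<in>J. \<bar>x\<bar>)) ^ m \<le> (1 + \<bar>x\<bar>) ^ m" by (intro power_mono) (auto intro!: add_nonneg_nonneg sum_nonneg)
    then show ?thesis using J[of "\<lambda>_. x"] mult_left_mono[OF _ \<open>C \<ge> 0\<close>] by (meson order_trans)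
  qed
  then show ?thesis by blast
qed

lemma integrable_hermite_sum_square: "integrable std_gauss (\<lambda>x. (hermite_sum c N x)\<^sup>2)"
proof -
  obtain C m where 1: "\<And>x. \<bar>hermite_sum c N x\<bar> \<le> C * (1 + \<bar>x\<bar>) ^ m" using hermite_sum_growth by blast
  show ?thesis
  proof (rule integrable_std_gauss_growth)
    fix x
    have "\<bar>hermite_sum c N x\<bar>\<^sup>2 \<le> (C * (1 + \<bar>x\<bar>) ^ m)\<^sup>2" by (rule power_mono[OF 1]) simp
    then show "\<bar>(hermite_sum c N x)\<^sup>2\<bar> \<le> C\<^sup>2 * (1 + \<bar>x\<bar>) ^ (m * 2)" by (simp add: power_mult_distrib power_mult)
  qed simp
qed

lemma has_hermite_exp_tail:
  assumes "has_hermite_exp f c"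
  shows "has_hermite_exp (\<lambda>x. f x - hermite_sum c N x) (\<lambda>q. if q < N then 0 else c q)"
  unfolding has_hermite_exp_def
proof (intro conjI)
  have f: "f \<in> borel_measurable borel" "integrable std_gauss (\<lambda>x. (f x)\<^sup>2)" using assms by (auto simp: has_hermite_exp_def)
  note [measurable] = f(1)
  show "(\<lambda>x. f x - hermite_sum c N x) \<in> borel_measurable borel" by simp
  show "integrable std_gauss (\<lambda>x. (f x - hermite_sum c N x)\<^sup>2)"
    by (rule integrable_square_add(2)) (use f integrable_hermite_sum_square in auto)
  have "(\<lambda>K. \<integral>x. (f x - hermite_sum c (K + N) x)\<^sup>2 \<partial>std_gauss) \<longlonglongrightarrow> 0"
    using assms unfolding has_hermite_exp_def by (intro LIMSEQ_ignore_initial_segment) auto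
  moreover have "f x - hermite_sum c (K + N) x = f x - hermite_sum c N x - hermite_sum (\<lambda>q. if q < N then 0 else c q) (K + N) x" for K x
  proof -
    have "hermite_sum c (K + N) x = (\<Sum>q<K + N. (if q < N then c q * hermite q x else 0) + (if q < N then 0 else c q) * hermite q x)"
      unfolding hermite_sum_def by (intro sum.cong) auto
    also have "\<dots> = (\<Sum>q<K + N. if q < N then c q * hermite q x else 0) + hermite_sum (\<lambda>q. if q < N then 0 else c q) (K + N) x"
      unfolding hermite_sum_def sum.distrib ..
    also have "(\<Sum>q<K + N. if q < N then c q * hermite q x else 0) = hermite_sum c N x"
      unfolding hermite_sum_def by (intro sum.mono_neutral_cong_right) auto
    finally show ?thesis by simp
  qed
  ultimately have "(\<lambda>K. \<integral>x. (f x - hermite_sum c N x - hermite_sum (\<lambda>q. if q < N then 0 else c q) (K + N) x)\<^sup>2 \<partial>std_gauss) \<longlonglongrightarrow> 0"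
    by simp
  then show "(\<lambda>K. \<integral>x. (f x - hermite_sum c N x - hermite_sum (\<lambda>q. if q < N then 0 else c q) K x)\<^sup>2 \<partial>std_gauss) \<longlonglongrightarrow> 0"
    by (rule LIMSEQ_offset)
qed

context std_gaussian_family
begin

lemma E_sum:
  "(\<And>k. k \<in> T \<Longrightarrow> moderate (\<Phi> k)) \<Longrightarrow>
    expectation (\<lambda>w. \<Sum>k\<in>T. \<Phi> k (\<lambda>j. \<xi> j w)) = (\<Sum>k\<in>T. expectation (\<lambda>w. \<Phi> k (\<lambda>j. \<xi> j w)))"
  by (rule Bochner_Integration.integral_sum) (auto intro: integrable_moderate)

lemma expectation_hermite_sum_mult:
  "expectation (\<lambda>w. hermite_sum c N (\<xi> i w) * hermite_sum c N (\<xi> j w)) = (\<Sum>q<N. fact q * (c q)\<^sup>2 * r i j ^ q)"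
proof -
  have i2: "integrable M (\<lambda>w. hermite a (\<xi> i w) * hermite b (\<xi> j w))" for a b
    by (rule integrable_moderate[of "\<lambda>y. hermite a (y i) * hermite b (y j)"]) (intro moderate_intros)
  have "expectation (\<lambda>w. hermite_sum c N (\<xi> i w) * hermite_sum c N (\<xi> j w))
    = expectation (\<lambda>w. \<Sum>a<N. \<Sum>b<N. c a * c b * (hermite a (\<xi> i w) * hermite b (\<xi> j w)))"
    unfolding hermite_sum_def sum_product by (simp add: mult_ac)
  also have "\<dots> = (\<Sum>a<N. \<Sum>b<N. c a * c b * (if a = b then fact a * r i j ^ a else 0))"
    by (simp add: i2 expectation_hermite_mult)
  also have "\<dots> = (\<Sum>a<N. \<Sum>b<N. if a = b then fact a * (c a)\<^sup>2 * r i j ^ a else 0)"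
    by (intro sum.cong) (auto simp: power2_eq_square)
  also have "\<dots> = (\<Sum>q<N. fact q * (c q)\<^sup>2 * r i j ^ q)" by simp
  finally show ?thesis .
qed

text \<open>The correlation is a power series in \<open>r i j\<close> with nonnegative coefficients and, since \<open>c 0 = 0\<close>, without
constant term; on \<open>[-1, 1]\<close> it is therefore at most \<open>\<bar>r i j\<bar>\<close> times its value at \<open>1\<close>.\<close>
lemma hermite_exp_correlation:
  assumes f: "has_hermite_exp f c" and c0: "c 0 = 0"
  shows "\<bar>expectation (\<lambda>w. f (\<xi> i w) * f (\<xi> j w))\<bar> \<le> \<bar>r i j\<bar> * (\<integral>x. (f x)\<^sup>2 \<partial>std_gauss)"
proof -
  have fm[measurable]: "f \<in> borel_measurable borel" and fi: "integrable std_gauss (\<lambda>x. (f x)\<^sup>2)"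
    and fl: "(\<lambda>N. \<integral>x. (f x - hermite_sum c N x)\<^sup>2 \<partial>std_gauss) \<longlonglongrightarrow> 0"
    using f by (auto simp: has_hermite_exp_def)
  have lim: "(\<lambda>N. expectation (\<lambda>w. hermite_sum c N (\<xi> i w) * hermite_sum c N (\<xi> j w))) \<longlonglongrightarrow> expectation (\<lambda>w. f (\<xi> i w) * f (\<xi> j w))" for i j
  proof -
    have 1: "integrable M (\<lambda>x. (f (\<xi> i x))\<^sup>2)" for i using fi by (simp add: integrable_\<xi>[where f = "\<lambda>x. (f x)\<^sup>2"])
    have 2: "integrable M (\<lambda>x. (hermite_sum c n (\<xi> i x))\<^sup>2)" for i n
      using integrable_hermite_sum_square by (simp add: integrable_\<xi>[where f = "\<lambda>x. (hermite_sum c n x)\<^sup>2"])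
    have 3: "(\<lambda>N. expectation (\<lambda>x. (f (\<xi> i x) - hermite_sum c N (\<xi> i x))\<^sup>2)) \<longlonglongrightarrow> 0" for i
      using fl by (simp add: integral_\<xi>[where f = "\<lambda>x. (f x - hermite_sum c _ x)\<^sup>2"])
    show ?thesis by (rule L2_tendsto_inner[OF _ _ _ _ 1 1 2 2 3 3]) auto
  qed
  have "\<bar>expectation (\<lambda>w. hermite_sum c N (\<xi> i w) * hermite_sum c N (\<xi> j w))\<bar>
     \<le> \<bar>r i j\<bar> * expectation (\<lambda>w. hermite_sum c N (\<xi> i w) * hermite_sum c N (\<xi> i w))" for N
  proof -
    have "\<bar>\<Sum>q<N. fact q * (c q)\<^sup>2 * r i j ^ q\<bar> \<le> (\<Sum>q<N. \<bar>r i j\<bar> * (fact q * (c q)\<^sup>2 * r i i ^ q))"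
    proof (rule order_trans[OF sum_abs sum_mono])
      fix q
      show "\<bar>fact q * (c q)\<^sup>2 * r i j ^ q\<bar> \<le> \<bar>r i j\<bar> * (fact q * (c q)\<^sup>2 * r i i ^ q)"
      proof (cases q)
        case (Suc q')
        have "\<bar>r i j\<bar> ^ Suc q' \<le> \<bar>r i j\<bar> * 1"
          unfolding power_Suc using abs_r_le_1[of i j] by (intro mult_left_mono power_le_one) auto
        then have "(fact q * (c q)\<^sup>2) * \<bar>r i j\<bar> ^ q \<le> (fact q * (c q)\<^sup>2) * \<bar>r i j\<bar>"
          using Suc by (intro mult_left_mono) auto
        then show ?thesis by (simp add: abs_mult power_abs mult_ac)
      qed (simp add: c0)
    qed
    then show ?thesis unfolding expectation_hermite_sum_mult sum_distrib_left .
  qed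
  then have "\<bar>expectation (\<lambda>w. f (\<xi> i w) * f (\<xi> j w))\<bar> \<le> \<bar>r i j\<bar> * expectation (\<lambda>w. f (\<xi> i w) * f (\<xi> i w))"
    by (intro LIMSEQ_le[OF tendsto_rabs[OF lim] tendsto_mult_left[OF lim]]) auto
  then show ?thesis using integral_\<xi>[of "\<lambda>x. (f x)\<^sup>2" i] by (simp add: power2_eq_square)
qed

text \<open>Covariances are bounded by \<open>hermite_exp_correlation\<close>, so a bound on the row sums of \<open>r\<close> makes the variance
grow linearly in the number of terms. This is used twice: to neglect the tail of a Hermite expansion
uniformly, and to obtain the rate of convergence of the power variations.\<close>
lemma hermite_exp_sum_second_moment:
  fixes \<delta> R :: real
  assumes f: "has_hermite_exp f c" and c0: "c 0 = 0" and I: "finite I"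
    and w: "\<And>i. i \<in> I \<Longrightarrow> \<bar>u i\<bar> \<le> \<delta>" and R: "\<And>i. i \<in> I \<Longrightarrow> (\<Sum>j\<in>I. \<bar>r i j\<bar>) \<le> R"
  shows "integrable M (\<lambda>w. (\<Sum>i\<in>I. u i * f (\<xi> i w))\<^sup>2)"
    and "expectation (\<lambda>w. (\<Sum>i\<in>I. u i * f (\<xi> i w))\<^sup>2) \<le> card I * \<delta>\<^sup>2 * R * (\<integral>x. (f x)\<^sup>2 \<partial>std_gauss)"
proof -
  have fm[measurable]: "f \<in> borel_measurable borel" and fi: "integrable std_gauss (\<lambda>x. (f x)\<^sup>2)"
    using f by (auto simp: has_hermite_exp_def)
  have i: "integrable M (\<lambda>w. (f (\<xi> i w))\<^sup>2)" for i using fi by (simp add: integrable_\<xi>[where f = "\<lambda>x. (f x)\<^sup>2"])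
  have ij: "integrable M (\<lambda>w. f (\<xi> i w) * f (\<xi> j w))" for i j
    by (rule integrable_mult_square_integrable) (use i in auto)
  have eq: "(\<Sum>i\<in>I. u i * f (\<xi> i w))\<^sup>2 = (\<Sum>i\<in>I. \<Sum>j\<in>I. u i * u j * (f (\<xi> i w) * f (\<xi> j w)))" for w
    unfolding power2_eq_square sum_product by (simp add: mult_ac)
  show "integrable M (\<lambda>w. (\<Sum>i\<in>I. u i * f (\<xi> i w))\<^sup>2)" unfolding eq by (simp add: ij)
  define S where "S = (\<integral>x. (f x)\<^sup>2 \<partial>std_gauss)"
  have S0: "S \<ge> 0" unfolding S_def by simp
  have "expectation (\<lambda>w. (\<Sum>i\<in>I. u i * f (\<xi> i w))\<^sup>2) = (\<Sum>i\<in>I. \<Sum>j\<in>I. u i * u j * expectation (\<lambda>w. f (\<xi> i w) * f (\<xi> j w)))"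
    unfolding eq by (simp add: ij)
  also have "\<dots> \<le> (\<Sum>i\<in>I. \<Sum>j\<in>I. \<delta>\<^sup>2 * (\<bar>r i j\<bar> * S))"
  proof (intro sum_mono)
    fix i j assume ij: "i \<in> I" "j \<in> I"
    have d0: "\<delta> \<ge> 0" using w[OF ij(1)] by linarith
    have "u i * u j * expectation (\<lambda>w. f (\<xi> i w) * f (\<xi> j w)) \<le> \<bar>u i\<bar> * \<bar>u j\<bar> * \<bar>expectation (\<lambda>w. f (\<xi> i w) * f (\<xi> j w))\<bar>"
      unfolding abs_mult[symmetric] by (rule abs_ge_self)
    also have "\<dots> \<le> (\<delta> * \<delta>) * (\<bar>r i j\<bar> * S)"
      unfolding S_def using w[OF ij(1)] w[OF ij(2)] d0 by (intro mult_mono hermite_exp_correlation[OF f c0]) auto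
    finally show "u i * u j * expectation (\<lambda>w. f (\<xi> i w) * f (\<xi> j w)) \<le> \<delta>\<^sup>2 * (\<bar>r i j\<bar> * S)" by (simp add: power2_eq_square)
  qed
  also have "\<dots> = (\<Sum>i\<in>I. (\<Sum>j\<in>I. \<bar>r i j\<bar>) * (\<delta>\<^sup>2 * S))" by (simp add: sum_distrib_right sum_distrib_left mult_ac)
  also have "\<dots> \<le> (\<Sum>i\<in>I. R * (\<delta>\<^sup>2 * S))" using R S0 by (intro sum_mono mult_right_mono) auto
  also have "\<dots> = card I * \<delta>\<^sup>2 * R * S" by simp
  finally show "expectation (\<lambda>w. (\<Sum>i\<in>I. u i * f (\<xi> i w))\<^sup>2) \<le> card I * \<delta>\<^sup>2 * R * (\<integral>x. (f x)\<^sup>2 \<partial>std_gauss)" unfolding S_def .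
qed

end

section \<open>The Stein equation for finite Hermite sums\<close>

context std_gaussian_family
begin

context
  fixes c :: "nat \<Rightarrow> real" and N :: nat
begin

abbreviation (input) hP :: "real \<Rightarrow> real" where "hP x \<equiv> (\<Sum>q<N. c q * hermite (Suc q) x)"
abbreviation (input) hA :: "real \<Rightarrow> real" where "hA \<equiv> hermite_sum c N"
abbreviation (input) hB :: "real \<Rightarrow> real" where "hB \<equiv> hermite_sum (\<lambda>q. real (Suc q) * c q) N"

text \<open>For the sum \<open>F\<close> of the functions \<open>u i * hP (\<xi> i)\<close>, this is the pairing of the Malliavin derivative of \<open>F\<close>
with the derivative of its preimage under minus the Ornstein-Uhlenbeck generator. The preimage divides the
coefficient of \<open>hermite q\<close> by \<open>q\<close>, which is why \<open>hA\<close> has the coefficients of \<open>hP\<close> shifted by one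
while \<open>hB\<close> is the derivative of \<open>hP\<close>.\<close>
definition stein_kernel :: "'i set \<Rightarrow> ('i \<Rightarrow> real) \<Rightarrow> ('i \<Rightarrow> real) \<Rightarrow> real" where
  "stein_kernel I u y = (\<Sum>i\<in>I. \<Sum>j\<in>I. u i * u j * r i j * (hA (y i) * hB (y j)))"

definition stein_sum :: "'i set \<Rightarrow> ('i \<Rightarrow> real) \<Rightarrow> ('i \<Rightarrow> real) \<Rightarrow> real" where
  "stein_sum I u y = (\<Sum>i\<in>I. u i * hP (y i))"

lemma moderate_stein_kernel: "moderate (stein_kernel I u)"
  unfolding stein_kernel_def[abs_def] by (intro moderate_intros moderate_hermite_sum)

lemma moderate_stein_sum: "moderate (stein_sum I u)"
  unfolding stein_sum_def[abs_def] by (intro moderate_intros)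

lemma gdiff_stein_sum: "gdiff i (stein_sum I u) (\<lambda>y. \<Sum>j\<in>I. u j * (hB (y j) * r i j))"
proof -
  have "gdiff i (\<lambda>y. \<Sum>j\<in>I. u j * (\<Sum>q<N. c q * hermite (Suc q) (y j)))
     (\<lambda>y. \<Sum>j\<in>I. u j * (\<Sum>q<N. c q * (real (Suc q) * hermite (Suc q - 1) (y j) * r i j)))"
    by (intro gdiff_sum gdiff_cmult gdiff_hermite)
  moreover have "(\<Sum>q<N. c q * (real (Suc q) * hermite (Suc q - 1) x * s)) = hB x * s" for x s
    unfolding hermite_sum_def sum_distrib_right by (intro sum.cong refl) (simp add: mult_ac)
  ultimately show ?thesis unfolding stein_sum_def[abs_def] by simp
qed

text \<open>Every summand of \<open>hP\<close> has degree at least one, so one Hermite factor can be integrated by parts with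
\<open>hermite_ibp\<close>. For \<open>\<Psi> = sin (t * F)\<close> and \<open>\<Psi> = cos (t * F)\<close> the identity is a differential equation for
the characteristic function of \<open>F\<close>, exactly that of a normal law up to the fluctuation of the kernel.\<close>
lemma stein_identity:
  assumes d: "\<And>i. gdiff i \<Psi> (\<lambda>y. \<Psi>1 y * (\<Sum>j\<in>I. u j * (hB (y j) * r i j)))" and m: "moderate \<Psi>1"
  shows "expectation (\<lambda>w. stein_sum I u (\<lambda>j. \<xi> j w) * \<Psi> (\<lambda>j. \<xi> j w))
    = expectation (\<lambda>w. \<Psi>1 (\<lambda>j. \<xi> j w) * stein_kernel I u (\<lambda>j. \<xi> j w))"
proof -
  have mP: "moderate \<Psi>" using gdiffD(1)[OF d] .
  define D where "D i y = (\<Sum>j\<in>I. u j * (hB (y j) * r i j))" for i and y :: "'i \<Rightarrow> real"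
  have mD: "moderate (D i)" for i unfolding D_def[abs_def] by (intro moderate_intros moderate_hermite_sum)
  have m1: "moderate (\<lambda>y. u i * (c q * (hermite (Suc q) (y i) * \<Psi> y)))" for i q by (intro moderate_intros mP)
  have m2: "moderate (\<lambda>y. u i * (c q * (hermite q (y i) * (\<Psi>1 y * D i y))))" for i q by (intro moderate_intros m mD)
  have "expectation (\<lambda>w. stein_sum I u (\<lambda>j. \<xi> j w) * \<Psi> (\<lambda>j. \<xi> j w))
    = expectation (\<lambda>w. \<Sum>i\<in>I. \<Sum>q<N. u i * (c q * (hermite (Suc q) (\<xi> i w) * \<Psi> (\<lambda>j. \<xi> j w))))"
    by (simp only: stein_sum_def sum_distrib_right sum_distrib_left mult.assoc)
  also have "\<dots> = (\<Sum>i\<in>I. \<Sum>q<N. expectation (\<lambda>w. u i * (c q * (hermite (Suc q) (\<xi> i w) * \<Psi> (\<lambda>j. \<xi> j w)))))"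
    by (subst E_sum[of I "\<lambda>i y. \<Sum>q<N. u i * (c q * (hermite (Suc q) (y i) * \<Psi> y))"], intro moderate_sum m1,
        intro sum.cong refl, subst E_sum[of _ "\<lambda>q y. u _ * (c q * (hermite (Suc q) (y _) * \<Psi> y))"], rule m1, rule refl)
  also have "\<dots> = (\<Sum>i\<in>I. \<Sum>q<N. expectation (\<lambda>w. u i * (c q * (hermite q (\<xi> i w) * (\<Psi>1 (\<lambda>j. \<xi> j w) * D i (\<lambda>j. \<xi> j w))))))"
  proof (intro sum.cong refl)
    fix i q
    show "expectation (\<lambda>w. u i * (c q * (hermite (Suc q) (\<xi> i w) * \<Psi> (\<lambda>j. \<xi> j w))))
      = expectation (\<lambda>w. u i * (c q * (hermite q (\<xi> i w) * (\<Psi>1 (\<lambda>j. \<xi> j w) * D i (\<lambda>j. \<xi> j w)))))"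
      unfolding integral_mult_right_zero D_def by (simp only: hermite_ibp[OF d])
  qed
  also have "\<dots> = expectation (\<lambda>w. \<Sum>i\<in>I. \<Sum>q<N. u i * (c q * (hermite q (\<xi> i w) * (\<Psi>1 (\<lambda>j. \<xi> j w) * D i (\<lambda>j. \<xi> j w)))))"
    by (subst E_sum[of I "\<lambda>i y. \<Sum>q<N. u i * (c q * (hermite q (y i) * (\<Psi>1 y * D i y)))"], intro moderate_sum m2,
        intro sum.cong refl, subst E_sum[of _ "\<lambda>q y. u _ * (c q * (hermite q (y _) * (\<Psi>1 y * D _ y)))"], rule m2, rule refl)
  also have "\<dots> = expectation (\<lambda>w. \<Psi>1 (\<lambda>j. \<xi> j w) * stein_kernel I u (\<lambda>j. \<xi> j w))"
  proof (intro Bochner_Integration.integral_cong refl)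
    fix w
    let ?y = "\<lambda>j. \<xi> j w"
    have "(\<Sum>i\<in>I. \<Sum>q<N. u i * (c q * (hermite q (?y i) * (\<Psi>1 ?y * D i ?y)))) = (\<Sum>i\<in>I. \<Psi>1 ?y * (u i * (hA (?y i) * D i ?y)))"
      by (intro sum.cong refl) (simp add: hermite_sum_def sum_distrib_left sum_distrib_right mult_ac)
    also have "\<dots> = \<Psi>1 ?y * (\<Sum>i\<in>I. u i * (hA (?y i) * D i ?y))" by (simp only: sum_distrib_left)
    also have "(\<Sum>i\<in>I. u i * (hA (?y i) * D i ?y)) = stein_kernel I u ?y"
      unfolding stein_kernel_def D_def sum_distrib_left by (simp add: mult_ac)
    finally show "(\<Sum>i\<in>I. \<Sum>q<N. u i * (c q * (hermite q (?y i) * (\<Psi>1 ?y * D i ?y)))) = \<Psi>1 ?y * stein_kernel I u ?y" .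
  qed
  finally show ?thesis .
qed

lemma stein_second_moment:
  "expectation (\<lambda>w. (stein_sum I u (\<lambda>j. \<xi> j w))\<^sup>2) = expectation (\<lambda>w. stein_kernel I u (\<lambda>j. \<xi> j w))"
  using stein_identity[of "stein_sum I u" "\<lambda>_. 1" u I] gdiff_stein_sum by (simp add: power2_eq_square moderate_const)

text \<open>The variance of the kernel is a fourfold sum of differences of fourth moments and products of second
moments; by \<open>hermite_sum_decoupling\<close> each of them carries an extra covariance factor linking the two
pairs, so the sum is of order \<open>card I\<close> instead of \<open>(card I)\<^sup>2\<close>.\<close>
lemma stein_kernel_variance:
  "\<exists>C\<ge>0. \<forall>I u \<delta> R. finite I \<longrightarrow> (\<forall>i\<in>I. \<bar>u i\<bar> \<le> \<delta>) \<longrightarrow> (\<forall>i\<in>I. (\<Sum>j\<in>I. \<bar>r i j\<bar>) \<le> R) \<longrightarrow>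
     expectation (\<lambda>w. (stein_kernel I u (\<lambda>j. \<xi> j w) - expectation (\<lambda>w. stein_kernel I u (\<lambda>j. \<xi> j w)))\<^sup>2)
       \<le> C * (\<delta> ^ 4 * R ^ 3 * card I)"
proof -
  let ?E4 = "\<lambda>i j k l. expectation (\<lambda>w. (hA (\<xi> i w) * hB (\<xi> j w)) * (hA (\<xi> k w) * hB (\<xi> l w)))"
  let ?E2 = "\<lambda>i j. expectation (\<lambda>w. hA (\<xi> i w) * hB (\<xi> j w))"
  obtain C where C: "C \<ge> 0" "\<And>i j k l. \<bar>?E4 i j k l - ?E2 i j * ?E2 k l\<bar> \<le> C * (\<bar>r i k\<bar> + \<bar>r i l\<bar> + \<bar>r j k\<bar> + \<bar>r j l\<bar>)"
    using hermite_sum_decoupling by blast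
  have "expectation (\<lambda>w. (stein_kernel I u (\<lambda>j. \<xi> j w) - expectation (\<lambda>w. stein_kernel I u (\<lambda>j. \<xi> j w)))\<^sup>2)
       \<le> (4 * C) * (\<delta> ^ 4 * R ^ 3 * card I)"
    if I: "finite I" and u: "\<And>i. i \<in> I \<Longrightarrow> \<bar>u i\<bar> \<le> \<delta>" and R: "\<And>i. i \<in> I \<Longrightarrow> (\<Sum>j\<in>I. \<bar>r i j\<bar>) \<le> R" for I u \<delta> R
  proof -
    define a where "a i j = u i * u j * r i j" for i j
    let ?T = "\<lambda>w. stein_kernel I u (\<lambda>j. \<xi> j w)"
    have i2: "integrable M (\<lambda>w. hA (\<xi> i w) * hB (\<xi> j w))" for i j
      by (rule integrable_moderate[of "\<lambda>y. hA (y i) * hB (y j)"]) (intro moderate_intros moderate_hermite_sum)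
    have i4: "integrable M (\<lambda>w. (hA (\<xi> i w) * hB (\<xi> j w)) * (hA (\<xi> k w) * hB (\<xi> l w)))" for i j k l
      by (rule integrable_moderate[of "\<lambda>y. (hA (y i) * hB (y j)) * (hA (y k) * hB (y l))"]) (intro moderate_intros moderate_hermite_sum)
    have T: "?T w = (\<Sum>i\<in>I. \<Sum>j\<in>I. a i j * (hA (\<xi> i w) * hB (\<xi> j w)))" for w
      unfolding stein_kernel_def a_def ..
    have ET: "expectation ?T = (\<Sum>i\<in>I. \<Sum>j\<in>I. a i j * ?E2 i j)"
      unfolding T by (simp add: i2 del: of_nat_Suc)
    have T2: "(?T w)\<^sup>2 = (\<Sum>i\<in>I. \<Sum>j\<in>I. \<Sum>k\<in>I. \<Sum>l\<in>I. (a i j * a k l) * ((hA (\<xi> i w) * hB (\<xi> j w)) * (hA (\<xi> k w) * hB (\<xi> l w))))" for w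
      unfolding T power2_eq_square sum_sum_mult_sum_sum by (simp add: mult_ac)
    have ET2: "expectation (\<lambda>w. (?T w)\<^sup>2) = (\<Sum>i\<in>I. \<Sum>j\<in>I. \<Sum>k\<in>I. \<Sum>l\<in>I. (a i j * a k l) * ?E4 i j k l)"
      unfolding T2 by (simp add: i4 del: of_nat_Suc)
    have iT: "integrable M ?T" "integrable M (\<lambda>w. (?T w)\<^sup>2)"
      unfolding T2 by (simp_all add: T i2 i4 del: of_nat_Suc)
    have "expectation (\<lambda>w. (?T w - expectation ?T)\<^sup>2) = expectation (\<lambda>w. (?T w)\<^sup>2) - (expectation ?T)\<^sup>2"
      by (rule variance_eq[OF iT])
    also have "\<dots> = (\<Sum>i\<in>I. \<Sum>j\<in>I. \<Sum>k\<in>I. \<Sum>l\<in>I. (a i j * a k l) * (?E4 i j k l - ?E2 i j * ?E2 k l))"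
      unfolding ET2 unfolding ET power2_eq_square sum_sum_mult_sum_sum
      by (simp add: right_diff_distrib sum_subtractf mult_ac)
    also have "\<dots> \<le> (\<Sum>i\<in>I. \<Sum>j\<in>I. \<Sum>k\<in>I. \<Sum>l\<in>I. (C * \<delta> ^ 4) * (\<bar>r i j\<bar> * \<bar>r k l\<bar> * (\<bar>r i k\<bar> + \<bar>r i l\<bar> + \<bar>r j k\<bar> + \<bar>r j l\<bar>)))"
    proof (intro sum_mono)
      fix i j k l assume m: "i \<in> I" "j \<in> I" "k \<in> I" "l \<in> I"
      have d0: "0 \<le> \<delta>" using u[OF m(1)] by linarith
      have uu: "\<bar>u i * u j * (u k * u l)\<bar> \<le> \<delta> * \<delta> * (\<delta> * \<delta>)"
        unfolding abs_mult using m u d0 by (intro mult_mono mult_nonneg_nonneg abs_ge_zero) auto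
      have "(a i j * a k l) * (?E4 i j k l - ?E2 i j * ?E2 k l) \<le> \<bar>(a i j * a k l) * (?E4 i j k l - ?E2 i j * ?E2 k l)\<bar>"
        by (rule abs_ge_self)
      also have "\<dots> = (\<bar>u i * u j * (u k * u l)\<bar> * (\<bar>r i j\<bar> * \<bar>r k l\<bar>)) * \<bar>?E4 i j k l - ?E2 i j * ?E2 k l\<bar>"
        unfolding a_def abs_mult by (simp only: mult_ac)
      also have "\<dots> \<le> ((\<delta> * \<delta> * (\<delta> * \<delta>)) * (\<bar>r i j\<bar> * \<bar>r k l\<bar>)) * (C * (\<bar>r i k\<bar> + \<bar>r i l\<bar> + \<bar>r j k\<bar> + \<bar>r j l\<bar>))"
        using d0 by (intro mult_mono uu C(2) order_refl mult_nonneg_nonneg abs_ge_zero)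
      also have "\<dots> = (C * \<delta> ^ 4) * (\<bar>r i j\<bar> * \<bar>r k l\<bar> * (\<bar>r i k\<bar> + \<bar>r i l\<bar> + \<bar>r j k\<bar> + \<bar>r j l\<bar>))"
        by (simp only: power4_eq_xxxx mult_ac)
      finally show "(a i j * a k l) * (?E4 i j k l - ?E2 i j * ?E2 k l)
        \<le> (C * \<delta> ^ 4) * (\<bar>r i j\<bar> * \<bar>r k l\<bar> * (\<bar>r i k\<bar> + \<bar>r i l\<bar> + \<bar>r j k\<bar> + \<bar>r j l\<bar>))" .
    qed
    also have "\<dots> = (C * \<delta> ^ 4) * (\<Sum>i\<in>I. \<Sum>j\<in>I. \<Sum>k\<in>I. \<Sum>l\<in>I. \<bar>r i j\<bar> * \<bar>r k l\<bar> * (\<bar>r i k\<bar> + \<bar>r i l\<bar> + \<bar>r j k\<bar> + \<bar>r j l\<bar>))"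
      by (simp only: sum_distrib_left)
    also have "\<dots> \<le> (C * \<delta> ^ 4) * (4 * (R ^ 3 * card I))"
      using C(1) by (intro mult_left_mono chain_sum_bound4 I R) auto
    finally show ?thesis by (simp add: mult_ac)
  qed
  then show ?thesis using C(1) by (intro exI[of _ "4 * C"]) auto
qed

text \<open>If the kernel were constant, \<open>stein_identity\<close> would give \<open>f' = - t * s * f\<close> for the characteristic function.
The deviation of the kernel from its mean enters only through its standard deviation, and
\<open>gaussian_ode_bound\<close> turns this into an estimate of the characteristic function itself.\<close>
lemma char_stein_sum_bound:
  fixes I u t
  defines "F \<equiv> \<lambda>w. stein_sum I u (\<lambda>j. \<xi> j w)" and "T \<equiv> \<lambda>w. stein_kernel I u (\<lambda>j. \<xi> j w)"
  defines "s \<equiv> expectation T"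
  shows "\<bar>expectation (\<lambda>w. cos (t * F w)) - exp (- s * t\<^sup>2 / 2)\<bar> \<le> t\<^sup>2 * sqrt (expectation (\<lambda>w. (T w - s)\<^sup>2))"
    and "\<bar>expectation (\<lambda>w. sin (t * F w))\<bar> \<le> t\<^sup>2 * sqrt (expectation (\<lambda>w. (T w - s)\<^sup>2))"
proof -
  let ?e = "sqrt (expectation (\<lambda>w. (T w - s)\<^sup>2))"
  let ?y = "\<lambda>w j. \<xi> j w"
  have mF: "moderate (stein_sum I u)" and mT: "moderate (stein_kernel I u)" by (rule moderate_stein_sum moderate_stein_kernel)+
  have iF2: "integrable M (\<lambda>w. (F w)\<^sup>2)"
    unfolding F_def by (rule integrable_moderate[of "\<lambda>y. (stein_sum I u y)\<^sup>2"]) (intro moderate_intros mF)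
  have [measurable]: "F \<in> borel_measurable M" "T \<in> borel_measurable M"
    unfolding F_def T_def using integrable_moderate[OF mF] integrable_moderate[OF mT] by (auto dest: borel_measurable_integrable)
  have iT: "integrable M T" unfolding T_def by (rule integrable_moderate[OF mT])
  have iTs: "integrable M (\<lambda>w. (T w - s)\<^sup>2)"
    unfolding T_def by (rule integrable_moderate[of "\<lambda>y. (stein_kernel I u y - s)\<^sup>2"]) (intro moderate_intros mT)
  have s0: "s \<ge> 0" unfolding s_def T_def stein_second_moment[symmetric] by simp
  have e0: "?e \<ge> 0" by simp
  have Fsin: "expectation (\<lambda>w. F w * sin (t * F w)) = t * expectation (\<lambda>w. cos (t * F w) * T w)" for t
  proof -
    have "expectation (\<lambda>w. F w * sin (t * F w)) = expectation (\<lambda>w. (t * cos (t * F w)) * T w)"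
      unfolding F_def T_def
    proof (rule stein_identity[of "\<lambda>y. sin (t * stein_sum I u y)" "\<lambda>y. t * cos (t * stein_sum I u y)"])
      show "gdiff i (\<lambda>y. sin (t * stein_sum I u y)) (\<lambda>y. t * cos (t * stein_sum I u y) * (\<Sum>j\<in>I. u j * (hB (y j) * r i j)))" for i
        using gdiff_sin[OF gdiff_cmult[OF gdiff_stein_sum[of i I u], of t]] by (simp add: mult_ac)
      show "moderate (\<lambda>y. t * cos (t * stein_sum I u y))" by (intro moderate_intros mF)
    qed
    then show ?thesis by (simp add: mult.assoc)
  qed
  have Fcos: "expectation (\<lambda>w. F w * cos (t * F w)) = - t * expectation (\<lambda>w. sin (t * F w) * T w)" for t
  proof -
    have "expectation (\<lambda>w. F w * cos (t * F w)) = expectation (\<lambda>w. (- t * sin (t * F w)) * T w)"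
      unfolding F_def T_def
    proof (rule stein_identity[of "\<lambda>y. cos (t * stein_sum I u y)" "\<lambda>y. - t * sin (t * stein_sum I u y)"])
      show "gdiff i (\<lambda>y. cos (t * stein_sum I u y)) (\<lambda>y. - t * sin (t * stein_sum I u y) * (\<Sum>j\<in>I. u j * (hB (y j) * r i j)))" for i
        using gdiff_cos[OF gdiff_cmult[OF gdiff_stein_sum[of i I u], of t]] by (simp add: mult_ac)
      show "moderate (\<lambda>y. - t * sin (t * stein_sum I u y))" by (intro moderate_intros mF)
    qed
    then show ?thesis by (simp add: mult.assoc)
  qed
  have bd: "\<bar>expectation (\<lambda>w. g (t * F w) * (T w - s))\<bar> \<le> ?e" if g: "\<And>x. \<bar>g x\<bar> \<le> 1" "g \<in> borel_measurable borel" for g :: "real \<Rightarrow> real" and t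
  proof -
    note [measurable] = g(2)
    have i1: "integrable M (\<lambda>w. T w - s)" using iT by simp
    have b: "\<bar>g (t * F w) * (T w - s)\<bar> \<le> \<bar>T w - s\<bar>" for w
      unfolding abs_mult using mult_right_mono[OF g(1)[of "t * F w"], of "\<bar>T w - s\<bar>"] by simp
    have i: "integrable M (\<lambda>w. g (t * F w) * (T w - s))"
      by (rule Bochner_Integration.integrable_bound[OF i1]) (use b in auto)
    have "\<bar>expectation (\<lambda>w. g (t * F w) * (T w - s))\<bar> \<le> expectation (\<lambda>w. \<bar>g (t * F w) * (T w - s)\<bar>)" by (rule integral_abs_bound)
    also have "\<dots> \<le> expectation (\<lambda>w. \<bar>T w - s\<bar>)" by (intro integral_mono integrable_abs i i1 b)
    also have "\<dots> \<le> ?e" by (rule expectation_abs_le_sqrt[OF _ iTs]) simp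
    finally show ?thesis .
  qed
  have icT: "integrable M (\<lambda>w. cos (t * F w) * T w)" "integrable M (\<lambda>w. sin (t * F w) * T w)" for t
    by (rule Bochner_Integration.integrable_bound[OF iT]; auto simp: abs_mult intro!: mult_left_le_one_le)+
  have split: "expectation (\<lambda>w. cos (t * F w) * (T w - s)) = expectation (\<lambda>w. cos (t * F w) * T w) - s * expectation (\<lambda>w. cos (t * F w))"
    "expectation (\<lambda>w. sin (t * F w) * (T w - s)) = expectation (\<lambda>w. sin (t * F w) * T w) - s * expectation (\<lambda>w. sin (t * F w))" for t
    using icT[of t] by (simp_all add: right_diff_distrib mult.commute[of s])
  have "\<bar>expectation (\<lambda>w. cos (t * F w)) - expectation (\<lambda>w. cos (0 * F w)) * exp (- s * t\<^sup>2 / 2)\<bar> \<le> t\<^sup>2 * ?e"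
  proof (rule gaussian_ode_bound[OF DERIV_expectation_trig(1)[OF _ iF2] _ s0 e0])
    fix t
    have "- expectation (\<lambda>w. F w * sin (t * F w)) + t * s * expectation (\<lambda>w. cos (t * F w)) = - t * expectation (\<lambda>w. cos (t * F w) * (T w - s))"
      unfolding Fsin split by (simp add: algebra_simps)
    then show "\<bar>- expectation (\<lambda>w. F w * sin (t * F w)) + t * s * expectation (\<lambda>w. cos (t * F w))\<bar> \<le> \<bar>t\<bar> * ?e"
      using mult_left_mono[OF bd[of cos t], of "\<bar>t\<bar>"] by (simp add: abs_mult)
  qed simp
  then show "\<bar>expectation (\<lambda>w. cos (t * F w)) - exp (- s * t\<^sup>2 / 2)\<bar> \<le> t\<^sup>2 * ?e" by (simp add: prob_space)
  have "\<bar>expectation (\<lambda>w. sin (t * F w)) - expectation (\<lambda>w. sin (0 * F w)) * exp (- s * t\<^sup>2 / 2)\<bar> \<le> t\<^sup>2 * ?e"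
  proof (rule gaussian_ode_bound[OF DERIV_expectation_trig(2)[OF _ iF2] _ s0 e0])
    fix t
    have "expectation (\<lambda>w. F w * cos (t * F w)) + t * s * expectation (\<lambda>w. sin (t * F w)) = - t * expectation (\<lambda>w. sin (t * F w) * (T w - s))"
      unfolding Fcos split by (simp add: algebra_simps)
    then show "\<bar>expectation (\<lambda>w. F w * cos (t * F w)) + t * s * expectation (\<lambda>w. sin (t * F w))\<bar> \<le> \<bar>t\<bar> * ?e"
      using mult_left_mono[OF bd[of sin t], of "\<bar>t\<bar>"] by (simp add: abs_mult)
  qed simp
  then show "\<bar>expectation (\<lambda>w. sin (t * F w))\<bar> \<le> t\<^sup>2 * ?e" by simp
qed

end

end

section \<open>A central limit theorem of Breuer and Major\<close>

lemma abs_cos_diff_le: "\<bar>cos x - cos y\<bar> \<le> \<bar>x - y\<bar>" for x y :: real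
  using field_differentiable_bound[of UNIV cos "\<lambda>x. - sin x" 1 x y] by (auto intro!: derivative_eq_intros)

lemma abs_sin_diff_le: "\<bar>sin x - sin y\<bar> \<le> \<bar>x - y\<bar>" for x y :: real
  using field_differentiable_bound[of UNIV sin cos 1 x y] by (auto intro!: derivative_eq_intros)

lemma (in prob_space) trig_expectation_diff_le:
  assumes [measurable]: "F \<in> borel_measurable M" "G \<in> borel_measurable M" and i: "integrable M (\<lambda>w. (F w - G w)\<^sup>2)"
  shows "\<bar>expectation (\<lambda>w. cos (t * F w)) - expectation (\<lambda>w. cos (t * G w))\<bar> \<le> \<bar>t\<bar> * sqrt (expectation (\<lambda>w. (F w - G w)\<^sup>2))"
    and "\<bar>expectation (\<lambda>w. sin (t * F w)) - expectation (\<lambda>w. sin (t * G w))\<bar> \<le> \<bar>t\<bar> * sqrt (expectation (\<lambda>w. (F w - G w)\<^sup>2))"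
proof -
  have i1: "integrable M (\<lambda>w. F w - G w)" using square_integrable_imp_integrable[OF _ i] by simp
  have key: "\<bar>expectation (\<lambda>w. g (t * F w)) - expectation (\<lambda>w. g (t * G w))\<bar> \<le> \<bar>t\<bar> * sqrt (expectation (\<lambda>w. (F w - G w)\<^sup>2))"
    if g: "\<And>x y. \<bar>g x - g y\<bar> \<le> \<bar>x - y\<bar>" and ig: "integrable M (\<lambda>w. g (t * F w))" "integrable M (\<lambda>w. g (t * G w))" for g :: "real \<Rightarrow> real"
  proof -
    have "\<bar>expectation (\<lambda>w. g (t * F w)) - expectation (\<lambda>w. g (t * G w))\<bar> = \<bar>expectation (\<lambda>w. g (t * F w) - g (t * G w))\<bar>"
      using ig by simp
    also have "\<dots> \<le> expectation (\<lambda>w. \<bar>g (t * F w) - g (t * G w)\<bar>)" by (rule integral_abs_bound)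
    also have "\<dots> \<le> expectation (\<lambda>w. \<bar>t\<bar> * \<bar>F w - G w\<bar>)"
    proof (intro integral_mono integrable_abs ig integrable_mult_right i1 Bochner_Integration.integrable_diff[OF ig])
      fix w show "\<bar>g (t * F w) - g (t * G w)\<bar> \<le> \<bar>t\<bar> * \<bar>F w - G w\<bar>"
        using g[of "t * F w" "t * G w"] by (simp add: right_diff_distrib[symmetric] abs_mult)
    qed
    also have "\<dots> = \<bar>t\<bar> * expectation (\<lambda>w. \<bar>F w - G w\<bar>)" by simp
    also have "\<dots> \<le> \<bar>t\<bar> * sqrt (expectation (\<lambda>w. (F w - G w)\<^sup>2))"
      by (intro mult_left_mono expectation_abs_le_sqrt i) auto
    finally show ?thesis .
  qed
  show "\<bar>expectation (\<lambda>w. cos (t * F w)) - expectation (\<lambda>w. cos (t * G w))\<bar> \<le> \<bar>t\<bar> * sqrt (expectation (\<lambda>w. (F w - G w)\<^sup>2))"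
    by (rule key[OF abs_cos_diff_le integrable_cos integrable_cos]) (simp_all add: borel_measurable_times)
  show "\<bar>expectation (\<lambda>w. sin (t * F w)) - expectation (\<lambda>w. sin (t * G w))\<bar> \<le> \<bar>t\<bar> * sqrt (expectation (\<lambda>w. (F w - G w)\<^sup>2))"
    by (rule key[OF abs_sin_diff_le integrable_sin integrable_sin]) (simp_all add: borel_measurable_times)
qed

context std_gaussian_family
begin

text \<open>The expansion is cut off at order \<open>N\<close>. The remainder is negligible in mean square, uniformly in \<open>n\<close>, by
\<open>hermite_exp_sum_second_moment\<close>. For the finite part \<open>char_stein_sum_bound\<close> applies, with an error that is
bounded through \<open>stein_kernel_variance\<close> by a multiple of \<open>\<delta> n\<close>, and its variance converges to the partial
sum of the series for \<open>\<sigma>2\<close>. Letting \<open>N\<close> tend to infinity gives the limit.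
The weights may depend on \<open>n\<close> and on the index, so that linear combinations of power variations at
different scales are covered.\<close>
theorem breuer_major:
  fixes I :: "nat \<Rightarrow> 'i set" and u :: "nat \<Rightarrow> 'i \<Rightarrow> real" and \<delta> :: "nat \<Rightarrow> real" and R B :: real
  assumes f: "has_hermite_exp f c" and c0: "c 0 = 0" and I: "\<And>n. finite (I n)"
    and u: "\<And>n i. i \<in> I n \<Longrightarrow> \<bar>u n i\<bar> \<le> \<delta> n"
    and R: "\<And>n i. i \<in> I n \<Longrightarrow> (\<Sum>j\<in>I n. \<bar>r i j\<bar>) \<le> R" "R \<ge> 0"
    and B: "\<And>n. card (I n) * (\<delta> n)\<^sup>2 \<le> B" and \<delta>: "\<delta> \<longlonglongrightarrow> 0"
    and s: "\<And>q. q \<ge> 1 \<Longrightarrow> (\<lambda>n. \<Sum>i\<in>I n. \<Sum>j\<in>I n. u n i * u n j * r i j ^ q) \<longlonglongrightarrow> s q"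
    and \<sigma>: "(\<lambda>q. fact q * (c q)\<^sup>2 * s q) sums \<sigma>2"
  shows "(\<lambda>n. expectation (\<lambda>w. cos (t * (\<Sum>i\<in>I n. u n i * f (\<xi> i w))))) \<longlonglongrightarrow> exp (- \<sigma>2 * t\<^sup>2 / 2)"
    and "(\<lambda>n. expectation (\<lambda>w. sin (t * (\<Sum>i\<in>I n. u n i * f (\<xi> i w))))) \<longlonglongrightarrow> 0"
proof -
  have fm[measurable]: "f \<in> borel_measurable borel" and fi: "integrable std_gauss (\<lambda>x. (f x)\<^sup>2)"
    and fl: "(\<lambda>N. \<integral>x. (f x - hermite_sum c N x)\<^sup>2 \<partial>std_gauss) \<longlonglongrightarrow> 0"
    using f by (auto simp: has_hermite_exp_def)
  define F where "F n w = (\<Sum>i\<in>I n. u n i * f (\<xi> i w))" for n w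
  define G where "G N n w = (\<Sum>i\<in>I n. u n i * hermite_sum c (Suc N) (\<xi> i w))" for N n w
  define tail where "tail N = (\<integral>x. (f x - hermite_sum c (Suc N) x)\<^sup>2 \<partial>std_gauss)" for N
  define \<eta> where "\<eta> N = \<bar>t\<bar> * sqrt (B * R * tail N)" for N
  define cc where "cc q = c (Suc q)" for q
  have [measurable]: "F n \<in> borel_measurable M" "G N n \<in> borel_measurable M" for N n unfolding F_def G_def by measurable
  have tail0: "tail N \<ge> 0" for N unfolding tail_def by simp
  have B0: "B \<ge> 0" using B[of 0] by (meson order_trans mult_nonneg_nonneg of_nat_0_le_iff zero_le_power2)
  have tail: "tail \<longlonglongrightarrow> 0" unfolding tail_def by (rule LIMSEQ_Suc[OF fl])
  have \<eta>0: "\<eta> \<longlonglongrightarrow> 0"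
    unfolding \<eta>_def using tendsto_mult_left[OF tendsto_real_sqrt[OF tendsto_mult_left[OF tail, of "B * R"]], of "\<bar>t\<bar>"] by simp
  have FG: "F n w - G N n w = (\<Sum>i\<in>I n. u n i * (f (\<xi> i w) - hermite_sum c (Suc N) (\<xi> i w)))" for N n w
    unfolding F_def G_def by (simp add: right_diff_distrib sum_subtractf)
  have m2: "integrable M (\<lambda>w. (F n w - G N n w)\<^sup>2)" "\<bar>t\<bar> * sqrt (expectation (\<lambda>w. (F n w - G N n w)\<^sup>2)) \<le> \<eta> N" for n N
  proof -
    note sm = hermite_exp_sum_second_moment[OF has_hermite_exp_tail[OF f, of "Suc N"] _ I u R(1), of n]
    show "integrable M (\<lambda>w. (F n w - G N n w)\<^sup>2)" unfolding FG by (rule sm(1)) auto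
    have "expectation (\<lambda>w. (F n w - G N n w)\<^sup>2) \<le> card (I n) * (\<delta> n)\<^sup>2 * R * tail N"
      unfolding FG tail_def by (rule sm(2)) auto
    also have "\<dots> \<le> B * R * tail N" using B[of n] R(2) tail0 by (intro mult_right_mono) auto
    finally show "\<bar>t\<bar> * sqrt (expectation (\<lambda>w. (F n w - G N n w)\<^sup>2)) \<le> \<eta> N"
      unfolding \<eta>_def by (intro mult_left_mono real_sqrt_le_mono) auto
  qed
  \<comment> \<open>The constant term is zero, so the truncated expansion has the form to which the Stein identity applies.\<close>
  have Gs: "G N n w = stein_sum cc N (I n) (u n) (\<lambda>j. \<xi> j w)" for N n w
    unfolding G_def stein_sum_def hermite_sum_def cc_def sum.lessThan_Suc_shift by (simp add: c0)
  define v where "v N n = expectation (\<lambda>w. stein_kernel cc N (I n) (u n) (\<lambda>j. \<xi> j w))" for N n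
  have v_eq: "v N n = (\<Sum>q<Suc N. fact q * (c q)\<^sup>2 * (\<Sum>i\<in>I n. \<Sum>j\<in>I n. u n i * u n j * r i j ^ q))" for N n
  proof -
    have i2: "integrable M (\<lambda>w. hermite_sum c (Suc N) (\<xi> i w) * hermite_sum c (Suc N) (\<xi> j w))" for i j
      by (rule integrable_moderate[of "\<lambda>y. hermite_sum c (Suc N) (y i) * hermite_sum c (Suc N) (y j)"]) (intro moderate_intros moderate_hermite_sum)
    have "v N n = expectation (\<lambda>w. (G N n w)\<^sup>2)" unfolding v_def Gs stein_second_moment ..
    also have "\<dots> = expectation (\<lambda>w. \<Sum>i\<in>I n. \<Sum>j\<in>I n. u n i * u n j * (hermite_sum c (Suc N) (\<xi> i w) * hermite_sum c (Suc N) (\<xi> j w)))"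
      unfolding G_def power2_eq_square sum_product by (simp add: mult_ac)
    also have "\<dots> = (\<Sum>i\<in>I n. \<Sum>j\<in>I n. u n i * u n j * (\<Sum>q<Suc N. fact q * (c q)\<^sup>2 * r i j ^ q))"
      by (simp add: i2 expectation_hermite_sum_mult del: sum.lessThan_Suc)
    also have "\<dots> = (\<Sum>i\<in>I n. \<Sum>j\<in>I n. \<Sum>q<Suc N. fact q * (c q)\<^sup>2 * (u n i * u n j * r i j ^ q))"
      unfolding sum_distrib_left by (simp only: mult_ac)
    also have "\<dots> = (\<Sum>i\<in>I n. \<Sum>q<Suc N. \<Sum>j\<in>I n. fact q * (c q)\<^sup>2 * (u n i * u n j * r i j ^ q))"
      by (intro sum.cong refl sum.swap)
    also have "\<dots> = (\<Sum>q<Suc N. \<Sum>i\<in>I n. \<Sum>j\<in>I n. fact q * (c q)\<^sup>2 * (u n i * u n j * r i j ^ q))"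
      by (rule sum.swap)
    also have "\<dots> = (\<Sum>q<Suc N. fact q * (c q)\<^sup>2 * (\<Sum>i\<in>I n. \<Sum>j\<in>I n. u n i * u n j * r i j ^ q))"
      by (simp only: sum_distrib_left)
    finally show ?thesis .
  qed
  define \<sigma>N where "\<sigma>N N = (\<Sum>q<Suc N. fact q * (c q)\<^sup>2 * s q)" for N
  have v_lim: "v N \<longlonglongrightarrow> \<sigma>N N" for N
    unfolding v_eq[abs_def] \<sigma>N_def
  proof (rule tendsto_sum)
    fix q
    show "(\<lambda>n. fact q * (c q)\<^sup>2 * (\<Sum>i\<in>I n. \<Sum>j\<in>I n. u n i * u n j * r i j ^ q)) \<longlonglongrightarrow> fact q * (c q)\<^sup>2 * s q"
      by (cases "q = 0") (auto simp: c0 intro!: tendsto_mult_left s)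
  qed
  define er where "er N n = t\<^sup>2 * sqrt (expectation (\<lambda>w. (stein_kernel cc N (I n) (u n) (\<lambda>j. \<xi> j w) - v N n)\<^sup>2))" for N n
  have er0: "er N \<longlonglongrightarrow> 0" for N
  proof -
    obtain C where C: "C \<ge> 0" and Cb: "\<And>I u \<delta> R. finite I \<Longrightarrow> (\<forall>i\<in>I. \<bar>u i\<bar> \<le> \<delta>) \<Longrightarrow> (\<forall>i\<in>I. (\<Sum>j\<in>I. \<bar>r i j\<bar>) \<le> R) \<Longrightarrow>
     expectation (\<lambda>w. (stein_kernel cc N I u (\<lambda>j. \<xi> j w) - expectation (\<lambda>w. stein_kernel cc N I u (\<lambda>j. \<xi> j w)))\<^sup>2)
       \<le> C * (\<delta> ^ 4 * R ^ 3 * card I)" using stein_kernel_variance[of cc N] by blast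
    have b: "er N n \<le> t\<^sup>2 * sqrt (C * R ^ 3 * B * (\<delta> n)\<^sup>2)" for n
    proof -
      have "expectation (\<lambda>w. (stein_kernel cc N (I n) (u n) (\<lambda>j. \<xi> j w) - v N n)\<^sup>2) \<le> C * ((\<delta> n) ^ 4 * R ^ 3 * card (I n))"
        unfolding v_def by (rule Cb) (use I u R in auto)
      also have "\<dots> = (C * R ^ 3 * (\<delta> n)\<^sup>2) * (card (I n) * (\<delta> n)\<^sup>2)" by (simp add: power4_eq_xxxx power2_eq_square mult_ac)
      also have "\<dots> \<le> (C * R ^ 3 * (\<delta> n)\<^sup>2) * B" using C R(2) by (intro mult_left_mono B) auto
      finally have "expectation (\<lambda>w. (stein_kernel cc N (I n) (u n) (\<lambda>j. \<xi> j w) - v N n)\<^sup>2) \<le> C * R ^ 3 * B * (\<delta> n)\<^sup>2" by (simp only: mult_ac)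
      then show ?thesis unfolding er_def by (intro mult_left_mono real_sqrt_le_mono) auto
    qed
    have l: "(\<lambda>n. t\<^sup>2 * sqrt (C * R ^ 3 * B * (\<delta> n)\<^sup>2)) \<longlonglongrightarrow> 0"
      using tendsto_mult_left[OF tendsto_real_sqrt[OF tendsto_mult_left[OF tendsto_power[OF \<delta>, of 2], of "C * R ^ 3 * B"]], of "t\<^sup>2"] by simp
    have "er N n \<ge> 0" for n unfolding er_def by simp
    then show ?thesis using b by (intro tendsto_sandwich[OF _ _ tendsto_const l]) auto
  qed
  have el: "(\<lambda>n. exp (- v N n * t\<^sup>2 / 2)) \<longlonglongrightarrow> exp (- \<sigma>N N * t\<^sup>2 / 2)" for N
    by (intro tendsto_intros v_lim) auto
  have "(\<lambda>n. expectation (\<lambda>w. cos (t * G N n w)) - exp (- v N n * t\<^sup>2 / 2)) \<longlonglongrightarrow> 0" for N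
    using char_stein_sum_bound(1)[of t cc N] unfolding Gs v_def er_def[symmetric]
    by (intro Lim_null_comparison[OF _ er0[of N]]) (simp add: er_def v_def)
  then have cl: "(\<lambda>n. expectation (\<lambda>w. cos (t * G N n w))) \<longlonglongrightarrow> exp (- \<sigma>N N * t\<^sup>2 / 2)" for N
    using tendsto_add[OF _ el[of N], of "\<lambda>n. expectation (\<lambda>w. cos (t * G N n w)) - exp (- v N n * t\<^sup>2 / 2)" 0] by simp
  have sl: "(\<lambda>n. expectation (\<lambda>w. sin (t * G N n w))) \<longlonglongrightarrow> 0" for N
    using char_stein_sum_bound(2)[of t cc N] unfolding Gs
    by (intro Lim_null_comparison[OF _ er0[of N]]) (simp add: er_def v_def)
  have \<sigma>l: "\<sigma>N \<longlonglongrightarrow> \<sigma>2" using LIMSEQ_Suc[OF \<sigma>[unfolded sums_def]] unfolding \<sigma>N_def .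
  have L: "(\<lambda>N. exp (- \<sigma>N N * t\<^sup>2 / 2)) \<longlonglongrightarrow> exp (- \<sigma>2 * t\<^sup>2 / 2)" by (intro tendsto_intros \<sigma>l) auto
  have "(\<lambda>n. expectation (\<lambda>w. cos (t * F n w))) \<longlonglongrightarrow> exp (- \<sigma>2 * t\<^sup>2 / 2)"
    by (rule tendsto_by_approximation[OF order_trans[OF trig_expectation_diff_le(1) m2(2)] \<eta>0 cl L]) (auto intro: m2(1))
  then show "(\<lambda>n. expectation (\<lambda>w. cos (t * (\<Sum>i\<in>I n. u n i * f (\<xi> i w))))) \<longlonglongrightarrow> exp (- \<sigma>2 * t\<^sup>2 / 2)" unfolding F_def .
  have "(\<lambda>n. expectation (\<lambda>w. sin (t * F n w))) \<longlonglongrightarrow> 0"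
    by (rule tendsto_by_approximation[OF order_trans[OF trig_expectation_diff_le(2) m2(2)] \<eta>0 sl tendsto_const]) (auto intro: m2(1))
  then show "(\<lambda>n. expectation (\<lambda>w. sin (t * (\<Sum>i\<in>I n. u n i * f (\<xi> i w))))) \<longlonglongrightarrow> 0" unfolding F_def .
qed

end

section \<open>Hermite expansions in one variable\<close>

text \<open>A single standard normal variable is the simplest Gaussian family; the orthogonality of the Hermite
polynomials is then a special case of \<open>expectation_hermite_mult\<close>.\<close>
lemma std_gaussian_family_single: "std_gaussian_family std_gauss (\<lambda>_::unit. \<lambda>x. x) (\<lambda>_ _. 1)"
proof
  fix T :: "unit set" and c :: "unit \<Rightarrow> real" assume "finite T"
  have "(\<Sum>s\<in>T. \<Sum>t\<in>T. c s * c t * 1) = (sum c T)\<^sup>2" by (simp add: power2_eq_square sum_product)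
  then show "(\<integral>w. cos (\<Sum>t\<in>T. c t * w) \<partial>std_gauss) = exp (- (\<Sum>s\<in>T. \<Sum>t\<in>T. c s * c t * 1) / 2)"
    "(\<integral>w. sin (\<Sum>t\<in>T. c t * w) \<partial>std_gauss) = 0"
    using cos_sin_std_gauss[of "sum c T"] by (simp_all add: sum_distrib_right)
qed auto

lemma hermite_orthogonal: "(\<integral>x. hermite p x * hermite q x \<partial>std_gauss) = (if p = q then fact p else 0)"
  using std_gaussian_family.expectation_hermite_mult[OF std_gaussian_family_single, of p q] by simp

lemma integrable_hermite_square: "integrable std_gauss (\<lambda>x. (hermite q x)\<^sup>2)"
  by (rule std_gaussian_family.integrable_moderate[OF std_gaussian_family_single, of "\<lambda>y. (hermite q (y ()))\<^sup>2"]) (intro moderate_intros)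

lemma integrable_hermite_mult_hermite: "integrable std_gauss (\<lambda>x. hermite p x * hermite q x)"
  by (rule integrable_mult_square_integrable[OF _ _ integrable_hermite_square integrable_hermite_square]) simp_all

lemma integral_hermite_sum_mult_hermite:
  "(\<integral>x. hermite_sum c N x * hermite q x \<partial>std_gauss) = (if q < N then fact q * c q else 0)"
proof -
  have "(\<integral>x. hermite_sum c N x * hermite q x \<partial>std_gauss) = (\<integral>x. (\<Sum>p<N. c p * (hermite p x * hermite q x)) \<partial>std_gauss)"
    unfolding hermite_sum_def sum_distrib_right by (simp only: mult.assoc)
  also have "\<dots> = (\<Sum>p<N. c p * (if p = q then fact p else 0))"
    by (simp add: integrable_hermite_mult_hermite hermite_orthogonal)
  also have "\<dots> = (\<Sum>p<N. if p = q then fact q * c q else 0)" by (intro sum.cong) auto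
  finally show ?thesis by simp
qed

lemma has_hermite_exp_coeff:
  assumes "has_hermite_exp f c"
  shows "c q = (\<integral>x. f x * hermite q x \<partial>std_gauss) / fact q"
proof -
  have fm[measurable]: "f \<in> borel_measurable borel" and fi: "integrable std_gauss (\<lambda>x. (f x)\<^sup>2)"
    and fl: "(\<lambda>N. \<integral>x. (f x - hermite_sum c N x)\<^sup>2 \<partial>std_gauss) \<longlonglongrightarrow> 0"
    using assms by (auto simp: has_hermite_exp_def)
  have "(\<lambda>N. \<integral>x. hermite_sum c N x * hermite q x \<partial>std_gauss) \<longlonglongrightarrow> (\<integral>x. f x * hermite q x \<partial>std_gauss)"
    by (rule L2_tendsto_inner[OF _ _ _ _ fi integrable_hermite_square integrable_hermite_sum_square integrable_hermite_square fl]) auto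
  moreover have "(\<lambda>N. \<integral>x. hermite_sum c N x * hermite q x \<partial>std_gauss) \<longlonglongrightarrow> fact q * c q"
    unfolding integral_hermite_sum_mult_hermite
    by (rule tendsto_eventually) (use eventually_gt_at_top[of q] in eventually_elim, simp)
  ultimately have "fact q * c q = (\<integral>x. f x * hermite q x \<partial>std_gauss)" by (rule LIMSEQ_unique[rotated])
  then show ?thesis by (simp add: field_simps)
qed

lemma hermite_expansion_iff:
  assumes [measurable]: "f \<in> borel_measurable borel" and fi: "integrable std_gauss (\<lambda>x. (f x)\<^sup>2)"
  shows "hermite_expansion f c \<longleftrightarrow> has_hermite_exp f c"
proof -
  have i: "integrable std_gauss (\<lambda>x. (f x - hermite_sum c N x)\<^sup>2)" for N
    by (rule integrable_square_add(2)) (use fi integrable_hermite_sum_square in auto)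
  have "(\<integral>\<^sup>+x. ennreal ((f x - (\<Sum>q<N. c q * hermite q x))\<^sup>2) \<partial>std_gauss) = ennreal (\<integral>x. (f x - hermite_sum c N x)\<^sup>2 \<partial>std_gauss)" for N
    using nn_integral_eq_integral[OF i[of N]] by (simp add: hermite_sum_def)
  then have "hermite_expansion f c \<longleftrightarrow> (\<lambda>N. ennreal (\<integral>x. (f x - hermite_sum c N x)\<^sup>2 \<partial>std_gauss)) \<longlonglongrightarrow> ennreal 0"
    unfolding hermite_expansion_def by simp
  also have "\<dots> \<longleftrightarrow> (\<lambda>N. \<integral>x. (f x - hermite_sum c N x)\<^sup>2 \<partial>std_gauss) \<longlonglongrightarrow> 0"
    by (rule tendsto_ennreal_iff) auto
  finally show ?thesis unfolding has_hermite_exp_def using fi assms(1) by blast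
qed

lemma hermite_coeff_eq:
  assumes "has_hermite_exp f c"
  shows "hermite_coeff f = c"
proof -
  have f: "f \<in> borel_measurable borel" "integrable std_gauss (\<lambda>x. (f x)\<^sup>2)" using assms by (auto simp: has_hermite_exp_def)
  show ?thesis unfolding hermite_coeff_def
  proof (rule the_equality)
    show "hermite_expansion f c" using assms hermite_expansion_iff[OF f] by simp
    fix d assume "hermite_expansion f d"
    then have "has_hermite_exp f d" using hermite_expansion_iff[OF f] by simp
    then show "d = c" using has_hermite_exp_coeff[OF assms] has_hermite_exp_coeff[of f d] by (intro ext) simp
  qed
qed

lemma has_hermite_exp_summable:
  assumes "has_hermite_exp f c"
  shows "summable (\<lambda>q. fact q * (c q)\<^sup>2)"
proof -
  have fm[measurable]: "f \<in> borel_measurable borel" and fi: "integrable std_gauss (\<lambda>x. (f x)\<^sup>2)"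
    and fl: "(\<lambda>N. \<integral>x. (f x - hermite_sum c N x)\<^sup>2 \<partial>std_gauss) \<longlonglongrightarrow> 0"
    using assms by (auto simp: has_hermite_exp_def)
  have "(\<lambda>N. \<integral>x. hermite_sum c N x * hermite_sum c N x \<partial>std_gauss) \<longlonglongrightarrow> (\<integral>x. f x * f x \<partial>std_gauss)"
    by (rule L2_tendsto_inner[OF _ _ _ _ fi fi integrable_hermite_sum_square integrable_hermite_sum_square fl fl]) auto
  then have "(\<lambda>q. fact q * (c q)\<^sup>2) sums (\<integral>x. f x * f x \<partial>std_gauss)"
    using std_gaussian_family.expectation_hermite_sum_mult[OF std_gaussian_family_single, of c] unfolding sums_def by simp
  then show ?thesis by (rule sums_summable)
qed

section \<open>Absolute moments of the standard normal law\<close>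

lemma has_integral_half_line: "(f has_integral y) {0..} \<longleftrightarrow> (f has_integral y) {0<..}" for f :: "real \<Rightarrow> real"
  by (rule has_integral_spike_set_eq) (auto intro: negligible_subset[of "{0}"])

text \<open>The substitution \<open>t = x\<^sup>2 / 2\<close> turns the Gamma integral into the integral over the positive half line.\<close>
lemma has_bochner_integral_std_gauss_abs_powr:
  fixes a :: real
  assumes a: "a > -1"
  shows "has_bochner_integral lborel (\<lambda>x. std_normal_density x * \<bar>x\<bar> powr a) (2 powr (a / 2) * Gamma ((1 + a) / 2) / sqrt pi)"
proof -
  define s where "s = (1 + a) / 2"
  have s: "s > 0" using a by (simp add: s_def)
  define f where "f t = t powr (s - 1) / exp t" for t :: real
  have f0: "(f has_integral Gamma s) {0<..}"
  proof -
    have "(f has_integral Gamma s) {0..}" unfolding f_def[abs_def] by (rule Gamma_integral_real[OF s])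
    then show ?thesis by (simp add: has_integral_half_line)
  qed
  have fa: "f absolutely_integrable_on {0<..}"
    using f0 by (intro nonnegative_absolutely_integrable_1) (auto simp: f_def has_integral_iff)
  have img: "(\<lambda>x::real. x\<^sup>2 / 2) ` {0<..} = {0<..}"
  proof (intro set_eqI iffI)
    fix y :: real assume "y \<in> {0<..}"
    then show "y \<in> (\<lambda>x. x\<^sup>2 / 2) ` {0<..}" by (intro image_eqI[of _ _ "sqrt (2 * y)"]) auto
  qed auto
  have inj: "inj_on (\<lambda>x::real. x\<^sup>2 / 2) {0<..}" by (auto simp: inj_on_def)
  have "(\<lambda>x. \<bar>x\<bar> * f (x\<^sup>2 / 2)) absolutely_integrable_on {0<..} \<and> integral {0<..} (\<lambda>x. \<bar>x\<bar> * f (x\<^sup>2 / 2)) = Gamma s"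
    using f0 fa img
    by (subst has_absolute_integral_change_of_variables_1'[OF _ _ inj])
       (auto intro!: derivative_eq_intros simp: has_integral_iff)
  then have h: "((\<lambda>x. \<bar>x\<bar> * f (x\<^sup>2 / 2)) has_integral Gamma s) {0<..}"
    by (auto simp: has_integral_iff absolutely_integrable_on_def)
  define C where "C = 1 / sqrt (2 * pi) * 2 powr (s - 1)"
  have C0: "C \<ge> 0" by (simp add: C_def)
  have fs: "std_normal_density x * \<bar>x\<bar> powr a = C * (\<bar>x\<bar> * f (x\<^sup>2 / 2))" if "x > 0" for x
  proof -
    have "(x\<^sup>2 / 2) powr (s - 1) = x powr (2 * (s - 1)) / 2 powr (s - 1)"
      using that by (simp add: powr_divide powr_powr flip: powr_numeral)
    moreover have "x * x powr (2 * (s - 1)) = x powr a"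
    proof -
      have "2 * (s - 1) = a - 1" by (simp add: s_def field_simps)
      then show ?thesis using that powr_add[of x 1 "a - 1"] by simp
    qed
    ultimately show ?thesis
      using that by (simp add: C_def f_def std_normal_density_def exp_minus field_simps)
  qed
  have "((\<lambda>x. C * (\<bar>x\<bar> * f (x\<^sup>2 / 2))) has_integral (C * Gamma s)) {0<..}"
    by (rule has_integral_mult_right[OF h])
  then have "((\<lambda>x. std_normal_density x * \<bar>x\<bar> powr a) has_integral (C * Gamma s)) {0<..}"
    by (rule has_integral_eq[rotated]) (simp only: fs greaterThan_iff)
  then have "((\<lambda>x. std_normal_density x * \<bar>x\<bar> powr a) has_integral (C * Gamma s)) {0..}"
    by (simp add: has_integral_half_line)
  then have n: "(\<integral>\<^sup>+x. ennreal (indicator {0..} x * (std_normal_density x * \<bar>x\<bar> powr a)) \<partial>lborel) = ennreal (C * Gamma s)"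
    by (rule nn_integral_has_integral_lebesgue[rotated]) simp
  have "has_bochner_integral lborel (\<lambda>x. indicator {0..} x *\<^sub>R (std_normal_density x * \<bar>x\<bar> powr a)) (C * Gamma s)"
    unfolding real_scaleR_def
    by (rule has_bochner_integral_nn_integral[OF _ _ _ n]) (use C0 Gamma_real_pos[OF s] in auto)
  then have "has_bochner_integral lborel (\<lambda>x. std_normal_density x * \<bar>x\<bar> powr a) (2 *\<^sub>R (C * Gamma s))"
    by (rule has_bochner_integral_even_function) (simp add: std_normal_density_def)
  then have "has_bochner_integral lborel (\<lambda>x. std_normal_density x * \<bar>x\<bar> powr a) (2 * (C * Gamma s))" by simp
  moreover have "2 * C = 2 powr (a / 2) / sqrt pi"
  proof -
    have "2 * 2 powr (s - 1) = 2 powr s" using powr_add[of 2 1 "s - 1"] by simp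
    moreover have "2 powr s = 2 powr (a / 2) * sqrt 2"
      using powr_add[of 2 "a / 2" "1 / 2"] by (simp add: s_def powr_half_sqrt add_divide_distrib add.commute)
    ultimately show ?thesis by (simp add: C_def real_sqrt_mult field_simps)
  qed
  ultimately show ?thesis by (simp add: s_def mult.assoc[symmetric])
qed

lemma std_gauss_abs_powr:
  fixes a :: real
  assumes "a > -1"
  shows "integrable std_gauss (\<lambda>x. \<bar>x\<bar> powr a)"
    and "(\<integral>x. \<bar>x\<bar> powr a \<partial>std_gauss) = 2 powr (a / 2) * Gamma ((1 + a) / 2) / sqrt pi"
  using has_bochner_integral_std_gauss_abs_powr[OF assms]
  by (simp_all add: has_bochner_integral_iff integrable_std_gauss integral_std_gauss)

section \<open>Approximation by polynomials in the Gaussian mean square\<close>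

lemma L2_dominated_convergence:
  fixes f :: "real \<Rightarrow> real"
  assumes [measurable]: "\<And>n. F n \<in> borel_measurable borel" "f \<in> borel_measurable borel" "g \<in> borel_measurable borel"
    and l: "AE x in std_gauss. (\<lambda>n. F n x) \<longlonglongrightarrow> f x" and b: "\<And>n. AE x in std_gauss. \<bar>f x - F n x\<bar> \<le> g x"
    and g: "integrable std_gauss (\<lambda>x. (g x)\<^sup>2)"
  shows "(\<lambda>n. \<integral>x. (f x - F n x)\<^sup>2 \<partial>std_gauss) \<longlonglongrightarrow> 0"
proof -
  have "(\<lambda>n. \<integral>x. (f x - F n x)\<^sup>2 \<partial>std_gauss) \<longlonglongrightarrow> (\<integral>x. 0 \<partial>std_gauss)"
  proof (rule integral_dominated_convergence[where w = "\<lambda>x. (g x)\<^sup>2"])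
    show "AE x in std_gauss. (\<lambda>n. (f x - F n x)\<^sup>2) \<longlonglongrightarrow> 0"
      using l
    proof eventually_elim
      case (elim x)
      have "(\<lambda>n. (f x - F n x)\<^sup>2) \<longlonglongrightarrow> (f x - f x)\<^sup>2" by (intro tendsto_intros elim)
      then show ?case by simp
    qed
    fix n
    show "AE x in std_gauss. norm ((f x - F n x)\<^sup>2) \<le> (g x)\<^sup>2"
      using b[of n]
    proof eventually_elim
      case (elim x)
      then show ?case using power_mono[of "\<bar>f x - F n x\<bar>" "g x" 2] by simp
    qed
  qed (use g in auto)
  then show ?thesis by simp
qed

text \<open>Membership in the closure of the polynomials in mean square. It is shown first for functions that are
convenient for approximation, and afterwards converted into a Hermite expansion.\<close>
definition approximable :: "(real \<Rightarrow> real) \<Rightarrow> bool" where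
  "approximable f \<longleftrightarrow> f \<in> borel_measurable borel \<and> integrable std_gauss (\<lambda>x. (f x)\<^sup>2) \<and>
     (\<forall>e>0. \<exists>p. (\<integral>x. (f x - poly p x)\<^sup>2 \<partial>std_gauss) < e)"

lemma integrable_poly: "integrable std_gauss (poly p)"
proof -
  have "integrable std_gauss (\<lambda>x. \<Sum>i\<le>degree p. coeff p i * x ^ i)"
  proof (intro Bochner_Integration.integrable_sum integrable_mult_right)
    fix i show "integrable std_gauss (\<lambda>x. x ^ i)"
      by (rule Bochner_Integration.integrable_bound[OF integrable_std_gauss_abs_power[of i]]) (auto simp: power_abs)
  qed
  then show ?thesis unfolding poly_altdef[abs_def] .
qed

lemma measurable_poly [measurable]: "poly (p :: real poly) \<in> borel_measurable borel"
  by (rule borel_measurable_continuous_onI) (intro continuous_intros)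

lemma integrable_poly_square: "integrable std_gauss (\<lambda>x. (poly p x)\<^sup>2)"
proof -
  have "(\<lambda>x. (poly p x)\<^sup>2) = poly (p ^ 2)" by (auto simp: poly_power)
  then show ?thesis using integrable_poly[of "p ^ 2"] by simp
qed

lemma approximable_poly: "approximable (poly p)"
  unfolding approximable_def
proof (intro conjI allI impI)
  fix e :: real assume "e > 0"
  then show "\<exists>q. (\<integral>x. (poly p x - poly q x)\<^sup>2 \<partial>std_gauss) < e" by (intro exI[of _ p]) simp
qed (simp_all add: integrable_poly_square)

lemma square_add_le: "(a + b)\<^sup>2 \<le> 2 * a\<^sup>2 + 2 * (b::real)\<^sup>2"
  using sum_squares_bound[of a b] by (simp add: power2_sum)

lemma approximable_limit:
  assumes F: "\<And>n. approximable (F n)" and [measurable]: "f \<in> borel_measurable borel"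
    and i: "integrable std_gauss (\<lambda>x. (f x)\<^sup>2)" and l: "(\<lambda>n. \<integral>x. (f x - F n x)\<^sup>2 \<partial>std_gauss) \<longlonglongrightarrow> 0"
  shows "approximable f"
  unfolding approximable_def
proof (intro conjI allI impI i)
  fix e :: real assume e: "e > 0"
  define d where "d = e / 4"
  have d: "d > 0" "e = 4 * d" using e by (auto simp: d_def)
  obtain n where n: "(\<integral>x. (f x - F n x)\<^sup>2 \<partial>std_gauss) < d"
    using eventually_happens'[OF sequentially_bot order_tendstoD(2)[OF l d(1)]] by blast
  have Fm[measurable]: "F n \<in> borel_measurable borel" and Fi: "integrable std_gauss (\<lambda>x. (F n x)\<^sup>2)"
    using F[of n] by (auto simp: approximable_def)
  obtain p where p: "(\<integral>x. (F n x - poly p x)\<^sup>2 \<partial>std_gauss) < d" using F[of n] d(1) unfolding approximable_def by blast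
  have i1: "integrable std_gauss (\<lambda>x. (f x - F n x)\<^sup>2)" by (rule integrable_square_add(2)) (use i Fi in auto)
  have i2: "integrable std_gauss (\<lambda>x. (F n x - poly p x)\<^sup>2)" by (rule integrable_square_add(2)) (use Fi integrable_poly_square in auto)
  have i3: "integrable std_gauss (\<lambda>x. (f x - poly p x)\<^sup>2)" by (rule integrable_square_add(2)) (use i integrable_poly_square in auto)
  have "(\<integral>x. (f x - poly p x)\<^sup>2 \<partial>std_gauss) \<le> (\<integral>x. 2 * (f x - F n x)\<^sup>2 + 2 * (F n x - poly p x)\<^sup>2 \<partial>std_gauss)"
  proof (intro integral_mono i3 Bochner_Integration.integrable_add integrable_mult_right i1 i2)
    fix x show "(f x - poly p x)\<^sup>2 \<le> 2 * (f x - F n x)\<^sup>2 + 2 * (F n x - poly p x)\<^sup>2"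
      using square_add_le[of "f x - F n x" "F n x - poly p x"] by simp
  qed
  also have "\<dots> = 2 * (\<integral>x. (f x - F n x)\<^sup>2 \<partial>std_gauss) + 2 * (\<integral>x. (F n x - poly p x)\<^sup>2 \<partial>std_gauss)"
    using i1 i2 by simp
  also have "\<dots> < e" using n p d by linarith
  finally show "\<exists>p. (\<integral>x. (f x - poly p x)\<^sup>2 \<partial>std_gauss) < e" by blast
qed simp

lemma approximable_lincomb:
  assumes f: "approximable f" and g: "approximable g"
  shows "approximable (\<lambda>x. f x + c * g x)"
  unfolding approximable_def
proof (intro conjI allI impI)
  have fm[measurable]: "f \<in> borel_measurable borel" "g \<in> borel_measurable borel"
    and fi: "integrable std_gauss (\<lambda>x. (f x)\<^sup>2)" "integrable std_gauss (\<lambda>x. (g x)\<^sup>2)"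
    using f g by (auto simp: approximable_def)
  have cg: "integrable std_gauss (\<lambda>x. (c * g x)\<^sup>2)" using fi by (simp add: power_mult_distrib)
  show "(\<lambda>x. f x + c * g x) \<in> borel_measurable borel" by simp
  show "integrable std_gauss (\<lambda>x. (f x + c * g x)\<^sup>2)" by (rule integrable_square_add(1)) (use fi cg in auto)
  fix e :: real assume e: "e > 0"
  define d where "d = e / (2 + 2 * c\<^sup>2)"
  have c2: "2 + 2 * c\<^sup>2 > 0" by (simp add: add_pos_nonneg)
  have d: "d > 0" "2 * d + 2 * (c\<^sup>2 * d) = e"
  proof -
    show "d > 0" using e c2 by (simp add: d_def)
    have "d * (2 + 2 * c\<^sup>2) = e" using c2 by (simp add: d_def)
    then show "2 * d + 2 * (c\<^sup>2 * d) = e" by (simp add: algebra_simps)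
  qed
  obtain p where p: "(\<integral>x. (f x - poly p x)\<^sup>2 \<partial>std_gauss) < d" using f d(1) unfolding approximable_def by blast
  obtain q where q: "(\<integral>x. (g x - poly q x)\<^sup>2 \<partial>std_gauss) < d" using g d(1) unfolding approximable_def by blast
  have i1: "integrable std_gauss (\<lambda>x. (f x - poly p x)\<^sup>2)" "integrable std_gauss (\<lambda>x. (g x - poly q x)\<^sup>2)"
    by (rule integrable_square_add(2); use fi integrable_poly_square in auto)+
  have i3: "integrable std_gauss (\<lambda>x. (f x + c * g x - poly (p + smult c q) x)\<^sup>2)"
    by (rule integrable_square_add(2)[OF _ _ \<open>integrable std_gauss (\<lambda>x. (f x + c * g x)\<^sup>2)\<close> integrable_poly_square]) simp_all
  have "(\<integral>x. (f x + c * g x - poly (p + smult c q) x)\<^sup>2 \<partial>std_gauss) \<le> (\<integral>x. 2 * (f x - poly p x)\<^sup>2 + 2 * (c\<^sup>2 * (g x - poly q x)\<^sup>2) \<partial>std_gauss)"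
  proof (intro integral_mono i3 Bochner_Integration.integrable_add integrable_mult_right i1)
    fix x show "(f x + c * g x - poly (p + smult c q) x)\<^sup>2 \<le> 2 * (f x - poly p x)\<^sup>2 + 2 * (c\<^sup>2 * (g x - poly q x)\<^sup>2)"
    proof -
      have "f x + c * g x - poly (p + smult c q) x = (f x - poly p x) + c * (g x - poly q x)" by (simp add: algebra_simps)
      then show ?thesis using square_add_le[of "f x - poly p x" "c * (g x - poly q x)"] by (simp only: power_mult_distrib)
    qed
  qed
  also have "\<dots> = 2 * (\<integral>x. (f x - poly p x)\<^sup>2 \<partial>std_gauss) + 2 * (c\<^sup>2 * (\<integral>x. (g x - poly q x)\<^sup>2 \<partial>std_gauss))"
    using i1 by simp
  also have "\<dots> < 2 * d + 2 * (c\<^sup>2 * d)"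
    using p mult_left_mono[OF less_imp_le[OF q], of "c\<^sup>2"] by simp
  finally show "\<exists>p. (\<integral>x. (f x + c * g x - poly p x)\<^sup>2 \<partial>std_gauss) < e" unfolding d(2) by blast
qed

lemma approximable_sum:
  fixes n :: nat
  shows "(\<And>k. k < n \<Longrightarrow> approximable (F k)) \<Longrightarrow> approximable (\<lambda>x. \<Sum>k<n. b k * F k x)"
proof (induction n)
  case 0
  have "(\<lambda>x::real. 0) = poly 0" by auto
  then show ?case using approximable_poly[of 0] by simp
next
  case (Suc n)
  then show ?case using approximable_lincomb[of "\<lambda>x. \<Sum>k<n. b k * F k x" "F n" "b n"] by simp
qed

lemma integrable_power_exp_quarter: "integrable std_gauss (\<lambda>x. (\<bar>x\<bar> ^ j * exp (x\<^sup>2 / 8))\<^sup>2)"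
proof -
  have "integrable lborel (\<lambda>x. sqrt 2 * (normal_density 0 (sqrt 2) x * (x - 0) ^ (2 * j)))"
    by (intro integrable_mult_right integrable_normal_moment) simp
  moreover have "std_normal_density x * (\<bar>x\<bar> ^ j * exp (x\<^sup>2 / 8))\<^sup>2 = sqrt 2 * (normal_density 0 (sqrt 2) x * (x - 0) ^ (2 * j))" for x
  proof -
    have "(\<bar>x\<bar> ^ j * exp (x\<^sup>2 / 8))\<^sup>2 = x ^ (2 * j) * exp (x\<^sup>2 / 4)"
      by (simp add: power_mult_distrib exp_double[symmetric] power_even_abs power_mult[symmetric] mult.commute[of j])
    moreover have "exp (- x\<^sup>2 / 2) * exp (x\<^sup>2 / 4) = exp (- x\<^sup>2 / 4)" by (simp add: exp_add[symmetric])
    ultimately show ?thesis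
      by (simp add: std_normal_density_def normal_density_def real_sqrt_mult field_simps)
  qed
  ultimately show ?thesis by (subst integrable_std_gauss) auto
qed

text \<open>One exponential factor \<open>exp (- x\<^sup>2 / 8)\<close> is expanded into its power series at a time. The exponent is chosen
so small that the dominating function \<open>\<bar>x\<bar> ^ j * exp (x\<^sup>2 / 8)\<close> of the partial sums is still square
integrable; peeling off the factors one by one avoids any growth of this bound with \<open>k\<close>.\<close>
lemma approximable_power_exp: "approximable (\<lambda>x. x ^ j * exp (- real k * x\<^sup>2 / 8))"
proof (induction k arbitrary: j)
  case 0
  have "(\<lambda>x::real. x ^ j) = poly (monom 1 j)" by (auto simp: poly_monom)
  then show ?case using approximable_poly[of "monom 1 j"] by simp
next
  case (Suc k)
  define F where "F n x = (\<Sum>m<n. ((- 1 / 8) ^ m / fact m) * (x ^ (j + 2 * m) * exp (- real k * x\<^sup>2 / 8)))" for n and x :: real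
  have Feq: "F n x = (x ^ j * exp (- real k * x\<^sup>2 / 8)) * (\<Sum>m<n. (- x\<^sup>2 / 8) ^ m / fact m)" for n x
  proof -
    have "(- x\<^sup>2 / 8) ^ m = (- 1 / 8) ^ m * x ^ (2 * m)" for m
      using power_mult_distrib[of "- 1 / 8" "x\<^sup>2" m] by (simp add: power_mult)
    then show ?thesis unfolding F_def sum_distrib_left by (intro sum.cong refl) (simp add: power_add)
  qed
  have exps: "(\<lambda>n. \<Sum>m<n. y ^ m / fact m) \<longlonglongrightarrow> exp y" for y :: real
    using exp_converges[of y] by (simp only: sums_def real_scaleR_def divide_inverse mult.commute)
  have partial: "\<bar>\<Sum>m<n. (- x\<^sup>2 / 8) ^ m / fact m\<bar> \<le> exp (x\<^sup>2 / 8)" for n and x :: real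
  proof -
    have "\<bar>\<Sum>m<n. (- x\<^sup>2 / 8) ^ m / fact m\<bar> \<le> (\<Sum>m<n. (x\<^sup>2 / 8) ^ m / fact m)"
      by (rule order_trans[OF sum_abs]) (simp add: power_abs)
    also have "\<dots> \<le> exp (x\<^sup>2 / 8)"
    proof -
      have e: "(\<lambda>m. (x\<^sup>2 / 8) ^ m / fact m) sums exp (x\<^sup>2 / 8)"
        using exp_converges[of "x\<^sup>2 / 8"] by (simp only: real_scaleR_def divide_inverse mult.commute)
      show ?thesis using sum_le_suminf[OF sums_summable[OF e], of "{..<n}"] sums_unique[OF e] by simp
    qed
    finally show ?thesis .
  qed
  have e1: "exp (- real k * x\<^sup>2 / 8) \<le> 1" for x :: real by simp
  have ex: "x ^ j * exp (- real (Suc k) * x\<^sup>2 / 8) = (x ^ j * exp (- real k * x\<^sup>2 / 8)) * exp (- x\<^sup>2 / 8)" for x :: real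
  proof -
    have "- real (Suc k) * x\<^sup>2 / 8 = - real k * x\<^sup>2 / 8 + - x\<^sup>2 / 8" by (simp add: field_simps)
    then show ?thesis by (simp only: exp_add mult.assoc)
  qed
  show ?case
  proof (rule approximable_limit[of F])
    show "approximable (F n)" for n unfolding F_def[abs_def] by (rule approximable_sum) (rule Suc.IH)
    show "(\<lambda>x. x ^ j * exp (- real (Suc k) * x\<^sup>2 / 8)) \<in> borel_measurable borel" by measurable
    show "integrable std_gauss (\<lambda>x. (x ^ j * exp (- real (Suc k) * x\<^sup>2 / 8))\<^sup>2)"
    proof (rule Bochner_Integration.integrable_bound[OF integrable_power_exp_quarter[of j]])
      show "AE x in std_gauss. norm ((x ^ j * exp (- real (Suc k) * x\<^sup>2 / 8))\<^sup>2) \<le> norm ((\<bar>x\<bar> ^ j * exp (x\<^sup>2 / 8))\<^sup>2)"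
      proof (rule AE_I2)
        fix x :: real
        have "0 \<le> real (Suc k) * x\<^sup>2 / 8" by (intro divide_nonneg_pos mult_nonneg_nonneg) simp_all
        then have "- real (Suc k) * x\<^sup>2 / 8 \<le> 0" "0 \<le> x\<^sup>2 / 8" by (simp_all del: of_nat_Suc)
        then have "exp (- real (Suc k) * x\<^sup>2 / 8) \<le> exp (x\<^sup>2 / 8)" unfolding exp_le_cancel_iff by (rule order_trans)
        then have "\<bar>x\<bar> ^ j * exp (- real (Suc k) * x\<^sup>2 / 8) \<le> \<bar>x\<bar> ^ j * exp (x\<^sup>2 / 8)" by (intro mult_left_mono) auto
        then have "(\<bar>x\<bar> ^ j * exp (- real (Suc k) * x\<^sup>2 / 8))\<^sup>2 \<le> (\<bar>x\<bar> ^ j * exp (x\<^sup>2 / 8))\<^sup>2" by (intro power_mono) auto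
        then show "norm ((x ^ j * exp (- real (Suc k) * x\<^sup>2 / 8))\<^sup>2) \<le> norm ((\<bar>x\<bar> ^ j * exp (x\<^sup>2 / 8))\<^sup>2)"
        proof -
          have "\<bar>x ^ j * exp (- real (Suc k) * x\<^sup>2 / 8)\<bar> = \<bar>x\<bar> ^ j * exp (- real (Suc k) * x\<^sup>2 / 8)"
            by (simp only: abs_mult power_abs abs_exp_cancel)
          then have "(x ^ j * exp (- real (Suc k) * x\<^sup>2 / 8))\<^sup>2 = (\<bar>x\<bar> ^ j * exp (- real (Suc k) * x\<^sup>2 / 8))\<^sup>2"
            by (metis power2_abs)
          with \<open>(\<bar>x\<bar> ^ j * exp (- real (Suc k) * x\<^sup>2 / 8))\<^sup>2 \<le> (\<bar>x\<bar> ^ j * exp (x\<^sup>2 / 8))\<^sup>2\<close>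
          show ?thesis by (simp only: real_norm_def abs_power2)
        qed
      qed
    qed measurable
    show "(\<lambda>n. \<integral>x. (x ^ j * exp (- real (Suc k) * x\<^sup>2 / 8) - F n x)\<^sup>2 \<partial>std_gauss) \<longlonglongrightarrow> 0"
    proof (rule L2_dominated_convergence[where g = "\<lambda>x. 2 * (\<bar>x\<bar> ^ j * exp (x\<^sup>2 / 8))"])
      show "F n \<in> borel_measurable borel" for n unfolding F_def[abs_def] by measurable
      show "integrable std_gauss (\<lambda>x. (2 * (\<bar>x\<bar> ^ j * exp (x\<^sup>2 / 8)))\<^sup>2)"
        using integrable_power_exp_quarter[of j] unfolding power_mult_distrib[of 2] by (rule integrable_mult_right)
      show "AE x in std_gauss. (\<lambda>n. F n x) \<longlonglongrightarrow> x ^ j * exp (- real (Suc k) * x\<^sup>2 / 8)"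
        unfolding Feq ex by (intro AE_I2 tendsto_mult_left exps)
      show "AE x in std_gauss. \<bar>x ^ j * exp (- real (Suc k) * x\<^sup>2 / 8) - F n x\<bar> \<le> 2 * (\<bar>x\<bar> ^ j * exp (x\<^sup>2 / 8))" for n
      proof (rule AE_I2)
        fix x :: real
        have a: "\<bar>x ^ j * exp (- real k * x\<^sup>2 / 8)\<bar> \<le> \<bar>x\<bar> ^ j"
          unfolding abs_mult power_abs using e1[of x] by (intro mult_left_le) auto
        have "\<bar>exp (- x\<^sup>2 / 8)\<bar> \<le> exp (x\<^sup>2 / 8)" by simp
        then have "\<bar>x ^ j * exp (- real (Suc k) * x\<^sup>2 / 8)\<bar> \<le> \<bar>x\<bar> ^ j * exp (x\<^sup>2 / 8)"
          unfolding ex abs_mult[of "x ^ j * exp (- real k * x\<^sup>2 / 8)"] using a by (intro mult_mono) auto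
        moreover have "\<bar>F n x\<bar> \<le> \<bar>x\<bar> ^ j * exp (x\<^sup>2 / 8)"
          unfolding Feq abs_mult[of "x ^ j * exp (- real k * x\<^sup>2 / 8)"] using a partial by (intro mult_mono) auto
        ultimately show "\<bar>x ^ j * exp (- real (Suc k) * x\<^sup>2 / 8) - F n x\<bar> \<le> 2 * (\<bar>x\<bar> ^ j * exp (x\<^sup>2 / 8))"
          by linarith
      qed
    qed measurable
  qed
qed

text \<open>By the Weierstrass theorem on \<open>[0, 1]\<close> the function \<open>G\<close> is a uniform limit of polynomials in
\<open>exp (- x\<^sup>2 / 8)\<close>, and these are covered by \<open>approximable_power_exp\<close>.\<close>
lemma approximable_continuous_exp:
  fixes G :: "real \<Rightarrow> real"
  assumes G: "continuous_on {0..1} G"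
  shows "approximable (\<lambda>x. G (exp (- x\<^sup>2 / 8)))"
proof -
  define y where "y x = exp (- x\<^sup>2 / 8)" for x :: real
  have y: "y x \<in> {0..1}" for x by (simp add: y_def)
  have cG: "continuous_on UNIV (\<lambda>x. G (y x))"
    by (rule continuous_on_compose2[OF G]) (use y in \<open>auto simp: y_def intro!: continuous_intros\<close>)
  have Gm[measurable]: "(\<lambda>x. G (y x)) \<in> borel_measurable borel" by (rule borel_measurable_continuous_onI[OF cG])
  have "compact (G ` {0..1})" by (rule compact_continuous_image[OF G]) simp
  from compact_imp_bounded[OF this, unfolded bounded_iff] obtain K where "\<forall>z\<in>G ` {0..1}. norm z \<le> K" by (rule exE)
  from bspec[OF this imageI] have K: "\<bar>G z\<bar> \<le> K" if "z \<in> {0..1}" for z using that by (simp only: real_norm_def)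
  have Gi: "integrable std_gauss (\<lambda>x. (G (y x))\<^sup>2)"
  proof (rule std_gauss.integrable_const_bound[where B = "K\<^sup>2"])
    show "AE x in std_gauss. norm ((G (y x))\<^sup>2) \<le> K\<^sup>2"
    proof (rule AE_I2)
      fix x show "norm ((G (y x))\<^sup>2) \<le> K\<^sup>2" using power_mono[OF K[OF y[of x]] abs_ge_zero, of 2] by simp
    qed
  qed simp
  define e where "e n = 1 / real (Suc n)" for n
  have e: "e n > 0" for n by (simp add: e_def)
  have "\<forall>n. \<exists>F. approximable F \<and> (\<forall>x. \<bar>G (y x) - F x\<bar> \<le> e n)"
  proof
    fix n
    obtain g where g: "real_polynomial_function g" "\<And>z. z \<in> {0..1} \<Longrightarrow> \<bar>G z - g z\<bar> < e n"
      by (rule Stone_Weierstrass_real_polynomial_function[OF compact_Icc G e[of n]]) (rule that)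
    obtain a m where a: "g = (\<lambda>z. \<Sum>i\<le>m. a i * z ^ i)" using g(1) unfolding real_polynomial_function_iff_sum by blast
    have "approximable (\<lambda>x. \<Sum>i<Suc m. a i * (x ^ 0 * exp (- real i * x\<^sup>2 / 8)))"
      by (rule approximable_sum) (rule approximable_power_exp)
    moreover have "(\<Sum>i<Suc m. a i * (x ^ 0 * exp (- real i * x\<^sup>2 / 8))) = g (y x)" for x
    proof -
      have "exp (- real i * x\<^sup>2 / 8) = y x ^ i" for i
        using exp_of_nat_mult[of i "- x\<^sup>2 / 8"] by (simp add: y_def)
      then show ?thesis unfolding a lessThan_Suc_atMost by simp
    qed
    ultimately have "approximable (\<lambda>x. g (y x))" by simp
    then show "\<exists>F. approximable F \<and> (\<forall>x. \<bar>G (y x) - F x\<bar> \<le> e n)"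
      using less_imp_le[OF g(2)[OF y]] by (intro exI[of _ "\<lambda>x. g (y x)"] conjI allI)
  qed
  from choice[OF this] obtain F where F0: "\<forall>n. approximable (F n) \<and> (\<forall>x. \<bar>G (y x) - F n x\<bar> \<le> e n)"
    by (rule exE)
  then have F: "approximable (F n)" "\<bar>G (y x) - F n x\<bar> \<le> e n" for n x by simp_all
  have Fm[measurable]: "F n \<in> borel_measurable borel" for n using F(1) by (auto simp: approximable_def)
  have e0: "e \<longlonglongrightarrow> 0" unfolding e_def by (rule LIMSEQ_Suc[OF lim_1_over_n])
  have "(\<lambda>n. \<integral>x. (G (y x) - F n x)\<^sup>2 \<partial>std_gauss) \<longlonglongrightarrow> 0"
  proof (rule L2_dominated_convergence[where g = "\<lambda>_. 1"])
    show "AE x in std_gauss. (\<lambda>n. F n x) \<longlonglongrightarrow> G (y x)"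
    proof (rule AE_I2)
      fix x
      have "(\<lambda>n. G (y x) - F n x) \<longlonglongrightarrow> 0"
        by (rule Lim_null_comparison[OF _ e0]) (use F(2) in auto)
      from tendsto_diff[OF tendsto_const[of "G (y x)"] this] show "(\<lambda>n. F n x) \<longlonglongrightarrow> G (y x)" by simp
    qed
    fix n show "AE x in std_gauss. \<bar>G (y x) - F n x\<bar> \<le> 1"
    proof (rule AE_I2)
      fix x
      have "e n \<le> 1" by (simp add: e_def)
      then show "\<bar>G (y x) - F n x\<bar> \<le> 1" by (rule order_trans[OF F(2)])
    qed
  qed auto
  then have "approximable (\<lambda>x. G (y x))" by (rule approximable_limit[OF F(1) Gm Gi])
  then show ?thesis unfolding y_def .
qed

text \<open>With \<open>y = exp (- x\<^sup>2 / 8)\<close> one has \<open>x\<^sup>2 = - 8 * ln y\<close>. Since \<open>\<gamma> < 0\<close>, the resulting function of \<open>y\<close> extends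
continuously by \<open>0\<close> to \<open>y = 0\<close>.\<close>
lemma approximable_regularized_powr:
  assumes \<gamma>: "\<gamma> < 0" and \<epsilon>: "\<epsilon> > 0"
  shows "approximable (\<lambda>x. (x\<^sup>2 + \<epsilon>) powr (\<gamma> / 2))"
proof -
  define G where "G y = (if y \<le> 0 then 0 else (\<epsilon> - 8 * ln y) powr (\<gamma> / 2))" for y :: real
  have "continuous_on {0..1} G"
    unfolding continuous_on_eq_continuous_within
  proof
    fix y :: real assume y: "y \<in> {0..1}"
    show "continuous (at y within {0..1}) G"
    proof (cases "y = 0")
      case True
      have "((\<lambda>y. (\<epsilon> - 8 * ln y) powr (\<gamma> / 2)) \<longlongrightarrow> 0) (at_right 0)"
      proof -
        have "filterlim (\<lambda>y::real. 8 * ln y) at_bot (at_right 0)"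
          by (rule filterlim_tendsto_pos_mult_at_bot[OF tendsto_const _ ln_at_0]) simp
        then have "filterlim (\<lambda>y::real. - (8 * ln y)) at_top (at_right 0)" by (simp add: filterlim_uminus_at_top)
        then have "filterlim (\<lambda>y::real. \<epsilon> + - (8 * ln y)) at_top (at_right 0)"
          by (rule filterlim_tendsto_add_at_top[OF tendsto_const])
        then have "((\<lambda>y. (\<epsilon> + - (8 * ln y)) powr (\<gamma> / 2)) \<longlongrightarrow> 0) (at_right 0)"
          by (rule tendsto_neg_powr[rotated]) (use \<gamma> in simp)
        then show ?thesis by simp
      qed
      then have "(G \<longlongrightarrow> 0) (at_right 0)"
        by (rule Lim_transform_eventually) (auto simp: G_def eventually_at_filter intro!: always_eventually)
      then have "(G \<longlongrightarrow> 0) (at 0 within {0..1})"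
        by (simp add: at_within_Icc_at_right)
      then show ?thesis using True by (simp add: continuous_within G_def)
    next
      case False
      then have y': "0 < y" "y \<le> 1" using y by auto
      have "\<epsilon> - 8 * ln y > 0" using y' \<epsilon> ln_le_zero_iff[of y] by linarith
      then have "isCont (\<lambda>y. (\<epsilon> - 8 * ln y) powr (\<gamma> / 2)) y" using y' by (intro continuous_intros) auto
      moreover have "\<forall>\<^sub>F z in nhds y. (\<epsilon> - 8 * ln z) powr (\<gamma> / 2) = G z"
        using eventually_nhds_in_open[of "{0<..}" y] y' by (auto elim!: eventually_mono simp: G_def)
      ultimately have "isCont G y" by (simp only: isCont_cong)
      then show ?thesis by (rule continuous_at_imp_continuous_at_within)
    qed
  qed
  from approximable_continuous_exp[OF this] show ?thesis by (simp add: G_def add.commute)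
qed

lemma integrable_abs_powr_square:
  fixes \<gamma> :: real
  assumes "\<gamma> > - 1 / 2"
  shows "integrable std_gauss (\<lambda>x. (\<bar>x\<bar> powr \<gamma>)\<^sup>2)"
proof -
  have "(\<bar>x\<bar> powr \<gamma>)\<^sup>2 = \<bar>x\<bar> powr (2 * \<gamma>)" for x :: real
    unfolding power2_eq_square mult_2 powr_add ..
  then show ?thesis using std_gauss_abs_powr(1)[of "2 * \<gamma>"] assms by simp
qed

text \<open>The singularity at the origin is smoothed by \<open>\<epsilon> > 0\<close>. The smoothed functions increase to \<open>\<bar>x\<bar> powr \<gamma>\<close>, which
is square integrable precisely because \<open>\<gamma> > - 1 / 2\<close>.\<close>
lemma approximable_abs_powr:
  fixes \<gamma> :: real
  assumes \<gamma>: "- 1 / 2 < \<gamma>" "\<gamma> < 0"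
  shows "approximable (\<lambda>x. \<bar>x\<bar> powr \<gamma>)"
proof -
  define e where "e n = 1 / real (Suc n)" for n
  have e: "e n > 0" for n by (simp add: e_def)
  have e0: "e \<longlonglongrightarrow> 0" unfolding e_def by (rule LIMSEQ_Suc[OF lim_1_over_n])
  have nz: "AE x in std_gauss. x \<noteq> 0"
    by (subst AE_density) (auto intro: AE_mp[OF AE_lborel_singleton[of 0]])
  have sq: "(x\<^sup>2) powr (\<gamma> / 2) = \<bar>x\<bar> powr \<gamma>" if "x \<noteq> 0" for x :: real
  proof -
    have "x\<^sup>2 = \<bar>x\<bar> powr 2" using that by simp
    then show ?thesis by (simp only: powr_powr) simp
  qed
  have b: "0 \<le> (x\<^sup>2 + e n) powr (\<gamma> / 2)" "(x\<^sup>2 + e n) powr (\<gamma> / 2) \<le> \<bar>x\<bar> powr \<gamma>" if "x \<noteq> 0" for x n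
  proof -
    have "(x\<^sup>2 + e n) powr (\<gamma> / 2) \<le> (x\<^sup>2) powr (\<gamma> / 2)" using that e[of n] \<gamma> by (intro powr_mono2') auto
    then show "(x\<^sup>2 + e n) powr (\<gamma> / 2) \<le> \<bar>x\<bar> powr \<gamma>" using sq[OF that] by simp
  qed simp
  show ?thesis
  proof (rule approximable_limit[OF approximable_regularized_powr[OF \<gamma>(2) e] _ integrable_abs_powr_square[OF \<gamma>(1)]])
    show "(\<lambda>n. \<integral>x. (\<bar>x\<bar> powr \<gamma> - (x\<^sup>2 + e n) powr (\<gamma> / 2))\<^sup>2 \<partial>std_gauss) \<longlonglongrightarrow> 0"
    proof (rule L2_dominated_convergence[OF _ _ _ _ _ integrable_abs_powr_square[OF \<gamma>(1)]])
      show "AE x in std_gauss. (\<lambda>n. (x\<^sup>2 + e n) powr (\<gamma> / 2)) \<longlonglongrightarrow> \<bar>x\<bar> powr \<gamma>"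
        using nz
      proof eventually_elim
        case (elim x)
        have "(\<lambda>n. (x\<^sup>2 + e n) powr (\<gamma> / 2)) \<longlonglongrightarrow> (x\<^sup>2 + 0) powr (\<gamma> / 2)"
          using elim by (intro tendsto_intros e0) auto
        then show ?case using sq[OF elim] by simp
      qed
      show "AE x in std_gauss. \<bar>\<bar>x\<bar> powr \<gamma> - (x\<^sup>2 + e n) powr (\<gamma> / 2)\<bar> \<le> \<bar>x\<bar> powr \<gamma>" for n
        using nz
      proof eventually_elim
        case (elim x)
        show ?case using b[OF elim, of n] by linarith
      qed
    qed measurable
  qed measurable
qed

lemma poly_as_hermite_sum: "\<exists>a N. \<forall>x. poly p x = hermite_sum a N x"
proof (induction p)
  case 0
  show ?case by (intro exI[of _ "\<lambda>_. 0"] exI[of _ 0]) (simp add: hermite_sum_def)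
next
  case (pCons c p)
  obtain a N where a: "\<And>x. poly p x = hermite_sum a N x" using pCons by blast
  \<comment> \<open>Multiplication by the variable acts on the coefficients through
    \<open>x H\<^sub>q = H\<^bsub>q+1\<^esub> + q H\<^bsub>q-1\<^esub>\<close>.\<close>
  define b where "b q = (if q = 0 then c else 0) + (if q \<in> {1..N} then a (q - 1) else 0) + (if Suc q < N then a (Suc q) * real (Suc q) else 0)" for q
  have "poly (pCons c p) x = hermite_sum b (Suc N) x" for x
  proof -
    have "x * hermite_sum a N x = (\<Sum>q<N. a q * hermite (Suc q) x) + (\<Sum>q<N. a q * (real q * hermite (q - 1) x))"
      unfolding hermite_sum_def sum_distrib_left sum.distrib[symmetric]
      by (intro sum.cong refl) (simp add: hermite_Suc algebra_simps)
    also have "(\<Sum>q<N. a q * hermite (Suc q) x) = (\<Sum>q<Suc N. (if q \<in> {1..N} then a (q - 1) else 0) * hermite q x)"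
    proof -
      have "(\<Sum>q<N. (if Suc q \<in> {1..N} then a (Suc q - 1) else 0) * hermite (Suc q) x) = (\<Sum>q<N. a q * hermite (Suc q) x)"
        by (intro sum.cong refl) auto
      then show ?thesis unfolding sum.lessThan_Suc_shift by simp
    qed
    also have "(\<Sum>q<N. a q * (real q * hermite (q - 1) x)) = (\<Sum>q<Suc N. (if Suc q < N then a (Suc q) * real (Suc q) else 0) * hermite q x)"
    proof -
      have "(\<Sum>q<Suc N. (if Suc q < N then a (Suc q) * real (Suc q) else 0) * hermite q x) = (\<Sum>q<N - 1. a (Suc q) * (real (Suc q) * hermite q x))"
        by (rule sum.mono_neutral_cong_right) auto
      then show ?thesis by (cases N) (simp_all add: sum.lessThan_Suc_shift del: sum.lessThan_Suc of_nat_Suc)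
    qed
    finally have "x * hermite_sum a N x = (\<Sum>q<Suc N. (if q \<in> {1..N} then a (q - 1) else 0) * hermite q x)
      + (\<Sum>q<Suc N. (if Suc q < N then a (Suc q) * real (Suc q) else 0) * hermite q x)" .
    moreover have "c = (\<Sum>q<Suc N. (if q = 0 then c else 0) * hermite q x)"
      unfolding sum.lessThan_Suc_shift by simp
    ultimately have "c + x * hermite_sum a N x = hermite_sum b (Suc N) x"
      unfolding hermite_sum_def[of b] b_def distrib_right sum.distrib by linarith
    then show ?thesis using a by simp
  qed
  then show ?case by blast
qed

text \<open>The truncated Hermite sum with these coefficients is the orthogonal projection onto the polynomials of
bounded degree, so it is at least as close to \<open>f\<close> as any approximating polynomial of that degree.\<close>
lemma approximable_imp_has_hermite_exp:
  assumes f: "approximable f"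
  shows "has_hermite_exp f (\<lambda>q. (\<integral>x. f x * hermite q x \<partial>std_gauss) / fact q)"
proof -
  define c where "c q = (\<integral>x. f x * hermite q x \<partial>std_gauss) / fact q" for q
  have fm[measurable]: "f \<in> borel_measurable borel" and fi: "integrable std_gauss (\<lambda>x. (f x)\<^sup>2)"
    using f by (auto simp: approximable_def)
  have ei: "integrable std_gauss (\<lambda>x. (f x - hermite_sum c K x)\<^sup>2)" for K
    by (rule integrable_square_add(2)) (use fi integrable_hermite_sum_square in auto)
  have orth: "(\<integral>x. (f x - hermite_sum c K x) * hermite q x \<partial>std_gauss) = 0" if "q < K" for q K
  proof -
    have "integrable std_gauss (\<lambda>x. f x * hermite q x)" "integrable std_gauss (\<lambda>x. hermite_sum c K x * hermite q x)"
      by (rule integrable_mult_square_integrable[OF _ _ _ integrable_hermite_square]; simp add: fi integrable_hermite_sum_square)+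
    then have "(\<integral>x. (f x - hermite_sum c K x) * hermite q x \<partial>std_gauss) = (\<integral>x. f x * hermite q x \<partial>std_gauss) - (\<integral>x. hermite_sum c K x * hermite q x \<partial>std_gauss)"
      by (simp add: left_diff_distrib)
    also have "\<dots> = 0" using that by (simp add: integral_hermite_sum_mult_hermite c_def)
    finally show ?thesis .
  qed
  \<comment> \<open>Pythagoras: the error of the projection is orthogonal to every Hermite sum of the same order.\<close>
  have best: "(\<integral>x. (f x - hermite_sum c K x)\<^sup>2 \<partial>std_gauss) \<le> (\<integral>x. (f x - hermite_sum a N x)\<^sup>2 \<partial>std_gauss)" if "N \<le> K" for a N K
  proof -
    define b where "b q = c q - (if q < N then a q else 0)" for q
    have d: "hermite_sum c K x - hermite_sum a N x = hermite_sum b K x" for x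
    proof -
      have "hermite_sum a N x = (\<Sum>q<K. (if q < N then a q else 0) * hermite q x)"
        unfolding hermite_sum_def using that by (intro sum.mono_neutral_cong_left) auto
      then show ?thesis by (simp add: hermite_sum_def b_def left_diff_distrib sum_subtractf)
    qed
    have i1: "integrable std_gauss (\<lambda>x. (f x - hermite_sum c K x) * hermite q x)" for q
      by (rule integrable_mult_square_integrable[OF _ _ ei integrable_hermite_square]) simp_all
    have i2: "integrable std_gauss (\<lambda>x. (f x - hermite_sum c K x) * hermite_sum b K x)"
      by (rule integrable_mult_square_integrable[OF _ _ ei integrable_hermite_sum_square]) simp_all
    have z: "(\<integral>x. (f x - hermite_sum c K x) * hermite_sum b K x \<partial>std_gauss) = 0"
    proof -
      have "(\<integral>x. (f x - hermite_sum c K x) * hermite_sum b K x \<partial>std_gauss) = (\<integral>x. (\<Sum>q<K. b q * ((f x - hermite_sum c K x) * hermite q x)) \<partial>std_gauss)"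
        unfolding hermite_sum_def[of b] sum_distrib_left by (simp only: mult_ac)
      also have "\<dots> = (\<Sum>q<K. b q * (\<integral>x. (f x - hermite_sum c K x) * hermite q x \<partial>std_gauss))" by (simp add: i1)
      also have "\<dots> = 0" by (simp add: orth)
      finally show ?thesis .
    qed
    have "(\<integral>x. (f x - hermite_sum a N x)\<^sup>2 \<partial>std_gauss) = (\<integral>x. (f x - hermite_sum c K x)\<^sup>2 + 2 * ((f x - hermite_sum c K x) * hermite_sum b K x) + (hermite_sum b K x)\<^sup>2 \<partial>std_gauss)"
      unfolding d[symmetric] by (intro Bochner_Integration.integral_cong refl) (simp add: power2_eq_square algebra_simps)
    also have "\<dots> = (\<integral>x. (f x - hermite_sum c K x)\<^sup>2 \<partial>std_gauss) + 2 * 0 + (\<integral>x. (hermite_sum b K x)\<^sup>2 \<partial>std_gauss)"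
      using ei[of K] i2 integrable_hermite_sum_square[of b K] by (simp add: z)
    finally show ?thesis by simp
  qed
  have "(\<lambda>N. \<integral>x. (f x - hermite_sum c N x)\<^sup>2 \<partial>std_gauss) \<longlonglongrightarrow> 0"
  proof (rule LIMSEQ_I)
    fix e :: real assume "e > 0"
    then obtain p where p: "(\<integral>x. (f x - poly p x)\<^sup>2 \<partial>std_gauss) < e" using f unfolding approximable_def by blast
    obtain a N where "\<And>x. poly p x = hermite_sum a N x" using poly_as_hermite_sum by blast
    then have "(\<integral>x. (f x - hermite_sum c K x)\<^sup>2 \<partial>std_gauss) < e" if "N \<le> K" for K
      using best[OF that, of a] p by simp
    then show "\<exists>N. \<forall>K\<ge>N. norm ((\<integral>x. (f x - hermite_sum c K x)\<^sup>2 \<partial>std_gauss) - 0) < e" by auto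
  qed
  then show ?thesis unfolding has_hermite_exp_def c_def using fi by simp
qed

section \<open>Decay of the increment covariances\<close>

text \<open>Taylor's formula on the interval \<open>[r / 2, r + X]\<close>, which stays away from the singularity of the power.\<close>
lemma powr_second_order_remainder:
  fixes h X :: real
  assumes X: "X \<ge> 0"  and h: "h < 3"
  shows "\<exists>C\<ge>0. \<forall>r y. r \<ge> 2 * X + 1 \<longrightarrow> \<bar>y\<bar> \<le> X \<longrightarrow>
    \<bar>(r + y) powr h - (r powr h + h * r powr (h - 1) * y + h * (h - 1) / 2 * r powr (h - 2) * y\<^sup>2)\<bar> \<le> C * r powr (h - 3)"
proof -
  define k where "k = h * (h - 1) * (h - 2) / 6"
  \<comment> \<open>The intermediate point of the remainder is at least \<open>r / 2\<close>, and \<open>t powr (h - 3)\<close> decreases in \<open>t\<close>.\<close>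
  define C where "C = \<bar>k\<bar> * (1 / 2) powr (h - 3) * X ^ 3"
  have C0: "C \<ge> 0" using X by (simp add: C_def)
  have "\<bar>(r + y) powr h - (r powr h + h * r powr (h - 1) * y + h * (h - 1) / 2 * r powr (h - 2) * y\<^sup>2)\<bar> \<le> C * r powr (h - 3)"
    if r: "r \<ge> 2 * X + 1" and y: "\<bar>y\<bar> \<le> X" for r y
  proof (cases "y = 0")
    case True then show ?thesis using C0 by simp
  next
    case False
    define diff where "diff m z = (\<Prod>i<m. h - real i) * z powr (h - real m)" for m and z :: real
    have rpos: "r > 0" using r X by linarith
    have "\<exists>t. (if r + y < r then r + y < t \<and> t < r else r < t \<and> t < r + y) \<and>
       (\<lambda>z. z powr h) (r + y) = (\<Sum>m<3. (diff m r / fact m) * (r + y - r) ^ m) + (diff 3 t / fact 3) * (r + y - r) ^ 3"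
    proof (rule Taylor[where a = "r / 2" and b = "r + X"])
      show "diff 0 = (\<lambda>z. z powr h)" by (auto simp: diff_def)
      show "\<forall>m t. m < 3 \<and> r / 2 \<le> t \<and> t \<le> r + X \<longrightarrow> (diff m has_real_derivative diff (Suc m) t) (at t)"
      proof (intro allI impI)
        fix m :: nat and t assume "m < 3 \<and> r / 2 \<le> t \<and> t \<le> r + X"
        then have t: "t > 0" using rpos by simp
        have "((\<lambda>z. (\<Prod>i<m. h - real i) * z powr (h - real m)) has_real_derivative (\<Prod>i<m. h - real i) * ((h - real m) * t powr (h - real m - 1))) (at t)"
          by (rule DERIV_cmult[OF has_real_derivative_powr[OF t]])
        moreover have "(\<Prod>i<m. h - real i) * ((h - real m) * t powr (h - real m - 1)) = diff (Suc m) t"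
          by (simp add: diff_def algebra_simps)
        ultimately show "(diff m has_real_derivative diff (Suc m) t) (at t)" unfolding diff_def[abs_def] by simp
      qed
    qed (use r y X False in auto)
    then obtain t where t: "if r + y < r then r + y < t \<and> t < r else r < t \<and> t < r + y"
      and eq: "(r + y) powr h = (\<Sum>m<3. (diff m r / fact m) * y ^ m) + (diff 3 t / fact 3) * y ^ 3" by auto
    have t2: "t \<ge> r / 2" using t r y X by (auto split: if_splits)
    have tpos: "t > 0" using t2 rpos by simp
    have s: "(\<Sum>m<3. (diff m r / fact m) * y ^ m) = r powr h + h * r powr (h - 1) * y + h * (h - 1) / 2 * r powr (h - 2) * y\<^sup>2"
      by (simp add: diff_def eval_nat_numeral lessThan_Suc)
    have d3: "diff 3 t / fact 3 = k * t powr (h - 3)"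
      by (simp add: diff_def eval_nat_numeral lessThan_Suc k_def)
    have "t powr (h - 3) \<le> (r / 2) powr (h - 3)" using t2 rpos h by (intro powr_mono2') auto
    also have "\<dots> = (1 / 2) powr (h - 3) * r powr (h - 3)" using rpos powr_mult[of "1/2" r "h - 3"] by simp
    finally have tb: "t powr (h - 3) \<le> (1 / 2) powr (h - 3) * r powr (h - 3)" .
    have "\<bar>(diff 3 t / fact 3) * y ^ 3\<bar> = \<bar>k\<bar> * t powr (h - 3) * \<bar>y\<bar> ^ 3" unfolding d3 by (simp add: abs_mult power_abs)
    also have "\<dots> \<le> \<bar>k\<bar> * ((1 / 2) powr (h - 3) * r powr (h - 3)) * X ^ 3"
      using tb y X by (intro mult_mono mult_left_mono power_mono) auto
    also have "\<dots> = C * r powr (h - 3)" by (simp add: C_def)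
    finally show ?thesis unfolding eq s by simp
  qed
  then show ?thesis using C0 by blast
qed

text \<open>The coefficients annihilate polynomials of degree two, so only the third-order Taylor remainder of the
power function survives.\<close>
lemma vanishing_moments_decay:
  fixes b x :: "'s \<Rightarrow> real"
  assumes S: "finite S" and m0: "(\<Sum>s\<in>S. b s) = 0" and m1: "(\<Sum>s\<in>S. b s * x s) = 0" and m2: "(\<Sum>s\<in>S. b s * (x s)\<^sup>2) = 0"
    and X: "\<And>s. s \<in> S \<Longrightarrow> \<bar>x s\<bar> \<le> X" "X \<ge> 0" and h: "h < 3"
  shows "\<exists>C\<ge>0. \<forall>r. r \<ge> 2 * X + 1 \<longrightarrow> \<bar>\<Sum>s\<in>S. b s * \<bar>r + x s\<bar> powr h\<bar> \<le> C * r powr (h - 3)"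
proof -
  obtain C where C: "C \<ge> 0" and Cb: "\<And>r y. r \<ge> 2 * X + 1 \<Longrightarrow> \<bar>y\<bar> \<le> X \<Longrightarrow>
    \<bar>(r + y) powr h - (r powr h + h * r powr (h - 1) * y + h * (h - 1) / 2 * r powr (h - 2) * y\<^sup>2)\<bar> \<le> C * r powr (h - 3)"
    using powr_second_order_remainder[OF X(2) h] by blast
  have "\<bar>\<Sum>s\<in>S. b s * \<bar>r + x s\<bar> powr h\<bar> \<le> ((\<Sum>s\<in>S. \<bar>b s\<bar>) * C) * r powr (h - 3)" if r: "r \<ge> 2 * X + 1" for r
  proof -
    define P where "P y = r powr h + h * r powr (h - 1) * y + h * (h - 1) / 2 * r powr (h - 2) * y\<^sup>2" for y
    have "(\<Sum>s\<in>S. b s * P (x s)) = r powr h * (\<Sum>s\<in>S. b s) + h * r powr (h - 1) * (\<Sum>s\<in>S. b s * x s) + h * (h - 1) / 2 * r powr (h - 2) * (\<Sum>s\<in>S. b s * (x s)\<^sup>2)"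
      by (simp add: P_def sum_distrib_left sum.distrib distrib_left mult_ac sum_divide_distrib sum_distrib_right)
    then have P0: "(\<Sum>s\<in>S. b s * P (x s)) = 0" using m0 m1 m2 by simp
    have "\<bar>r + x s\<bar> = r + x s" if "s \<in> S" for s using X(1)[OF that] X(2) r by linarith
    then have "(\<Sum>s\<in>S. b s * \<bar>r + x s\<bar> powr h) = (\<Sum>s\<in>S. b s * ((r + x s) powr h - P (x s)))"
      using P0 by (simp add: right_diff_distrib sum_subtractf)
    then have "\<bar>\<Sum>s\<in>S. b s * \<bar>r + x s\<bar> powr h\<bar> \<le> (\<Sum>s\<in>S. \<bar>b s * ((r + x s) powr h - P (x s))\<bar>)"
      by (simp only: sum_abs)
    also have "\<dots> \<le> (\<Sum>s\<in>S. \<bar>b s\<bar> * (C * r powr (h - 3)))"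
      unfolding abs_mult P_def by (intro sum_mono mult_left_mono Cb r X(1)) auto
    also have "\<dots> = ((\<Sum>s\<in>S. \<bar>b s\<bar>) * C) * r powr (h - 3)" by (simp only: sum_distrib_right mult.assoc)
    finally show ?thesis .
  qed
  moreover have "(\<Sum>s\<in>S. \<bar>b s\<bar>) * C \<ge> 0" using C by (simp add: sum_nonneg)
  ultimately show ?thesis by blast
qed

lemma summable_on_int:
  fixes g :: "int \<Rightarrow> real"
  assumes "summable (\<lambda>n. \<bar>g (int n)\<bar>)" "summable (\<lambda>n. \<bar>g (- int n)\<bar>)"
  shows "(\<lambda>r. \<bar>g r\<bar>) summable_on UNIV"
proof -
  have 1: "(\<lambda>r. \<bar>g r\<bar>) summable_on (int ` UNIV)"
    using norm_summable_imp_summable_on[of "\<lambda>n. \<bar>g (int n)\<bar>"] assms(1) by (subst summable_on_reindex) (auto simp: o_def)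
  have 2: "(\<lambda>r. \<bar>g r\<bar>) summable_on ((\<lambda>n. - int n) ` UNIV)"
    using norm_summable_imp_summable_on[of "\<lambda>n. \<bar>g (- int n)\<bar>"] assms(2) by (subst summable_on_reindex) (auto simp: o_def inj_on_def)
  have 3: "(\<lambda>r. \<bar>g r\<bar>) summable_on ((\<lambda>n. - int n) ` UNIV - int ` UNIV)"
    by (rule summable_on_subset_banach[OF 2]) auto
  have "(\<lambda>r. \<bar>g r\<bar>) summable_on (int ` UNIV \<union> ((\<lambda>n. - int n) ` UNIV - int ` UNIV))"
    by (rule summable_on_Un_disjoint[OF 1 3]) auto
  moreover have "int ` UNIV \<union> ((\<lambda>n. - int n) ` UNIV - int ` UNIV) = UNIV"
  proof (intro set_eqI iffI UNIV_I)
    fix r :: int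
    show "r \<in> int ` UNIV \<union> ((\<lambda>n. - int n) ` UNIV - int ` UNIV)"
    proof (cases "r \<ge> 0")
      case True then have "r = int (nat r)" by simp then show ?thesis by blast
    next
      case False then have "r = - int (nat (- r))" "r \<notin> int ` UNIV" by auto then show ?thesis by blast
    qed
  qed
  ultimately show ?thesis by simp
qed

lemma vanishing_moments_summable:
  fixes b x :: "'s \<Rightarrow> real"
  assumes S: "finite S" and m: "(\<Sum>s\<in>S. b s) = 0" "(\<Sum>s\<in>S. b s * x s) = 0" "(\<Sum>s\<in>S. b s * (x s)\<^sup>2) = 0"
    and h: "h < 2"
  shows "(\<lambda>r::int. \<bar>\<Sum>s\<in>S. b s * \<bar>real_of_int r + x s\<bar> powr h\<bar>) summable_on UNIV"
proof -
  define X where "X = (\<Sum>s\<in>S. \<bar>x s\<bar>)"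
  have X: "\<bar>x s\<bar> \<le> X" if "s \<in> S" for s unfolding X_def using S that by (intro member_le_sum) auto
  have X0: "X \<ge> 0" by (simp add: X_def sum_nonneg)
  have key: "summable (\<lambda>n. \<bar>\<Sum>s\<in>S. b s * \<bar>real n + y s\<bar> powr h\<bar>)"
    if y: "(\<Sum>s\<in>S. b s * y s) = 0" "(\<Sum>s\<in>S. b s * (y s)\<^sup>2) = 0" "\<And>s. s \<in> S \<Longrightarrow> \<bar>y s\<bar> \<le> X" for y
  proof -
    obtain C where C: "\<And>r. r \<ge> 2 * X + 1 \<Longrightarrow> \<bar>\<Sum>s\<in>S. b s * \<bar>r + y s\<bar> powr h\<bar> \<le> C * r powr (h - 3)"
      using vanishing_moments_decay[OF S m(1) y(1,2) y(3) X0, of h] h by auto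
    show ?thesis
    proof (rule summable_comparison_test_ev)
      show "summable (\<lambda>n. C * real n powr (h - 3))"
        using h by (intro summable_mult) (simp add: summable_real_powr_iff)
      show "\<forall>\<^sub>F n in sequentially. norm (\<bar>\<Sum>s\<in>S. b s * \<bar>real n + y s\<bar> powr h\<bar>) \<le> C * real n powr (h - 3)"
        using eventually_ge_at_top[of "nat \<lceil>2 * X + 1\<rceil>"]
      proof eventually_elim
        case (elim n)
        then have "real n \<ge> 2 * X + 1" by linarith
        from C[OF this] show ?case by simp
      qed
    qed
  qed
  show ?thesis
  proof (rule summable_on_int)
    show "summable (\<lambda>n. \<bar>\<Sum>s\<in>S. b s * \<bar>real_of_int (int n) + x s\<bar> powr h\<bar>)"
      using key[OF m(2,3) X] by simp
    have "summable (\<lambda>n. \<bar>\<Sum>s\<in>S. b s * \<bar>real n + - x s\<bar> powr h\<bar>)"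
      using m X by (intro key) (auto simp: sum_negf)
    moreover have "\<bar>real_of_int (- int n) + x s\<bar> = \<bar>real n + - x s\<bar>" for n s by simp
    ultimately show "summable (\<lambda>n. \<bar>\<Sum>s\<in>S. b s * \<bar>real_of_int (- int n) + x s\<bar> powr h\<bar>)" by presburger
  qed
qed

text \<open>Two discrete derivatives, one in each summation index, annihilate the square: its expansion contains
only \<open>p\<^sup>2\<close>, \<open>p * p'\<close> and \<open>p'\<^sup>2\<close>, each of which is of degree at most one in \<open>p\<close> or in \<open>p'\<close>.\<close>
lemma double_increment_moments:
  fixes a :: "nat \<Rightarrow> real" and k :: real
  assumes a0: "(\<Sum>p=0..K. a p) = 0" and a1: "(\<Sum>p=0..K. real p * a p) = 0"
  shows "(\<Sum>(p,p')\<in>{0..K}\<times>{0..K}. a p * a p') = 0"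
    "(\<Sum>(p,p')\<in>{0..K}\<times>{0..K}. a p * a p' * (real p - k * real p')) = 0"
    "(\<Sum>(p,p')\<in>{0..K}\<times>{0..K}. a p * a p' * (real p - k * real p')\<^sup>2) = 0"
proof -
  define s where "s f g = (\<Sum>p=0..K. \<Sum>p'=0..K. (a p * f p) * (a p' * g p'))" for f g :: "nat \<Rightarrow> real"
  have s: "s f g = (\<Sum>p=0..K. a p * f p) * (\<Sum>p=0..K. a p * g p)" for f g
    unfolding s_def sum_product ..
  have a1': "(\<Sum>p=0..K. a p * real p) = 0" using a1 by (simp add: mult.commute)
  show "(\<Sum>(p,p')\<in>{0..K}\<times>{0..K}. a p * a p') = 0"
    using s[of "\<lambda>_. 1" "\<lambda>_. 1"] a0 by (simp add: s_def sum.cartesian_product)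
  have "(\<Sum>(p,p')\<in>{0..K}\<times>{0..K}. a p * a p' * (real p - k * real p')) = s real (\<lambda>_. 1) - k * s (\<lambda>_. 1) real"
    unfolding s_def sum_distrib_left sum_subtractf[symmetric] sum.cartesian_product by (intro sum.cong refl) (auto simp: algebra_simps)
  then show "(\<Sum>(p,p')\<in>{0..K}\<times>{0..K}. a p * a p' * (real p - k * real p')) = 0" using a0 a1' by (simp add: s)
  have "(\<Sum>(p,p')\<in>{0..K}\<times>{0..K}. a p * a p' * (real p - k * real p')\<^sup>2)
    = s (\<lambda>p. (real p)\<^sup>2) (\<lambda>_. 1) - 2 * k * s real real + k\<^sup>2 * s (\<lambda>_. 1) (\<lambda>p. (real p)\<^sup>2)"
    unfolding s_def sum_distrib_left sum_subtractf[symmetric] sum.distrib[symmetric] sum.cartesian_product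
    by (intro sum.cong refl) (auto simp: algebra_simps power2_eq_square)
  then show "(\<Sum>(p,p')\<in>{0..K}\<times>{0..K}. a p * a p' * (real p - k * real p')\<^sup>2) = 0" using a0 a1' by (simp add: s)
qed

text \<open>The sum decays like \<open>\<bar>r\<bar> powr (h - 3)\<close>. This is where increments with one vanishing moment beyond the
zeroth enter: they keep the correlations summable for every Hurst index below one.\<close>
lemma double_increment_summable:
  fixes a :: "nat \<Rightarrow> real" and k h :: real
  assumes a0: "(\<Sum>p=0..K. a p) = 0" and a1: "(\<Sum>p=0..K. real p * a p) = 0" and h: "h < 2"
  shows "(\<lambda>r::int. \<bar>\<Sum>p=0..K. \<Sum>p'=0..K. a p * a p' * \<bar>real_of_int r + real p - k * real p'\<bar> powr h\<bar>) summable_on UNIV"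
proof -
  note m = double_increment_moments(1)[OF a0 a1] double_increment_moments(2,3)[OF a0 a1, of k]
  have "(\<lambda>r::int. \<bar>\<Sum>s\<in>{0..K}\<times>{0..K}. (a (fst s) * a (snd s)) * \<bar>real_of_int r + (real (fst s) - k * real (snd s))\<bar> powr h\<bar>) summable_on UNIV"
    by (rule vanishing_moments_summable) (use m h in \<open>simp_all add: case_prod_beta\<close>)
  then show ?thesis by (simp add: sum.cartesian_product case_prod_beta add_diff_eq)
qed

section \<open>Averages along a summable kernel\<close>

lemma partial_sum_error:
  fixes g :: "'a \<Rightarrow> real"
  assumes g: "(\<lambda>r. \<bar>g r\<bar>) summable_on UNIV" and T: "finite T"
  shows "\<bar>sum g T - infsum g UNIV\<bar> \<le> infsum (\<lambda>r. \<bar>g r\<bar>) UNIV - (\<Sum>r\<in>T. \<bar>g r\<bar>)"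
proof -
  have ab: "(\<lambda>r. norm (g r)) summable_on UNIV" using g by simp
  have g1: "g summable_on (UNIV - T)" "(\<lambda>r. \<bar>g r\<bar>) summable_on (UNIV - T)"
    using abs_summable_summable[OF ab] g by (auto intro: summable_on_subset_banach)
  have U: "T \<union> (UNIV - T) = UNIV" by auto
  have 1: "infsum g UNIV = sum g T + infsum g (UNIV - T)"
    using infsum_Un_disjoint[OF summable_on_finite[OF T] g1(1)] T unfolding U by simp
  have 2: "infsum (\<lambda>r. \<bar>g r\<bar>) UNIV = (\<Sum>r\<in>T. \<bar>g r\<bar>) + infsum (\<lambda>r. \<bar>g r\<bar>) (UNIV - T)"
    using infsum_Un_disjoint[OF summable_on_finite[OF T] g1(2)] T unfolding U by simp
  have "\<bar>infsum g (UNIV - T)\<bar> \<le> infsum (\<lambda>r. \<bar>g r\<bar>) (UNIV - T)"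
    using norm_infsum_bound[of g "UNIV - T"] g1(2) by simp
  then show ?thesis using 1 2 by linarith
qed

text \<open>For most \<open>p'\<close> the inner sum runs over a shifted interval that contains any prescribed finite set, so it is
close to the full sum; the at most \<open>2 * m\<close> exceptional boundary indices are washed out by the average.
The slope \<open>k\<close> is \<open>1\<close> for covariances within one scale and \<open>2\<close> between a scale and its double.\<close>
lemma average_shifted_sums:
  fixes g :: "int \<Rightarrow> real" and N N' :: "nat \<Rightarrow> nat" and k :: nat
  assumes g: "(\<lambda>r. \<bar>g r\<bar>) summable_on UNIV" and N: "filterlim N at_top sequentially"
    and N': "\<And>n. k * N n \<le> N' n" and k: "k \<ge> 1"
  shows "(\<lambda>n. (\<Sum>p'<N n. \<Sum>p<N' n. g (int p - int k * int p')) / real (N n)) \<longlonglongrightarrow> infsum g UNIV"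
proof (rule LIMSEQ_I)
  fix e :: real assume e: "e > 0"
  define G where "G = infsum g UNIV"
  define A where "A = infsum (\<lambda>r. \<bar>g r\<bar>) UNIV"
  have A0: "A \<ge> 0" unfolding A_def by (rule infsum_nonneg) simp
  define d where "d = e / 2"
  have d: "d > 0" "e = d + d" using e by (auto simp: d_def)
  have "((\<lambda>r. \<bar>g r\<bar>) has_sum A) UNIV" unfolding A_def by (rule has_sum_infsum[OF g])
  then have "((sum (\<lambda>r. \<bar>g r\<bar>)) \<longlongrightarrow> A) (finite_subsets_at_top UNIV)" unfolding has_sum_def .
  from order_tendstoD(1)[OF this, of "A - d"] d
  obtain F where F: "finite F" and F2: "A - d < (\<Sum>r\<in>F. \<bar>g r\<bar>)"
    unfolding eventually_finite_subsets_at_top by auto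
  \<comment> \<open>All of \<open>F\<close> lies in \<open>(- m, m)\<close>; a position at distance \<open>m\<close> from both ends sees the whole of \<open>F\<close>.\<close>
  define m where "m = Suc (nat (Max (insert 0 (abs ` F))))"
  have m: "\<bar>r\<bar> < int m" if "r \<in> F" for r
  proof -
    have "\<bar>r\<bar> \<le> Max (insert 0 (abs ` F))" using F that by (intro Max_ge) auto
    then show ?thesis unfolding m_def by linarith
  qed
  define B where "B n p' = \<bar>(\<Sum>p<N' n. g (int p - int k * int p')) - G\<bar>" for n p'
  have BT: "B n p' \<le> A - (\<Sum>r\<in>(\<lambda>p. int p - int k * int p') ` {..<N' n}. \<bar>g r\<bar>)" for n p'
  proof -
    have inj: "inj_on (\<lambda>p. int p - int k * int p') {..<N' n}" by (auto simp: inj_on_def)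
    have "(\<Sum>p<N' n. g (int p - int k * int p')) = sum g ((\<lambda>p. int p - int k * int p') ` {..<N' n})"
      by (simp add: sum.reindex[OF inj])
    then show ?thesis using partial_sum_error[OF g, of "(\<lambda>p. int p - int k * int p') ` {..<N' n}"] by (simp add: B_def A_def G_def)
  qed
  have B1: "B n p' \<le> A" for n p'
  proof -
    have "(\<Sum>r\<in>(\<lambda>p. int p - int k * int p') ` {..<N' n}. \<bar>g r\<bar>) \<ge> 0" by (rule sum_nonneg) simp
    then show ?thesis using BT[of n p'] by linarith
  qed
  have B2: "B n p' \<le> d" if p': "m \<le> p'" "p' + m < N n" for n p'
  proof -
    have "F \<subseteq> (\<lambda>p. int p - int k * int p') ` {..<N' n}"
    proof
      fix r assume r: "r \<in> F"
      have kp: "int p' \<le> int k * int p'" using k by (cases k) (auto simp: algebra_simps)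
      have "k * (p' + m) \<le> k * N n" using p' by (intro mult_le_mono) auto
      moreover have "m \<le> k * m" using k by simp
      moreover have "k * (p' + m) = k * p' + k * m" by (rule distrib_left)
      ultimately have "k * p' + m \<le> N' n" using N'[of n] by linarith
      then have "int k * int p' + int m \<le> int (N' n)" by (metis of_nat_add of_nat_mult of_nat_le_iff)
      then have "0 \<le> r + int k * int p'" "r + int k * int p' < int (N' n)" using m[OF r] p'(1) kp by linarith+
      then show "r \<in> (\<lambda>p. int p - int k * int p') ` {..<N' n}"
        by (intro image_eqI[of _ _ "nat (r + int k * int p')"]) auto
    qed
    then have "(\<Sum>r\<in>F. \<bar>g r\<bar>) \<le> (\<Sum>r\<in>(\<lambda>p. int p - int k * int p') ` {..<N' n}. \<bar>g r\<bar>)" by (intro sum_mono2) auto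
    then show ?thesis using BT[of n p'] F2 by linarith
  qed
  have avg: "(\<Sum>p'<N n. B n p') \<le> real (N n) * d + 2 * real m * A" for n
  proof -
    have "(\<Sum>p'<N n. B n p') \<le> (\<Sum>p'<N n. d + (if p' < m then A else 0) + (if N n \<le> p' + m then A else 0))"
    proof (rule sum_mono)
      fix p'
      show "B n p' \<le> d + (if p' < m then A else 0) + (if N n \<le> p' + m then A else 0)"
        using B1[of n p'] B2[of p' n] A0 d by (cases "p' < m"; cases "N n \<le> p' + m") auto
    qed
    also have "\<dots> = real (N n) * d + (\<Sum>p'<N n. if p' < m then A else 0) + (\<Sum>p'<N n. if N n \<le> p' + m then A else 0)"
      by (simp add: sum.distrib)
    also have "(\<Sum>p'<N n. if p' < m then A else 0) = real (card {p' \<in> {..<N n}. p' < m}) * A" by (simp add: sum.If_cases Int_def)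
    also have "\<dots> \<le> real m * A"
    proof -
      have "card {p' \<in> {..<N n}. p' < m} \<le> card {..<m}" by (rule card_mono) auto
      then show ?thesis using A0 by (intro mult_right_mono) auto
    qed
    also have "(\<Sum>p'<N n. if N n \<le> p' + m then A else 0) = real (card {p' \<in> {..<N n}. N n \<le> p' + m}) * A" by (simp add: sum.If_cases Int_def)
    also have "\<dots> \<le> real m * A"
    proof -
      have "card {p' \<in> {..<N n}. N n \<le> p' + m} \<le> card {N n - m..<N n}" by (rule card_mono) auto
      then show ?thesis using A0 by (intro mult_right_mono) auto
    qed
    finally show ?thesis by (simp add: mult_ac add_ac)
  qed
  obtain n0 where n0: "\<And>n. n \<ge> n0 \<Longrightarrow> real (N n) \<ge> max 1 ((2 * real m * A + 1) / d)"
  proof -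
    have "filterlim (\<lambda>n. real (N n)) at_top sequentially" by (rule filterlim_compose[OF filterlim_real_sequentially N])
    then show ?thesis using that unfolding filterlim_at_top eventually_sequentially by blast
  qed
  show "\<exists>no. \<forall>n\<ge>no. norm ((\<Sum>p'<N n. \<Sum>p<N' n. g (int p - int k * int p')) / real (N n) - infsum g UNIV) < e"
  proof (intro exI allI impI)
    fix n assume "n \<ge> n0"
    then have Nn: "real (N n) \<ge> 1" "real (N n) \<ge> (2 * real m * A + 1) / d" using n0[of n] by auto
    then have Npos: "real (N n) > 0" by linarith
    have big: "2 * real m * A < real (N n) * d" using Nn(2) d by (simp add: field_simps)
    have "(\<Sum>p'<N n. \<Sum>p<N' n. g (int p - int k * int p')) - real (N n) * G = (\<Sum>p'<N n. (\<Sum>p<N' n. g (int p - int k * int p')) - G)"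
      by (simp add: sum_subtractf)
    then have "\<bar>(\<Sum>p'<N n. \<Sum>p<N' n. g (int p - int k * int p')) - real (N n) * G\<bar> \<le> (\<Sum>p'<N n. B n p')"
      unfolding B_def by (simp only: sum_abs)
    then have "\<bar>(\<Sum>p'<N n. \<Sum>p<N' n. g (int p - int k * int p')) - real (N n) * G\<bar> < real (N n) * e"
      using avg[of n] big unfolding d(2) distrib_left by linarith
    moreover have "(\<Sum>p'<N n. \<Sum>p<N' n. g (int p - int k * int p')) / real (N n) - G = ((\<Sum>p'<N n. \<Sum>p<N' n. g (int p - int k * int p')) - real (N n) * G) / real (N n)"
      using Npos by (simp add: field_simps)
    ultimately show "norm ((\<Sum>p'<N n. \<Sum>p<N' n. g (int p - int k * int p')) / real (N n) - infsum g UNIV) < e"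
      using Npos by (simp add: G_def[symmetric] pos_divide_less_eq mult.commute)
  qed
qed

section \<open>The functions defining the estimator of the stability index\<close>

lemma h_fun_deriv:
  assumes "u > 0" "v > 0" "x > 0"
  shows "(h_fun u v has_real_derivative (u * v / x\<^sup>2 * (Digamma (1 + u / x) - Digamma (1 + v / x)))) (at x)"
proof -
  have 1: "((\<lambda>x. ln (Gamma (1 + w / x))) has_real_derivative Digamma (1 + w / x) * (- w / x\<^sup>2)) (at x)" if "w > 0" for w
  proof -
    have pos: "1 + w / x > 0" using that assms by (simp add: add_pos_pos)
    then have ni: "1 + w / x \<notin> \<int>\<^sub>\<le>\<^sub>0" by (auto elim!: nonpos_Ints_cases)
    have G: "Gamma (1 + w / x) > 0" by (rule Gamma_real_pos[OF pos])
    show ?thesis using ni G assms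
      by (auto intro!: derivative_eq_intros simp: field_simps power2_eq_square)
  qed
  have alg: "u * (a * (- v / x\<^sup>2)) - v * (b * (- u / x\<^sup>2)) = u * v / x\<^sup>2 * (b - a)" for a b
    by (simp add: divide_inverse algebra_simps)
  show ?thesis unfolding h_fun_def[abs_def]
    by (rule DERIV_cong[OF DERIV_diff[OF DERIV_cmult[OF 1[OF assms(2)]] DERIV_cmult[OF 1[OF assms(1)]]]])
       (rule alg)
qed

text \<open>The Digamma function is strictly increasing on the positive axis.\<close>
lemma h_fun_deriv_pos:
  fixes u v x :: real
  assumes "u > v" "v > 0" "x > 0"
  shows "u * v / x\<^sup>2 * (Digamma (1 + u / x) - Digamma (1 + v / x)) > 0"
proof -
  have "v / x < u / x" by (rule divide_strict_right_mono[OF assms(1,3)])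
  moreover have "0 < v / x" using assms by simp
  ultimately have "1 + v / x < 1 + u / x" "1 + v / x > 0" by linarith+
  then have "Digamma (1 + v / x) < Digamma (1 + u / x)" by (intro Digamma_real_strict_mono)
  then show ?thesis using assms by (intro mult_pos_pos divide_pos_pos) auto
qed

lemma h_fun_strict_mono:
  assumes "u > v" "v > 0" "0 < x" "x < y"
  shows "h_fun u v x < h_fun u v y"
proof (rule DERIV_pos_imp_increasing[OF assms(4)])
  fix z assume "x \<le> z" "z \<le> y"
  then have z: "z > 0" using assms by linarith
  have u: "u > 0" using assms by linarith
  show "\<exists>d. (h_fun u v has_real_derivative d) (at z) \<and> d > 0"
    by (rule exI, rule conjI, rule h_fun_deriv[OF u assms(2) z], rule h_fun_deriv_pos[OF assms(1,2) z])
qed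

lemma h_fun_tendsto_0:
  assumes "u > 0" "v > 0"
  shows "(h_fun u v \<longlongrightarrow> 0) at_top"
proof -
  have 1: "((\<lambda>x. ln (Gamma (1 + w / x))) \<longlongrightarrow> ln (Gamma (1 + 0))) at_top" for w :: real
  proof -
    have "((\<lambda>x. w / x) \<longlongrightarrow> 0) at_top" by (rule tendsto_divide_0[OF tendsto_const filterlim_at_top_imp_at_infinity[OF filterlim_ident]])
    then have "((\<lambda>x. 1 + w / x) \<longlongrightarrow> 1 + 0) at_top" by (intro tendsto_add tendsto_const)
    then have "((\<lambda>x. Gamma (1 + w / x)) \<longlongrightarrow> Gamma (1 + 0)) at_top" by (rule tendsto_Gamma) auto
    then show ?thesis by (rule tendsto_ln) simp
  qed
  have "(h_fun u v \<longlongrightarrow> u * ln (Gamma (1 + 0)) - v * ln (Gamma (1 + 0))) at_top"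
    unfolding h_fun_def[abs_def] by (intro tendsto_diff tendsto_mult_left 1)
  then show ?thesis by simp
qed

text \<open>The function increases strictly to its limit \<open>0\<close> at infinity.\<close>
lemma h_fun_neg:
  assumes "u > v" "v > 0" "x > 0"
  shows "h_fun u v x < 0"
proof -
  have u: "u > 0" using assms by linarith
  have "h_fun u v x < h_fun u v (x + 1)" using assms by (intro h_fun_strict_mono) auto
  also have "h_fun u v (x + 1) \<le> 0"
  proof (rule tendsto_lowerbound[OF h_fun_tendsto_0[OF u assms(2)]])
    show "\<forall>\<^sub>F y in at_top. h_fun u v (x + 1) \<le> h_fun u v y"
      using eventually_gt_at_top[of "x + 1"]
    proof eventually_elim
      case (elim y)
      then show ?case using assms by (intro less_imp_le h_fun_strict_mono) auto
    qed
  qed simp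
  finally show ?thesis .
qed

lemma phi_fun_h_fun:
  assumes "u > v" "v > 0" "x > 0"
  shows "phi_fun u v (h_fun u v x) = x"
proof -
  have "inj_on (h_fun u v) {0<..}"
  proof (rule inj_onI)
    fix x y assume "x \<in> {0<..}" "y \<in> {0<..}" "h_fun u v x = h_fun u v y"
    then show "x = y" using h_fun_strict_mono[OF assms(1,2), of x y] h_fun_strict_mono[OF assms(1,2), of y x]
      by (cases x y rule: linorder_cases) auto
  qed
  then have "the_inv_into {0<..} (h_fun u v) (h_fun u v x) = x" using assms(3) by (intro the_inv_into_f_f) auto
  then show ?thesis unfolding phi_fun_def using h_fun_neg[OF assms] by simp
qed

text \<open>The inverse function theorem: the derivative of \<open>h_fun u v\<close> is positive.\<close>
lemma phi_fun_deriv: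
  assumes "u > v" "v > 0" "x > 0"
  shows "(phi_fun u v has_real_derivative inverse (u * v / x\<^sup>2 * (Digamma (1 + u / x) - Digamma (1 + v / x)))) (at (h_fun u v x))"
proof -
  define D where "D = u * v / x\<^sup>2 * (Digamma (1 + u / x) - Digamma (1 + v / x))"
  have u: "u > 0" using assms by linarith
  have D: "D > 0" unfolding D_def by (rule h_fun_deriv_pos[OF assms])
  have "(phi_fun u v has_derivative (\<lambda>y. inverse D * y)) (at (h_fun u v x))"
  proof (rule has_derivative_inverse_strong[of "{0<..}" x "h_fun u v" "phi_fun u v" "\<lambda>y. D * y" "\<lambda>y. inverse D * y"])
    show "(h_fun u v has_derivative (\<lambda>y. D * y)) (at x)"
      using h_fun_deriv[OF u assms(2,3)] unfolding has_field_derivative_def D_def .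
    show "continuous_on {0<..} (h_fun u v)"
    proof (rule continuous_at_imp_continuous_on, rule ballI)
      fix z :: real assume "z \<in> {0<..}"
      then have "z > 0" by simp
      from DERIV_isCont[OF h_fun_deriv[OF u assms(2) this]] show "isCont (h_fun u v) z" .
    qed
    show "(\<lambda>y. D * y) \<circ> (\<lambda>y. inverse D * y) = id" using D by (auto simp: fun_eq_iff)
    show "phi_fun u v (h_fun u v z) = z" if "z \<in> {0<..}" for z using phi_fun_h_fun[OF assms(1,2)] that by simp
  qed (use assms in auto)
  then show ?thesis unfolding has_field_derivative_def D_def .
qed

text \<open>On the range of \<open>h_fun u v\<close>, an interval, the inverse is monotone; off the range the function takes at most
two values.\<close>
lemma measurable_phi_fun [measurable]:
  assumes "u > v" "v > 0"
  shows "phi_fun u v \<in> borel_measurable borel"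
proof -
  have u: "u > 0" using assms by linarith
  let ?J = "h_fun u v ` {0<..}"
  have cont: "continuous_on {0<..} (h_fun u v)"
  proof (rule continuous_at_imp_continuous_on, rule ballI)
    fix z :: real assume "z \<in> {0<..}"
    then have "z > 0" by simp
    from DERIV_isCont[OF h_fun_deriv[OF u assms(2) this]] show "isCont (h_fun u v) z" .
  qed
  have "connected ?J" by (rule connected_continuous_image[OF cont]) (rule connected_Ioi)
  then have J: "?J \<in> sets borel" by (intro real_interval_borel_measurable) (simp add: is_interval_connected_1)
  have mono: "mono_on ?J (phi_fun u v)"
  proof (rule mono_onI)
    fix r s assume "r \<in> ?J" "s \<in> ?J" "r \<le> s"
    then obtain x y where xy: "x > 0" "y > 0" "r = h_fun u v x" "s = h_fun u v y" by auto
    have "x \<le> y"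
    proof (rule ccontr)
      assume "\<not> x \<le> y"
      then have "h_fun u v y < h_fun u v x" using xy by (intro h_fun_strict_mono assms) auto
      then show False using xy \<open>r \<le> s\<close> by simp
    qed
    then show "phi_fun u v r \<le> phi_fun u v s" using xy phi_fun_h_fun[OF assms] by simp
  qed
  \<comment> \<open>Outside the range of \<open>h\<close> the definite description has no witness, so \<^const>\<open>the_inv_into\<close> returns one fixed value.\<close>
  define c0 where "c0 = (THE x::real. False)"
  have out: "phi_fun u v s = (if s \<ge> 0 then 0 else c0)" if "s \<notin> ?J" for s
  proof -
    have "(\<lambda>x. x \<in> {0<..} \<and> h_fun u v x = s) = (\<lambda>x. False)" using that by auto
    then show ?thesis unfolding phi_fun_def the_inv_into_def c0_def by simp
  qed
  have "phi_fun u v \<in> borel_measurable (restrict_space borel ?J)" by (rule borel_measurable_mono_on_fnc[OF mono])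
  moreover have "phi_fun u v \<in> borel_measurable (restrict_space borel (- ?J))"
  proof (subst measurable_cong)
    show "phi_fun u v s = (if s \<ge> 0 then 0 else c0)" if "s \<in> space (restrict_space borel (- ?J))" for s
      using out that by (simp add: space_restrict_space)
    show "(\<lambda>s. if s \<ge> 0 then 0 else c0) \<in> borel_measurable (restrict_space borel (- ?J))"
      by (rule measurable_restrict_space1) measurable
  qed
  ultimately have pieces: "phi_fun u v \<in> borel_measurable (restrict_space borel \<Omega>)" if "\<Omega> \<in> {?J, - ?J}" for \<Omega>
    using that by (elim insertE emptyE) simp_all
  have sets: "\<Omega> \<inter> space borel \<in> sets borel" if "\<Omega> \<in> {?J, - ?J}" for \<Omega>
    using that borel_comp[OF J] J by (elim insertE emptyE) simp_all
  show ?thesis by (rule measurable_piecewise_restrict[of "{?J, - ?J}", OF _ sets _ pieces]) simp_all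
qed

text \<open>The powers of \<open>\<sigma>\<close> and of \<open>2\<close> cancel between the two logarithms, and \<^const>\<open>C_const\<close> exchanges the remaining
factors for the Gamma values of \<open>h_fun u v\<close> at the stability index \<open>2\<close> of the normal law.\<close>
lemma psi_fun_at_gaussian_moments:
  assumes "0 < v" "v < u" "u < 1 / 2" and \<sigma>: "\<sigma> > 0"
  defines "m \<equiv> \<lambda>\<gamma>. \<sigma> powr \<gamma> * (2 powr (\<gamma> / 2) * Gamma ((1 + \<gamma>) / 2) / sqrt pi)"
  shows "psi_fun u v (m (- u)) (m (- v)) = h_fun u v 2"
proof -
  have ln_m: "ln (m (- w)) = - w * ln \<sigma> - w / 2 * ln 2 + ln (Gamma ((1 - w) / 2)) - ln pi / 2" if "w < 1" for w
  proof -
    have G: "Gamma ((1 - w) / 2) > 0" using that by (intro Gamma_real_pos) simp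
    show ?thesis unfolding m_def using G \<sigma> by (simp add: ln_mult ln_div ln_powr ln_sqrt)
  qed
  have v1: "v < 1" and u1: "u < 1" using assms by linarith+
  show ?thesis
    unfolding psi_fun_def ln_m[OF u1] ln_m[OF v1] unfolding C_const_def h_fun_def
    by (simp add: algebra_simps diff_divide_distrib)
qed

lemma psi_fun_has_derivative:
  assumes "x0 > 0" "y0 > 0"
  shows "((\<lambda>(x, y). psi_fun u v x y) has_derivative (\<lambda>(dx, dy). - v / x0 * dx + u / y0 * dy)) (at (x0, y0))"
proof -
  have 1: "((\<lambda>z. ln (fst z)) has_derivative (\<lambda>d. fst d * inverse x0)) (at (x0, y0))"
    by (rule DERIV_compose_FDERIV[where f = ln and g = fst]) (use assms in \<open>auto intro: DERIV_ln has_derivative_fst[OF has_derivative_ident]\<close>)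
  have 2: "((\<lambda>z. ln (snd z)) has_derivative (\<lambda>d. snd d * inverse y0)) (at (x0, y0))"
    by (rule DERIV_compose_FDERIV[where f = ln and g = snd]) (use assms in \<open>auto intro: DERIV_ln has_derivative_snd[OF has_derivative_ident]\<close>)
  have "((\<lambda>z. (- v) * ln (fst z) + u * ln (snd z) + C_const u v) has_derivative
     (\<lambda>d. (- v) * (fst d * inverse x0) + u * (snd d * inverse y0) + 0)) (at (x0, y0))"
    by (intro has_derivative_add has_derivative_mult_right has_derivative_const 1 2)
  then show ?thesis by (simp add: psi_fun_def case_prod_unfold divide_inverse mult_ac)
qed

section \<open>Normal limits, the delta method and boundedness in probability\<close>

lemma normal_law_eq_distr:
  assumes "s > 0"
  shows "normal_law m s = distr std_gauss borel (\<lambda>x. m + sqrt s * x)"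
proof -
  have "distributed std_gauss lborel (\<lambda>x. x) std_normal_density"
    unfolding distributed_def by (auto simp: distr_id2 cong: distr_cong)
  then have "distributed std_gauss lborel (\<lambda>x. m + sqrt s * x) (normal_density (m + sqrt s * 0) (\<bar>sqrt s\<bar> * 1))"
    by (rule std_gauss.normal_density_affine) (use assms in auto)
  then have "distr std_gauss lborel (\<lambda>x. m + sqrt s * x) = density lborel (normal_density m (sqrt s))"
    using assms by (simp add: distributed_def)
  moreover have "distr std_gauss lborel (\<lambda>x. m + sqrt s * x) = distr std_gauss borel (\<lambda>x. m + sqrt s * x)"
    by (rule distr_cong) auto
  ultimately show ?thesis using assms by (simp add: normal_law_def)
qed

text \<open>The normal laws are affine images of the standard one, so their moments and characteristic functions are
inherited; in this form the degenerate law with \<open>s = 0\<close> fits in as well.\<close>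
lemma normal_law_distr:
  assumes "s \<ge> 0"
  shows "normal_law m s = distr std_gauss borel (\<lambda>x. m + sqrt s * x)"
proof (cases "s = 0")
  case True
  have "distr std_gauss borel (\<lambda>x. m) = return borel m"
    by (rule std_gauss.distr_const) simp
  then show ?thesis using True by (simp add: normal_law_def)
next
  case False then show ?thesis using assms by (intro normal_law_eq_distr) simp
qed

lemma real_distribution_normal_law: "s \<ge> 0 \<Longrightarrow> real_distribution (normal_law m s)"
  unfolding normal_law_distr by (rule std_gauss.real_distribution_distr) simp

lemma cos_sin_normal_law:
  assumes "s \<ge> 0"
  shows "(\<integral>x. cos (t * x) \<partial>normal_law 0 s) = exp (- s * t\<^sup>2 / 2)" "(\<integral>x. sin (t * x) \<partial>normal_law 0 s) = 0"
  unfolding normal_law_distr[OF assms] using cos_sin_std_gauss[of "t * sqrt s"] assms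
  by (simp_all add: integral_distr power_mult_distrib mult.assoc[symmetric] mult.commute[of s])

lemma normal_law_moments:
  assumes "s \<ge> 0"
  shows "integrable (normal_law m s) (\<lambda>x. x\<^sup>2)" "(\<integral>x. x \<partial>normal_law m s) = m" "(\<integral>x. x\<^sup>2 \<partial>normal_law m s) = m\<^sup>2 + s"
proof -
  have i1: "integrable std_gauss (\<lambda>x. x)" and i2: "integrable std_gauss (\<lambda>x. x\<^sup>2)"
  proof -
    have "(\<lambda>x::real. x) = poly [:0, 1:]" "(\<lambda>x::real. x\<^sup>2) = poly [:0, 0, 1:]" by (auto simp: power2_eq_square)
    then show "integrable std_gauss (\<lambda>x. x)" "integrable std_gauss (\<lambda>x. x\<^sup>2)" by (simp_all only: integrable_poly)
  qed
  have e1: "(\<integral>x. x \<partial>std_gauss) = 0" and e2: "(\<integral>x. x\<^sup>2 \<partial>std_gauss) = 1"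
    using hermite_orthogonal[of 1 0] hermite_orthogonal[of 1 1] by (simp_all add: power2_eq_square)
  have sq: "(m + sqrt s * x)\<^sup>2 = m\<^sup>2 + 2 * m * sqrt s * x + s * x\<^sup>2" for x
    using assms by (simp add: power2_sum power_mult_distrib)
  show "integrable (normal_law m s) (\<lambda>x. x\<^sup>2)"
    unfolding normal_law_distr[OF assms] by (subst integrable_distr_eq) (simp_all add: sq i1 i2)
  have "(\<integral>x. x \<partial>normal_law m s) = (\<integral>x. m + sqrt s * x \<partial>std_gauss)"
    unfolding normal_law_distr[OF assms] by (rule integral_distr) simp_all
  also have "\<dots> = m" using i1 std_gauss.prob_space by (simp add: e1)
  finally show "(\<integral>x. x \<partial>normal_law m s) = m" .
  have "(\<integral>x. x\<^sup>2 \<partial>normal_law m s) = (\<integral>x. m\<^sup>2 + 2 * m * sqrt s * x + s * x\<^sup>2 \<partial>std_gauss)"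
    unfolding normal_law_distr[OF assms] sq[symmetric] by (rule integral_distr) simp_all
  also have "\<dots> = m\<^sup>2 + s" using i1 i2 std_gauss.prob_space by (simp add: e1 e2)
  finally show "(\<integral>x. x\<^sup>2 \<partial>normal_law m s) = m\<^sup>2 + s" .
qed

text \<open>Even the degenerate limit law charges no point except \<open>0\<close>, so its distribution function is continuous at
every nonzero point.\<close>
lemma normal_law_no_atom:
  assumes "s \<ge> 0" "x \<noteq> 0"
  shows "measure (normal_law 0 s) {x} = 0"
proof (cases "s = 0")
  case True then show ?thesis using assms by (simp add: normal_law_def measure_return indicator_def)
next
  case False
  have "emeasure (density lborel (normal_density 0 (sqrt s))) {x} = 0"
    by (subst emeasure_density) (simp_all add: nn_integral_null_set)
  then show ?thesis using False by (simp add: normal_law_def measure_def)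
qed

lemma (in prob_space) weak_conv_normal:
  assumes [measurable]: "\<And>n. Y n \<in> borel_measurable M" and s: "s \<ge> 0"
    and c: "\<And>t. (\<lambda>n. expectation (\<lambda>w. cos (t * Y n w))) \<longlonglongrightarrow> exp (- s * t\<^sup>2 / 2)"
    and d: "\<And>t. (\<lambda>n. expectation (\<lambda>w. sin (t * Y n w))) \<longlonglongrightarrow> 0"
  shows "weak_conv_m (\<lambda>n. distr M borel (Y n)) (normal_law 0 s)"
proof (rule levy_continuity)
  show "real_distribution (distr M borel (Y n))" for n by (rule real_distribution_distr) simp
  show rn: "real_distribution (normal_law 0 s)" by (rule real_distribution_normal_law[OF s])
  fix t
  interpret N: real_distribution "normal_law 0 s" by (rule rn)
  have "distr (normal_law 0 s) borel (\<lambda>x. x) = normal_law 0 s" by (rule distr_id2) simp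
  then have "char (normal_law 0 s) t = Complex (exp (- s * t\<^sup>2 / 2)) 0"
    using char_distr_cos_sin[OF N.prob_space_axioms, of "\<lambda>x. x" t] cos_sin_normal_law[OF s, of t] by simp
  moreover have "(\<lambda>n. Complex (expectation (\<lambda>w. cos (t * Y n w))) (expectation (\<lambda>w. sin (t * Y n w)))) \<longlonglongrightarrow> Complex (exp (- s * t\<^sup>2 / 2)) 0"
    by (intro tendsto_Complex c d)
  ultimately show "(\<lambda>n. char (distr M borel (Y n)) t) \<longlonglongrightarrow> char (normal_law 0 s) t"
    by (simp add: char_distr_cos_sin[OF prob_space_axioms])
qed

lemma (in prob_space) trig_expectation_close:
  fixes f :: "real \<Rightarrow> real"
  assumes [measurable]: "Y \<in> borel_measurable M" "L \<in> borel_measurable M" "f \<in> borel_measurable borel"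
    and lip: "\<And>x y. \<bar>f x - f y\<bar> \<le> \<bar>x - y\<bar>" and bd: "\<And>x. \<bar>f x\<bar> \<le> 1" and e: "e \<ge> 0"
    and p: "prob {w \<in> space M. \<bar>Y w - L w\<bar> > e} \<le> q"
  shows "\<bar>expectation (\<lambda>w. f (t * Y w)) - expectation (\<lambda>w. f (t * L w))\<bar> \<le> \<bar>t\<bar> * e + 2 * q"
proof -
  let ?A = "{w \<in> space M. \<bar>Y w - L w\<bar> > e}"
  have A[measurable]: "?A \<in> sets M" by measurable
  have i: "integrable M (\<lambda>w. f (t * Z w))" if [measurable]: "Z \<in> borel_measurable M" for Z
    by (rule integrable_const_bound[where B = 1]) (auto simp: bd)
  have iA: "integrable M (indicator ?A :: _ \<Rightarrow> real)" by (rule integrable_real_indicator) (auto simp: emeasure_eq_measure)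
  have "\<bar>expectation (\<lambda>w. f (t * Y w)) - expectation (\<lambda>w. f (t * L w))\<bar> = \<bar>expectation (\<lambda>w. f (t * Y w) - f (t * L w))\<bar>"
    by (simp add: i)
  also have "\<dots> \<le> expectation (\<lambda>w. \<bar>f (t * Y w) - f (t * L w)\<bar>)" by (rule integral_abs_bound)
  also have "\<dots> \<le> expectation (\<lambda>w. \<bar>t\<bar> * e + 2 * indicator ?A w)"
  proof (intro integral_mono integrable_abs Bochner_Integration.integrable_diff[OF i i] Bochner_Integration.integrable_add integrable_mult_right iA)
    fix w assume w: "w \<in> space M"
    show "\<bar>f (t * Y w) - f (t * L w)\<bar> \<le> \<bar>t\<bar> * e + 2 * indicator ?A w"
    proof (cases "w \<in> ?A")
      case True
      have "\<bar>f (t * Y w) - f (t * L w)\<bar> \<le> 2" using bd[of "t * Y w"] bd[of "t * L w"] by linarith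
      moreover have "0 \<le> \<bar>t\<bar> * e" using e by simp
      ultimately show ?thesis using True by simp
    next
      case False
      then have "\<bar>Y w - L w\<bar> \<le> e" using w by simp
      then have "\<bar>t\<bar> * \<bar>Y w - L w\<bar> \<le> \<bar>t\<bar> * e" by (intro mult_left_mono) auto
      then have "\<bar>t * Y w - t * L w\<bar> \<le> \<bar>t\<bar> * e" by (simp add: right_diff_distrib[symmetric] abs_mult)
      then show ?thesis using order_trans[OF lip[of "t * Y w" "t * L w"]] False by simp
    qed
  qed auto
  also have "\<dots> = \<bar>t\<bar> * e + 2 * prob ?A" using iA by (simp add: prob_space)
  finally show ?thesis using p by linarith
qed

text \<open>Off the event that \<open>(U n, V n)\<close> is at distance at least \<open>e / (\<rho> n * \<epsilon>)\<close> from \<open>(x0, y0)\<close>, differentiability bounds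
the linearisation error, multiplied by \<open>\<rho> n\<close>, by \<open>e\<close>; the probability of the event is controlled by the second moments.\<close>
lemma (in prob_space) delta_method_prob:
  fixes U V :: "nat \<Rightarrow> 'a \<Rightarrow> real" and g :: "real \<Rightarrow> real \<Rightarrow> real"
  assumes [measurable]: "\<And>n. U n \<in> borel_measurable M" "\<And>n. V n \<in> borel_measurable M"
    and g: "((\<lambda>(x, y). g x y) has_derivative (\<lambda>(dx, dy). g1 * dx + g2 * dy)) (at (x0, y0))"
    and \<rho>: "filterlim \<rho> at_top sequentially" and C: "C \<ge> 0"
    and U2: "\<forall>\<^sub>F n in sequentially. integrable M (\<lambda>w. (U n w - x0)\<^sup>2) \<and> expectation (\<lambda>w. (U n w - x0)\<^sup>2) \<le> C / (\<rho> n)\<^sup>2"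
    and V2: "\<forall>\<^sub>F n in sequentially. integrable M (\<lambda>w. (V n w - y0)\<^sup>2) \<and> expectation (\<lambda>w. (V n w - y0)\<^sup>2) \<le> C / (\<rho> n)\<^sup>2"
    and [measurable]: "\<And>n. (\<lambda>w. g (U n w) (V n w)) \<in> borel_measurable M"
    and e: "e > 0" and q: "q > 0"
  shows "\<forall>\<^sub>F n in sequentially. prob {w \<in> space M. \<bar>\<rho> n * (g (U n w) (V n w) - g x0 y0) - \<rho> n * (g1 * (U n w - x0) + g2 * (V n w - y0))\<bar> > e} \<le> q"
proof -
  \<comment> \<open>This choice makes the Chebyshev bound \<open>2 * C * \<epsilon>\<^sup>2 / e\<^sup>2\<close> at most \<open>q\<close>.\<close>
  define \<epsilon> where "\<epsilon> = sqrt (q * e\<^sup>2 / (2 * C + 1))"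
  have C1: "2 * C + 1 > 0" using C by simp
  have \<epsilon>: "\<epsilon> > 0" "\<epsilon>\<^sup>2 = q * e\<^sup>2 / (2 * C + 1)" using e q C1 by (simp_all add: \<epsilon>_def)
  obtain \<delta> where \<delta>: "\<delta> > 0" and \<delta>b: "\<And>z. norm (z - (x0, y0)) < \<delta> \<Longrightarrow>
     norm ((\<lambda>(x, y). g x y) z - (\<lambda>(x, y). g x y) (x0, y0) - (\<lambda>(dx, dy). g1 * dx + g2 * dy) (z - (x0, y0))) \<le> \<epsilon> * norm (z - (x0, y0))"
    using g[unfolded has_derivative_at_alt] \<epsilon>(1) by blast
  have "\<forall>\<^sub>F n in sequentially. \<rho> n \<ge> max 1 (e / (\<epsilon> * \<delta>))" using \<rho> unfolding filterlim_at_top by blast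
  with U2 V2 show ?thesis
  proof eventually_elim
    case (elim n)
    have \<rho>1: "\<rho> n > 0" and \<rho>2: "e / (\<rho> n * \<epsilon>) \<le> \<delta>"
    proof -
      show "\<rho> n > 0" using elim by simp
      have "e / (\<epsilon> * \<delta>) \<le> \<rho> n" using elim by simp
      then show "e / (\<rho> n * \<epsilon>) \<le> \<delta>" using \<epsilon> \<delta> \<open>\<rho> n > 0\<close> by (simp add: field_simps)
    qed
    define h where "h w = sqrt ((U n w - x0)\<^sup>2 + (V n w - y0)\<^sup>2)" for w
    have hn: "norm ((U n w, V n w) - (x0, y0)) = h w" for w by (simp add: h_def norm_Pair)
    have h2: "(h w)\<^sup>2 = (U n w - x0)\<^sup>2 + (V n w - y0)\<^sup>2" for w by (simp add: h_def)
    have hm[measurable]: "h \<in> borel_measurable M" unfolding h_def by measurable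
    have h0: "h w \<ge> 0" for w by (simp add: h_def)
    define a where "a = e / (\<rho> n * \<epsilon>)"
    have a: "a > 0" unfolding a_def using e \<rho>1 \<epsilon> by simp
    have sub: "{w \<in> space M. \<bar>\<rho> n * (g (U n w) (V n w) - g x0 y0) - \<rho> n * (g1 * (U n w - x0) + g2 * (V n w - y0))\<bar> > e} \<subseteq> {w \<in> space M. \<bar>h w\<bar> \<ge> a}"
    proof
      fix w assume w: "w \<in> {w \<in> space M. \<bar>\<rho> n * (g (U n w) (V n w) - g x0 y0) - \<rho> n * (g1 * (U n w - x0) + g2 * (V n w - y0))\<bar> > e}"
      have "h w \<ge> a"
      proof (rule ccontr)
        assume "\<not> h w \<ge> a"
        then have ha: "h w < a" by simp
        then have "h w < \<delta>" using \<rho>2 a_def by simp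
        then have "\<bar>g (U n w) (V n w) - g x0 y0 - (g1 * (U n w - x0) + g2 * (V n w - y0))\<bar> \<le> \<epsilon> * h w"
          using \<delta>b[of "(U n w, V n w)"] unfolding hn by simp
        then have "\<rho> n * \<bar>g (U n w) (V n w) - g x0 y0 - (g1 * (U n w - x0) + g2 * (V n w - y0))\<bar> \<le> \<rho> n * (\<epsilon> * h w)"
          using \<rho>1 by (intro mult_left_mono) auto
        also have "\<dots> \<le> \<rho> n * (\<epsilon> * a)" using ha \<rho>1 \<epsilon> by (intro mult_left_mono) auto
        also have "\<dots> = e" unfolding a_def using \<rho>1 \<epsilon> by simp
        finally have "\<bar>\<rho> n * (g (U n w) (V n w) - g x0 y0 - (g1 * (U n w - x0) + g2 * (V n w - y0)))\<bar> \<le> e"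
          using \<rho>1 by (simp add: abs_mult)
        then show False using w by (simp add: right_diff_distrib)
      qed
      then show "w \<in> {w \<in> space M. \<bar>h w\<bar> \<ge> a}" using w h0[of w] by simp
    qed
    have ih: "integrable M (\<lambda>w. (h w)\<^sup>2)" unfolding h2 using elim by simp
    have "prob {w \<in> space M. \<bar>\<rho> n * (g (U n w) (V n w) - g x0 y0) - \<rho> n * (g1 * (U n w - x0) + g2 * (V n w - y0))\<bar> > e} \<le> prob {w \<in> space M. \<bar>h w\<bar> \<ge> a}"
      by (rule finite_measure_mono[OF sub]) measurable
    also have "\<dots> \<le> expectation (\<lambda>w. (h w)\<^sup>2) / a\<^sup>2" by (rule second_moment_method[OF hm ih a])
    also have "expectation (\<lambda>w. (h w)\<^sup>2) = expectation (\<lambda>w. (U n w - x0)\<^sup>2) + expectation (\<lambda>w. (V n w - y0)\<^sup>2)"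
      unfolding h2 using elim by simp
    also have "\<dots> / a\<^sup>2 \<le> (C / (\<rho> n)\<^sup>2 + C / (\<rho> n)\<^sup>2) / a\<^sup>2" using elim by (intro divide_right_mono add_mono) auto
    also have "\<dots> = 2 * C * \<epsilon>\<^sup>2 / e\<^sup>2" unfolding a_def using \<rho>1 e \<epsilon>(1) by (simp add: field_simps power_mult_distrib power_divide)
    also have "\<dots> = q * (2 * C / (2 * C + 1))" unfolding \<epsilon>(2) using e by (simp add: mult_ac)
    also have "\<dots> \<le> q * 1" using C1 C q by (intro mult_left_mono) (auto simp: divide_le_eq)
    finally show ?case by simp
  qed
qed

lemma (in prob_space) trig_limit_transfer:
  fixes Y L :: "nat \<Rightarrow> 'a \<Rightarrow> real" and f :: "real \<Rightarrow> real"
  assumes [measurable]: "\<And>n. Y n \<in> borel_measurable M" "\<And>n. L n \<in> borel_measurable M" "f \<in> borel_measurable borel"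
    and lip: "\<And>x y. \<bar>f x - f y\<bar> \<le> \<bar>x - y\<bar>" and bd: "\<And>x. \<bar>f x\<bar> \<le> 1"
    and p: "\<And>e q. e > 0 \<Longrightarrow> q > 0 \<Longrightarrow> \<forall>\<^sub>F n in sequentially. prob {w \<in> space M. \<bar>Y n w - L n w\<bar> > e} \<le> q"
    and l: "(\<lambda>n. expectation (\<lambda>w. f (t * L n w))) \<longlonglongrightarrow> a"
  shows "(\<lambda>n. expectation (\<lambda>w. f (t * Y n w))) \<longlonglongrightarrow> a"
proof -
  have "(\<lambda>n. expectation (\<lambda>w. f (t * Y n w)) - expectation (\<lambda>w. f (t * L n w))) \<longlonglongrightarrow> 0"
  proof (rule tendstoI)
    fix \<epsilon> :: real assume \<epsilon>: "\<epsilon> > 0"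
    define d where "d = \<epsilon> / (\<bar>t\<bar> + 3)"
    have t3: "\<bar>t\<bar> + 3 > 0" by simp
    have d: "d > 0" using \<epsilon> t3 by (simp add: d_def)
    have "\<epsilon> = d * (\<bar>t\<bar> + 3)" using t3 by (simp add: d_def)
    then have dl: "\<bar>t\<bar> * d + 2 * d < \<epsilon>" using d by (simp add: algebra_simps)
    show "\<forall>\<^sub>F n in sequentially. dist (expectation (\<lambda>w. f (t * Y n w)) - expectation (\<lambda>w. f (t * L n w))) 0 < \<epsilon>"
      using p[OF d d]
    proof eventually_elim
      case (elim n)
      have "\<bar>expectation (\<lambda>w. f (t * Y n w)) - expectation (\<lambda>w. f (t * L n w))\<bar> \<le> \<bar>t\<bar> * d + 2 * d"
        by (rule trig_expectation_close[OF _ _ _ lip bd _ elim]) (use d in auto)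
      then show ?case using dl by simp
    qed
  qed
  from tendsto_add[OF this l] show ?thesis by simp
qed

lemma (in prob_space) tail_le_cdf:
  assumes [measurable]: "Y \<in> borel_measurable M"
  shows "prob {w \<in> space M. \<bar>Y w\<bar> > B} \<le> 1 - cdf (distr M borel Y) B + cdf (distr M borel Y) (- B)"
proof -
  have c: "cdf (distr M borel Y) x = prob {w \<in> space M. Y w \<le> x}" for x
    unfolding cdf_def by (subst measure_distr) (auto intro!: arg_cong[where f = prob])
  have "prob {w \<in> space M. \<bar>Y w\<bar> > B} \<le> prob ({w \<in> space M. Y w > B} \<union> {w \<in> space M. Y w \<le> - B})"
    by (rule finite_measure_mono) auto
  also have "\<dots> \<le> prob {w \<in> space M. Y w > B} + prob {w \<in> space M. Y w \<le> - B}"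
    by (rule measure_Un_le) auto
  also have "prob {w \<in> space M. Y w > B} = 1 - prob {w \<in> space M. Y w \<le> B}"
    by (subst prob_compl[symmetric]) (auto intro!: arg_cong[where f = prob])
  finally show ?thesis by (simp add: c)
qed

lemma cdf_tail_tendsto_0:
  assumes "real_distribution \<mu>"
  shows "((\<lambda>B. 1 - cdf \<mu> B + cdf \<mu> (- B)) \<longlongrightarrow> 0) at_top"
proof -
  interpret real_distribution \<mu> by fact
  have "((\<lambda>B. 1 - cdf \<mu> B + cdf \<mu> (- B)) \<longlongrightarrow> 1 - 1 + 0) at_top"
    by (intro tendsto_intros cdf_lim_at_top_prob filterlim_compose[OF cdf_lim_at_bot filterlim_uminus_at_bot_at_top])
  then show ?thesis by simp
qed

text \<open>A weakly convergent sequence is tight. Large indices are handled by the tail of the limit law, at the points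
\<open>\<plusminus> B0\<close> where its distribution function is continuous, and the finitely many remaining ones by their own tails.\<close>
lemma (in prob_space) O_prob_of_weak_conv:
  fixes Z W :: "nat \<Rightarrow> 'a \<Rightarrow> real"
  assumes A: "A \<noteq> {}" and Zm: "\<And>n. n \<in> A \<Longrightarrow> Z n \<in> borel_measurable M"
    and n0: "\<And>n. n \<in> A \<Longrightarrow> n > 0"
    and W: "\<And>n. n \<in> A \<Longrightarrow> \<exists>m. W m = (\<lambda>w. sqrt (real n) * Z n w)"
    and Wm[measurable]: "\<And>m. W m \<in> borel_measurable M"
    and s: "s \<ge> 0" and conv: "weak_conv_m (\<lambda>m. distr M borel (W m)) (normal_law 0 s)"
  shows "O_prob M A (\<lambda>n. real n powr (- 1 / 2)) Z"
  unfolding O_prob_def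
proof (intro exI[of _ "\<lambda>n w. sqrt (real n) * Z n w"] conjI ballI)
  fix n w assume "n \<in> A"
  then have "real n > 0" using n0 by simp
  then have "real n powr (- 1 / 2) * sqrt (real n) = 1"
    by (simp add: powr_half_sqrt[symmetric] powr_add[symmetric] del: powr_half_sqrt)
  then show "Z n w = real n powr (- 1 / 2) * (sqrt (real n) * Z n w)" by (simp add: mult.assoc[symmetric])
next
  show "bounded_in_prob M A (\<lambda>n w. sqrt (real n) * Z n w)"
    unfolding bounded_in_prob_def
  proof (intro conjI ballI allI impI)
    show "(\<lambda>w. sqrt (real n) * Z n w) \<in> borel_measurable M" if "n \<in> A" for n using Zm[OF that] by measurable
    fix \<epsilon> :: real assume \<epsilon>: "\<epsilon> > 0"
    define d where "d = \<epsilon> / 2"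
    have d: "d > 0" "d < \<epsilon>" using \<epsilon> by (auto simp: d_def)
    define tl where "tl \<mu> B = 1 - cdf \<mu> B + cdf \<mu> (- B)" for \<mu> :: "real measure" and B
    have tlim: "(tl \<mu> \<longlongrightarrow> 0) at_top" if "real_distribution \<mu>" for \<mu> unfolding tl_def by (rule cdf_tail_tendsto_0[OF that])
    have rn: "real_distribution (normal_law 0 s)" by (rule real_distribution_normal_law[OF s])
    have rW: "real_distribution (distr M borel (W m))" for m by (rule real_distribution_distr) simp
    have "\<forall>\<^sub>F B in at_top. tl (normal_law 0 s) B < d \<and> B > 0"
      by (rule eventually_conj[OF order_tendstoD(2)[OF tlim[OF rn] d(1)] eventually_gt_at_top])
    then obtain B0 where B0: "tl (normal_law 0 s) B0 < d" "B0 > 0" using eventually_happens'[OF trivial_limit_at_top_linorder] by blast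
    have "(\<lambda>m. tl (distr M borel (W m)) B0) \<longlonglongrightarrow> tl (normal_law 0 s) B0"
      unfolding tl_def
    proof (intro tendsto_intros)
      have "isCont (cdf (normal_law 0 s)) x" if "x \<noteq> 0" for x
        using normal_law_no_atom[OF s that] finite_borel_measure.isCont_cdf[OF real_distribution.finite_borel_measure_M[OF rn]] by simp
      then show "(\<lambda>m. cdf (distr M borel (W m)) B0) \<longlonglongrightarrow> cdf (normal_law 0 s) B0" "(\<lambda>m. cdf (distr M borel (W m)) (- B0)) \<longlonglongrightarrow> cdf (normal_law 0 s) (- B0)"
        using conv B0(2) unfolding weak_conv_m_def weak_conv_def by auto
    qed
    from order_tendstoD(2)[OF this B0(1)] obtain m0 where m0: "\<And>m. m \<ge> m0 \<Longrightarrow> tl (distr M borel (W m)) B0 < d"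
      unfolding eventually_sequentially by blast
    have "\<forall>m\<in>{..<m0}. \<forall>\<^sub>F B in at_top. tl (distr M borel (W m)) B < d"
      using order_tendstoD(2)[OF tlim[OF rW] d(1)] by blast
    then have "\<forall>\<^sub>F B in at_top. \<forall>m\<in>{..<m0}. tl (distr M borel (W m)) B < d"
      by (simp add: eventually_ball_finite)
    then have "\<forall>\<^sub>F B in at_top. (\<forall>m\<in>{..<m0}. tl (distr M borel (W m)) B < d) \<and> B \<ge> B0"
      by (rule eventually_conj[OF _ eventually_ge_at_top])
    then obtain B where B: "\<And>m. m < m0 \<Longrightarrow> tl (distr M borel (W m)) B < d" "B \<ge> B0"
      using eventually_happens'[OF trivial_limit_at_top_linorder] by blast
    have bd: "prob {w \<in> space M. \<bar>W m w\<bar> > B} \<le> d" for m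
    proof (cases "m < m0")
      case True
      then show ?thesis using tail_le_cdf[OF Wm[of m], of B] B(1)[OF True] by (simp add: tl_def)
    next
      case False
      have "prob {w \<in> space M. \<bar>W m w\<bar> > B} \<le> prob {w \<in> space M. \<bar>W m w\<bar> > B0}"
        using B(2) by (intro finite_measure_mono) auto
      also have "\<dots> \<le> d" using tail_le_cdf[OF Wm[of m], of B0] m0[of m] False by (simp add: tl_def)
      finally show ?thesis .
    qed
    have "(SUP n\<in>A. prob {w \<in> space M. \<bar>sqrt (real n) * Z n w\<bar> > B}) \<le> d"
    proof (rule cSUP_least[OF A])
      fix n assume "n \<in> A"
      then obtain m where "W m = (\<lambda>w. sqrt (real n) * Z n w)" using W by blast
      then show "prob {w \<in> space M. \<bar>sqrt (real n) * Z n w\<bar> > B} \<le> d" using bd[of m] by simp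
    qed
    then show "\<exists>B>0. (SUP n\<in>A. prob {w \<in> space M. \<bar>sqrt (real n) * Z n w\<bar> > B}) < \<epsilon>"
      using B(2) B0(2) d by (intro exI[of _ B]) auto
  qed
qed

section \<open>Nondegeneracy of the increments\<close>

lemma integrable_indicator_has_integral:
  fixes f :: "real \<Rightarrow> real"
  assumes [measurable]: "f \<in> borel_measurable borel" "S \<in> sets borel"
    and f: "\<And>x. x \<in> S \<Longrightarrow> 0 \<le> f x" and I: "(f has_integral I) S"
  shows "integrable lborel (\<lambda>x. indicator S x * f x)"
proof -
  have n: "(\<integral>\<^sup>+x. ennreal (indicator S x * f x) \<partial>lborel) = ennreal I"
    by (rule nn_integral_has_integral_lebesgue[OF f I])
  show ?thesis
    by (rule integrableI_nonneg) (use f n in \<open>auto simp: indicator_def\<close>)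
qed

text \<open>The weight of the integral representation of \<open>\<bar>x\<bar> powr h\<close> as a superposition of \<open>1 - cos (x * u)\<close>.\<close>
definition frac_weight :: "real \<Rightarrow> real \<Rightarrow> real" where
  "frac_weight h u = indicator {0<..} u * u powr (- 1 - h)"

lemma measurable_frac_weight [measurable]: "frac_weight h \<in> borel_measurable borel"
  unfolding frac_weight_def[abs_def] by measurable

lemma frac_weight_nonneg: "frac_weight h u \<ge> 0"
  by (simp add: frac_weight_def indicator_def)

lemma one_minus_cos_le: "1 - cos u \<le> u\<^sup>2" for u :: real
proof -
  have "1 - cos u = 2 * (sin (u / 2))\<^sup>2" using cos_double_sin[of "u / 2"] by simp
  also have "(sin (u / 2))\<^sup>2 \<le> (u / 2)\<^sup>2" using abs_sin_x_le_abs_x[of "u / 2"] by (simp only: abs_le_square_iff)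
  finally have "1 - cos u \<le> 2 * (u / 2)\<^sup>2" by simp
  also have "\<dots> \<le> u\<^sup>2" by (simp add: power_divide)
  finally show ?thesis .
qed

lemma integrable_frac_kernel:
  assumes h: "0 < h" "h < 2"
  shows "integrable lborel (\<lambda>u. (1 - cos u) * frac_weight h u)"
proof (rule Bochner_Integration.integrable_bound)
  have 1: "integrable lborel (\<lambda>u::real. indicator {0..1} u * u powr (1 - h))"
    by (rule integrable_indicator_has_integral[OF _ _ _ has_integral_powr_from_0]) (use h in auto)
  have 2: "integrable lborel (\<lambda>u::real. indicator {1..} u * u powr (- 1 - h))"
    by (rule integrable_indicator_has_integral[OF _ _ _ has_integral_powr_to_inf]) (use h in auto)
  show "integrable lborel (\<lambda>u::real. indicator {0..1} u * u powr (1 - h) + 2 * (indicator {1..} u * u powr (- 1 - h)))"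
    by (intro Bochner_Integration.integrable_add integrable_mult_right 1 2)
  show "AE u in lborel. norm ((1 - cos u) * frac_weight h u) \<le> norm (indicator {0..1} u * u powr (1 - h) + 2 * (indicator {1..} u * u powr (- 1 - h)))"
  proof (rule AE_I2)
    fix u :: real
    have c: "0 \<le> 1 - cos u" "1 - cos u \<le> 2" using cos_le_one[of u] cos_ge_minus_one[of u] by linarith+
    consider "u \<le> 0" | "0 < u" "u \<le> 1" | "1 < u" by linarith
    then have "(1 - cos u) * frac_weight h u \<le> indicator {0..1} u * u powr (1 - h) + 2 * (indicator {1..} u * u powr (- 1 - h))"
    proof cases
      case 1 then show ?thesis by (simp add: frac_weight_def)
    next
      case 2
      have "(1 - cos u) * u powr (- 1 - h) \<le> u\<^sup>2 * u powr (- 1 - h)" by (intro mult_right_mono one_minus_cos_le) simp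
      also have "u\<^sup>2 * u powr (- 1 - h) = u powr 2 * u powr (- 1 - h)" using 2 by simp
      also have "\<dots> = u powr (1 - h)" unfolding powr_add[symmetric] by simp
      finally show ?thesis using 2 by (auto simp: frac_weight_def indicator_def)
    next
      case 3
      then show ?thesis using mult_right_mono[OF c(2), of "u powr (- 1 - h)"] by (simp add: frac_weight_def)
    qed
    moreover have "0 \<le> (1 - cos u) * frac_weight h u" using c frac_weight_nonneg by simp
    ultimately show "norm ((1 - cos u) * frac_weight h u) \<le> norm (indicator {0..1} u * u powr (1 - h) + 2 * (indicator {1..} u * u powr (- 1 - h)))"
      by simp
  qed
qed measurable

definition frac_const :: "real \<Rightarrow> real" where
  "frac_const h = (\<integral>u. (1 - cos u) * frac_weight h u \<partial>lborel)"

text \<open>Substituting \<open>u / x\<close> for \<open>u\<close> extracts the power of \<open>x\<close>.\<close>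
lemma frac_const_scaling:
  assumes h: "0 < h" "h < 2"
  shows "integrable lborel (\<lambda>u. (1 - cos (x * u)) * frac_weight h u)"
    and "(\<integral>u. (1 - cos (x * u)) * frac_weight h u \<partial>lborel) = frac_const h * \<bar>x\<bar> powr h"
proof -
  have pos: "integrable lborel (\<lambda>u. (1 - cos (x * u)) * frac_weight h u) \<and> (\<integral>u. (1 - cos (x * u)) * frac_weight h u \<partial>lborel) = frac_const h * x powr h"
    if x: "x > 0" for x
  proof -
    have w: "frac_weight h (x * u) = frac_weight h u * x powr (- 1 - h)" for u
      using x by (auto simp: frac_weight_def indicator_def powr_mult zero_less_mult_iff)
    have eq: "(1 - cos (x * u)) * frac_weight h (x * u) = x powr (- 1 - h) * ((1 - cos (x * u)) * frac_weight h u)" for u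
      unfolding w by (simp only: mult_ac)
    have nz: "x powr (- 1 - h) \<noteq> 0" using x by simp
    have "integrable lborel (\<lambda>u. (1 - cos (0 + x * u)) * frac_weight h (0 + x * u))"
      using x by (intro lborel_integrable_real_affine[OF integrable_frac_kernel[OF h]]) simp
    then have i: "integrable lborel (\<lambda>u. (1 - cos (x * u)) * frac_weight h u)"
      using nz unfolding add_0_left eq by simp
    have "frac_const h = \<bar>x\<bar> *\<^sub>R (\<integral>u. (1 - cos (0 + x * u)) * frac_weight h (0 + x * u) \<partial>lborel)"
      unfolding frac_const_def using x by (intro lborel_integral_real_affine) simp
    also have "\<dots> = x * (x powr (- 1 - h) * (\<integral>u. (1 - cos (x * u)) * frac_weight h u \<partial>lborel))"
      using x unfolding add_0_left eq by simp
    finally have "frac_const h * x powr h = (x * x powr (- 1 - h) * x powr h) * (\<integral>u. (1 - cos (x * u)) * frac_weight h u \<partial>lborel)" by (simp only: mult_ac)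
    also have "x * x powr (- 1 - h) * x powr h = x powr 1 * x powr (- 1 - h) * x powr h" using x by simp
    also have "\<dots> = 1" unfolding powr_add[symmetric] using x by simp
    finally show ?thesis using i by simp
  qed
  have "integrable lborel (\<lambda>u. (1 - cos (x * u)) * frac_weight h u) \<and> (\<integral>u. (1 - cos (x * u)) * frac_weight h u \<partial>lborel) = frac_const h * \<bar>x\<bar> powr h"
  proof (cases "x = 0")
    case True then show ?thesis by simp
  next
    case False
    have c: "cos (x * u) = cos (\<bar>x\<bar> * u)" for u by (cases "x \<ge> 0") (simp_all add: abs_if)
    show ?thesis unfolding c using pos[of "\<bar>x\<bar>"] False by simp
  qed
  then show "integrable lborel (\<lambda>u. (1 - cos (x * u)) * frac_weight h u)"
    "(\<integral>u. (1 - cos (x * u)) * frac_weight h u \<partial>lborel) = frac_const h * \<bar>x\<bar> powr h" by simp_all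
qed

text \<open>A common zero of both sums is a zero of the polynomial with coefficients \<open>a\<close> on the unit circle.\<close>
lemma trig_poly_zeros_finite:
  fixes a :: "nat \<Rightarrow> real"
  assumes "q \<le> K" "a q \<noteq> 0"
  shows "finite {u \<in> {0<..<1}. (\<Sum>p=0..K. a p * cos (real p * u)) = 0 \<and> (\<Sum>p=0..K. a p * sin (real p * u)) = 0}" (is "finite ?U")
proof -
  define P where "P = (\<Sum>p=0..K. monom (complex_of_real (a p)) p)"
  have "coeff P q = a q" unfolding P_def coeff_sum using assms(1) by (simp add: sum.delta)
  then have "P \<noteq> 0" using assms(2) by auto
  then have fin: "finite {z. poly P z = 0}" by (rule poly_roots_finite)
  have val: "poly P (cis u) = Complex (\<Sum>p=0..K. a p * cos (real p * u)) (\<Sum>p=0..K. a p * sin (real p * u))" for u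
  proof -
    have "Re (cis u ^ p) = cos (real p * u)" "Im (cis u ^ p) = sin (real p * u)" for p :: nat
      by (rule cos_n_Re_cis_pow_n[symmetric], rule sin_n_Im_cis_pow_n[symmetric])
    then show ?thesis unfolding P_def poly_sum poly_monom by (simp add: complex_eq_iff)
  qed
  have "cis ` ?U \<subseteq> {z. poly P z = 0}" using val by (auto simp: complex_eq_iff)
  then have "finite (cis ` ?U)" using fin by (rule finite_subset)
  moreover have "inj_on cis ?U"
  proof (rule inj_onI)
    fix u v assume uv: "u \<in> ?U" "v \<in> ?U" "cis u = cis v"
    then have "cos u = cos v" by (metis cis.sel(1))
    moreover have "u \<in> {0<..<1}" "v \<in> {0<..<1}" using uv(1,2) by blast+
    then have "0 \<le> u" "u \<le> pi" "0 \<le> v" "v \<le> pi" using pi_gt3 by auto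
    ultimately show "u = v" using cos_inj_pi[of u v] by blast
  qed
  ultimately show ?thesis by (rule finite_imageD)
qed

text \<open>Inserting the representation \<open>frac_const_scaling\<close> turns the quadratic form into minus the integral of
\<open>\<bar>\<Sum> a p * exp (\<i> * p * u)\<bar>\<^sup>2\<close> against a weight that is positive on the half line, and the trigonometric
polynomial has only finitely many zeros in \<open>(0, 1)\<close>. Consequently the increments have positive variance.\<close>
theorem abs_powr_strictly_negative_definite:
  fixes a :: "nat \<Rightarrow> real"
  assumes h: "0 < h" "h < 2" and a0: "(\<Sum>p=0..K. a p) = 0" and nz: "q \<le> K" "a q \<noteq> 0"
  shows "(\<Sum>p=0..K. \<Sum>p'=0..K. a p * a p' * \<bar>real p - real p'\<bar> powr h) < 0"
proof -
  define C where "C u = (\<Sum>p=0..K. a p * cos (real p * u))" for u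
  define S where "S u = (\<Sum>p=0..K. a p * sin (real p * u))" for u
  define D where "D = (\<Sum>p=0..K. \<Sum>p'=0..K. a p * a p' * \<bar>real p - real p'\<bar> powr h)"
  have aa: "(\<Sum>p=0..K. \<Sum>p'=0..K. a p * a p') = 0" unfolding sum_product[symmetric] a0 by simp
  have cs: "(\<Sum>p=0..K. \<Sum>p'=0..K. a p * a p' * (1 - cos ((real p - real p') * u))) = - ((C u)\<^sup>2 + (S u)\<^sup>2)" for u
  proof -
    have "(C u)\<^sup>2 + (S u)\<^sup>2 = (\<Sum>p=0..K. \<Sum>p'=0..K. a p * a p' * cos ((real p - real p') * u))"
      unfolding C_def S_def power2_eq_square sum_product sum.distrib[symmetric]
      by (intro sum.cong refl) (simp add: left_diff_distrib cos_diff algebra_simps)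
    then show ?thesis using aa by (simp add: right_diff_distrib sum_subtractf)
  qed
  have eqw: "((C u)\<^sup>2 + (S u)\<^sup>2) * frac_weight h u = - (\<Sum>p=0..K. \<Sum>p'=0..K. a p * a p' * ((1 - cos ((real p - real p') * u)) * frac_weight h u))" for u
  proof -
    have "(\<Sum>p=0..K. \<Sum>p'=0..K. a p * a p' * ((1 - cos ((real p - real p') * u)) * frac_weight h u))
      = (\<Sum>p=0..K. \<Sum>p'=0..K. a p * a p' * (1 - cos ((real p - real p') * u))) * frac_weight h u"
      by (simp only: sum_distrib_right mult.assoc)
    then show ?thesis unfolding cs by (simp only: mult_minus_left minus_minus)
  qed
  have int: "integrable lborel (\<lambda>u. ((C u)\<^sup>2 + (S u)\<^sup>2) * frac_weight h u)"
    unfolding eqw by (intro Bochner_Integration.integrable_minus Bochner_Integration.integrable_sum integrable_mult_right frac_const_scaling(1)[OF h])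
  have val: "(\<integral>u. ((C u)\<^sup>2 + (S u)\<^sup>2) * frac_weight h u \<partial>lborel) = - (frac_const h * D)"
  proof -
    have "(\<integral>u. ((C u)\<^sup>2 + (S u)\<^sup>2) * frac_weight h u \<partial>lborel) = - (\<Sum>p=0..K. \<Sum>p'=0..K. a p * a p' * (frac_const h * \<bar>real p - real p'\<bar> powr h))"
      unfolding eqw by (simp add: frac_const_scaling[OF h])
    also have "\<dots> = - (frac_const h * D)" unfolding D_def sum_distrib_left by (simp add: mult_ac)
    finally show ?thesis .
  qed
  have nn: "0 \<le> ((C u)\<^sup>2 + (S u)\<^sup>2) * frac_weight h u" for u using frac_weight_nonneg by simp
  have k0: "frac_const h \<ge> 0" unfolding frac_const_def
    by (intro integral_nonneg_AE AE_I2) (use frac_weight_nonneg in simp)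
  have "(\<integral>u. ((C u)\<^sup>2 + (S u)\<^sup>2) * frac_weight h u \<partial>lborel) \<noteq> 0"
  proof
    assume "(\<integral>u. ((C u)\<^sup>2 + (S u)\<^sup>2) * frac_weight h u \<partial>lborel) = 0"
    then have ae: "AE u in lborel. ((C u)\<^sup>2 + (S u)\<^sup>2) * frac_weight h u = 0"
      using integral_nonneg_eq_0_iff_AE[OF int] nn by simp
    let ?U = "{u \<in> {0<..<1}. C u = 0 \<and> S u = 0}"
    have "finite ?U" unfolding C_def S_def by (rule trig_poly_zeros_finite[where a = a and q = q and K = K, OF nz])
    then have "?U \<in> null_sets lborel" by (intro finite_imp_null_set_lborel)
    then have "AE u in lborel. u \<notin> ?U" by (rule AE_not_in)
    with ae have "AE u in lborel. u \<notin> {0<..<1::real}"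
    proof eventually_elim
      case (elim u)
      show ?case
      proof
        assume u: "u \<in> {0<..<1}"
        then have "frac_weight h u > 0" by (simp add: frac_weight_def)
        then have "(C u)\<^sup>2 + (S u)\<^sup>2 = 0" using elim(1) by simp
        then show False using elim(2) u by (simp add: sum_power2_eq_zero_iff)
      qed
    qed
    then have "{0<..<1::real} \<in> null_sets lborel" by (subst (asm) AE_iff_null_sets[symmetric]) auto
    then show False by (simp add: null_sets_def)
  qed
  moreover have "(\<integral>u. ((C u)\<^sup>2 + (S u)\<^sup>2) * frac_weight h u \<partial>lborel) \<ge> 0" by (intro integral_nonneg_AE AE_I2 nn)
  ultimately have "frac_const h * D < 0" unfolding val by linarith
  then show ?thesis using k0 unfolding D_def[symmetric] by (simp add: mult_less_0_iff)
qed

section \<open>The normalized increments of fractional Brownian motion\<close>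

text \<open>The two vanishing moments of the coefficients make the correlations of the increments summable, and a
nonzero coefficient makes their variance positive.\<close>
locale fbm_increments =
  fixes M :: "'w measure" and H :: real and X :: "real \<Rightarrow> 'w \<Rightarrow> real" and a :: "nat \<Rightarrow> real" and K :: nat
  assumes H: "0 < H" "H < 1" and fbm: "fractional_brownian_motion M H X"
    and a0: "(\<Sum>p=0..K. a p) = 0" and a1: "(\<Sum>p=0..K. real p * a p) = 0" and a_nz: "\<exists>p\<le>K. a p \<noteq> 0"
begin

sublocale prob_space M
  using fbm unfolding fractional_brownian_motion_def gaussian_process_def by simp

lemma X_measurable [measurable]: "X t \<in> borel_measurable M"
  using fbm unfolding fractional_brownian_motion_def gaussian_process_def by simp

definition var1 :: real where "var1 = expectation (\<lambda>w. (X 1 w)\<^sup>2)"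

lemma var1_pos: "var1 > 0"
  using fbm unfolding fractional_brownian_motion_def var1_def by simp

lemma X_mean: "expectation (X t) = 0"
  using fbm unfolding fractional_brownian_motion_def by simp

lemma X_cov: "expectation (\<lambda>w. X t w * X s w) = var1 / 2 * (\<bar>s\<bar> powr (2 * H) + \<bar>t\<bar> powr (2 * H) - \<bar>s - t\<bar> powr (2 * H))"
  using fbm unfolding fractional_brownian_motion_def var1_def by simp

text \<open>The times \<open>\<tau> j\<close> may coincide, as they do for overlapping increments; equal times are collected first.\<close>
lemma lin_comb_law:
  assumes "finite S"
  obtains m s where "s \<ge> 0" "distr M borel (\<lambda>w. \<Sum>j\<in>S. b j * X (\<tau> j) w) = normal_law m s"
proof -
  define c where "c t = (\<Sum>j\<in>{j \<in> S. \<tau> j = t}. b j)" for t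
  have eq: "(\<Sum>j\<in>S. b j * X (\<tau> j) w) = (\<Sum>t\<in>\<tau> ` S. c t * X t w)" for w
  proof -
    have "(\<Sum>j\<in>S. b j * X (\<tau> j) w) = (\<Sum>t\<in>\<tau> ` S. \<Sum>j\<in>{j \<in> S. \<tau> j = t}. b j * X (\<tau> j) w)"
      by (rule sum.image_gen[OF assms])
    also have "\<dots> = (\<Sum>t\<in>\<tau> ` S. c t * X t w)"
      unfolding c_def sum_distrib_right by (intro sum.cong refl) auto
    finally show ?thesis .
  qed
  have "finite (\<tau> ` S)" using assms by simp
  then have "\<exists>m s. s \<ge> 0 \<and> distr M borel (\<lambda>w. \<Sum>t\<in>\<tau> ` S. c t * X t w) = normal_law m s"
    using fbm unfolding fractional_brownian_motion_def gaussian_process_def by blast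
  then show ?thesis using that unfolding eq by blast
qed

lemma lin_comb_L2:
  assumes "finite S"
  shows "integrable M (\<lambda>w. (\<Sum>j\<in>S. b j * X (\<tau> j) w)\<^sup>2)"
proof -
  obtain m s where s: "s \<ge> 0" "distr M borel (\<lambda>w. \<Sum>j\<in>S. b j * X (\<tau> j) w) = normal_law m s" using lin_comb_law[OF assms] .
  have "integrable (distr M borel (\<lambda>w. \<Sum>j\<in>S. b j * X (\<tau> j) w)) (\<lambda>x. x\<^sup>2)"
    unfolding s(2) by (rule normal_law_moments(1)[OF s(1)])
  then show ?thesis by (subst (asm) integrable_distr_eq) auto
qed

lemma X_L2: "integrable M (\<lambda>w. (X t w)\<^sup>2)"
  using lin_comb_L2[of "{()}" "\<lambda>_. 1" "\<lambda>_. t"] by simp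

lemma X_L1: "integrable M (X t)"
  using square_integrable_imp_integrable[OF X_measurable X_L2] .

lemma X_prod: "integrable M (\<lambda>w. X s w * X t w)"
  by (rule integrable_mult_square_integrable[OF X_measurable X_measurable X_L2 X_L2])

lemma lin_comb_trig:
  fixes S :: "'j set" and b \<tau> :: "'j \<Rightarrow> real"
  assumes S: "finite S"
  defines "Z \<equiv> \<lambda>w. \<Sum>j\<in>S. b j * X (\<tau> j) w"
  shows "expectation (\<lambda>w. cos (Z w)) = exp (- expectation (\<lambda>w. (Z w)\<^sup>2) / 2)" "expectation (\<lambda>w. sin (Z w)) = 0"
proof -
  obtain m s where s: "s \<ge> 0" "distr M borel Z = normal_law m s" using lin_comb_law[OF S, of b \<tau>] unfolding Z_def .
  have [measurable]: "Z \<in> borel_measurable M" unfolding Z_def by measurable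
  have tr: "expectation (\<lambda>w. f (Z w)) = (\<integral>x. f x \<partial>normal_law m s)" if "f \<in> borel_measurable borel" for f :: "real \<Rightarrow> real"
    unfolding s(2)[symmetric] using that by (subst integral_distr) auto
  have "m = expectation Z" using tr[of "\<lambda>x. x"] normal_law_moments(2)[OF s(1)] by simp
  also have "\<dots> = 0" unfolding Z_def by (simp add: X_L1 X_mean)
  finally have m: "m = 0" .
  have "expectation (\<lambda>w. (Z w)\<^sup>2) = s" using tr[of "\<lambda>x. x\<^sup>2"] normal_law_moments(3)[OF s(1), of m] m by simp
  then show "expectation (\<lambda>w. cos (Z w)) = exp (- expectation (\<lambda>w. (Z w)\<^sup>2) / 2)" "expectation (\<lambda>w. sin (Z w)) = 0"
    using tr[of cos] tr[of sin] cos_sin_normal_law[OF s(1), of 1] m by simp_all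
qed

lemma incr_measurable [measurable]: "incr a K X p n \<in> borel_measurable M"
  unfolding incr_def[abs_def] by measurable

lemma incr_L2: "integrable M (\<lambda>w. (incr a K X p n w)\<^sup>2)"
  unfolding incr_def by (rule lin_comb_L2) simp

lemma incr_mean: "expectation (incr a K X p n) = 0"
  unfolding incr_def by (simp add: X_L1 X_mean)

text \<open>The increment form with lag \<open>r\<close>, where the second increment is stretched by the factor \<open>k\<close>.\<close>
definition D :: "real \<Rightarrow> real \<Rightarrow> real" where
  "D k r = (\<Sum>p=0..K. \<Sum>p'=0..K. a p * a p' * \<bar>r + real p - k * real p'\<bar> powr (2 * H))"

text \<open>The terms of the covariance that depend on one time only are annihilated by the vanishing sum of the
coefficients.\<close>
lemma incr_cov:
  "expectation (\<lambda>w. incr a K X p n w * incr a K X p' n' w)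
    = - var1 / 2 * (\<Sum>k=0..K. \<Sum>k'=0..K. a k * a k' * \<bar>(real k + real p) / real n - (real k' + real p') / real n'\<bar> powr (2 * H))"
proof -
  let ?s = "\<lambda>k. (real k + real p) / real n" and ?t = "\<lambda>k. (real k + real p') / real n'"
  have "expectation (\<lambda>w. incr a K X p n w * incr a K X p' n' w)
    = expectation (\<lambda>w. \<Sum>k=0..K. \<Sum>k'=0..K. a k * a k' * (X (?s k) w * X (?t k') w))"
    unfolding incr_def sum_product by (simp only: mult_ac)
  also have "\<dots> = (\<Sum>k=0..K. \<Sum>k'=0..K. a k * a k' * (var1 / 2 * (\<bar>?t k'\<bar> powr (2 * H) + \<bar>?s k\<bar> powr (2 * H) - \<bar>?t k' - ?s k\<bar> powr (2 * H))))"
    by (simp add: X_prod X_cov)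
  also have "\<dots> = var1 / 2 * ((\<Sum>k=0..K. \<Sum>k'=0..K. a k * (a k' * \<bar>?t k'\<bar> powr (2 * H))) + (\<Sum>k=0..K. \<Sum>k'=0..K. (a k * \<bar>?s k\<bar> powr (2 * H)) * a k')
      - (\<Sum>k=0..K. \<Sum>k'=0..K. a k * a k' * \<bar>?t k' - ?s k\<bar> powr (2 * H)))"
    unfolding sum_distrib_left sum.distrib[symmetric] sum_subtractf[symmetric] by (intro sum.cong refl) (simp add: algebra_simps)
  also have "\<dots> = - var1 / 2 * (\<Sum>k=0..K. \<Sum>k'=0..K. a k * a k' * \<bar>?t k' - ?s k\<bar> powr (2 * H))"
    unfolding sum_product[symmetric] a0 by simp
  finally show ?thesis by (simp only: abs_minus_commute)
qed

lemma D_eq: "rho a K H r = D 1 (real_of_int r) / D 1 0" "rho1 a K H r = D 2 (real_of_int r) / (2 powr H * D 1 0)"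
  unfolding rho_def rho1_def D_def by simp_all

lemma D0_neg: "D 1 0 < 0"
proof -
  obtain q where "q \<le> K" "a q \<noteq> 0" using a_nz by blast
  then show ?thesis using abs_powr_strictly_negative_definite[where h = "2 * H" and K = K and a = a and q = q] H a0 unfolding D_def by simp
qed

lemma incr_sd_sq: "(incr_sd M a K X)\<^sup>2 = - var1 / 2 * D 1 0" and incr_sd_pos: "incr_sd M a K X > 0"
proof -
  have "expectation (\<lambda>w. incr a K X 0 1 w * incr a K X 0 1 w) = - var1 / 2 * D 1 0"
    unfolding incr_cov D_def by simp
  then have v: "variance (incr a K X 0 1) = - var1 / 2 * D 1 0"
    by (simp add: incr_mean power2_eq_square)
  have p: "- var1 / 2 * D 1 0 > 0" using var1_pos D0_neg by (simp add: mult_pos_neg)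
  show "(incr_sd M a K X)\<^sup>2 = - var1 / 2 * D 1 0" "incr_sd M a K X > 0"
    unfolding incr_sd_def v using p by simp_all
qed

abbreviation sd :: real where "sd \<equiv> incr_sd M a K X"

definition scale :: "nat \<Rightarrow> nat" where "scale n = max 1 n"

lemma scale_pos: "real (scale n) > 0" by (simp add: scale_def)

text \<open>The increments at position \<open>snd i\<close> and scale \<open>fst i\<close>, normalised to variance one by self-similarity.
The meaningless scale \<open>0\<close> is replaced by \<open>1\<close>, so that all indices belong to the family.\<close>
definition \<zeta> :: "nat \<times> nat \<Rightarrow> 'w \<Rightarrow> real" where
  "\<zeta> i w = real (scale (fst i)) powr H / sd * incr a K X (snd i) (scale (fst i)) w"

definition R :: "nat \<times> nat \<Rightarrow> nat \<times> nat \<Rightarrow> real" where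
  "R i j = expectation (\<lambda>w. \<zeta> i w * \<zeta> j w)"

lemma \<zeta>_measurable [measurable]: "\<zeta> i \<in> borel_measurable M"
  unfolding \<zeta>_def[abs_def] by measurable

lemma \<zeta>_L2: "integrable M (\<lambda>w. (\<zeta> i w)\<^sup>2)"
  unfolding \<zeta>_def power_mult_distrib by (intro integrable_mult_right incr_L2)

lemma R_eq:
  "R i j = real (scale (fst i)) powr H * real (scale (fst j)) powr H *
    (\<Sum>k=0..K. \<Sum>k'=0..K. a k * a k' * \<bar>(real k + real (snd i)) / real (scale (fst i)) - (real k' + real (snd j)) / real (scale (fst j))\<bar> powr (2 * H)) / D 1 0"
proof -
  have "R i j = real (scale (fst i)) powr H * real (scale (fst j)) powr H / sd\<^sup>2 *
     expectation (\<lambda>w. incr a K X (snd i) (scale (fst i)) w * incr a K X (snd j) (scale (fst j)) w)"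
  proof -
    have "\<zeta> i w * \<zeta> j w = (real (scale (fst i)) powr H * real (scale (fst j)) powr H / sd\<^sup>2) * (incr a K X (snd i) (scale (fst i)) w * incr a K X (snd j) (scale (fst j)) w)" for w
      unfolding \<zeta>_def by (simp add: power2_eq_square)
    then show ?thesis unfolding R_def by simp
  qed
  then show ?thesis unfolding incr_cov incr_sd_sq using var1_pos D0_neg by (simp add: field_simps)
qed

text \<open>By self-similarity the correlation depends only on the lag, not on the scale.\<close>
lemma R_same_scale: "R (n, p) (n, p') = rho a K H (int p - int p')"
proof -
  let ?N = "real (scale n)"
  have "\<bar>(real k + real p) / ?N - (real k' + real p') / ?N\<bar> powr (2 * H) = ?N powr (- 2 * H) * \<bar>real_of_int (int p - int p') + real k - 1 * real k'\<bar> powr (2 * H)" for k k'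
  proof -
    have "(real k + real p) / ?N - (real k' + real p') / ?N = (real_of_int (int p - int p') + real k - 1 * real k') / ?N"
      using scale_pos[of n] by (simp add: field_simps)
    then show ?thesis using scale_pos[of n] by (simp add: powr_divide powr_minus_divide)
  qed
  then have "R (n, p) (n, p') = ?N powr H * ?N powr H * (\<Sum>k=0..K. \<Sum>k'=0..K. a k * a k' * (?N powr (- 2 * H) * \<bar>real_of_int (int p - int p') + real k - 1 * real k'\<bar> powr (2 * H))) / D 1 0"
    unfolding R_eq by simp
  also have "\<dots> = (?N powr H * ?N powr H * ?N powr (- 2 * H)) * D 1 (real_of_int (int p - int p')) / D 1 0"
    unfolding D_def sum_distrib_left sum_distrib_right by (simp add: mult_ac)
  also have "?N powr H * ?N powr H * ?N powr (- 2 * H) = 1"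
    unfolding powr_add[symmetric] using scale_pos[of n] by simp
  finally show ?thesis by (simp add: D_eq)
qed

lemma R_two_scales:
  assumes "m > 0"
  shows "R (2 * m, p) (m, p') = rho1 a K H (int p - 2 * int p')"
proof -
  have sc: "real (scale (2 * m)) = 2 * real m" "real (scale m) = real m" using assms by (auto simp: scale_def)
  let ?N = "2 * real m"
  have mp: "real m > 0" using assms by simp
  have "\<bar>(real k + real p) / ?N - (real k' + real p') / real m\<bar> powr (2 * H) = ?N powr (- 2 * H) * \<bar>real_of_int (int p - 2 * int p') + real k - 2 * real k'\<bar> powr (2 * H)" for k k'
  proof -
    have "(real k + real p) / ?N - (real k' + real p') / real m = (real_of_int (int p - 2 * int p') + real k - 2 * real k') / ?N"
      using mp by (simp add: field_simps)
    then show ?thesis using mp by (simp add: powr_divide powr_minus_divide)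
  qed
  then have "R (2 * m, p) (m, p') = ?N powr H * real m powr H * (\<Sum>k=0..K. \<Sum>k'=0..K. a k * a k' * (?N powr (- 2 * H) * \<bar>real_of_int (int p - 2 * int p') + real k - 2 * real k'\<bar> powr (2 * H))) / D 1 0"
    unfolding R_eq fst_conv snd_conv sc by simp
  also have "\<dots> = (?N powr H * real m powr H * ?N powr (- 2 * H)) * D 2 (real_of_int (int p - 2 * int p')) / D 1 0"
    unfolding D_def sum_distrib_left sum_distrib_right by (simp add: mult_ac)
  also have "?N powr H * real m powr H * ?N powr (- 2 * H) = (?N powr H * ?N powr H * ?N powr (- 2 * H)) / 2 powr H"
    using mp by (simp add: powr_mult)
  also have "?N powr H * ?N powr H * ?N powr (- 2 * H) = 1"
    unfolding powr_add[symmetric] using mp by simp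
  finally show ?thesis by (simp add: D_eq)
qed

lemma rho_0: "rho a K H 0 = 1"
  unfolding D_eq using D0_neg by simp

sublocale G: std_gaussian_family M \<zeta> R
proof
  fix T :: "(nat \<times> nat) set" and c :: "nat \<times> nat \<Rightarrow> real" assume T: "finite T"
  define b where "b j = c (fst j) * (real (scale (fst (fst j))) powr H / sd * a (snd j))" for j :: "(nat \<times> nat) \<times> nat"
  define \<tau> where "\<tau> j = (real (snd j) + real (snd (fst j))) / real (scale (fst (fst j)))" for j :: "(nat \<times> nat) \<times> nat"
  have eq: "(\<Sum>t\<in>T. c t * \<zeta> t w) = (\<Sum>j\<in>T \<times> {0..K}. b j * X (\<tau> j) w)" for w
  proof -
    have "(\<Sum>j\<in>T \<times> {0..K}. b j * X (\<tau> j) w) = (\<Sum>t\<in>T. \<Sum>k=0..K. b (t, k) * X (\<tau> (t, k)) w)"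
      by (simp add: sum.cartesian_product)
    also have "\<dots> = (\<Sum>t\<in>T. c t * \<zeta> t w)"
      unfolding \<zeta>_def incr_def b_def \<tau>_def sum_distrib_left by (simp add: mult_ac)
    finally show ?thesis ..
  qed
  have fin: "finite (T \<times> {0..K})" using T by simp
  have ij: "integrable M (\<lambda>w. \<zeta> s w * \<zeta> t w)" for s t
    by (rule integrable_mult_square_integrable[OF \<zeta>_measurable \<zeta>_measurable \<zeta>_L2 \<zeta>_L2])
  have "expectation (\<lambda>w. (\<Sum>t\<in>T. c t * \<zeta> t w)\<^sup>2) = expectation (\<lambda>w. \<Sum>s\<in>T. \<Sum>t\<in>T. c s * c t * (\<zeta> s w * \<zeta> t w))"
    unfolding power2_eq_square sum_product by (simp only: mult_ac)
  also have "\<dots> = (\<Sum>s\<in>T. \<Sum>t\<in>T. c s * c t * R s t)" by (simp add: ij R_def)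
  finally have q: "expectation (\<lambda>w. (\<Sum>t\<in>T. c t * \<zeta> t w)\<^sup>2) = (\<Sum>s\<in>T. \<Sum>t\<in>T. c s * c t * R s t)" .
  show "expectation (\<lambda>w. cos (\<Sum>t\<in>T. c t * \<zeta> t w)) = exp (- (\<Sum>s\<in>T. \<Sum>t\<in>T. c s * c t * R s t) / 2)"
    unfolding q[symmetric] unfolding eq by (rule lin_comb_trig(1)[OF fin])
  show "expectation (\<lambda>w. sin (\<Sum>t\<in>T. c t * \<zeta> t w)) = 0"
    unfolding eq by (rule lin_comb_trig(2)[OF fin])
next
  fix i show "R i i = 1" using R_same_scale[of "fst i" "snd i" "snd i"] by (simp add: rho_0)
next
  fix i j show "R i j = R j i" unfolding R_def by (simp add: mult.commute)
qed simp

lemma rho_summable: "(\<lambda>r. \<bar>rho a K H r\<bar>) summable_on UNIV" and rho1_summable: "(\<lambda>r. \<bar>rho1 a K H r\<bar>) summable_on UNIV"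
proof -
  have D: "(\<lambda>r::int. \<bar>D k (real_of_int r)\<bar>) summable_on UNIV" for k
    unfolding D_def using H by (intro double_increment_summable[OF a0 a1]) simp
  have "(\<lambda>r. \<bar>D 1 (real_of_int r)\<bar> * (1 / \<bar>D 1 0\<bar>)) summable_on UNIV" by (rule summable_on_cmult_left[OF D])
  then show "(\<lambda>r. \<bar>rho a K H r\<bar>) summable_on UNIV" by (simp add: D_eq(1) abs_divide)
  have "(\<lambda>r. \<bar>D 2 (real_of_int r)\<bar> * (1 / \<bar>2 powr H * D 1 0\<bar>)) summable_on UNIV" by (rule summable_on_cmult_left[OF D])
  then show "(\<lambda>r. \<bar>rho1 a K H r\<bar>) summable_on UNIV" by (simp add: D_eq(2) abs_divide)
qed

text \<open>Every value of \<^const>\<open>rho\<close> is a correlation between two members of the family.\<close>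
lemma abs_rho_le_1: "\<bar>rho a K H r\<bar> \<le> 1"
proof -
  have "r = int (nat r) - int (nat (- r))" by simp
  then show ?thesis using G.abs_r_le_1[of "(1, nat r)" "(1, nat (- r))"] R_same_scale[of 1 "nat r" "nat (- r)"] by simp
qed

lemma abs_rho1_le_1: "\<bar>rho1 a K H r\<bar> \<le> 1"
proof -
  have "r = int (nat r + nat (- r)) - 2 * int (nat (- r))" by auto
  then show ?thesis using G.abs_r_le_1[of "(2 * 1, nat r + nat (- r))" "(1, nat (- r))"] R_two_scales[of 1 "nat r + nat (- r)" "nat (- r)"] by simp
qed

end

section \<open>Power variations as Hermite sums\<close>

text \<open>Since \<open>\<bar>R r\<bar> \<le> 1\<close>, the inner sums are bounded by the sum of \<open>\<bar>R r\<bar>\<close> for every \<open>q \<ge> 1\<close>, and the coefficients are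
summable against the weights \<open>fact q\<close> because \<open>\<bar>g q * h q\<bar> \<le> (g q)\<^sup>2 + (h q)\<^sup>2\<close>. The terms below \<open>d\<close> vanish.\<close>
lemma herm_series_sums:
  fixes R :: "int \<Rightarrow> real"
  assumes g: "summable (\<lambda>q. fact q * (g q)\<^sup>2)" and h: "summable (\<lambda>q. fact q * (h q)\<^sup>2)"
    and R: "(\<lambda>r. \<bar>R r\<bar>) summable_on UNIV" "\<And>r. \<bar>R r\<bar> \<le> 1"
    and g0: "g 0 = 0" and d: "\<And>q. q < d \<Longrightarrow> g q = 0"
  shows "(\<lambda>q. fact q * g q * h q * infsum (\<lambda>r. R r ^ q) UNIV) sums herm_series d g h R"
proof -
  define A where "A = infsum (\<lambda>r. \<bar>R r\<bar>) UNIV"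
  let ?F = "\<lambda>q. fact q * g q * h q * infsum (\<lambda>r. R r ^ q) UNIV"
  have S: "\<bar>infsum (\<lambda>r. R r ^ q) UNIV\<bar> \<le> A" if "q \<ge> 1" for q
  proof -
    have le: "\<bar>R r ^ q\<bar> \<le> \<bar>R r\<bar>" for r
      using power_decreasing[OF that, of "\<bar>R r\<bar>"] R(2)[of r] by (simp add: power_abs)
    have s: "(\<lambda>r. \<bar>R r ^ q\<bar>) summable_on UNIV"
      by (rule summable_on_comparison_test[OF R(1)]) (use le in auto)
    have "\<bar>infsum (\<lambda>r. R r ^ q) UNIV\<bar> \<le> infsum (\<lambda>r. \<bar>R r ^ q\<bar>) UNIV"
      using norm_infsum_bound[of "\<lambda>r. R r ^ q" UNIV] s by simp
    also have "\<dots> \<le> A" unfolding A_def by (rule infsum_mono[OF s R(1)]) (use le in auto)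
    finally show ?thesis .
  qed
  have A0: "A \<ge> 0" unfolding A_def by (rule infsum_nonneg) simp
  have "summable (\<lambda>q. A * (fact q * (g q)\<^sup>2 + fact q * (h q)\<^sup>2))"
    by (intro summable_mult summable_add g h)
  moreover have "norm (norm (?F q)) \<le> A * (fact q * (g q)\<^sup>2 + fact q * (h q)\<^sup>2)" for q
  proof (cases "q = 0")
    case True then show ?thesis using g0 A0 by simp
  next
    case False
    have gh: "\<bar>g q * h q\<bar> \<le> (g q)\<^sup>2 + (h q)\<^sup>2"
      using sum_squares_bound[of "\<bar>g q\<bar>" "\<bar>h q\<bar>"] mult_nonneg_nonneg[of "\<bar>g q\<bar>" "\<bar>h q\<bar>"]
      unfolding abs_mult power2_abs by linarith
    have "norm (norm (?F q)) = fact q * \<bar>g q * h q\<bar> * \<bar>infsum (\<lambda>r. R r ^ q) UNIV\<bar>" by (simp add: abs_mult)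
    also have "\<dots> \<le> fact q * ((g q)\<^sup>2 + (h q)\<^sup>2) * A"
      using gh S[of q] False by (intro mult_mono) auto
    finally show ?thesis by (simp add: algebra_simps)
  qed
  ultimately have n: "summable (\<lambda>q. norm (?F q))" by (rule summable_comparison_test'[where N = 0])
  have "(?F has_sum suminf ?F) UNIV"
    by (rule norm_summable_imp_has_sum[OF n summable_sums[OF summable_norm_cancel[OF n]]])
  then have "infsum ?F UNIV = suminf ?F" by (rule infsumI)
  moreover have "infsum ?F UNIV = herm_series d g h R" unfolding herm_series_def
    by (rule infsum_cong_neutral) (use d in auto)
  ultimately show ?thesis using summable_sums[OF summable_norm_cancel[OF n]] by simp
qed

definition gauss_moment :: "real \<Rightarrow> real" where
  "gauss_moment \<gamma> = 2 powr (\<gamma> / 2) * Gamma ((1 + \<gamma>) / 2) / sqrt pi"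

lemma gauss_moment_pos: "\<gamma> > - 1 \<Longrightarrow> gauss_moment \<gamma> > 0"
  unfolding gauss_moment_def by (intro divide_pos_pos mult_pos_pos Gamma_real_pos) auto

context fbm_increments
begin

lemma K_pos: "K \<ge> 1"
proof (rule ccontr)
  assume "\<not> K \<ge> 1"
  then have "K = 0" by simp
  then show False using a0 a_nz by simp
qed

lemma \<zeta>_unit_scale: "\<zeta> (1, 0) w = incr a K X 0 1 w / sd"
  by (simp add: \<zeta>_def scale_def)

text \<open>The first normalised increment is standard normal, so the centring constant is a Gaussian moment.\<close>
lemma f_fun_eq:
  assumes "\<gamma> > - 1"
  shows "f_fun M a K X \<gamma> = (\<lambda>x. sd powr \<gamma> * (\<bar>x\<bar> powr \<gamma> - gauss_moment \<gamma>))"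
proof -
  have "expectation (\<lambda>w. \<bar>incr a K X 0 1 w / sd\<bar> powr \<gamma>) = gauss_moment \<gamma>"
    using G.integral_\<xi>[of "\<lambda>x. \<bar>x\<bar> powr \<gamma>" "(1, 0)"] std_gauss_abs_powr(2)[OF assms]
    unfolding \<zeta>_unit_scale gauss_moment_def by simp
  then show ?thesis unfolding f_fun_def[abs_def] by simp
qed

lemma abs_moment_eq:
  assumes "\<gamma> > - 1"
  shows "abs_moment M a K X \<gamma> = sd powr \<gamma> * gauss_moment \<gamma>"
proof -
  have eq: "\<bar>incr a K X 0 1 w\<bar> powr \<gamma> = sd powr \<gamma> * \<bar>\<zeta> (1, 0) w\<bar> powr \<gamma>" for w
    unfolding \<zeta>_unit_scale using incr_sd_pos by (simp add: powr_divide)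
  show ?thesis unfolding abs_moment_def eq
    using G.integral_\<xi>[of "\<lambda>x. \<bar>x\<bar> powr \<gamma>" "(1, 0)"] std_gauss_abs_powr(2)[OF assms]
    unfolding gauss_moment_def by simp
qed

lemma abs_moment_pos: "\<gamma> > - 1 \<Longrightarrow> abs_moment M a K X \<gamma> > 0"
  unfolding abs_moment_eq using incr_sd_pos gauss_moment_pos[of \<gamma>] by simp

lemma approximable_f_fun:
  assumes "- 1 / 2 < \<gamma>" "\<gamma> < 0"
  shows "approximable (f_fun M a K X \<gamma>)"
proof -
  have "approximable (\<lambda>x. poly [: - (sd powr \<gamma> * gauss_moment \<gamma>) :] x + sd powr \<gamma> * \<bar>x\<bar> powr \<gamma>)"
    by (rule approximable_lincomb[OF approximable_poly approximable_abs_powr[OF assms]])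
  moreover have "f_fun M a K X \<gamma> = (\<lambda>x. poly [: - (sd powr \<gamma> * gauss_moment \<gamma>) :] x + sd powr \<gamma> * \<bar>x\<bar> powr \<gamma>)"
    using assms by (subst f_fun_eq) (auto simp: algebra_simps)
  ultimately show ?thesis by simp
qed

lemma f_fun_hermite_exp:
  assumes "- 1 / 2 < \<gamma>" "\<gamma> < 0"
  shows "has_hermite_exp (f_fun M a K X \<gamma>) (f_coeff M a K X \<gamma>)"
proof -
  note h = approximable_imp_has_hermite_exp[OF approximable_f_fun[OF assms]]
  show ?thesis unfolding f_coeff_def hermite_coeff_eq[OF h] by (rule h)
qed

lemma f_coeff_0:
  assumes "- 1 / 2 < \<gamma>" "\<gamma> < 0"
  shows "f_coeff M a K X \<gamma> 0 = 0"
proof -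
  have g: "\<gamma> > - 1" using assms by simp
  note p = std_gauss_abs_powr[OF g]
  have "(\<integral>x. f_fun M a K X \<gamma> x * hermite 0 x \<partial>std_gauss) = sd powr \<gamma> * ((\<integral>x. \<bar>x\<bar> powr \<gamma> \<partial>std_gauss) - (\<integral>x. gauss_moment \<gamma> \<partial>std_gauss))"
    unfolding f_fun_eq[OF g] using p(1) by (simp add: Bochner_Integration.integral_diff)
  also have "\<dots> = 0" unfolding p(2) gauss_moment_def using std_gauss.prob_space by simp
  finally show ?thesis using has_hermite_exp_coeff[OF f_fun_hermite_exp[OF assms], of 0] by simp
qed

lemma f_coeff_below_rank: "q < f_rank M a K X \<gamma> \<Longrightarrow> f_coeff M a K X \<gamma> q = 0"
  unfolding f_rank_def hermite_rank_def f_coeff_def using not_less_Least by blast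

text \<open>The indices of the increments that enter the power variation at scale \<open>n\<close>.\<close>
definition blk :: "nat \<Rightarrow> (nat \<times> nat) set" where
  "blk n = Pair n ` {..<n - K + 1}"

lemma finite_blk [simp]: "finite (blk n)" by (simp add: blk_def)

lemma sum_blk: "(\<Sum>i\<in>blk n. F i) = (\<Sum>p<n - K + 1. F (n, p))"
  unfolding blk_def by (subst sum.reindex) (auto simp: inj_on_def)

lemma card_blk: "card (blk n) = n - K + 1"
  unfolding blk_def by (subst card_image) (auto simp: inj_on_def)

text \<open>The factor \<open>n powr (\<gamma> * H)\<close> in \<^const>\<open>W_stat\<close> is exactly the one that normalises the increments, so the statistic is
an average of \<^const>\<open>f_fun\<close> over the Gaussian family.\<close>
lemma W_stat_centered:
  assumes \<gamma>: "\<gamma> > - 1" and n: "n \<ge> 1"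
  shows "W_stat a K H X \<gamma> n w - abs_moment M a K X \<gamma> = (\<Sum>i\<in>blk n. 1 / real (n - K + 1) * f_fun M a K X \<gamma> (\<zeta> i w))"
proof -
  have f: "f_fun M a K X \<gamma> (\<zeta> (n, p) w) = real n powr (\<gamma> * H) * \<bar>incr a K X p n w\<bar> powr \<gamma> - abs_moment M a K X \<gamma>" for p
  proof -
    have "\<bar>\<zeta> (n, p) w\<bar> powr \<gamma> = (real n powr H * (1 / sd) * \<bar>incr a K X p n w\<bar>) powr \<gamma>"
      using n incr_sd_pos by (simp add: \<zeta>_def scale_def abs_mult)
    also have "\<dots> = (real n powr H) powr \<gamma> * (1 / sd) powr \<gamma> * \<bar>incr a K X p n w\<bar> powr \<gamma>"
      using incr_sd_pos by (simp add: powr_mult powr_divide)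
    also have "\<dots> = real n powr (\<gamma> * H) * (1 / sd) powr \<gamma> * \<bar>incr a K X p n w\<bar> powr \<gamma>"
      by (simp add: powr_powr mult.commute)
    finally have z: "\<bar>\<zeta> (n, p) w\<bar> powr \<gamma> = real n powr (\<gamma> * H) * (1 / sd) powr \<gamma> * \<bar>incr a K X p n w\<bar> powr \<gamma>" .
    have s: "sd powr \<gamma> * (1 / sd) powr \<gamma> = 1" using incr_sd_pos by (simp add: powr_divide)
    have "sd powr \<gamma> * \<bar>\<zeta> (n, p) w\<bar> powr \<gamma> = (sd powr \<gamma> * (1 / sd) powr \<gamma>) * (real n powr (\<gamma> * H) * \<bar>incr a K X p n w\<bar> powr \<gamma>)"
      unfolding z by (simp only: mult_ac)
    then show ?thesis unfolding f_fun_eq[OF \<gamma>] abs_moment_eq[OF \<gamma>] s by (simp add: right_diff_distrib)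
  qed
  have set: "{0..n - K} = {..<n - K + 1}" by auto
  have "(\<Sum>i\<in>blk n. 1 / real (n - K + 1) * f_fun M a K X \<gamma> (\<zeta> i w))
    = 1 / real (n - K + 1) * (real n powr (\<gamma> * H) * (\<Sum>p<n - K + 1. \<bar>incr a K X p n w\<bar> powr \<gamma>) - real (n - K + 1) * abs_moment M a K X \<gamma>)"
    unfolding sum_blk f sum_distrib_left[symmetric] sum_subtractf by simp
  also have "\<dots> = W_stat a K H X \<gamma> n w - abs_moment M a K X \<gamma>"
    unfolding W_stat_def V_stat_def set by (simp add: field_simps)
  finally show ?thesis ..
qed

lemma W_stat_measurable [measurable]: "W_stat a K H X \<gamma> n \<in> borel_measurable M"
  unfolding W_stat_def[abs_def] V_stat_def by measurable

definition rho_mass :: real where "rho_mass = infsum (\<lambda>r. \<bar>rho a K H r\<bar>) UNIV"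
definition rho1_mass :: real where "rho1_mass = infsum (\<lambda>r. \<bar>rho1 a K H r\<bar>) UNIV"

lemma rho_mass_nonneg: "rho_mass \<ge> 0" and rho1_mass_nonneg: "rho1_mass \<ge> 0"
  unfolding rho_mass_def rho1_mass_def by (simp_all add: infsum_nonneg)

lemma reindexed_sum_le:
  fixes g :: "int \<Rightarrow> real" and \<phi> :: "nat \<Rightarrow> int"
  assumes g: "(\<lambda>r. \<bar>g r\<bar>) summable_on UNIV" and "inj_on \<phi> {..<N}"
  shows "(\<Sum>p<N. \<bar>g (\<phi> p)\<bar>) \<le> infsum (\<lambda>r. \<bar>g r\<bar>) UNIV"
proof -
  have "(\<Sum>p<N. \<bar>g (\<phi> p)\<bar>) = (\<Sum>r\<in>\<phi> ` {..<N}. \<bar>g r\<bar>)" using assms(2) by (simp add: sum.reindex)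
  also have "\<dots> \<le> infsum (\<lambda>r. \<bar>g r\<bar>) UNIV" by (rule finite_sum_le_infsum[OF g]) auto
  finally show ?thesis .
qed

lemma row_same: "i \<in> blk n \<Longrightarrow> (\<Sum>j\<in>blk n. \<bar>R i j\<bar>) \<le> rho_mass"
proof -
  assume "i \<in> blk n"
  then obtain p where "i = (n, p)" by (auto simp: blk_def)
  then show ?thesis unfolding rho_mass_def using reindexed_sum_le[OF rho_summable, of "\<lambda>p'. int p - int p'" "n - K + 1"]
    by (simp add: sum_blk R_same_scale inj_on_def)
qed

lemma row_two_scales:
  assumes m: "m > 0"
  shows "i \<in> blk (2 * m) \<Longrightarrow> (\<Sum>j\<in>blk m. \<bar>R i j\<bar>) \<le> rho1_mass" and "i \<in> blk m \<Longrightarrow> (\<Sum>j\<in>blk (2 * m). \<bar>R i j\<bar>) \<le> rho1_mass"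
proof -
  assume "i \<in> blk (2 * m)"
  then obtain p where i: "i = (2 * m, p)" by (auto simp: blk_def)
  show "(\<Sum>j\<in>blk m. \<bar>R i j\<bar>) \<le> rho1_mass" unfolding rho1_mass_def i sum_blk R_two_scales[OF m]
    by (rule reindexed_sum_le[OF rho1_summable]) (simp add: inj_on_def)
next
  assume "i \<in> blk m"
  then obtain p where i: "i = (m, p)" by (auto simp: blk_def)
  have "R i (2 * m, p') = rho1 a K H (int p' - 2 * int p)" for p'
    unfolding i G.r_sym[of "(m, p)"] by (rule R_two_scales[OF m])
  then show "(\<Sum>j\<in>blk (2 * m). \<bar>R i j\<bar>) \<le> rho1_mass" unfolding rho1_mass_def sum_blk
    using reindexed_sum_le[OF rho1_summable, of "\<lambda>p'. int p' - 2 * int p" "2 * m - K + 1"] by (simp add: inj_on_def)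
qed

lemma W_stat_second_moment:
  assumes \<gamma>: "- 1 / 2 < \<gamma>" "\<gamma> < 0" and n: "n \<ge> 1"
  shows "integrable M (\<lambda>w. (W_stat a K H X \<gamma> n w - abs_moment M a K X \<gamma>)\<^sup>2)"
    and "expectation (\<lambda>w. (W_stat a K H X \<gamma> n w - abs_moment M a K X \<gamma>)\<^sup>2) \<le> rho_mass * (\<integral>x. (f_fun M a K X \<gamma> x)\<^sup>2 \<partial>std_gauss) / real (n - K + 1)"
proof -
  have g: "\<gamma> > - 1" using \<gamma> by simp
  have u: "\<bar>1 / real (n - K + 1)\<bar> \<le> 1 / real (n - K + 1)" for i :: "nat \<times> nat" by simp
  note m = G.hermite_exp_sum_second_moment[OF f_fun_hermite_exp[OF \<gamma>] f_coeff_0[OF \<gamma>] finite_blk, of n "\<lambda>_. 1 / real (n - K + 1)" "1 / real (n - K + 1)" rho_mass, OF u row_same]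
  show "integrable M (\<lambda>w. (W_stat a K H X \<gamma> n w - abs_moment M a K X \<gamma>)\<^sup>2)"
    unfolding W_stat_centered[OF g n] by (rule m(1))
  have "expectation (\<lambda>w. (W_stat a K H X \<gamma> n w - abs_moment M a K X \<gamma>)\<^sup>2) \<le> card (blk n) * (1 / real (n - K + 1))\<^sup>2 * rho_mass * (\<integral>x. (f_fun M a K X \<gamma> x)\<^sup>2 \<partial>std_gauss)"
    unfolding W_stat_centered[OF g n] by (rule m(2))
  also have "real (card (blk n)) * (1 / real (n - K + 1))\<^sup>2 = 1 / real (n - K + 1)"
    unfolding card_blk by (simp add: power2_eq_square)
  finally show "expectation (\<lambda>w. (W_stat a K H X \<gamma> n w - abs_moment M a K X \<gamma>)\<^sup>2) \<le> rho_mass * (\<integral>x. (f_fun M a K X \<gamma> x)\<^sup>2 \<partial>std_gauss) / real (n - K + 1)"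
    by simp
qed

lemma power_summable:
  fixes g :: "int \<Rightarrow> real"
  assumes "(\<lambda>r. \<bar>g r\<bar>) summable_on UNIV" "\<And>r. \<bar>g r\<bar> \<le> 1" "q \<ge> 1"
  shows "(\<lambda>r. \<bar>g r ^ q\<bar>) summable_on UNIV"
proof (rule summable_on_comparison_test[OF assms(1)])
  fix r show "\<bar>g r ^ q\<bar> \<le> \<bar>g r\<bar>"
    using power_decreasing[OF assms(3), of "\<bar>g r\<bar>"] assms(2)[of r] by (simp add: power_abs)
qed simp

lemma cov_sum_same:
  assumes q: "q \<ge> 1" and S: "filterlim S at_top sequentially"
  shows "(\<lambda>n. (\<Sum>i\<in>blk (S n). \<Sum>j\<in>blk (S n). R i j ^ q) / real (S n - K + 1)) \<longlonglongrightarrow> infsum (\<lambda>r. rho a K H r ^ q) UNIV"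
proof -
  have N: "filterlim (\<lambda>n. S n - K + 1) at_top sequentially"
    unfolding filterlim_at_top
  proof
    fix Z show "\<forall>\<^sub>F n in sequentially. Z \<le> S n - K + 1"
      using S[unfolded filterlim_at_top, rule_format, of "Z + K"] by eventually_elim simp
  qed
  have eq: "(\<Sum>i\<in>blk (S n). \<Sum>j\<in>blk (S n). R i j ^ q) = (\<Sum>p'<S n - K + 1. \<Sum>p<S n - K + 1. rho a K H (int p - int 1 * int p') ^ q)" for n
    unfolding sum_blk R_same_scale by (subst sum.swap) simp
  show ?thesis unfolding eq
    by (rule average_shifted_sums[OF power_summable[OF rho_summable abs_rho_le_1 q] N]) auto
qed

lemma cov_sum_two_scales:
  assumes q: "q \<ge> 1" and S: "filterlim S at_top sequentially" "\<And>n. S n \<ge> K"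
  shows "(\<lambda>n. (\<Sum>i\<in>blk (2 * S n). \<Sum>j\<in>blk (S n). R i j ^ q) / real (S n - K + 1)) \<longlonglongrightarrow> infsum (\<lambda>r. rho1 a K H r ^ q) UNIV"
proof -
  have N: "filterlim (\<lambda>n. S n - K + 1) at_top sequentially"
    unfolding filterlim_at_top
  proof
    fix Z show "\<forall>\<^sub>F n in sequentially. Z \<le> S n - K + 1"
      using S(1)[unfolded filterlim_at_top, rule_format, of "Z + K"] by eventually_elim simp
  qed
  have N': "2 * (S n - K + 1) \<le> 2 * S n - K + 1" for n using S(2)[of n] K_pos by arith
  have S0: "S n > 0" for n using S(2)[of n] K_pos by linarith
  have eq: "(\<Sum>i\<in>blk (2 * S n). \<Sum>j\<in>blk (S n). R i j ^ q) = (\<Sum>p'<S n - K + 1. \<Sum>p<2 * S n - K + 1. rho1 a K H (int p - int 2 * int p') ^ q)" for n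
    unfolding sum_blk R_two_scales[OF S0] by (subst sum.swap) simp
  show ?thesis unfolding eq
    by (rule average_shifted_sums[OF power_summable[OF rho1_summable abs_rho1_le_1 q] N N']) auto
qed

end

section \<open>Linear statistics and gradients\<close>

text \<open>Given the Gaussian limit of the linearised statistic, the linearisation error tends to zero in probability
and does not change the limit of the characteristic functions. That \<open>s\<close> is nonnegative comes for free: the
limit \<open>exp (- s / 2)\<close> of real parts of characteristic functions cannot exceed one.\<close>
lemma (in prob_space) delta_clt:
  fixes U V :: "nat \<Rightarrow> 'a \<Rightarrow> real" and g :: "real \<Rightarrow> real \<Rightarrow> real" and s C :: real
  assumes [measurable]: "\<And>n. U n \<in> borel_measurable M" "\<And>n. V n \<in> borel_measurable M"
    and g: "((\<lambda>(x, y). g x y) has_derivative (\<lambda>(dx, dy). g1 * dx + g2 * dy)) (at (x0, y0))"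
    and \<rho>: "filterlim \<rho> at_top sequentially" and C: "C \<ge> 0"
    and U2: "\<forall>\<^sub>F n in sequentially. integrable M (\<lambda>w. (U n w - x0)\<^sup>2) \<and> expectation (\<lambda>w. (U n w - x0)\<^sup>2) \<le> C / (\<rho> n)\<^sup>2"
    and V2: "\<forall>\<^sub>F n in sequentially. integrable M (\<lambda>w. (V n w - y0)\<^sup>2) \<and> expectation (\<lambda>w. (V n w - y0)\<^sup>2) \<le> C / (\<rho> n)\<^sup>2"
    and gm[measurable]: "\<And>n. (\<lambda>w. g (U n w) (V n w)) \<in> borel_measurable M"
    and lc: "\<And>t. (\<lambda>n. expectation (\<lambda>w. cos (t * (\<rho> n * (g1 * (U n w - x0) + g2 * (V n w - y0)))))) \<longlonglongrightarrow> exp (- s * t\<^sup>2 / 2)"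
    and ls: "\<And>t. (\<lambda>n. expectation (\<lambda>w. sin (t * (\<rho> n * (g1 * (U n w - x0) + g2 * (V n w - y0)))))) \<longlonglongrightarrow> 0"
  shows "s \<ge> 0" and "weak_conv_m (\<lambda>n. distr M borel (\<lambda>w. \<rho> n * (g (U n w) (V n w) - g x0 y0))) (normal_law 0 s)"
proof -
  define L where "L n w = \<rho> n * (g1 * (U n w - x0) + g2 * (V n w - y0))" for n w
  define Y where "Y n w = \<rho> n * (g (U n w) (V n w) - g x0 y0)" for n w
  have [measurable]: "L n \<in> borel_measurable M" "Y n \<in> borel_measurable M" for n
    unfolding L_def[abs_def] Y_def[abs_def] by measurable
  have p: "\<forall>\<^sub>F n in sequentially. prob {w \<in> space M. \<bar>Y n w - L n w\<bar> > e} \<le> q" if "e > 0" "q > 0" for e q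
    unfolding Y_def L_def by (rule delta_method_prob[OF assms(1,2) g \<rho> C U2 V2 gm that])
  have lc': "(\<lambda>n. expectation (\<lambda>w. cos (t * L n w))) \<longlonglongrightarrow> exp (- s * t\<^sup>2 / 2)" for t
    unfolding L_def by (rule lc)
  have ls': "(\<lambda>n. expectation (\<lambda>w. sin (t * L n w))) \<longlonglongrightarrow> 0" for t
    unfolding L_def by (rule ls)
  have "expectation (\<lambda>w. cos (1 * L n w)) \<le> 1" for n
  proof -
    have "expectation (\<lambda>w. cos (1 * L n w)) \<le> expectation (\<lambda>w. 1)"
      by (intro integral_mono integrable_cos) auto
    then show ?thesis by (simp add: prob_space)
  qed
  then have "exp (- s * 1\<^sup>2 / 2) \<le> 1" by (intro LIMSEQ_le_const2[OF lc'[of 1]]) auto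
  then show s: "s \<ge> 0" by simp
  have yc: "(\<lambda>n. expectation (\<lambda>w. cos (t * Y n w))) \<longlonglongrightarrow> exp (- s * t\<^sup>2 / 2)" for t
    by (rule trig_limit_transfer[of Y L cos, OF _ _ _ abs_cos_diff_le _ p lc']) auto
  have ys: "(\<lambda>n. expectation (\<lambda>w. sin (t * Y n w))) \<longlonglongrightarrow> 0" for t
    by (rule trig_limit_transfer[of Y L sin, OF _ _ _ abs_sin_diff_le _ p ls']) auto
  have "weak_conv_m (\<lambda>n. distr M borel (Y n)) (normal_law 0 s)"
    by (rule weak_conv_normal[OF _ s yc ys]) simp
  then show "weak_conv_m (\<lambda>n. distr M borel (\<lambda>w. \<rho> n * (g (U n w) (V n w) - g x0 y0))) (normal_law 0 s)"
    unfolding Y_def[abs_def] .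
qed

lemma weak_conv_m_offset: "weak_conv_m (\<lambda>n. \<mu> (n + k)) \<nu> \<Longrightarrow> weak_conv_m \<mu> \<nu>"
  unfolding weak_conv_m_def weak_conv_def by (blast intro: LIMSEQ_offset)

lemma gradient2_eq:
  assumes g: "((\<lambda>(x, y). g x y) has_derivative (\<lambda>(dx, dy). g1 * dx + g2 * dy)) (at (x0, y0))"
  shows "gradient2 g x0 y0 = vector [g1, g2]"
proof -
  have "((\<lambda>s. (s, y0)) has_derivative (\<lambda>d. (d, 0))) (at x0)" by (auto intro!: derivative_eq_intros)
  from has_derivative_compose[OF this g]
  have "((\<lambda>s. g s y0) has_derivative (\<lambda>d. g1 * d)) (at x0)" by simp
  then have 1: "deriv (\<lambda>s. g s y0) x0 = g1" unfolding has_field_derivative_def[symmetric] by (rule DERIV_imp_deriv)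
  have "((\<lambda>t. (x0, t)) has_derivative (\<lambda>d. (0, d))) (at y0)" by (auto intro!: derivative_eq_intros)
  from has_derivative_compose[OF this g]
  have "((\<lambda>t. g x0 t) has_derivative (\<lambda>d. g2 * d)) (at y0)" by simp
  then have 2: "deriv (\<lambda>t. g x0 t) y0 = g2" unfolding has_field_derivative_def[symmetric] by (rule DERIV_imp_deriv)
  show ?thesis unfolding gradient2_def 1 2 by simp
qed

lemma quadratic_form_2:
  fixes g1 g2 p q r :: real
  shows "((vector [g1, g2] :: real^2) v* (vector [vector [p, q], vector [q, r]] :: real^2^2)) \<bullet> vector [g1, g2]
    = g1\<^sup>2 * p + 2 * g1 * g2 * q + g2\<^sup>2 * r"
  by (simp add: vector_matrix_mult_def inner_vec_def sum_2 power2_eq_square algebra_simps)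

text \<open>On the open quadrant the function is \<open>(ln k + ln x - ln y) / (\<beta> * ln 2)\<close>.\<close>
lemma log_ratio_has_derivative:
  fixes k x0 y0 \<beta> :: real
  assumes "k > 0" "x0 > 0" "y0 > 0" "\<beta> \<noteq> 0"
  shows "((\<lambda>(x, y). 1 / \<beta> * log 2 (k * x / y)) has_derivative (\<lambda>(dx, dy). 1 / (\<beta> * ln 2 * x0) * dx + (- 1 / (\<beta> * ln 2 * y0)) * dy)) (at (x0, y0))"
proof -
  have 1: "((\<lambda>z. ln (fst z)) has_derivative (\<lambda>d. fst d * inverse x0)) (at (x0, y0))"
    by (rule DERIV_compose_FDERIV[where f = ln and g = fst]) (use assms in \<open>auto intro: DERIV_ln has_derivative_fst[OF has_derivative_ident]\<close>)
  have 2: "((\<lambda>z. ln (snd z)) has_derivative (\<lambda>d. snd d * inverse y0)) (at (x0, y0))"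
    by (rule DERIV_compose_FDERIV[where f = ln and g = snd]) (use assms in \<open>auto intro: DERIV_ln has_derivative_snd[OF has_derivative_ident]\<close>)
  have 3: "((\<lambda>z. 1 / (\<beta> * ln 2) * (ln k + ln (fst z) - ln (snd z))) has_derivative
     (\<lambda>d. 1 / (\<beta> * ln 2) * (0 + fst d * inverse x0 - snd d * inverse y0))) (at (x0, y0))"
    by (intro has_derivative_add has_derivative_diff has_derivative_mult_right has_derivative_const 1 2)
  have "((\<lambda>(x, y). 1 / \<beta> * log 2 (k * x / y)) has_derivative (\<lambda>d. 1 / (\<beta> * ln 2) * (0 + fst d * inverse x0 - snd d * inverse y0))) (at (x0, y0))"
  proof (rule has_derivative_transform_within_open[OF 3])
    show "open ({0<..} \<times> {0<..} :: (real \<times> real) set)" by (intro open_Times) auto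
    show "(x0, y0) \<in> {0<..} \<times> {0<..}" using assms by simp
    fix z :: "real \<times> real" assume "z \<in> {0<..} \<times> {0<..}"
    then have "fst z > 0" "snd z > 0" by auto
    then show "1 / (\<beta> * ln 2) * (ln k + ln (fst z) - ln (snd z)) = (case z of (x, y) \<Rightarrow> 1 / \<beta> * log 2 (k * x / y))"
      using assms by (simp add: case_prod_unfold log_def ln_mult ln_div)
  qed
  moreover have "(\<lambda>d. 1 / (\<beta> * ln 2) * (0 + fst d * inverse x0 - snd d * inverse y0))
     = (\<lambda>(dx, dy). 1 / (\<beta> * ln 2 * x0) * dx + (- 1 / (\<beta> * ln 2 * y0)) * dy)"
    using assms by (auto simp: fun_eq_iff divide_simps)
  ultimately show ?thesis by simp
qed

lemma hermite_sum_lincomb: "hermite_sum (\<lambda>q. a * c q + b * d q) N x = a * hermite_sum c N x + b * hermite_sum d N x"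
  unfolding hermite_sum_def sum_distrib_left sum.distrib[symmetric] by (intro sum.cong refl) (simp add: algebra_simps)

lemma has_hermite_exp_lincomb:
  assumes f: "has_hermite_exp f c" and g: "has_hermite_exp g d"
  shows "has_hermite_exp (\<lambda>x. a * f x + b * g x) (\<lambda>q. a * c q + b * d q)"
proof -
  have m[measurable]: "f \<in> borel_measurable borel" "g \<in> borel_measurable borel"
    and i: "integrable std_gauss (\<lambda>x. (f x)\<^sup>2)" "integrable std_gauss (\<lambda>x. (g x)\<^sup>2)"
    and lf: "(\<lambda>N. \<integral>x. (f x - hermite_sum c N x)\<^sup>2 \<partial>std_gauss) \<longlonglongrightarrow> 0"
    and lg: "(\<lambda>N. \<integral>x. (g x - hermite_sum d N x)\<^sup>2 \<partial>std_gauss) \<longlonglongrightarrow> 0"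
    using f g by (auto simp: has_hermite_exp_def)
  have ifN: "integrable std_gauss (\<lambda>x. (f x - hermite_sum c N x)\<^sup>2)" for N
    by (rule integrable_square_add(2)) (use i integrable_hermite_sum_square in auto)
  have igN: "integrable std_gauss (\<lambda>x. (g x - hermite_sum d N x)\<^sup>2)" for N
    by (rule integrable_square_add(2)) (use i integrable_hermite_sum_square in auto)
  let ?e = "\<lambda>N x. a * f x + b * g x - hermite_sum (\<lambda>q. a * c q + b * d q) N x"
  have eq: "?e N x = a * (f x - hermite_sum c N x) + b * (g x - hermite_sum d N x)" for N x
    unfolding hermite_sum_lincomb by (simp add: algebra_simps)
  have le: "(?e N x)\<^sup>2 \<le> 2 * a\<^sup>2 * (f x - hermite_sum c N x)\<^sup>2 + 2 * b\<^sup>2 * (g x - hermite_sum d N x)\<^sup>2" for N x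
    unfolding eq using square_add_le[of "a * (f x - hermite_sum c N x)" "b * (g x - hermite_sum d N x)"]
    by (simp add: power_mult_distrib mult.assoc)
  have ie: "integrable std_gauss (\<lambda>x. 2 * a\<^sup>2 * (f x - hermite_sum c N x)\<^sup>2 + 2 * b\<^sup>2 * (g x - hermite_sum d N x)\<^sup>2)" for N
    by (intro Bochner_Integration.integrable_add integrable_mult_right ifN igN)
  have ub: "(\<integral>x. (?e N x)\<^sup>2 \<partial>std_gauss) \<le> 2 * a\<^sup>2 * (\<integral>x. (f x - hermite_sum c N x)\<^sup>2 \<partial>std_gauss) + 2 * b\<^sup>2 * (\<integral>x. (g x - hermite_sum d N x)\<^sup>2 \<partial>std_gauss)" for N
  proof -
    have "(\<integral>x. (?e N x)\<^sup>2 \<partial>std_gauss) \<le> (\<integral>x. 2 * a\<^sup>2 * (f x - hermite_sum c N x)\<^sup>2 + 2 * b\<^sup>2 * (g x - hermite_sum d N x)\<^sup>2 \<partial>std_gauss)"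
      by (rule integral_mono_AE'[OF ie]) (use le in auto)
    also have "\<dots> = 2 * a\<^sup>2 * (\<integral>x. (f x - hermite_sum c N x)\<^sup>2 \<partial>std_gauss) + 2 * b\<^sup>2 * (\<integral>x. (g x - hermite_sum d N x)\<^sup>2 \<partial>std_gauss)"
      by (subst Bochner_Integration.integral_add) (simp_all add: ifN igN integrable_mult_right)
    finally show ?thesis .
  qed
  have "(\<lambda>N. 2 * a\<^sup>2 * (\<integral>x. (f x - hermite_sum c N x)\<^sup>2 \<partial>std_gauss) + 2 * b\<^sup>2 * (\<integral>x. (g x - hermite_sum d N x)\<^sup>2 \<partial>std_gauss)) \<longlonglongrightarrow> 2 * a\<^sup>2 * 0 + 2 * b\<^sup>2 * 0"
    by (intro tendsto_intros lf lg)
  then have lim0: "(\<lambda>N. 2 * a\<^sup>2 * (\<integral>x. (f x - hermite_sum c N x)\<^sup>2 \<partial>std_gauss) + 2 * b\<^sup>2 * (\<integral>x. (g x - hermite_sum d N x)\<^sup>2 \<partial>std_gauss)) \<longlonglongrightarrow> 0"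
    by simp
  have lim: "(\<lambda>N. \<integral>x. (?e N x)\<^sup>2 \<partial>std_gauss) \<longlonglongrightarrow> 0"
  proof (rule tendsto_sandwich[OF _ _ tendsto_const lim0])
    show "\<forall>\<^sub>F N in sequentially. 0 \<le> (\<integral>x. (?e N x)\<^sup>2 \<partial>std_gauss)" by (simp add: integral_nonneg_AE)
  qed (use ub in simp)
  have "integrable std_gauss (\<lambda>x. (a * f x + b * g x)\<^sup>2)"
    by (rule integrable_square_add(1)) (use i in \<open>auto simp: power_mult_distrib\<close>)
  then show ?thesis unfolding has_hermite_exp_def using lim by simp
qed

lemma filterlim_shift_at_top: "filterlim (\<lambda>n::nat. n + k) at_top sequentially"
  by (rule filterlim_at_top_mono[OF filterlim_ident]) simp

lemma const_over_nat_tendsto_0: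
  assumes "filterlim N at_top sequentially"
  shows "(\<lambda>n. c / real (N n)) \<longlonglongrightarrow> 0"
  by (rule tendsto_divide_0[OF tendsto_const filterlim_at_top_imp_at_infinity[OF filterlim_compose[OF filterlim_real_sequentially assms]]])

section \<open>The two estimators\<close>

context fbm_increments
begin

lemma shift_ratio: "(\<lambda>n. real (n + K) / real (n + 1)) \<longlonglongrightarrow> 1"
proof -
  have "(\<lambda>n. 1 + (real K - 1) / real (n + 1)) \<longlonglongrightarrow> 1 + 0"
    by (intro tendsto_add tendsto_const const_over_nat_tendsto_0 filterlim_shift_at_top)
  moreover have "1 + (real K - 1) / real (n + 1) = real (n + K) / real (n + 1)" for n by (simp add: field_simps)
  ultimately show ?thesis by simp
qed

lemma shift_ratio_double: "(\<lambda>n. real (2 * (n + K)) / real (2 * n + K + 1)) \<longlonglongrightarrow> 1"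
proof -
  have "filterlim (\<lambda>n. 2 * n + K + 1) at_top sequentially"
    by (rule filterlim_at_top_mono[OF filterlim_ident]) simp
  then have "(\<lambda>n. 1 + (real K - 1) / real (2 * n + K + 1)) \<longlonglongrightarrow> 1 + 0"
    by (intro tendsto_add tendsto_const const_over_nat_tendsto_0)
  moreover have "1 + (real K - 1) / real (2 * n + K + 1) = real (2 * (n + K)) / real (2 * n + K + 1)" for n by (simp add: field_simps)
  ultimately show ?thesis by simp
qed

lemma shift_le: "real (n + K) \<le> (real K + 1) * real (n + 1)"
  by (simp add: algebra_simps)

lemma shift_ratio_le: "2 * real (n + K) / real (n + 1) \<le> 2 * (real K + 1)"
proof -
  have "2 * real (n + K) \<le> 2 * ((real K + 1) * real (n + 1))" by (rule mult_left_mono[OF shift_le]) simp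
  then show ?thesis by (simp only: divide_le_eq mult.assoc) simp
qed

lemma sqrt_shift_tendsto_0: "(\<lambda>n. sqrt (2 * real (n + K)) / real (n + 1)) \<longlonglongrightarrow> 0"
proof (rule tendsto_sandwich[OF _ _ tendsto_const])
  show "\<forall>\<^sub>F n in sequentially. sqrt (2 * real (n + K)) / real (n + 1) \<le> sqrt (2 * (real K + 1) / real (n + 1))"
  proof (intro always_eventually allI)
    fix n
    have n1: "real (n + 1) > 0" by simp
    have "(sqrt (2 * real (n + K)) / real (n + 1))\<^sup>2 = 2 * real (n + K) / (real (n + 1))\<^sup>2" by (simp add: power_divide)
    also have "\<dots> \<le> 2 * ((real K + 1) * real (n + 1)) / (real (n + 1))\<^sup>2"
      using shift_le[of n] by (intro divide_right_mono) auto
    also have "\<dots> = 2 * (real K + 1) / real (n + 1)" using n1 by (simp add: power2_eq_square)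
    finally show "sqrt (2 * real (n + K)) / real (n + 1) \<le> sqrt (2 * (real K + 1) / real (n + 1))"
      by (rule real_le_rsqrt)
  qed
  have "(\<lambda>n. sqrt (2 * (real K + 1) / real (n + 1))) \<longlonglongrightarrow> sqrt 0"
    by (intro tendsto_real_sqrt const_over_nat_tendsto_0 filterlim_shift_at_top)
  then show "(\<lambda>n. sqrt (2 * (real K + 1) / real (n + 1))) \<longlonglongrightarrow> 0" by simp
qed auto

lemma f_series_sums:
  assumes "- 1 / 2 < \<gamma>" "\<gamma> < 0" "- 1 / 2 < \<gamma>'" "\<gamma>' < 0" and d: "d \<le> f_rank M a K X \<gamma>"
  shows "(\<lambda>q. fact q * f_coeff M a K X \<gamma> q * f_coeff M a K X \<gamma>' q * infsum (\<lambda>r. rho a K H r ^ q) UNIV)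
      sums herm_series d (f_coeff M a K X \<gamma>) (f_coeff M a K X \<gamma>') (rho a K H)"
    and "(\<lambda>q. fact q * f_coeff M a K X \<gamma> q * f_coeff M a K X \<gamma>' q * infsum (\<lambda>r. rho1 a K H r ^ q) UNIV)
      sums herm_series d (f_coeff M a K X \<gamma>) (f_coeff M a K X \<gamma>') (rho1 a K H)"
proof -
  note s = has_hermite_exp_summable[OF f_fun_hermite_exp[OF assms(1,2)]] has_hermite_exp_summable[OF f_fun_hermite_exp[OF assms(3,4)]]
  have b: "f_coeff M a K X \<gamma> q = 0" if "q < d" for q using f_coeff_below_rank[of q \<gamma>] that d by simp
  show "(\<lambda>q. fact q * f_coeff M a K X \<gamma> q * f_coeff M a K X \<gamma>' q * infsum (\<lambda>r. rho a K H r ^ q) UNIV)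
      sums herm_series d (f_coeff M a K X \<gamma>) (f_coeff M a K X \<gamma>') (rho a K H)"
    by (rule herm_series_sums[OF s rho_summable abs_rho_le_1 f_coeff_0[OF assms(1,2)] b])
  show "(\<lambda>q. fact q * f_coeff M a K X \<gamma> q * f_coeff M a K X \<gamma>' q * infsum (\<lambda>r. rho1 a K H r ^ q) UNIV)
      sums herm_series d (f_coeff M a K X \<gamma>) (f_coeff M a K X \<gamma>') (rho1 a K H)"
    by (rule herm_series_sums[OF s rho1_summable abs_rho1_le_1 f_coeff_0[OF assms(1,2)] b])
qed

text \<open>A linear combination of two power variations at one scale is the power variation of the combined function
\<open>g1 * f + g2 * f'\<close>, whose Hermite coefficients are the combinations of the coefficients. The scale is
\<open>n + K\<close>, so that exactly \<open>n + 1\<close> increments fit.\<close>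
lemma same_scale_linear_clt:
  fixes \<gamma> \<gamma>' g1 g2 :: real
  assumes \<gamma>: "- 1 / 2 < \<gamma>" "\<gamma> < 0" and \<gamma>': "- 1 / 2 < \<gamma>'" "\<gamma>' < 0"
  defines "d \<equiv> min (f_rank M a K X \<gamma>) (f_rank M a K X \<gamma>')"
  defines "c \<equiv> f_coeff M a K X \<gamma>" and "c' \<equiv> f_coeff M a K X \<gamma>'"
  defines "s \<equiv> g1\<^sup>2 * herm_series d c c (rho a K H) + 2 * g1 * g2 * herm_series d c c' (rho a K H) + g2\<^sup>2 * herm_series d c' c' (rho a K H)"
  defines "L \<equiv> \<lambda>n w. sqrt (real (n + K)) * (g1 * (W_stat a K H X \<gamma> (n + K) w - abs_moment M a K X \<gamma>)
      + g2 * (W_stat a K H X \<gamma>' (n + K) w - abs_moment M a K X \<gamma>'))"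
  shows "(\<lambda>n. expectation (\<lambda>w. cos (t * L n w))) \<longlonglongrightarrow> exp (- s * t\<^sup>2 / 2)"
    and "(\<lambda>n. expectation (\<lambda>w. sin (t * L n w))) \<longlonglongrightarrow> 0"
proof -
  define f where "f x = g1 * f_fun M a K X \<gamma> x + g2 * f_fun M a K X \<gamma>' x" for x
  define S where "S q = infsum (\<lambda>r. rho a K H r ^ q) UNIV" for q
  define u where "u n (i :: nat \<times> nat) = sqrt (real (n + K)) / real (n + 1)" for n i
  have hf: "has_hermite_exp f (\<lambda>q. g1 * c q + g2 * c' q)"
    unfolding f_def[abs_def] c_def c'_def by (rule has_hermite_exp_lincomb[OF f_fun_hermite_exp[OF \<gamma>] f_fun_hermite_exp[OF \<gamma>']])
  have hf0: "g1 * c 0 + g2 * c' 0 = 0" unfolding c_def c'_def f_coeff_0[OF \<gamma>] f_coeff_0[OF \<gamma>'] by simp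
  have L: "L n w = (\<Sum>i\<in>blk (n + K). u n i * f (\<zeta> i w))" for n w
  proof -
    have n1: "n + K \<ge> 1" using K_pos by simp
    have g: "\<gamma> > - 1" "\<gamma>' > - 1" using \<gamma> \<gamma>' by simp_all
    show ?thesis unfolding L_def u_def f_def W_stat_centered[OF g(1) n1] W_stat_centered[OF g(2) n1] sum_distrib_left sum.distrib[symmetric]
      by (intro sum.cong refl) (simp only: diff_add_inverse diff_add_inverse2 divide_inverse mult_1 algebra_simps)
  qed
  have u2: "u n i * u n j = (real (n + K) / real (n + 1)) / real (n + 1)" for n i j
    unfolding u_def by (simp add: power2_eq_square[symmetric] power_divide)
  have lim: "(\<lambda>n. \<Sum>i\<in>blk (n + K). \<Sum>j\<in>blk (n + K). u n i * u n j * R i j ^ q) \<longlonglongrightarrow> S q" if "q \<ge> 1" for q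
  proof -
    have "(\<Sum>i\<in>blk (n + K). \<Sum>j\<in>blk (n + K). u n i * u n j * R i j ^ q) = (real (n + K) / real (n + 1)) * ((\<Sum>i\<in>blk (n + K). \<Sum>j\<in>blk (n + K). R i j ^ q) / real (n + K - K + 1))" for n
      unfolding u2 sum_distrib_left[symmetric] by simp
    moreover have "(\<lambda>n. (real (n + K) / real (n + 1)) * ((\<Sum>i\<in>blk (n + K). \<Sum>j\<in>blk (n + K). R i j ^ q) / real (n + K - K + 1))) \<longlonglongrightarrow> 1 * S q"
      unfolding S_def by (rule tendsto_mult[OF shift_ratio cov_sum_same[OF that filterlim_shift_at_top]])
    ultimately show ?thesis by simp
  qed
  note se = f_series_sums(1)[OF \<gamma> \<gamma>, of d] f_series_sums(1)[OF \<gamma> \<gamma>', of d] f_series_sums(1)[OF \<gamma>' \<gamma>', of d]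
  have sums: "(\<lambda>q. fact q * (g1 * c q + g2 * c' q)\<^sup>2 * S q) sums s"
  proof -
    have "(\<lambda>q. g1\<^sup>2 * (fact q * c q * c q * S q) + 2 * g1 * g2 * (fact q * c q * c' q * S q) + g2\<^sup>2 * (fact q * c' q * c' q * S q)) sums s"
      unfolding s_def S_def c_def c'_def by (intro sums_add sums_mult se) (simp_all add: d_def)
    moreover have "g1\<^sup>2 * (fact q * c q * c q * S q) + 2 * g1 * g2 * (fact q * c q * c' q * S q) + g2\<^sup>2 * (fact q * c' q * c' q * S q) = fact q * (g1 * c q + g2 * c' q)\<^sup>2 * S q" for q
      by (simp add: power2_eq_square algebra_simps)
    ultimately show ?thesis by simp
  qed
  define \<delta> where "\<delta> n = sqrt (2 * real (n + K)) / real (n + 1)" for n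
  have ud: "\<bar>u n i\<bar> \<le> \<delta> n" for n i unfolding u_def \<delta>_def by (auto intro!: divide_right_mono)
  have B: "real (card (blk (n + K))) * (\<delta> n)\<^sup>2 \<le> 2 * (real K + 1)" for n
  proof -
    have "real (card (blk (n + K))) * (\<delta> n)\<^sup>2 = 2 * real (n + K) / real (n + 1)"
      unfolding \<delta>_def card_blk by (simp add: power_divide power2_eq_square)
    also have "\<dots> \<le> 2 * (real K + 1)" by (rule shift_ratio_le)
    finally show ?thesis .
  qed
  have d0: "\<delta> \<longlonglongrightarrow> 0" unfolding \<delta>_def[abs_def] by (rule sqrt_shift_tendsto_0)
  note bm = G.breuer_major[where I = "\<lambda>n. blk (n + K)" and u = u and \<delta> = \<delta> and R = rho_mass and B = "2 * (real K + 1)" and s = S and ?\<sigma>2.0 = s, OF hf hf0 finite_blk ud row_same rho_mass_nonneg B d0 lim sums]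
  show "(\<lambda>n. expectation (\<lambda>w. cos (t * L n w))) \<longlonglongrightarrow> exp (- s * t\<^sup>2 / 2)"
    unfolding L by (rule bm(1))
  show "(\<lambda>n. expectation (\<lambda>w. sin (t * L n w))) \<longlonglongrightarrow> 0"
    unfolding L by (rule bm(2))
qed

text \<open>Here the weights depend on the scale. The index set is the union of the blocks for \<open>m = n + K\<close> and \<open>2 * m\<close>; the
covariances inside a block average to sums of \<^const>\<open>rho\<close>, those between the blocks to sums of
\<^const>\<open>rho1\<close>. The coarse block has about half as many members, which in the limit doubles its contribution to the variance.\<close>
lemma two_scale_linear_clt:
  fixes \<gamma> g1 g2 :: real
  assumes \<gamma>: "- 1 / 2 < \<gamma>" "\<gamma> < 0"
  defines "c \<equiv> f_coeff M a K X \<gamma>"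
  defines "S0 \<equiv> herm_series (f_rank M a K X \<gamma>) c c (rho a K H)" and "T0 \<equiv> herm_series (f_rank M a K X \<gamma>) c c (rho1 a K H)"
  defines "s \<equiv> g1\<^sup>2 * (2 * S0) + 2 * g1 * g2 * T0 + g2\<^sup>2 * S0"
  defines "L \<equiv> \<lambda>n w. sqrt (real (2 * (n + K))) * (g1 * (W_stat a K H X \<gamma> (n + K) w - abs_moment M a K X \<gamma>)
      + g2 * (W_stat a K H X \<gamma> (2 * (n + K)) w - abs_moment M a K X \<gamma>))"
  shows "(\<lambda>n. expectation (\<lambda>w. cos (t * L n w))) \<longlonglongrightarrow> exp (- s * t\<^sup>2 / 2)"
    and "(\<lambda>n. expectation (\<lambda>w. sin (t * L n w))) \<longlonglongrightarrow> 0"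
proof -
  define f where "f = f_fun M a K X \<gamma>"
  define S where "S q = infsum (\<lambda>r. rho a K H r ^ q) UNIV" for q
  define T where "T q = infsum (\<lambda>r. rho1 a K H r ^ q) UNIV" for q
  define \<rho> where "\<rho> n = sqrt (real (2 * (n + K)))" for n
  define u1 where "u1 n = g1 * \<rho> n / real (n + 1)" for n
  define u2 where "u2 n = g2 * \<rho> n / real (2 * n + K + 1)" for n
  \<comment> \<open>The scale component of an index decides its block: \<open>n + K\<close> and \<open>2 * (n + K)\<close> are different because \<open>K\<close> is positive.\<close>
  define u where "u n (i :: nat \<times> nat) = (if fst i = n + K then u1 n else u2 n)" for n i
  define B1 where "B1 n = blk (n + K)" for n
  define B2 where "B2 n = blk (2 * (n + K))" for n
  have size: "n + K - K + 1 = n + 1" "2 * (n + K) - K + 1 = 2 * n + K + 1" for n by simp_all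
  have pos: "n + K > 0" "n + K \<ge> 1" "2 * (n + K) \<ge> 1" for n using K_pos by simp_all
  have fin: "finite (B1 n)" "finite (B2 n)" for n by (simp_all add: B1_def B2_def)
  have fst1: "i \<in> B1 n \<Longrightarrow> fst i = n + K" for i n by (auto simp: B1_def blk_def)
  have fst2: "i \<in> B2 n \<Longrightarrow> fst i = 2 * (n + K)" for i n by (auto simp: B2_def blk_def)
  have dis: "B1 n \<inter> B2 n = {}" for n using fst1[of _ n] fst2[of _ n] pos(1)[of n] by force
  have v1: "u n i = u1 n" if "i \<in> B1 n" for n i using fst1[OF that] by (simp add: u_def)
  have v2: "u n i = u2 n" if "i \<in> B2 n" for n i
  proof -
    have "fst i \<noteq> n + K" using fst2[OF that] pos(1)[of n] by arith
    then show ?thesis by (simp add: u_def)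
  qed
  have \<rho>2: "\<rho> n * \<rho> n = real (2 * (n + K))" for n by (simp add: \<rho>_def)
  have hf: "has_hermite_exp f c" unfolding f_def c_def by (rule f_fun_hermite_exp[OF \<gamma>])
  have hf0: "c 0 = 0" unfolding c_def by (rule f_coeff_0[OF \<gamma>])
  have split: "(\<Sum>i\<in>B1 n \<union> B2 n. F i) = (\<Sum>i\<in>B1 n. F i) + (\<Sum>i\<in>B2 n. F i)" for F :: "nat \<times> nat \<Rightarrow> real" and n
    by (rule sum.union_disjoint[OF fin dis])
  have L: "L n w = (\<Sum>i\<in>B1 n \<union> B2 n. u n i * f (\<zeta> i w))" for n w
  proof -
    have g: "\<gamma> > - 1" using \<gamma> by simp
    have "(\<Sum>i\<in>B1 n \<union> B2 n. u n i * f (\<zeta> i w)) = (\<Sum>i\<in>B1 n. u1 n * f (\<zeta> i w)) + (\<Sum>i\<in>B2 n. u2 n * f (\<zeta> i w))"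
      unfolding split using v1 v2 by simp
    also have "\<dots> = \<rho> n * (g1 * (\<Sum>i\<in>B1 n. 1 / real (n + 1) * f (\<zeta> i w)) + g2 * (\<Sum>i\<in>B2 n. 1 / real (2 * n + K + 1) * f (\<zeta> i w)))"
      unfolding u1_def u2_def sum_distrib_left[symmetric] by (simp add: algebra_simps add_divide_distrib)
    also have "\<dots> = L n w"
      unfolding L_def W_stat_centered[OF g pos(2)] W_stat_centered[OF g pos(3)] size f_def B1_def B2_def \<rho>_def ..
    finally show ?thesis ..
  qed
  have lim: "(\<lambda>n. \<Sum>i\<in>B1 n \<union> B2 n. \<Sum>j\<in>B1 n \<union> B2 n. u n i * u n j * R i j ^ q) \<longlonglongrightarrow> g1\<^sup>2 * (2 * S q) + 2 * g1 * g2 * T q + g2\<^sup>2 * S q" if q: "q \<ge> 1" for q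
  proof -
    define Q11 where "Q11 n = (\<Sum>i\<in>B1 n. \<Sum>j\<in>B1 n. R i j ^ q)" for n
    define Q22 where "Q22 n = (\<Sum>i\<in>B2 n. \<Sum>j\<in>B2 n. R i j ^ q)" for n
    define Q21 where "Q21 n = (\<Sum>i\<in>B2 n. \<Sum>j\<in>B1 n. R i j ^ q)" for n
    have Q12: "(\<Sum>i\<in>B1 n. \<Sum>j\<in>B2 n. R i j ^ q) = Q21 n" for n
      unfolding Q21_def by (subst sum.swap) (simp add: G.r_sym)
    have "(\<Sum>i\<in>B1 n \<union> B2 n. \<Sum>j\<in>B1 n \<union> B2 n. u n i * u n j * R i j ^ q)
      = (\<Sum>i\<in>B1 n. \<Sum>j\<in>B1 n. u1 n * u1 n * R i j ^ q) + (\<Sum>i\<in>B1 n. \<Sum>j\<in>B2 n. u1 n * u2 n * R i j ^ q)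
       + ((\<Sum>i\<in>B2 n. \<Sum>j\<in>B1 n. u2 n * u1 n * R i j ^ q) + (\<Sum>i\<in>B2 n. \<Sum>j\<in>B2 n. u2 n * u2 n * R i j ^ q))" for n
      unfolding split sum.distrib using v1 v2 by simp
    then have "(\<Sum>i\<in>B1 n \<union> B2 n. \<Sum>j\<in>B1 n \<union> B2 n. u n i * u n j * R i j ^ q)
      = u1 n * u1 n * Q11 n + 2 * (u1 n * u2 n) * Q21 n + u2 n * u2 n * Q22 n" for n
      unfolding sum_distrib_left[symmetric] Q12 Q11_def[symmetric] Q21_def[symmetric] Q22_def[symmetric] by simp
    moreover have "u1 n * u1 n * Q11 n = 2 * g1\<^sup>2 * ((real (n + K) / real (n + 1)) * (Q11 n / real (n + 1)))" for n
    proof -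
      have "u1 n * u1 n * Q11 n = g1\<^sup>2 * (\<rho> n * \<rho> n) * Q11 n / (real (n + 1) * real (n + 1))" by (simp add: u1_def power2_eq_square)
      then show ?thesis unfolding \<rho>2 by simp
    qed
    moreover have "2 * (u1 n * u2 n) * Q21 n = 2 * g1 * g2 * ((real (2 * (n + K)) / real (2 * n + K + 1)) * (Q21 n / real (n + 1)))" for n
    proof -
      have "2 * (u1 n * u2 n) * Q21 n = 2 * g1 * g2 * (\<rho> n * \<rho> n) * Q21 n / (real (n + 1) * real (2 * n + K + 1))" by (simp add: u1_def u2_def)
      then show ?thesis unfolding \<rho>2 by (simp add: mult_ac)
    qed
    moreover have "u2 n * u2 n * Q22 n = g2\<^sup>2 * ((real (2 * (n + K)) / real (2 * n + K + 1)) * (Q22 n / real (2 * n + K + 1)))" for n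
    proof -
      have "u2 n * u2 n * Q22 n = g2\<^sup>2 * (\<rho> n * \<rho> n) * Q22 n / (real (2 * n + K + 1) * real (2 * n + K + 1))" by (simp add: u2_def power2_eq_square)
      then show ?thesis unfolding \<rho>2 by simp
    qed
    moreover have "(\<lambda>n. 2 * g1\<^sup>2 * ((real (n + K) / real (n + 1)) * (Q11 n / real (n + 1)))
       + 2 * g1 * g2 * ((real (2 * (n + K)) / real (2 * n + K + 1)) * (Q21 n / real (n + 1)))
       + g2\<^sup>2 * ((real (2 * (n + K)) / real (2 * n + K + 1)) * (Q22 n / real (2 * n + K + 1))))
       \<longlonglongrightarrow> 2 * g1\<^sup>2 * (1 * S q) + 2 * g1 * g2 * (1 * T q) + g2\<^sup>2 * (1 * S q)"
    proof (intro tendsto_add tendsto_mult_left tendsto_mult[OF shift_ratio] tendsto_mult[OF shift_ratio_double])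
      have f2: "filterlim (\<lambda>n. 2 * (n + K)) at_top sequentially" by (rule filterlim_at_top_mono[OF filterlim_ident]) simp
      show "(\<lambda>n. Q11 n / real (n + 1)) \<longlonglongrightarrow> S q"
        using cov_sum_same[OF q filterlim_shift_at_top[of K]] unfolding Q11_def S_def B1_def size .
      show "(\<lambda>n. Q21 n / real (n + 1)) \<longlonglongrightarrow> T q"
        using cov_sum_two_scales[OF q filterlim_shift_at_top[of K]] unfolding Q21_def T_def B1_def B2_def size by simp
      show "(\<lambda>n. Q22 n / real (2 * n + K + 1)) \<longlonglongrightarrow> S q"
        using cov_sum_same[OF q f2] unfolding Q22_def S_def B2_def size .
    qed
    ultimately show ?thesis by (simp add: mult_ac)
  qed
  have sums: "(\<lambda>q. fact q * (c q)\<^sup>2 * (g1\<^sup>2 * (2 * S q) + 2 * g1 * g2 * T q + g2\<^sup>2 * S q)) sums s"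
  proof -
    have "(\<lambda>q. g1\<^sup>2 * (2 * (fact q * c q * c q * S q)) + 2 * g1 * g2 * (fact q * c q * c q * T q) + g2\<^sup>2 * (fact q * c q * c q * S q)) sums s"
      unfolding s_def S_def T_def S0_def T0_def c_def
      by (intro sums_add sums_mult f_series_sums[OF \<gamma> \<gamma>]) simp_all
    moreover have "g1\<^sup>2 * (2 * (fact q * c q * c q * S q)) + 2 * g1 * g2 * (fact q * c q * c q * T q) + g2\<^sup>2 * (fact q * c q * c q * S q)
      = fact q * (c q)\<^sup>2 * (g1\<^sup>2 * (2 * S q) + 2 * g1 * g2 * T q + g2\<^sup>2 * S q)" for q
      by (simp add: power2_eq_square algebra_simps)
    ultimately show ?thesis by simp
  qed
  define G0 where "G0 = \<bar>g1\<bar> + \<bar>g2\<bar>"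
  define \<delta> where "\<delta> n = G0 * (sqrt (2 * real (n + K)) / real (n + 1))" for n
  have \<rho>_eq: "\<rho> n = sqrt (2 * real (n + K))" for n by (simp add: \<rho>_def)
  have \<rho>0: "\<rho> n \<ge> 0" for n by (simp add: \<rho>_def)
  have ud: "\<bar>u n i\<bar> \<le> \<delta> n" for n i
  proof -
    have d: "\<delta> n = \<bar>g1\<bar> * (\<rho> n / real (n + 1)) + \<bar>g2\<bar> * (\<rho> n / real (n + 1))"
      unfolding \<delta>_def G0_def \<rho>_eq by (rule distrib_right)
    have p: "0 \<le> \<rho> n / real (n + 1)" "\<rho> n / real (2 * n + K + 1) \<le> \<rho> n / real (n + 1)"
      using \<rho>0[of n] by (auto intro!: divide_left_mono)
    have "\<bar>u1 n\<bar> = \<bar>g1\<bar> * (\<rho> n / real (n + 1))" unfolding u1_def using \<rho>0[of n] by (simp add: abs_mult)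
    moreover have "\<bar>u2 n\<bar> = \<bar>g2\<bar> * (\<rho> n / real (2 * n + K + 1))" unfolding u2_def using \<rho>0[of n] by (simp add: abs_mult)
    moreover have "\<bar>g2\<bar> * (\<rho> n / real (2 * n + K + 1)) \<le> \<bar>g2\<bar> * (\<rho> n / real (n + 1))" by (rule mult_left_mono[OF p(2)]) simp
    moreover have "0 \<le> \<bar>g1\<bar> * (\<rho> n / real (n + 1))" "0 \<le> \<bar>g2\<bar> * (\<rho> n / real (n + 1))" by (rule mult_nonneg_nonneg[OF abs_ge_zero p(1)])+
    ultimately show ?thesis unfolding d u_def by auto
  qed
  have B: "real (card (B1 n \<union> B2 n)) * (\<delta> n)\<^sup>2 \<le> (real K + 3) * (G0\<^sup>2 * (2 * (real K + 1)))" for n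
  proof -
    have n1: "real (n + 1) > 0" by simp
    have "card (B1 n \<union> B2 n) = 3 * n + K + 2"
      unfolding card_Un_disjoint[OF fin dis] by (simp add: B1_def B2_def card_blk)
    then have "real (card (B1 n \<union> B2 n)) \<le> (real K + 3) * real (n + 1)" by (simp add: algebra_simps)
    then have "real (card (B1 n \<union> B2 n)) * (\<delta> n)\<^sup>2 \<le> (real K + 3) * real (n + 1) * (\<delta> n)\<^sup>2" by (rule mult_right_mono) simp
    also have "\<dots> = (real K + 3) * (G0\<^sup>2 * (2 * real (n + K) / real (n + 1)))"
      using n1 unfolding \<delta>_def by (simp add: power_mult_distrib power_divide power2_eq_square)
    also have "\<dots> \<le> (real K + 3) * (G0\<^sup>2 * (2 * (real K + 1)))"
      by (intro mult_left_mono shift_ratio_le) simp_all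
    finally show ?thesis .
  qed
  have row: "(\<Sum>j\<in>B1 n \<union> B2 n. \<bar>R i j\<bar>) \<le> rho_mass + rho1_mass" if "i \<in> B1 n \<union> B2 n" for i n
  proof -
    from that consider "i \<in> B1 n" | "i \<in> B2 n" by blast
    then show ?thesis
    proof cases
      case 1
      then show ?thesis unfolding split using row_same[of i "n + K"] row_two_scales(2)[OF pos(1), of i n] by (simp add: B1_def B2_def)
    next
      case 2
      then show ?thesis unfolding split using row_same[of i "2 * (n + K)"] row_two_scales(1)[OF pos(1), of i n] by (simp add: B1_def B2_def)
    qed
  qed
  have A: "rho_mass + rho1_mass \<ge> 0" using rho_mass_nonneg rho1_mass_nonneg by simp
  have d0: "\<delta> \<longlonglongrightarrow> 0"
    using tendsto_mult_left[OF sqrt_shift_tendsto_0, of G0] unfolding \<delta>_def[abs_def] by simp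
  have fi: "finite (B1 n \<union> B2 n)" for n using fin by simp
  note bm = G.breuer_major[where I = "\<lambda>n. B1 n \<union> B2 n" and u = u and \<delta> = \<delta> and R = "rho_mass + rho1_mass" and B = "(real K + 3) * (G0\<^sup>2 * (2 * (real K + 1)))"
      and s = "\<lambda>q. g1\<^sup>2 * (2 * S q) + 2 * g1 * g2 * T q + g2\<^sup>2 * S q" and ?\<sigma>2.0 = s, OF hf hf0 fi ud row A B d0 lim sums]
  show "(\<lambda>n. expectation (\<lambda>w. cos (t * L n w))) \<longlonglongrightarrow> exp (- s * t\<^sup>2 / 2)"
    unfolding L by (rule bm(1))
  show "(\<lambda>n. expectation (\<lambda>w. sin (t * L n w))) \<longlonglongrightarrow> 0"
    unfolding L by (rule bm(2))
qed

definition f_norm2 :: "real \<Rightarrow> real" where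
  "f_norm2 \<gamma> = (\<integral>x. (f_fun M a K X \<gamma> x)\<^sup>2 \<partial>std_gauss)"

lemma f_norm2_nonneg: "f_norm2 \<gamma> \<ge> 0"
  unfolding f_norm2_def by (simp add: integral_nonneg_AE)

text \<open>The mean square error is of order \<open>1 / (N - K + 1)\<close>; for the scales used here this is comparable to \<open>1 / r\<^sup>2\<close> with \<open>r\<close>
the rate of the central limit theorem.\<close>
lemma W_stat_moment_rate:
  assumes \<gamma>: "- 1 / 2 < \<gamma>" "\<gamma> < 0" and N: "N \<ge> n + K" and r: "r > 0" "r\<^sup>2 \<le> 2 * real (n + K)" and C: "2 * (real K + 1) * rho_mass * f_norm2 \<gamma> \<le> C"
  shows "integrable M (\<lambda>w. (W_stat a K H X \<gamma> N w - abs_moment M a K X \<gamma>)\<^sup>2)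
      \<and> expectation (\<lambda>w. (W_stat a K H X \<gamma> N w - abs_moment M a K X \<gamma>)\<^sup>2) \<le> C / r\<^sup>2"
proof
  have N1: "N \<ge> 1" using N K_pos by simp
  show "integrable M (\<lambda>w. (W_stat a K H X \<gamma> N w - abs_moment M a K X \<gamma>)\<^sup>2)"
    by (rule W_stat_second_moment(1)[OF \<gamma> N1])
  have J: "0 \<le> rho_mass * f_norm2 \<gamma>" using rho_mass_nonneg f_norm2_nonneg by simp
  have "expectation (\<lambda>w. (W_stat a K H X \<gamma> N w - abs_moment M a K X \<gamma>)\<^sup>2) \<le> rho_mass * f_norm2 \<gamma> / real (N - K + 1)"
    using W_stat_second_moment(2)[OF \<gamma> N1] unfolding f_norm2_def .
  also have "\<dots> \<le> rho_mass * f_norm2 \<gamma> / real (n + 1)"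
    using N by (intro divide_left_mono J) auto
  also have "\<dots> \<le> 2 * (real K + 1) * rho_mass * f_norm2 \<gamma> / r\<^sup>2"
  proof -
    have "2 * real (n + K) \<le> 2 * ((real K + 1) * real (n + 1))" by (rule mult_left_mono[OF shift_le]) simp
    with r(2) have "r\<^sup>2 \<le> 2 * (real K + 1) * real (n + 1)" unfolding mult.assoc by (rule order_trans)
    then have "rho_mass * f_norm2 \<gamma> * r\<^sup>2 \<le> rho_mass * f_norm2 \<gamma> * (2 * (real K + 1) * real (n + 1))" by (rule mult_left_mono[OF _ J])
    then have "rho_mass * f_norm2 \<gamma> * r\<^sup>2 \<le> (2 * (real K + 1) * rho_mass * f_norm2 \<gamma>) * real (n + 1)" by (simp only: mult_ac)
    then show ?thesis using r(1) by (simp add: divide_le_eq le_divide_eq field_simps del: of_nat_Suc of_nat_add)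
  qed
  also have "\<dots> \<le> C / r\<^sup>2" using C by (intro divide_right_mono) auto
  finally show "expectation (\<lambda>w. (W_stat a K H X \<gamma> N w - abs_moment M a K X \<gamma>)\<^sup>2) \<le> C / r\<^sup>2" .
qed

lemma moment_const_nonneg: "0 \<le> 2 * (real K + 1) * rho_mass * f_norm2 \<gamma>"
  using rho_mass_nonneg f_norm2_nonneg by simp

lemma V_stat_measurable [measurable]: "V_stat a K X \<gamma> n \<in> borel_measurable M"
  unfolding V_stat_def[abs_def] by measurable

lemma H_hat_measurable [measurable]: "H_hat a K X \<beta> n \<in> borel_measurable M"
  unfolding H_hat_def[abs_def] by measurable

text \<open>The unknown powers of the scale in the two statistics differ by the factor \<open>2 powr (\<beta> * H)\<close>, from which the
estimator reads off \<open>H\<close>.\<close>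
lemma H_hat_eq:
  assumes "m > 0"
  shows "H_hat a K X \<beta> (2 * m) w = 1 / \<beta> * log 2 (2 powr (\<beta> * H) * W_stat a K H X \<beta> m w / W_stat a K H X \<beta> (2 * m) w)"
proof -
  have "2 powr (\<beta> * H) * (real m powr (\<beta> * H) * v) / (real (2 * m) powr (\<beta> * H) * v') = v / v'" for v v' :: real
    using assms by (simp add: powr_mult)
  then show ?thesis unfolding H_hat_def W_stat_def by simp
qed

text \<open>The delta method for the logarithm of the ratio at the point where both coordinates are the absolute moment.
The two partial derivatives are opposite there, so interchanging the roles of the two diagonal entries of
\<^const>\<open>Gamma1\<close> does not affect the asymptotic variance.\<close>
theorem H_hat_clt:
  assumes \<beta>: "- 1 / 2 < \<beta>" "\<beta> < 0"
  shows "Xi1 M a K H X \<beta> \<ge> 0"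
    and "weak_conv_m (\<lambda>m. distr M borel (\<lambda>w. sqrt (real (2 * m)) * (H_hat a K X \<beta> (2 * m) w - H))) (normal_law 0 (Xi1 M a K H X \<beta>))"
proof -
  define x0 where "x0 = abs_moment M a K X \<beta>"
  have x0: "x0 > 0" unfolding x0_def using \<beta> by (intro abs_moment_pos) simp
  have b0: "\<beta> \<noteq> 0" using \<beta> by simp
  define g where "g x y = 1 / \<beta> * log 2 (2 powr (\<beta> * H) * x / y)" for x y
  define g1 where "g1 = 1 / (\<beta> * ln 2 * x0)"
  define g2 where "g2 = - 1 / (\<beta> * ln 2 * x0)"
  have g: "((\<lambda>(x, y). g x y) has_derivative (\<lambda>(dx, dy). g1 * dx + g2 * dy)) (at (x0, x0))"
    unfolding g_def g1_def g2_def by (rule log_ratio_has_derivative) (use x0 b0 in auto)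
  have "((\<lambda>(x, y). 1 / \<beta> * log 2 (1 * x / y)) has_derivative (\<lambda>(dx, dy). g1 * dx + g2 * dy)) (at (x0, x0))"
    unfolding g1_def g2_def by (rule log_ratio_has_derivative) (use x0 b0 in auto)
  then have grad: "gradient2 (\<lambda>x y. 1 / \<beta> * log 2 (x / y)) x0 x0 = vector [g1, g2]"
    unfolding mult_1 by (rule gradient2_eq)
  let ?c = "f_coeff M a K X \<beta>"
  define S0 where "S0 = herm_series (f_rank M a K X \<beta>) ?c ?c (rho a K H)"
  define T0 where "T0 = herm_series (f_rank M a K X \<beta>) ?c ?c (rho1 a K H)"
  have "Xi1 M a K H X \<beta> = g1\<^sup>2 * S0 + 2 * g1 * g2 * T0 + g2\<^sup>2 * (2 * S0)"
    unfolding Xi1_def Gamma1_def Let_def x0_def[symmetric] grad S0_def[symmetric] T0_def[symmetric] by (rule quadratic_form_2)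
  \<comment> \<open>The two forms agree because \<open>g1\<^sup>2 = g2\<^sup>2\<close>.\<close>
  then have Xi: "Xi1 M a K H X \<beta> = g1\<^sup>2 * (2 * S0) + 2 * g1 * g2 * T0 + g2\<^sup>2 * S0"
    by (simp add: g1_def g2_def)
  have g0: "g x0 x0 = H" unfolding g_def using x0 b0 by (simp add: log_powr)
  have HU: "H_hat a K X \<beta> (2 * (n + K)) w = g (W_stat a K H X \<beta> (n + K) w) (W_stat a K H X \<beta> (2 * (n + K)) w)" for n w
    unfolding g_def by (rule H_hat_eq) (use K_pos in simp)
  let ?\<rho> = "\<lambda>n. sqrt (real (2 * (n + K)))"
  have rho: "filterlim ?\<rho> at_top sequentially"
    by (intro filterlim_compose[OF sqrt_at_top] filterlim_compose[OF filterlim_real_sequentially]) (rule filterlim_at_top_mono[OF filterlim_ident], simp)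
  define C where "C = 2 * (real K + 1) * rho_mass * f_norm2 \<beta>"
  have C: "C \<ge> 0" unfolding C_def by (rule moment_const_nonneg)
  have rp: "?\<rho> n > 0" "(?\<rho> n)\<^sup>2 \<le> 2 * real (n + K)" for n using K_pos by auto
  have U2: "\<forall>\<^sub>F n in sequentially. integrable M (\<lambda>w. (W_stat a K H X \<beta> (n + K) w - x0)\<^sup>2) \<and> expectation (\<lambda>w. (W_stat a K H X \<beta> (n + K) w - x0)\<^sup>2) \<le> C / (?\<rho> n)\<^sup>2"
    unfolding x0_def by (intro always_eventually allI W_stat_moment_rate[OF \<beta> _ rp]) (simp_all add: C_def)
  have V2: "\<forall>\<^sub>F n in sequentially. integrable M (\<lambda>w. (W_stat a K H X \<beta> (2 * (n + K)) w - x0)\<^sup>2) \<and> expectation (\<lambda>w. (W_stat a K H X \<beta> (2 * (n + K)) w - x0)\<^sup>2) \<le> C / (?\<rho> n)\<^sup>2"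
    unfolding x0_def by (intro always_eventually allI W_stat_moment_rate[OF \<beta> _ rp]) (simp_all add: C_def)
  have gm: "(\<lambda>w. g (W_stat a K H X \<beta> (n + K) w) (W_stat a K H X \<beta> (2 * (n + K)) w)) \<in> borel_measurable M" for n
    unfolding HU[symmetric] by measurable
  have lin: "(\<lambda>n. expectation (\<lambda>w. cos (t * (?\<rho> n * (g1 * (W_stat a K H X \<beta> (n + K) w - x0) + g2 * (W_stat a K H X \<beta> (2 * (n + K)) w - x0)))))) \<longlonglongrightarrow> exp (- Xi1 M a K H X \<beta> * t\<^sup>2 / 2)"
    "(\<lambda>n. expectation (\<lambda>w. sin (t * (?\<rho> n * (g1 * (W_stat a K H X \<beta> (n + K) w - x0) + g2 * (W_stat a K H X \<beta> (2 * (n + K)) w - x0)))))) \<longlonglongrightarrow> 0" for t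
    unfolding Xi S0_def T0_def x0_def by (rule two_scale_linear_clt[OF \<beta>])+
  note clt = delta_clt[OF W_stat_measurable W_stat_measurable g rho C U2 V2 gm lin]
  show "Xi1 M a K H X \<beta> \<ge> 0" by (rule clt(1))
  have "weak_conv_m (\<lambda>n. distr M borel (\<lambda>w. ?\<rho> n * (H_hat a K X \<beta> (2 * (n + K)) w - H))) (normal_law 0 (Xi1 M a K H X \<beta>))"
    using clt(2) unfolding HU g0 .
  then show "weak_conv_m (\<lambda>m. distr M borel (\<lambda>w. sqrt (real (2 * m)) * (H_hat a K X \<beta> (2 * m) w - H))) (normal_law 0 (Xi1 M a K H X \<beta>))"
    by (rule weak_conv_m_offset)
qed

lemma alpha_hat_measurable:
  assumes "\<beta>1 < \<beta>2" "\<beta>2 < 0"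
  shows "alpha_hat a K H X \<beta>1 \<beta>2 n \<in> borel_measurable M"
proof -
  have [measurable]: "phi_fun (- \<beta>1) (- \<beta>2) \<in> borel_measurable borel" using assms by (intro measurable_phi_fun) auto
  show ?thesis unfolding alpha_hat_def[abs_def] psi_fun_def by measurable
qed

text \<open>The delta method for \<open>phi_fun \<circ> psi_fun\<close> at the pair of absolute moments, where the value is \<open>2\<close> by
\<open>psi_fun_at_gaussian_moments\<close>.\<close>
theorem alpha_hat_clt:
  assumes \<beta>: "- 1 / 2 < \<beta>1" "\<beta>1 < \<beta>2" "\<beta>2 < 0"
  shows "Sigma1 M a K H X \<beta>1 \<beta>2 \<ge> 0"
    and "weak_conv_m (\<lambda>n. distr M borel (\<lambda>w. sqrt (real n) * (alpha_hat a K H X \<beta>1 \<beta>2 n w - 2))) (normal_law 0 (Sigma1 M a K H X \<beta>1 \<beta>2))"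
proof -
  have \<beta>1: "- 1 / 2 < \<beta>1" "\<beta>1 < 0" and \<beta>2: "- 1 / 2 < \<beta>2" "\<beta>2 < 0" using \<beta> by simp_all
  define x0 where "x0 = abs_moment M a K X \<beta>1"
  define y0 where "y0 = abs_moment M a K X \<beta>2"
  have x0: "x0 > 0" and y0: "y0 > 0" unfolding x0_def y0_def using \<beta>1 \<beta>2 by (simp_all add: abs_moment_pos)
  define u where "u = - \<beta>1"
  define v where "v = - \<beta>2"
  have uv: "0 < v" "v < u" "u < 1 / 2" using \<beta> by (auto simp: u_def v_def)
  have psi0: "psi_fun u v x0 y0 = h_fun u v 2"
    using psi_fun_at_gaussian_moments[OF uv incr_sd_pos] \<beta>1 \<beta>2
    unfolding x0_def y0_def u_def v_def gauss_moment_def by (simp add: abs_moment_eq gauss_moment_def)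
  define k where "k = inverse (u * v / 2\<^sup>2 * (Digamma (1 + u / 2) - Digamma (1 + v / 2)))"
  have phi': "(phi_fun u v has_real_derivative k) (at (psi_fun u v x0 y0))"
    unfolding psi0 k_def by (rule phi_fun_deriv) (use uv in auto)
  define g where "g x y = phi_fun u v (psi_fun u v x y)" for x y
  define g1 where "g1 = - v / x0 * k"
  define g2 where "g2 = u / y0 * k"
  have g: "((\<lambda>(x, y). g x y) has_derivative (\<lambda>(dx, dy). g1 * dx + g2 * dy)) (at (x0, y0))"
  proof -
    have phi'': "(phi_fun u v has_real_derivative k) (at ((\<lambda>(x, y). psi_fun u v x y) (x0, y0)))" using phi' by simp
    have "((\<lambda>z. phi_fun u v ((\<lambda>(x, y). psi_fun u v x y) z)) has_derivative (\<lambda>d. (\<lambda>(dx, dy). - v / x0 * dx + u / y0 * dy) d * k)) (at (x0, y0))"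
      by (rule DERIV_compose_FDERIV[OF phi'' psi_fun_has_derivative[OF x0 y0]])
    then show ?thesis unfolding g_def g1_def g2_def by (simp add: case_prod_unfold algebra_simps)
  qed
  let ?c1 = "f_coeff M a K X \<beta>1" and ?c2 = "f_coeff M a K X \<beta>2" and ?d = "min (f_rank M a K X \<beta>1) (f_rank M a K X \<beta>2)"
  have Sig: "Sigma1 M a K H X \<beta>1 \<beta>2 = g1\<^sup>2 * herm_series ?d ?c1 ?c1 (rho a K H) + 2 * g1 * g2 * herm_series ?d ?c1 ?c2 (rho a K H) + g2\<^sup>2 * herm_series ?d ?c2 ?c2 (rho a K H)"
    unfolding Sigma1_def Gamma2_def Let_def x0_def[symmetric] y0_def[symmetric] u_def[symmetric] v_def[symmetric] g_def[symmetric] gradient2_eq[OF g]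
    by (rule quadratic_form_2)
  have g0: "g x0 y0 = 2" unfolding g_def psi0 by (rule phi_fun_h_fun) (use uv in auto)
  have AU: "alpha_hat a K H X \<beta>1 \<beta>2 n w = g (W_stat a K H X \<beta>1 n w) (W_stat a K H X \<beta>2 n w)" for n w
    unfolding g_def alpha_hat_def u_def v_def ..
  let ?\<rho> = "\<lambda>n. sqrt (real (n + K))"
  have rho: "filterlim ?\<rho> at_top sequentially"
    by (intro filterlim_compose[OF sqrt_at_top] filterlim_compose[OF filterlim_real_sequentially] filterlim_shift_at_top)
  define C where "C = 2 * (real K + 1) * rho_mass * f_norm2 \<beta>1 + 2 * (real K + 1) * rho_mass * f_norm2 \<beta>2"
  have C: "C \<ge> 0" unfolding C_def using moment_const_nonneg[of \<beta>1] moment_const_nonneg[of \<beta>2] by linarith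
  have rp: "?\<rho> n > 0" "(?\<rho> n)\<^sup>2 \<le> 2 * real (n + K)" for n using K_pos by auto
  have U2: "\<forall>\<^sub>F n in sequentially. integrable M (\<lambda>w. (W_stat a K H X \<beta>1 (n + K) w - x0)\<^sup>2) \<and> expectation (\<lambda>w. (W_stat a K H X \<beta>1 (n + K) w - x0)\<^sup>2) \<le> C / (?\<rho> n)\<^sup>2"
    unfolding x0_def using moment_const_nonneg[of \<beta>2]
    by (intro always_eventually allI W_stat_moment_rate[OF \<beta>1 _ rp]) (auto simp: C_def)
  have V2: "\<forall>\<^sub>F n in sequentially. integrable M (\<lambda>w. (W_stat a K H X \<beta>2 (n + K) w - y0)\<^sup>2) \<and> expectation (\<lambda>w. (W_stat a K H X \<beta>2 (n + K) w - y0)\<^sup>2) \<le> C / (?\<rho> n)\<^sup>2"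
    unfolding y0_def using moment_const_nonneg[of \<beta>1]
    by (intro always_eventually allI W_stat_moment_rate[OF \<beta>2 _ rp]) (auto simp: C_def)
  have gm: "(\<lambda>w. g (W_stat a K H X \<beta>1 (n + K) w) (W_stat a K H X \<beta>2 (n + K) w)) \<in> borel_measurable M" for n
    unfolding AU[symmetric] using alpha_hat_measurable[OF \<beta>(2,3)] .
  have lin: "(\<lambda>n. expectation (\<lambda>w. cos (t * (?\<rho> n * (g1 * (W_stat a K H X \<beta>1 (n + K) w - x0) + g2 * (W_stat a K H X \<beta>2 (n + K) w - y0)))))) \<longlonglongrightarrow> exp (- Sigma1 M a K H X \<beta>1 \<beta>2 * t\<^sup>2 / 2)"
    "(\<lambda>n. expectation (\<lambda>w. sin (t * (?\<rho> n * (g1 * (W_stat a K H X \<beta>1 (n + K) w - x0) + g2 * (W_stat a K H X \<beta>2 (n + K) w - y0)))))) \<longlonglongrightarrow> 0" for t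
    unfolding Sig x0_def y0_def by (rule same_scale_linear_clt[OF \<beta>1 \<beta>2])+
  note clt = delta_clt[OF W_stat_measurable W_stat_measurable g rho C U2 V2 gm lin]
  show "Sigma1 M a K H X \<beta>1 \<beta>2 \<ge> 0" by (rule clt(1))
  have "weak_conv_m (\<lambda>n. distr M borel (\<lambda>w. ?\<rho> n * (alpha_hat a K H X \<beta>1 \<beta>2 (n + K) w - 2))) (normal_law 0 (Sigma1 M a K H X \<beta>1 \<beta>2))"
    using clt(2) unfolding AU g0 .
  then show "weak_conv_m (\<lambda>n. distr M borel (\<lambda>w. sqrt (real n) * (alpha_hat a K H X \<beta>1 \<beta>2 n w - 2))) (normal_law 0 (Sigma1 M a K H X \<beta>1 \<beta>2))"
    by (rule weak_conv_m_offset)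
qed

end

theorem theorem3p1:
  fixes M :: "'w measure" and X :: "real \<Rightarrow> 'w \<Rightarrow> real"
    and H \<beta> \<beta>1 \<beta>2 :: real and a :: "nat \<Rightarrow> real" and K L :: nat
  assumes "0 < H" and "H < 1"
    and "fractional_brownian_motion M H X"
    and "L \<ge> 1" and "K \<ge> 1"
    and "\<forall>q\<in>{0..L}. (\<Sum>k=0..K. real k ^ q * a k) = 0"
    and "(\<Sum>k=0..K. real k ^ (L + 1) * a k) \<noteq> 0"
    and "- 1 / 2 < \<beta>" and "\<beta> < 0"
    and "- 1 / 2 < \<beta>1" and "\<beta>1 < \<beta>2" and "\<beta>2 < 0"
  shows "(O_prob M {n. even n \<and> n \<ge> 2 * K} (\<lambda>n. real n powr (- 1 / 2))
            (\<lambda>n w. H_hat a K X \<beta> n w - H) \<and>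
          O_prob M {n. n \<ge> K} (\<lambda>n. real n powr (- 1 / 2))
            (\<lambda>n w. alpha_hat a K H X \<beta>1 \<beta>2 n w - 2)) \<and>
         (weak_conv_m
            (\<lambda>m. distr M borel (\<lambda>w. sqrt (real (2 * m)) * (H_hat a K X \<beta> (2 * m) w - H)))
            (normal_law 0 (Xi1 M a K H X \<beta>)) \<and>
          weak_conv_m
            (\<lambda>n. distr M borel (\<lambda>w. sqrt (real n) * (alpha_hat a K H X \<beta>1 \<beta>2 n w - 2)))
            (normal_law 0 (Sigma1 M a K H X \<beta>1 \<beta>2)))"
proof -
  interpret fbm_increments M H X a K
  proof
    show "0 < H" "H < 1" "fractional_brownian_motion M H X" using assms by auto
    show "(\<Sum>p=0..K. a p) = 0" using bspec[OF assms(6), of 0] by simp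
    show "(\<Sum>p=0..K. real p * a p) = 0" using bspec[OF assms(6), of 1] assms(4) by simp
    show "\<exists>p\<le>K. a p \<noteq> 0"
    proof (rule ccontr)
      assume "\<not> (\<exists>p\<le>K. a p \<noteq> 0)"
      then have "(\<Sum>k=0..K. real k ^ (L + 1) * a k) = 0" by (intro sum.neutral) auto
      then show False using assms(7) by simp
    qed
  qed
  note h = H_hat_clt[OF assms(8,9)] and al = alpha_hat_clt[OF assms(10-12)]
  note am = alpha_hat_measurable[OF assms(11,12)]
  have 1: "O_prob M {n. even n \<and> n \<ge> 2 * K} (\<lambda>n. real n powr (- 1 / 2)) (\<lambda>n w. H_hat a K X \<beta> n w - H)"
  proof (rule O_prob_of_weak_conv[OF _ _ _ _ _ h])
    have "2 * K \<in> {n. even n \<and> n \<ge> 2 * K}" by simp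
    then show "{n. even n \<and> n \<ge> 2 * K} \<noteq> {}" by blast
    fix n assume n: "n \<in> {n. even n \<and> n \<ge> 2 * K}"
    then show "n > 0" using assms(5) by auto
    show "(\<lambda>w. H_hat a K X \<beta> n w - H) \<in> borel_measurable M" by measurable
    from n obtain m where "n = 2 * m" by blast
    then show "\<exists>m. (\<lambda>w. sqrt (real (2 * m)) * (H_hat a K X \<beta> (2 * m) w - H)) = (\<lambda>w. sqrt (real n) * (H_hat a K X \<beta> n w - H))"
      by blast
  next
    fix m show "(\<lambda>w. sqrt (real (2 * m)) * (H_hat a K X \<beta> (2 * m) w - H)) \<in> borel_measurable M" by measurable
  qed
  have 2: "O_prob M {n. n \<ge> K} (\<lambda>n. real n powr (- 1 / 2)) (\<lambda>n w. alpha_hat a K H X \<beta>1 \<beta>2 n w - 2)"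
  proof (rule O_prob_of_weak_conv[OF _ _ _ _ _ al])
    show "{n. n \<ge> K} \<noteq> {}" by blast
    fix n assume n: "n \<in> {n. n \<ge> K}"
    then show "n > 0" using assms(5) by auto
    show "(\<lambda>w. alpha_hat a K H X \<beta>1 \<beta>2 n w - 2) \<in> borel_measurable M" by (intro borel_measurable_diff am) simp
    show "\<exists>m. (\<lambda>w. sqrt (real m) * (alpha_hat a K H X \<beta>1 \<beta>2 m w - 2)) = (\<lambda>w. sqrt (real n) * (alpha_hat a K H X \<beta>1 \<beta>2 n w - 2))"
      by blast
  next
    fix m show "(\<lambda>w. sqrt (real m) * (alpha_hat a K H X \<beta>1 \<beta>2 m w - 2)) \<in> borel_measurable M"
      by (intro borel_measurable_times borel_measurable_diff am) simp_all
  qed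
  show ?thesis using 1 2 h(2) al(2) by blast
qed

end
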